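(* Assume (H1) and (H2), let $(u_0,u_1)\in V\times H$, and let $u$ be the maximal energy solution of (P) on $[0,T_{\max})$. (i) (Negative shifted initial energy.) Suppose $\ell\ge \frac{1}{(p_--1)^2}$ and $\mathcal E(0)<0$. Then $T_{\max}<\infty$ and $\limsup_{t\uparrow T_{\max}}\left(\|u(t)\|_V+\|u_t(t)\|_2\right)=\infty$. Put $\beta:=-\mathcal E(0)>0$. For every $\sigma>0$ such that $(p_--2)[(u_0,u_1)+\beta\sigma]>2\|\nabla u_0\|_2^2$, one has $$T_{\max}\le\frac{2(\|u_0\|_2^2+\beta\sigma^2)}{(p_--2)[(u_0,u_1)+\beta\sigma]-2\|\nabla u_0\|_2^2}.$$ In particular, minimizing the right-hand side over all admissible $\sigma$ gives $$T_{\max}\le\frac{4\left[\sqrt{d_0^2+(p_--2)^2\beta\|u_0\|_2^2}-d_0\right]}{(p_--2)^2\beta},\qquad d_0:=(p_--2)(u_0,u_1)-2\|\nabla u_0\|_2^2.$$ (ii) (Zero shifted initial energy.) Suppose $\ell>\frac1{(p_--1)^2}$, $\mathcal E(0)=0$ and $(u_0,u_1)>0$. Then $T_{\max}<\infty$, $\limsup_{t\uparrow T_{\max}}\left(\|u(t)\|_V+\|u_t(t)\|_2\right)=\infty$, and the upper bound $(\ast)$ below holds (here $L_0=(u_0,u_1)$). (iii) (Positive shifted initial energy.) Suppose $\ell>\frac1{(p_--1)^2}$ and $$0<\mathcal E(0)<\frac{C}{p_-}(u_0,u_1).$$ Then $T_{\max}<\infty$, $\limsup_{t\uparrow T_{\max}}\left(\|u(t)\|_V+\|u_t(t)\|_2\right)=\infty$,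 and the upper bound $(\ast)$ below holds, without any additional restriction on the initial energy. In both cases (ii) and (iii), define $$L_0:=(u_0,u_1)-\frac{p_-}{C}\mathcal E(0)>0,\qquad \beta:=\frac{CL_0}{2p_-},$$ let $\tau$ be the unique positive solution of $$CL_0\tau^2+\left[L_0-\frac{2(\mathcal E(0)+\beta)}{\lambda_1}\right]\tau-\|u_0\|_2^2=0,$$ and set $$U_\tau:=\left(\|u_0\|_2+\sqrt{\tfrac{\tau(\mathcal E(0)+\beta)}{\lambda_1}}\right)^2,\quad G_\tau:=\left(\|\nabla u_0\|_2+\sqrt{\tau(\mathcal E(0)+\beta)}\right)^2,\quad d_\tau:=\frac{p_--2}{2}L_0-2G_\tau.$$ The upper bound is $$(\ast)\qquad T_{\max}\le\tau+\frac{4\left[\sqrt{d_\tau^2+(p_--2)^2\beta U_\tau}-d_\tau\right]}{(p_--2)^2\beta}.$$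
   Context: Setting. $n\ge1$ and $\Omega\subset\mathbb R^n$ is a bounded domain with smooth boundary; $V=H_0^1(\Omega)$ with $\|z\|_V=\|\nabla z\|_2$; $H=L^2(\Omega)$; $\|\cdot\|_2$ and $(\cdot,\cdot)$ are the $L^2(\Omega)$ norm and inner product; $\langle\cdot,\cdot\rangle$ is the pairing of $V^*$ and $V$; $\lambda_1>0$ is the first Dirichlet eigenvalue of $-\Delta$ on $\Omega$. (H1): $p:\Omega\to\mathbb R$ is measurable and $2<p_-:=\operatorname{ess\,inf}_\Omega p\le p(x)\le p_+:=\operatorname{ess\,sup}_\Omega p<2^*$ for a.e. $x$, where $2^*=2n/(n-2)$ if $n\ge3$ and $2^*=\infty$ if $n\le2$. (H2): $g\in C^1([0,\infty))$, $g\ge0$, $g'\le0$, and $\ell:=1-\int_0^\infty g(s)\,ds>0$. Problem (P): $u_{tt}-\Delta u+\int_0^t g(t-s)\Delta u(s)\,ds-\Delta u_t=|u|^{p(x)-2}u\log|u|$ in $\Omega\times(0,\infty)$, $u=0$ on $\partial\Omega\times(0,\infty)$, $u(0)=u_0$, $u_t(0)=u_1$; the source is $0$ at $u=0$. For $(u_0,u_1)\in V\times H$, an energy solution on $[0,T]$ is $u\in C([0,T];V)$ with $u_t\in C([0,T];H)\cap L^2(0,T;V)$, $u_{tt}\in L^2(0,T;V^* )$, $u(0)=u_0$, $u_t(0)=u_1$, such that for every $z\in V$ and a.e. $t\in(0,T)$: $\langle u_{tt},z\rangle+(\nabla u,\nabla z)+(\nabla u_t,\nabla z)-\int_0^tg(t-s)(\nabla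 u(s),\nabla z)\,ds=\int_\Omega|u|^{p(x)-2}u\log|u|\,z\,dx$. Energies. $F(x,r)=\frac{|r|^{p(x)}}{p(x)}\log|r|-\frac{|r|^{p(x)}}{p(x)^2}$, $F(x,0)=0$; $(g\circ\nabla u)(t)=\int_0^tg(t-s)\|\nabla u(t)-\nabla u(s)\|_2^2\,ds$; $$E(t)=\tfrac12\|u_t(t)\|_2^2+\tfrac12\Big(1-\int_0^tg(s)\,ds\Big)\|\nabla u(t)\|_2^2+\tfrac12(g\circ\nabla u)(t)-\int_\Omega F(x,u(t))\,dx.$$ For $q\ge p_-$: $c_{p_-}(q)=\frac{q-p_-}{q^2}e^{-q/(q-p_-)}$ if $q>p_-$ and $c_{p_-}(p_-)=0$. $C_*=\int_\Omega c_{p_-}(p(x))\,dx$ (finite). The shifted energy is $\mathcal E(t)=E(t)+C_*/p_-$. Local theory (taken as known under (H1), (H2)). For every $(u_0,u_1)\in V\times H$, (P) has a unique maximal energy solution on $[0,T_{\max})$, $T_{\max}\in(0,\infty]$ (an energy solution on $[0,T]$ for each $T<T_{\max}$); if $T_{\max}<\infty$ then $\limsup_{t\uparrow T_{\max}}(\|u(t)\|_V+\|u_t(t)\|_2)=\infty$; $E$ is locally absolutely continuous and, for a.e. $t<T_{\max}$, $E'(t)=-\|\nabla u_t(t)\|_2^2-\frac12g(t)\|\nabla u(t)\|_2^2+\frac12\int_0^tg'(t-s)\|\nabla u(t)-\nabla u(s)\|_2^2\,ds$. Constant. When $\ell>1/(p_--1)^2$, set $C=\min\left\{p_-+2,\ \frac{2\lambda_1[(p_--1)^2\ell-1]}{2p_-+\lambda_1}\right\}>0$.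 *)

theory Defs
  imports "HOL-Analysis.Analysis" "HOL-Probability.Essential_Supremum"
begin
primrec Ck :: "nat \<Rightarrow> ('a::euclidean_space \<Rightarrow> real) \<Rightarrow> bool" where
  "Ck 0 f \<longleftrightarrow> continuous_on UNIV f"
| "Ck (Suc k) f \<longleftrightarrow>
     f differentiable_on UNIV \<and> (\<forall>v. Ck k (\<lambda>x. frechet_derivative f (at x) v))"

definition smooth :: "('a::euclidean_space \<Rightarrow> real) \<Rightarrow> bool" where
  "smooth f \<longleftrightarrow> (\<forall>k. Ck k f)"

definition test_functions :: "'a::euclidean_space set \<Rightarrow> ('a \<Rightarrow> real) set" where
  "test_functions U = {\<phi>. smooth \<phi> \<and> (\<exists>K. compact K \<and> K \<subseteq> U \<and> (\<forall>x. x \<notin> K \<longrightarrow> \<phi> x = 0))}"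

text \<open>Near each boundary point the domain is, after relabelling and reorienting the coordinate
  axes (the choice of \<open>i\<close> and of the sign \<open>s\<close>), the strict epigraph of a smooth function \<open>\<gamma>\<close> of
  the remaining \<open>n - 1\<close> coordinates; such a function is encoded as a function on the whole space
  that does not depend on the \<open>i\<close>-th coordinate.\<close>

definition smooth_boundary :: "(real^'n) set \<Rightarrow> bool" where
  "smooth_boundary \<Omega> \<longleftrightarrow>
     (\<forall>x0\<in>frontier \<Omega>. \<exists>r>0. \<exists>i. \<exists>s\<in>{1, -1}. \<exists>\<gamma>. smooth \<gamma> \<and>
        (\<forall>x y. (\<forall>j. j \<noteq> i \<longrightarrow> x $ j = y $ j) \<longrightarrow> \<gamma> x = \<gamma> y) \<and>
        \<Omega> \<inter> ball x0 r = {x \<in> ball x0 r. s * x $ i > \<gamma> x})"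

definition smooth_bounded_domain :: "(real^'n) set \<Rightarrow> bool" where
  "smooth_bounded_domain \<Omega> \<longleftrightarrow>
     open \<Omega> \<and> connected \<Omega> \<and> \<Omega> \<noteq> {} \<and> bounded \<Omega> \<and> smooth_boundary \<Omega>"

text \<open>Elements of the function spaces are represented by functions on the whole space; values
  outside \<open>\<Omega>\<close> are irrelevant, and functions that agree almost everywhere on \<open>\<Omega>\<close> represent the same
  element. The codomain of the \<open>L\<^sup>2\<close> notions is real or a Euclidean space (for gradients).\<close>

definition L2 :: "(real^'n) set \<Rightarrow> (real^'n \<Rightarrow> 'b::euclidean_space) set" where
  "L2 \<Omega> = {f. f \<in> borel_measurable (lebesgue_on \<Omega>) \<and>
              integrable (lebesgue_on \<Omega>) (\<lambda>x. (norm (f x))\<^sup>2)}"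

definition l2_inner ::
  "(real^'n) set \<Rightarrow> (real^'n \<Rightarrow> 'b::euclidean_space) \<Rightarrow> (real^'n \<Rightarrow> 'b) \<Rightarrow> real" where
  "l2_inner \<Omega> f h = (LINT x|lebesgue_on \<Omega>. f x \<bullet> h x)"

definition l2_norm :: "(real^'n) set \<Rightarrow> (real^'n \<Rightarrow> 'b::euclidean_space) \<Rightarrow> real" where
  "l2_norm \<Omega> f = sqrt (LINT x|lebesgue_on \<Omega>. (norm (f x))\<^sup>2)"

definition grad :: "(real^'n \<Rightarrow> real) \<Rightarrow> real^'n \<Rightarrow> real^'n" where
  "grad \<phi> x = (\<chi> i. frechet_derivative \<phi> (at x) (axis i 1))"

definition has_weak_grad ::
  "(real^'n) set \<Rightarrow> (real^'n \<Rightarrow> real) \<Rightarrow> (real^'n \<Rightarrow> real^'n) \<Rightarrow> bool" where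
  "has_weak_grad \<Omega> u w \<longleftrightarrow> u \<in> L2 \<Omega> \<and> w \<in> L2 \<Omega> \<and>
     (\<forall>\<phi>\<in>test_functions \<Omega>. \<forall>i.
        (LINT x|lebesgue_on \<Omega>. u x * grad \<phi> x $ i) = - (LINT x|lebesgue_on \<Omega>. w x $ i * \<phi> x))"

text \<open>The weak gradient is determined up to equality almost everywhere.\<close>

definition weak_grad :: "(real^'n) set \<Rightarrow> (real^'n \<Rightarrow> real) \<Rightarrow> real^'n \<Rightarrow> real^'n" where
  "weak_grad \<Omega> u = (SOME w. has_weak_grad \<Omega> u w)"

definition H01 :: "(real^'n) set \<Rightarrow> (real^'n \<Rightarrow> real) set" where
  "H01 \<Omega> = {u. \<exists>w. has_weak_grad \<Omega> u w \<and>
     (\<exists>\<phi>. (\<forall>k::nat. \<phi> k \<in> test_functions \<Omega>) \<and>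
          (\<lambda>k. l2_norm \<Omega> (\<lambda>x. \<phi> k x - u x)) \<longlonglongrightarrow> 0 \<and>
          (\<lambda>k. l2_norm \<Omega> (\<lambda>x. grad (\<phi> k) x - w x)) \<longlonglongrightarrow> 0)}"

definition V_norm :: "(real^'n) set \<Rightarrow> (real^'n \<Rightarrow> real) \<Rightarrow> real" where
  "V_norm \<Omega> z = l2_norm \<Omega> (weak_grad \<Omega> z)"

definition V_dual :: "(real^'n) set \<Rightarrow> ((real^'n \<Rightarrow> real) \<Rightarrow> real) set" where
  "V_dual \<Omega> = {\<zeta>.
     (\<forall>z\<in>H01 \<Omega>. \<forall>w\<in>H01 \<Omega>. \<forall>a b. \<zeta> (\<lambda>x. a * z x + b * w x) = a * \<zeta> z + b * \<zeta> w) \<and>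
     (\<exists>M. \<forall>z\<in>H01 \<Omega>. \<bar>\<zeta> z\<bar> \<le> M * V_norm \<Omega> z)}"

definition V_dual_norm :: "(real^'n) set \<Rightarrow> ((real^'n \<Rightarrow> real) \<Rightarrow> real) \<Rightarrow> real" where
  "V_dual_norm \<Omega> \<zeta> = (SUP z\<in>{z \<in> H01 \<Omega>. V_norm \<Omega> z \<le> 1}. \<bar>\<zeta> z\<bar>)"

definition dirichlet_eigenvalue :: "(real^'n) set \<Rightarrow> real \<Rightarrow> bool" where
  "dirichlet_eigenvalue \<Omega> \<mu> \<longleftrightarrow>
     (\<exists>z\<in>H01 \<Omega>. \<not> (AE x in lebesgue_on \<Omega>. z x = 0) \<and>
        (\<forall>v\<in>H01 \<Omega>. l2_inner \<Omega> (weak_grad \<Omega> z) (weak_grad \<Omega> v) = \<mu> * l2_inner \<Omega> z v))"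

definition lambda1 :: "(real^'n) set \<Rightarrow> real" where
  "lambda1 \<Omega> = (LEAST \<mu>. dirichlet_eigenvalue \<Omega> \<mu>)"

text \<open>For functions of time with values in a function space, \<open>X\<close> is the carrier of that space and
  \<open>N\<close> its norm; \<open>cont_time\<close> and \<open>L2_time\<close> express membership in \<open>C([0,T];X)\<close> and \<open>L\<^sup>2(0,T;X)\<close>.
  Differences are pointwise, so \<open>N\<close> must (and does, for the norms used below) ignore the choice
  of representatives.\<close>

definition strongly_measurable ::
  "'b::minus set \<Rightarrow> ('b \<Rightarrow> real) \<Rightarrow> real \<Rightarrow> (real \<Rightarrow> 'b) \<Rightarrow> bool" where
  "strongly_measurable X N T f \<longleftrightarrow>
     (\<exists>s. (\<forall>k::nat. finite (s k ` {0<..<T}) \<and> s k ` {0<..<T} \<subseteq> X \<and>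
             (\<forall>y. {t \<in> {0<..<T}. s k t = y} \<in> sets lebesgue)) \<and>
          (AE t in lebesgue_on {0<..<T}. (\<lambda>k. N (s k t - f t)) \<longlonglongrightarrow> 0))"

definition cont_time :: "'b::minus set \<Rightarrow> ('b \<Rightarrow> real) \<Rightarrow> real \<Rightarrow> (real \<Rightarrow> 'b) \<Rightarrow> bool" where
  "cont_time X N T f \<longleftrightarrow>
     (\<forall>t\<in>{0..T}. f t \<in> X \<and> ((\<lambda>s. N (f s - f t)) \<longlongrightarrow> 0) (at t within {0..T}))"

definition L2_time :: "'b::minus set \<Rightarrow> ('b \<Rightarrow> real) \<Rightarrow> real \<Rightarrow> (real \<Rightarrow> 'b) \<Rightarrow> bool" where
  "L2_time X N T f \<longleftrightarrow>
     (AE t in lebesgue_on {0<..<T}. f t \<in> X) \<and> strongly_measurable X N T f \<and>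
     integrable (lebesgue_on {0<..<T}) (\<lambda>t. (N (f t))\<^sup>2)"

definition weak_time_deriv :: "real \<Rightarrow> (real \<Rightarrow> real) \<Rightarrow> (real \<Rightarrow> real) \<Rightarrow> bool" where
  "weak_time_deriv T a b \<longleftrightarrow>
     (\<forall>\<phi>\<in>test_functions {0<..<T}.
        (LINT t|lebesgue_on {0<..<T}. a t * deriv \<phi> t) =
        - (LINT t|lebesgue_on {0<..<T}. b t * \<phi> t))"

definition abs_continuous_on :: "real \<Rightarrow> real \<Rightarrow> (real \<Rightarrow> real) \<Rightarrow> bool" where
  "abs_continuous_on a b f \<longleftrightarrow>
     (\<forall>\<epsilon>>0. \<exists>\<delta>>0. \<forall>I. finite I \<and> (\<forall>(s, t)\<in>I. a \<le> s \<and> s \<le> t \<and> t \<le> b) \<and>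
        disjoint_family_on (\<lambda>(s, t). {s<..<t}) I \<and> (\<Sum>(s, t)\<in>I. t - s) < \<delta> \<longrightarrow>
        (\<Sum>(s, t)\<in>I. \<bar>f t - f s\<bar>) < \<epsilon>)"

definition p_essinf :: "(real^'n) set \<Rightarrow> (real^'n \<Rightarrow> real) \<Rightarrow> ereal" where
  "p_essinf \<Omega> p = Liminf (ae_filter (lebesgue_on \<Omega>)) (\<lambda>x. ereal (p x))"

definition p_esssup :: "(real^'n) set \<Rightarrow> (real^'n \<Rightarrow> real) \<Rightarrow> ereal" where
  "p_esssup \<Omega> p = esssup (lebesgue_on \<Omega>) (\<lambda>x. ereal (p x))"

definition p_minus :: "(real^'n) set \<Rightarrow> (real^'n \<Rightarrow> real) \<Rightarrow> real" where
  "p_minus \<Omega> p = real_of_ereal (p_essinf \<Omega> p)"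

definition two_star :: "nat \<Rightarrow> ereal" where
  "two_star n = (if n \<ge> 3 then ereal (2 * real n / (real n - 2)) else \<infinity>)"

definition H1 :: "(real^'n) set \<Rightarrow> (real^'n \<Rightarrow> real) \<Rightarrow> bool" where
  "H1 \<Omega> p \<longleftrightarrow> p \<in> borel_measurable (lebesgue_on \<Omega>) \<and>
     2 < p_essinf \<Omega> p \<and>
     (AE x in lebesgue_on \<Omega>. p_essinf \<Omega> p \<le> ereal (p x) \<and> ereal (p x) \<le> p_esssup \<Omega> p) \<and>
     p_esssup \<Omega> p < two_star CARD('n)"

definition kernel_deriv :: "(real \<Rightarrow> real) \<Rightarrow> real \<Rightarrow> real" where
  "kernel_deriv g s = vector_derivative g (at s within {0..})"

definition ell :: "(real \<Rightarrow> real) \<Rightarrow> real" where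
  "ell g = 1 - (LINT s|lebesgue_on {0..}. g s)"

definition H2 :: "(real \<Rightarrow> real) \<Rightarrow> bool" where
  "H2 g \<longleftrightarrow> g differentiable_on {0..} \<and> continuous_on {0..} (kernel_deriv g) \<and>
     (\<forall>s\<ge>0. g s \<ge> 0) \<and> (\<forall>s\<ge>0. kernel_deriv g s \<le> 0) \<and>
     integrable (lebesgue_on {0..}) g \<and> ell g > 0"

text \<open>\<open>source q r\<close> is $|r|^{q-2} r \log |r|$, and \<open>source_primitive q r\<close> its primitive in \<open>r\<close>.\<close>

definition source :: "real \<Rightarrow> real \<Rightarrow> real" where
  "source q r = (if r = 0 then 0 else \<bar>r\<bar> powr (q - 2) * r * ln \<bar>r\<bar>)"

definition source_primitive :: "real \<Rightarrow> real \<Rightarrow> real" where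
  "source_primitive q r =
     (if r = 0 then 0 else \<bar>r\<bar> powr q / q * ln \<bar>r\<bar> - \<bar>r\<bar> powr q / q\<^sup>2)"

text \<open>The pair \<open>u, ut\<close> consists of a solution and its time derivative. Time derivatives are taken
  in the sense of distributions on \<open>(0,T)\<close> with values in the dual of \<open>H01 \<Omega>\<close>, into which \<open>L2 \<Omega>\<close> is
  embedded through the \<open>L\<^sup>2\<close> inner product. The last clause asserts both that the source term
  is integrable against \<open>z\<close> and that the weak form of the equation holds.\<close>

definition energy_solution ::
  "(real^'n) set \<Rightarrow> (real^'n \<Rightarrow> real) \<Rightarrow> (real \<Rightarrow> real) \<Rightarrow> (real^'n \<Rightarrow> real) \<Rightarrow> (real^'n \<Rightarrow> real) \<Rightarrow>
   real \<Rightarrow> (real \<Rightarrow> real^'n \<Rightarrow> real) \<Rightarrow> (real \<Rightarrow> real^'n \<Rightarrow> real) \<Rightarrow> bool" where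
  "energy_solution \<Omega> p g u0 u1 T u ut \<longleftrightarrow>
     cont_time (H01 \<Omega>) (V_norm \<Omega>) T u \<and>
     cont_time (L2 \<Omega>) (l2_norm \<Omega>) T ut \<and>
     L2_time (H01 \<Omega>) (V_norm \<Omega>) T ut \<and>
     (\<forall>z\<in>H01 \<Omega>. weak_time_deriv T (\<lambda>t. l2_inner \<Omega> (u t) z) (\<lambda>t. l2_inner \<Omega> (ut t) z)) \<and>
     (AE x in lebesgue_on \<Omega>. u 0 x = u0 x) \<and>
     (AE x in lebesgue_on \<Omega>. ut 0 x = u1 x) \<and>
     (\<exists>utt. L2_time (V_dual \<Omega>) (V_dual_norm \<Omega>) T utt \<and>
        (\<forall>z\<in>H01 \<Omega>. weak_time_deriv T (\<lambda>t. l2_inner \<Omega> (ut t) z) (\<lambda>t. utt t z)) \<and>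
        (\<forall>z\<in>H01 \<Omega>. AE t in lebesgue_on {0<..<T}.
           has_bochner_integral (lebesgue_on \<Omega>) (\<lambda>x. source (p x) (u t x) * z x)
             (utt t z
              + l2_inner \<Omega> (weak_grad \<Omega> (u t)) (weak_grad \<Omega> z)
              + l2_inner \<Omega> (weak_grad \<Omega> (ut t)) (weak_grad \<Omega> z)
              - (LINT s|lebesgue_on {0..t}.
                   g (t - s) * l2_inner \<Omega> (weak_grad \<Omega> (u s)) (weak_grad \<Omega> z)))))"

definition solution_before ::
  "(real^'n) set \<Rightarrow> (real^'n \<Rightarrow> real) \<Rightarrow> (real \<Rightarrow> real) \<Rightarrow> (real^'n \<Rightarrow> real) \<Rightarrow> (real^'n \<Rightarrow> real) \<Rightarrow>
   ereal \<Rightarrow> (real \<Rightarrow> real^'n \<Rightarrow> real) \<Rightarrow> (real \<Rightarrow> real^'n \<Rightarrow> real) \<Rightarrow> bool" where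
  "solution_before \<Omega> p g u0 u1 Tmax u ut \<longleftrightarrow>
     (\<forall>T. 0 < T \<and> ereal T < Tmax \<longrightarrow> energy_solution \<Omega> p g u0 u1 T u ut)"

definition maximal_energy_solution ::
  "(real^'n) set \<Rightarrow> (real^'n \<Rightarrow> real) \<Rightarrow> (real \<Rightarrow> real) \<Rightarrow> (real^'n \<Rightarrow> real) \<Rightarrow> (real^'n \<Rightarrow> real) \<Rightarrow>
   ereal \<Rightarrow> (real \<Rightarrow> real^'n \<Rightarrow> real) \<Rightarrow> (real \<Rightarrow> real^'n \<Rightarrow> real) \<Rightarrow> bool" where
  "maximal_energy_solution \<Omega> p g u0 u1 Tmax u ut \<longleftrightarrow>
     0 < Tmax \<and> solution_before \<Omega> p g u0 u1 Tmax u ut \<and>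
     \<not> (\<exists>T' u' ut'. Tmax < T' \<and> solution_before \<Omega> p g u0 u1 T' u' ut' \<and>
          (\<forall>t. 0 \<le> t \<and> ereal t < Tmax \<longrightarrow> (AE x in lebesgue_on \<Omega>. u' t x = u t x)))"

definition blows_up_at ::
  "(real^'n) set \<Rightarrow> ereal \<Rightarrow> (real \<Rightarrow> real^'n \<Rightarrow> real) \<Rightarrow> (real \<Rightarrow> real^'n \<Rightarrow> real) \<Rightarrow> bool" where
  "blows_up_at \<Omega> Tmax u ut \<longleftrightarrow>
     Limsup (at_left (real_of_ereal Tmax))
       (\<lambda>t. ereal (V_norm \<Omega> (u t) + l2_norm \<Omega> (ut t))) = \<infinity>"

definition memory_energy ::
  "(real^'n) set \<Rightarrow> (real \<Rightarrow> real) \<Rightarrow> (real \<Rightarrow> real^'n \<Rightarrow> real) \<Rightarrow> real \<Rightarrow> real" where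
  "memory_energy \<Omega> k u t =
     (LINT s|lebesgue_on {0..t}.
        k (t - s) * (l2_norm \<Omega> (\<lambda>x. weak_grad \<Omega> (u t) x - weak_grad \<Omega> (u s) x))\<^sup>2)"

definition energy ::
  "(real^'n) set \<Rightarrow> (real^'n \<Rightarrow> real) \<Rightarrow> (real \<Rightarrow> real) \<Rightarrow>
   (real \<Rightarrow> real^'n \<Rightarrow> real) \<Rightarrow> (real \<Rightarrow> real^'n \<Rightarrow> real) \<Rightarrow> real \<Rightarrow> real" where
  "energy \<Omega> p g u ut t =
     1/2 * (l2_norm \<Omega> (ut t))\<^sup>2
     + 1/2 * (1 - (LINT s|lebesgue_on {0..t}. g s)) * (l2_norm \<Omega> (weak_grad \<Omega> (u t)))\<^sup>2
     + 1/2 * memory_energy \<Omega> g u t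
     - (LINT x|lebesgue_on \<Omega>. source_primitive (p x) (u t x))"

definition c_shift :: "real \<Rightarrow> real \<Rightarrow> real" where
  "c_shift pm q = (if q > pm then (q - pm) / q\<^sup>2 * exp (- q / (q - pm)) else 0)"

definition C_star :: "(real^'n) set \<Rightarrow> (real^'n \<Rightarrow> real) \<Rightarrow> real" where
  "C_star \<Omega> p = (LINT x|lebesgue_on \<Omega>. c_shift (p_minus \<Omega> p) (p x))"

definition shifted_energy ::
  "(real^'n) set \<Rightarrow> (real^'n \<Rightarrow> real) \<Rightarrow> (real \<Rightarrow> real) \<Rightarrow>
   (real \<Rightarrow> real^'n \<Rightarrow> real) \<Rightarrow> (real \<Rightarrow> real^'n \<Rightarrow> real) \<Rightarrow> real \<Rightarrow> real" where
  "shifted_energy \<Omega> p g u ut t = energy \<Omega> p g u ut t + C_star \<Omega> p / p_minus \<Omega> p"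

definition blowup_const :: "(real^'n) set \<Rightarrow> (real^'n \<Rightarrow> real) \<Rightarrow> (real \<Rightarrow> real) \<Rightarrow> real" where
  "blowup_const \<Omega> p g =
     min (p_minus \<Omega> p + 2)
         (2 * lambda1 \<Omega> * ((p_minus \<Omega> p - 1)\<^sup>2 * ell g - 1) / (2 * p_minus \<Omega> p + lambda1 \<Omega>))"

text \<open>The local theory of the problem is used as a hypothesis; it quantifies over all initial data.\<close>

definition local_theory :: "(real^'n) set \<Rightarrow> (real^'n \<Rightarrow> real) \<Rightarrow> (real \<Rightarrow> real) \<Rightarrow> bool" where
  "local_theory \<Omega> p g \<longleftrightarrow>
     (\<forall>u0\<in>H01 \<Omega>. \<forall>u1\<in>L2 \<Omega>.
        (\<exists>Tmax u ut. maximal_energy_solution \<Omega> p g u0 u1 Tmax u ut) \<and>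
        (\<forall>Tmax u ut T' u' ut'.
           maximal_energy_solution \<Omega> p g u0 u1 Tmax u ut \<and>
           maximal_energy_solution \<Omega> p g u0 u1 T' u' ut' \<longrightarrow>
           T' = Tmax \<and>
           (\<forall>t. 0 \<le> t \<and> ereal t < Tmax \<longrightarrow> (AE x in lebesgue_on \<Omega>. u' t x = u t x))) \<and>
        (\<forall>Tmax u ut. maximal_energy_solution \<Omega> p g u0 u1 Tmax u ut \<longrightarrow>
           (Tmax < \<infinity> \<longrightarrow> blows_up_at \<Omega> Tmax u ut) \<and>
           (\<forall>T. 0 < T \<and> ereal T < Tmax \<longrightarrow> abs_continuous_on 0 T (energy \<Omega> p g u ut)) \<and>
           (AE t in lebesgue. 0 < t \<and> ereal t < Tmax \<longrightarrow>
              (energy \<Omega> p g u ut has_real_derivative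
                 (- (l2_norm \<Omega> (weak_grad \<Omega> (ut t)))\<^sup>2
                  - 1/2 * g t * (l2_norm \<Omega> (weak_grad \<Omega> (u t)))\<^sup>2
                  + 1/2 * memory_energy \<Omega> (kernel_deriv g) u t)) (at t))))"

end

theory Submission
  imports Defs "HOL-Complex_Analysis.Great_Picard" "HOL-Library.Diagonal_Subsequence"
begin

text \<open>The blow-up argument rests on two differential inequalities, both consequences of one estimate.
  Tested with \<open>u\<close> itself, the equation gives
  \<open>(pairing + dirichlet / 2)' = kinetic + force\<close>, where \<open>pairing = (u, ut)\<close>, \<open>dirichlet\<close> and \<open>kinetic\<close>
  are the squared norms of \<open>grad u\<close> and \<open>ut\<close>, and half of the Dirichlet energy stems from the strong
  damping (\<open>momentum_deriv\<close>). The source is at least \<open>pm\<close> times its primitive, up to a constant which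
  is exactly the shift of the energy; this is the minimization of \<open>a y ln y + b y\<close> behind
  \<open>source_ge_primitive\<close>. Hence (\<open>momentum_deriv_ge\<close>)
  \<open>kinetic + force \<ge> (1 + pm / 2) kinetic + gap dirichlet - pm shifted\<close>,
  where the condition on the kernel makes \<open>gap\<close> nonnegative.

  If the shifted energy is at most \<open>-\<beta> < 0\<close> at some time \<open>t1\<close>, then it stays below \<open>-\<beta>\<close> by at least
  the dissipation since \<open>t1\<close>. The functional
  \<open>\<psi>(t) = mass + \<integral> dirichlet + (T1 - t) dirichlet(t1) + \<beta> (t - t1 + \<sigma>)\<^sup>2\<close> then satisfies
  \<open>\<psi> \<psi>'' \<ge> (pm + 2) / 4 (\<psi>')\<^sup>2\<close>, so a negative power of \<open>\<psi>\<close> is concave and reaches zero before an explicit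
  time (\<open>concavity_bound\<close>, \<open>concavity_estimate\<close>). Minimizing this time over \<open>\<sigma>\<close> gives the bounds in closed
  form (\<open>optimal_shift\<close>). For negative initial energy \<open>t1 = 0\<close>.

  If the initial energy is nonnegative, the excess \<open>pairing - (pm / C) shifted\<close> grows at least
  at the exponential rate \<open>C\<close> (\<open>excess_growth\<close>): the constant \<open>C\<close> is chosen such that the increment of the
  Dirichlet energy hidden in the momentum is paid for by the dissipation. As long as the energy
  stays above \<open>-\<beta>\<close>, the growing excess forces the mass up faster than the
  energy available for dissipation allows it to move, and at the time \<open>\<tau>\<close> the two bounds contradict each other
  (\<open>energy_reaches_level\<close>). So the energy falls to \<open>-\<beta>\<close> before \<open>\<tau>\<close>, where the concavity estimate takes
  over, with data controlled by the displacement since time zero (\<open>lifespan_of_positive_excess\<close>). A finite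
  lifespan entails the unboundedness of the norms by the local theory.

  Two kinds of preparation carry these computations. The first is static: the Sobolev embedding below the
  critical exponent and the compactness theorem of Rellich, both read off from
  averages over small cubes (\<open>avg_diff_estimate\<close>), and from them the integrability and continuity of
  the source and the variational characterization of the first eigenvalue (\<open>lambda1_Poincare\<close>). The second
  concerns time: the equation holds weakly, for test functions fixed in time, so all
  identities are first proved as increments over an interval \<open>[s, t]\<close>, tested with combinations of \<open>u s\<close> and
  \<open>u t\<close> that make them exact, and then differentiated or summed (\<open>deriv_of_increment\<close>,
  \<open>decreasing_of_local\<close>).\<close>

section \<open>Smooth functions and cut-offs\<close>

lemma Ck_const: "Ck k (\<lambda>x. c)"
proof (induction k arbitrary: c)
  case (Suc k)
  show ?case using Suc[of 0] by (auto simp: differentiable_on_def)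
qed simp

lemma Ck_SucD:
  assumes "Ck (Suc k) f"
  shows "Ck k f"
  using assms
proof (induction k arbitrary: f)
  case 0
  then show ?case by (simp add: differentiable_imp_continuous_on)
next
  case (Suc k)
  then show ?case by simp
qed

lemma Ck_has_derivative:
  assumes "Ck (Suc k) f"
  shows "(f has_derivative frechet_derivative f (at x)) (at x)"
  using assms by (simp add: differentiable_on_def frechet_derivative_works)

lemma Ck_SucI:
  assumes "\<And>x. (f has_derivative f' x) (at x)" "\<And>v. Ck k (\<lambda>x. f' x v)"
  shows "Ck (Suc k) f"
proof -
  have "f' x = frechet_derivative f (at x)" for x
    by (rule frechet_derivative_at[OF assms(1)])
  with assms(2) have "\<forall>v. Ck k (\<lambda>x. frechet_derivative f (at x) v)" by simp
  moreover have "f differentiable_on UNIV"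
    using assms(1) by (auto simp: differentiable_on_def differentiable_def)
  ultimately show ?thesis by simp
qed

lemma Ck_add:
  assumes "Ck k f" "Ck k h"
  shows "Ck k (\<lambda>x. f x + h x)"
  using assms
proof (induction k arbitrary: f h)
  case 0
  then show ?case by (auto intro: continuous_intros)
next
  case (Suc k)
  show ?case
    by (rule Ck_SucI[where f' = "\<lambda>x v. frechet_derivative f (at x) v + frechet_derivative h (at x) v"])
       (use Suc in \<open>auto intro!: has_derivative_add Ck_has_derivative simp del: Ck.simps(2) intro: Suc.IH\<close>,
        use Suc in \<open>auto intro: Suc.IH\<close>)
qed

lemma Ck_mult:
  assumes "Ck k f" "Ck k h"
  shows "Ck k (\<lambda>x. f x * h x)"
  using assms
proof (induction k arbitrary: f h)
  case 0
  then show ?case by (auto intro: continuous_intros)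
next
  case (Suc k)
  show ?case
  proof (rule Ck_SucI[where f' = "\<lambda>x v. f x * frechet_derivative h (at x) v
                                       + frechet_derivative f (at x) v * h x"])
    show "((\<lambda>x. f x * h x) has_derivative
        (\<lambda>v. f x * frechet_derivative h (at x) v + frechet_derivative f (at x) v * h x)) (at x)" for x
      by (rule has_derivative_mult; rule Ck_has_derivative; fact)
    show "Ck k (\<lambda>x. f x * frechet_derivative h (at x) v + frechet_derivative f (at x) v * h x)" for v
      using Suc.prems by (intro Ck_add Suc.IH Ck_SucD[OF Suc.prems(1)] Ck_SucD[OF Suc.prems(2)]) auto
  qed
qed

lemma Ck_affine:
  fixes h :: "real \<Rightarrow> real" and l :: "'a::euclidean_space \<Rightarrow> real"
  assumes "bounded_linear l" "Ck k h"
  shows "Ck k (\<lambda>x. h (l x + c))"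
  using assms(2)
proof (induction k arbitrary: h)
  case 0
  have "continuous_on UNIV (\<lambda>x. l x + c)"
    by (intro continuous_intros linear_continuous_on assms)
  with 0 show ?case
    by (auto intro: continuous_on_compose2[of UNIV h])
next
  case (Suc k)
  show ?case
  proof (rule Ck_SucI[where f' = "\<lambda>x v. frechet_derivative h (at (l x + c)) (l v)"])
    fix x
    have 1: "((\<lambda>x. l x + c) has_derivative l) (at x)"
      using has_derivative_add[OF bounded_linear.has_derivative[OF assms(1) has_derivative_ident[of "at x"]]
          has_derivative_const[of c]] by simp
    show "((\<lambda>x. h (l x + c)) has_derivative (\<lambda>v. frechet_derivative h (at (l x + c)) (l v))) (at x)"
      using has_derivative_compose[OF 1 Ck_has_derivative[OF Suc.prems]] by simp
  next
    show "Ck k (\<lambda>x. frechet_derivative h (at (l x + c)) (l v))" for v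
      by (rule Suc.IH) (use Suc.prems in simp)
  qed
qed

lemma Ck_real_SucI:
  assumes "\<And>x. (f has_real_derivative f' x) (at x)" "Ck k f'"
  shows "Ck (Suc k) f"
proof (rule Ck_SucI[where f' = "\<lambda>x v. f' x * v"])
  show "(f has_derivative (*) (f' x)) (at x)" for x
    using assms(1)[of x] by (simp add: has_field_derivative_def)
  show "Ck k (\<lambda>x. f' x * v)" for v
    by (intro Ck_mult Ck_const assms)
qed

lemma smooth_const: "smooth (\<lambda>x. c)"
  by (simp add: smooth_def Ck_const)

lemma smooth_add: "smooth f \<Longrightarrow> smooth h \<Longrightarrow> smooth (\<lambda>x. f x + h x)"
  by (simp add: smooth_def Ck_add)

lemma smooth_mult: "smooth f \<Longrightarrow> smooth h \<Longrightarrow> smooth (\<lambda>x. f x * h x)"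
  by (simp add: smooth_def Ck_mult)

lemma smooth_affine:
  fixes h :: "real \<Rightarrow> real"
  assumes "bounded_linear l" "smooth h"
  shows "smooth (\<lambda>x. h (l x + c))"
  using Ck_affine[OF assms(1)] assms(2) by (simp add: smooth_def)

lemma smooth_prod:
  assumes "\<And>i. i \<in> I \<Longrightarrow> smooth (f i)"
  shows "smooth (\<lambda>x. \<Prod>i\<in>I. f i x)"
  using assms
  by (induction I rule: infinite_finite_induct) (auto intro: smooth_const smooth_mult)

lemma smooth_has_derivative:
  "smooth f \<Longrightarrow> (f has_derivative frechet_derivative f (at x)) (at x)"
  unfolding smooth_def using Ck_has_derivative by blast

lemma smooth_continuous_on: "smooth f \<Longrightarrow> continuous_on S f"
  unfolding smooth_def using continuous_on_subset[of UNIV f S] by (metis Ck.simps(1) top_greatest)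

lemma smooth_frechet_derivative:
  "smooth f \<Longrightarrow> smooth (\<lambda>x. frechet_derivative f (at x) v)"
  unfolding smooth_def by (metis Ck.simps(2))

text \<open>The functions \<open>exp (- 1 / x) / x ^ j\<close>, cut off at \<open>0\<close>, form a family closed under
  differentiation up to linear combinations; at the origin the factor \<open>exp (- 1 / x)\<close> beats every
  power, so each of them vanishes there to second order.\<close>

definition flat :: "nat \<Rightarrow> real \<Rightarrow> real" where
  "flat j x = (if x > 0 then exp (- 1 / x) / x ^ j else 0)"

text \<open>The exponential series gives \<open>exp (1 / x) \<ge> (1 / x) ^ (j + 2) / fact (j + 2)\<close>; two spare powers of \<open>x\<close>
  remain after division by \<open>x ^ j\<close>, enough for a vanishing derivative at the origin.\<close>

lemma flat_bound: "\<bar>flat j x\<bar> \<le> fact (j + 2) * x\<^sup>2"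
proof (cases "x > 0")
  case True
  have "(1 / x) ^ (j + 2) /\<^sub>R fact (j + 2) \<le> exp (1 / x)"
  proof -
    have "(\<Sum>n\<in>{j + 2}. (1 / x) ^ n /\<^sub>R fact n) \<le> (\<Sum>n. (1 / x) ^ n /\<^sub>R fact n)"
      using True summable_exp_generic[of "1 / x"] by (intro sum_le_suminf) auto
    then show ?thesis by (simp add: exp_def)
  qed
  then have "exp (- (1 / x)) \<le> fact (j + 2) * x ^ (j + 2)"
    using True by (simp add: exp_minus field_simps del: power_Suc fact_Suc power_add)
  then have "exp (- 1 / x) / x ^ j \<le> fact (j + 2) * x\<^sup>2"
    using True by (simp add: divide_simps power_add power2_eq_square mult_ac del: fact_Suc)
  with True show ?thesis by (simp add: flat_def)
qed (simp add: flat_def)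

lemma flat_deriv: "(flat j has_real_derivative (flat (j + 2) x - real j * flat (j + 1) x)) (at x)"
proof -
  consider "x > 0" | "x < 0" | "x = 0" by linarith
  then show ?thesis
  proof cases
    case 1
    have "((\<lambda>x. exp (- 1 / x) / x ^ j) has_real_derivative
        (flat (j + 2) x - real j * flat (j + 1) x)) (at x)"
      using 1 by (auto intro!: derivative_eq_intros simp: flat_def field_simps power_add)
         (cases j; simp add: field_simps power2_eq_square)
    then show ?thesis
      by (rule has_field_derivative_transform_within_open[where S = "{0<..}"])
         (use 1 in \<open>auto simp: flat_def\<close>)
  next
    case 2
    have "((\<lambda>x. 0) has_real_derivative 0) (at x)" by simp
    then have "(flat j has_real_derivative 0) (at x)"
      by (rule has_field_derivative_transform_within_open[where S = "{..<0}"])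
         (use 2 in \<open>auto simp: flat_def\<close>)
    with 2 show ?thesis by (simp add: flat_def)
  next
    case 3
    have "((\<lambda>h. flat j h / h) \<longlongrightarrow> 0) (at 0)"
    proof (rule Lim_null_comparison)
      show "\<forall>\<^sub>F h in at 0. norm (flat j h / h) \<le> fact (j + 2) * \<bar>h\<bar>"
      proof (rule eventuallyI)
        fix h :: real
        show "norm (flat j h / h) \<le> fact (j + 2) * \<bar>h\<bar>"
          using flat_bound[of j h]
          by (cases "h = 0") (auto simp: field_simps power2_eq_square abs_mult_self_eq simp del: fact_Suc)
      qed
      show "((\<lambda>h. fact (j + 2) * \<bar>h::real\<bar>) \<longlongrightarrow> 0) (at 0)"
        by (auto intro!: tendsto_eq_intros)
    qed
    then have "(flat j has_real_derivative 0) (at 0)"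
      by (simp add: DERIV_def flat_def)
    with 3 show ?thesis by (simp add: flat_def)
  qed
qed

lemma Ck_flat: "Ck k (flat j)"
proof (induction k arbitrary: j)
  case 0
  have "continuous_on UNIV (flat j)"
    using flat_deriv[of j] by (meson DERIV_continuous continuous_at_imp_continuous_on)
  then show ?case by simp
next
  case (Suc k)
  have eq: "flat (j + 2) x - real j * flat (j + 1) x = flat (j + 2) x + (- real j) * flat (j + 1) x" for x
    by simp
  show ?case
    by (rule Ck_real_SucI[where f' = "\<lambda>x. flat (j + 2) x - real j * flat (j + 1) x"], rule flat_deriv)
       (unfold eq, intro Ck_add Ck_mult Ck_const Suc)
qed

text \<open>A smooth step is a normalised antiderivative of the bump \<open>flat 0 x * flat 0 (1 - x)\<close>. Its
  rescalings approximate jump functions, and their derivatives approximate point masses.\<close>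

lemma smooth_step_exists:
  obtains S S' :: "real \<Rightarrow> real" where
    "smooth S" "\<And>x. (S has_real_derivative S' x) (at x)" "continuous_on UNIV S'"
    "\<And>x. 0 \<le> S' x" "\<And>x. x \<le> 0 \<Longrightarrow> S x = 0" "\<And>x. x \<ge> 1 \<Longrightarrow> S x = 1"
    "\<And>x. 0 \<le> S x \<and> S x \<le> 1" "\<And>x. x \<le> 0 \<or> x \<ge> 1 \<Longrightarrow> S' x = 0"
proof -
  define e where "e = (\<lambda>x. flat 0 x * flat 0 (1 - x))"
  have bl: "bounded_linear (\<lambda>x::real. - x)"
    by (rule bounded_linear_minus[OF bounded_linear_ident])
  have Ck_e: "Ck k e" for k
    using Ck_mult[OF Ck_flat[of k 0] Ck_affine[OF bl Ck_flat[of k 0], of 1]] by (simp add: e_def)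
  have cont_e: "continuous_on UNIV e" using Ck_e[of 0] by simp
  have "\<exists>F. \<forall>x::real. -\<infinity> < ereal x \<longrightarrow> ereal x < \<infinity> \<longrightarrow> (F has_vector_derivative e x) (at x)"
    by (rule einterval_antiderivative) (use cont_e in \<open>auto simp: continuous_on_eq_continuous_at\<close>)
  then obtain F where F: "(F has_real_derivative e x) (at x)" for x
    by (auto simp: has_real_derivative_iff_has_vector_derivative)
  have e0: "e x \<ge> 0" for x by (simp add: e_def flat_def)
  have F_mono: "F x \<le> F y" if "x \<le> y" for x y
    by (rule DERIV_nonneg_imp_nondecreasing[OF that]) (use F e0 in blast)
  have e_out: "e x = 0" if "x \<le> 0 \<or> x \<ge> 1" for x using that by (auto simp: e_def flat_def)
  have F_left: "F x = F 0" if "x \<le> 0" for x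
  proof (cases "x = 0")
    case False
    with that have "x < 0" by simp
    then obtain z where "x < z" "z < 0" "F 0 - F x = (0 - x) * e z"
      using MVT2[of x 0 F e] F by auto
    then show ?thesis using e_out[of z] by simp
  qed simp
  have F_right: "F x = F 1" if "x \<ge> 1" for x
  proof (cases "x = 1")
    case False
    with that have "1 < x" by simp
    then obtain z where "1 < z" "z < x" "F x - F 1 = (x - 1) * e z"
      using MVT2[of 1 x F e] F by auto
    then show ?thesis using e_out[of z] by simp
  qed simp
  define Z where "Z = F 1 - F 0"
  have "Z > 0"
  proof -
    obtain z where z: "0 < z" "z < 1" "F 1 - F 0 = (1 - 0) * e z"
      using MVT2[of 0 1 F e] F by auto
    moreover have "e z > 0" using z by (simp add: e_def flat_def)
    ultimately show ?thesis by (simp add: Z_def)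
  qed
  define S where "S = (\<lambda>x. (F x - F 0) / Z)"
  define S' where "S' = (\<lambda>x. e x * (1 / Z))"
  have S: "(S has_real_derivative S' x) (at x)" for x
    unfolding S_def S'_def using \<open>Z > 0\<close> F[of x]
    by (auto intro!: derivative_eq_intros)
  have "Ck k S" for k
  proof (cases k)
    case 0
    have "continuous_on UNIV S"
      using S by (meson DERIV_continuous continuous_at_imp_continuous_on)
    then show ?thesis using 0 by simp
  next
    case (Suc m)
    have "Ck m S'" unfolding S'_def by (intro Ck_mult Ck_e Ck_const)
    then show ?thesis unfolding Suc by (rule Ck_real_SucI[OF S])
  qed
  then have "smooth S" by (simp add: smooth_def)
  moreover have "continuous_on UNIV S'"
    unfolding S'_def by (intro continuous_intros cont_e)
  moreover have "S' x \<ge> 0" for x using e0 \<open>Z > 0\<close> by (simp add: S'_def)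
  moreover have "S x = 0" if "x \<le> 0" for x using F_left[OF that] by (simp add: S_def)
  moreover have "S x = 1" if "x \<ge> 1" for x
    using F_right[OF that] \<open>Z > 0\<close> by (simp add: S_def Z_def)
  moreover have "0 \<le> S x \<and> S x \<le> 1" for x
  proof -
    have "F 0 \<le> F x" using F_left[of x] F_mono[of 0 x] by fastforce
    moreover have "F x \<le> F 1" using F_right[of x] F_mono[of x 1] by fastforce
    ultimately show ?thesis using \<open>Z > 0\<close> by (simp add: S_def Z_def field_simps)
  qed
  moreover have "S' x = 0" if "x \<le> 0 \<or> x \<ge> 1" for x using e_out[OF that] by (simp add: S'_def)
  ultimately show ?thesis using that S by blast
qed

lemma test_functionsI:
  "smooth \<phi> \<Longrightarrow> compact K \<Longrightarrow> K \<subseteq> U \<Longrightarrow> (\<And>x. x \<notin> K \<Longrightarrow> \<phi> x = 0) \<Longrightarrow> \<phi> \<in> test_functions U"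
  by (auto simp: test_functions_def)

text \<open>Products over the coordinates of steepening smooth steps, one for each face of the box.\<close>

lemma box_cutoffs:
  fixes a b :: "real^'n"
  assumes "box a b \<subseteq> U"
  obtains \<phi> where "\<And>m::nat. \<phi> m \<in> test_functions U" "\<And>m x. 0 \<le> \<phi> m x \<and> \<phi> m x \<le> 1"
    "\<And>x. (\<lambda>m. \<phi> m x) \<longlonglongrightarrow> indicator (box a b) x"
proof -
  obtain S S' :: "real \<Rightarrow> real" where SS: "smooth S"
    "\<And>x. (S has_real_derivative S' x) (at x)" "continuous_on UNIV S'" "\<And>x. 0 \<le> S' x"
    "\<And>x. x \<le> 0 \<Longrightarrow> S x = 0" "\<And>x. x \<ge> 1 \<Longrightarrow> S x = 1" "\<And>x. 0 \<le> S x \<and> S x \<le> 1"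
    "\<And>x. x \<le> 0 \<or> x \<ge> 1 \<Longrightarrow> S' x = 0"
    by (rule smooth_step_exists) blast
  note S = SS(1,5,6,7)
  define \<phi> where "\<phi> = (\<lambda>(m::nat) (x::real^'n).
      \<Prod>i\<in>UNIV. S (real (Suc m) * x $ i + (- real (Suc m) * a $ i - 1)) *
                S (- real (Suc m) * x $ i + (real (Suc m) * b $ i - 1)))"
  have bl: "bounded_linear (\<lambda>x::real^'n. c * x $ i)" for c i
    by (intro bounded_linear_const_mult bounded_linear_vec_nth)
  define K where "K = (\<lambda>m. cbox (\<chi> i. a $ i + 1 / real (Suc m)) (\<chi> i. b $ i - 1 / real (Suc m)))"
  have zero: "\<phi> m x = 0" if out: "x \<notin> K m" for m x
  proof -
    obtain i where i: "\<not> (a $ i + 1 / real (Suc m) \<le> x $ i \<and> x $ i \<le> b $ i - 1 / real (Suc m))"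
      using out unfolding K_def mem_box_cart by auto
    have "real (Suc m) * x $ i + (- real (Suc m) * a $ i - 1) \<le> 0
        \<or> - real (Suc m) * x $ i + (real (Suc m) * b $ i - 1) \<le> 0"
      using i by (simp add: field_simps not_le del: of_nat_Suc) linarith
    then have "S (real (Suc m) * x $ i + (- real (Suc m) * a $ i - 1)) *
        S (- real (Suc m) * x $ i + (real (Suc m) * b $ i - 1)) = 0"
      using S(2) by auto
    then show ?thesis unfolding \<phi>_def by (intro prod_zero) auto
  qed
  \<comment> \<open>The shift by \<open>-1\<close> in the arguments of the steps keeps the support inside the open box.\<close>
  have K_box: "K m \<subseteq> box a b" for m
  proof
    fix x assume x: "x \<in> K m"
    have "a $ i < x $ i \<and> x $ i < b $ i" for i
    proof -
      have "a $ i + 1 / real (Suc m) \<le> x $ i" "x $ i \<le> b $ i - 1 / real (Suc m)" "1 / real (Suc m) > 0"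
        using x by (auto simp: K_def mem_box_cart)
      then show ?thesis by linarith
    qed
    then show "x \<in> box a b" by (simp add: mem_box_cart)
  qed
  have "\<phi> m \<in> test_functions U" for m
  proof (rule test_functionsI[of _ "K m"])
    show "smooth (\<phi> m)" unfolding \<phi>_def
      by (intro smooth_prod smooth_mult smooth_affine bl S)
    show "compact (K m)" by (simp add: K_def)
    show "K m \<subseteq> U" using K_box assms by blast
    show "\<phi> m x = 0" if "x \<notin> K m" for x by (rule zero[OF that])
  qed
  moreover have "0 \<le> \<phi> m x \<and> \<phi> m x \<le> 1" for m x
    unfolding \<phi>_def using S(4) by (auto intro!: prod_nonneg prod_le_1 mult_le_one)
  moreover have "(\<lambda>m. \<phi> m x) \<longlonglongrightarrow> indicator (box a b) x" for x
  proof (cases "x \<in> box a b")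
    case True
    have "\<forall>\<^sub>F m in sequentially. \<forall>i\<in>UNIV.
        S (real (Suc m) * x $ i + (- real (Suc m) * a $ i - 1)) = 1 \<and>
        S (- real (Suc m) * x $ i + (real (Suc m) * b $ i - 1)) = 1"
    proof (rule eventually_ball_finite, simp, rule ballI)
      fix i
      have ev: "\<forall>\<^sub>F m in sequentially. 2 \<le> real (Suc m) * c" if "c > 0" for c :: real
      proof -
        obtain N :: nat where N: "2 / c < real N" using reals_Archimedean2 by blast
        show ?thesis
        proof (rule eventually_sequentiallyI)
          fix m assume "N \<le> m"
          then have "2 / c < real (Suc m)" using N by linarith
          then show "2 \<le> real (Suc m) * c" using that by (simp add: field_simps)
        qed
      qed
      have "x $ i - a $ i > 0" "b $ i - x $ i > 0" using True by (auto simp: mem_box_cart)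
      then have "\<forall>\<^sub>F m in sequentially. 2 \<le> real (Suc m) * (x $ i - a $ i) \<and>
          2 \<le> real (Suc m) * (b $ i - x $ i)"
        using eventually_conj[OF ev ev] by blast
      then show "\<forall>\<^sub>F m in sequentially.
          S (real (Suc m) * x $ i + (- real (Suc m) * a $ i - 1)) = 1 \<and>
          S (- real (Suc m) * x $ i + (real (Suc m) * b $ i - 1)) = 1"
        by eventually_elim (auto intro!: S(3) simp: algebra_simps)
    qed
    then have "\<forall>\<^sub>F m in sequentially. \<phi> m x = 1"
      by eventually_elim (simp add: \<phi>_def)
    then show ?thesis using True by (simp add: tendsto_eventually)
  next
    case False
    then have "\<phi> m x = 0" for m using zero[of x m] K_box[of m] by blast
    with False show ?thesis by simp
  qed
  ultimately show ?thesis using that by blast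
qed

lemma smooth_deriv_direction:
  fixes \<phi> :: "real^'n \<Rightarrow> real"
  assumes "smooth \<phi>"
  shows "(\<phi> has_derivative (\<lambda>h. grad \<phi> x \<bullet> h)) (at x)"
proof -
  let ?D = "frechet_derivative \<phi> (at x)"
  have D: "(\<phi> has_derivative ?D) (at x)" by (rule smooth_has_derivative[OF assms])
  have lin: "linear ?D" using D by (rule has_derivative_linear)
  have "?D h = grad \<phi> x \<bullet> h" for h
  proof -
    have "?D h = ?D (\<Sum>i\<in>UNIV. h $ i *\<^sub>R axis i 1)"
      by (simp add: basis_expansion scalar_mult_eq_scaleR[symmetric])
    also have "\<dots> = (\<Sum>i\<in>UNIV. h $ i * ?D (axis i 1))"
      by (simp add: linear_sum[OF lin] linear_scale[OF lin])
    finally show ?thesis by (simp add: grad_def inner_vec_def mult.commute)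
  qed
  then have "?D = (\<lambda>h. grad \<phi> x \<bullet> h)" by auto
  with D show ?thesis by simp
qed

lemma smooth_grad_component: "smooth \<phi> \<Longrightarrow> smooth (\<lambda>x. grad \<phi> x $ i)"
  by (simp add: grad_def smooth_frechet_derivative)

lemma continuous_on_grad: "smooth \<phi> \<Longrightarrow> continuous_on S (grad \<phi>)"
  by (intro continuous_on_vec_lambda[of S "\<lambda>i x. grad \<phi> x $ i", simplified]
      smooth_continuous_on smooth_grad_component)

lemma grad_eqI:
  fixes \<phi> :: "real^'n \<Rightarrow> real"
  assumes "(\<phi> has_derivative (\<lambda>h. w \<bullet> h)) (at x)"
  shows "grad \<phi> x = w"
  using frechet_derivative_at[OF assms, symmetric]
  by (simp add: grad_def vec_eq_iff inner_axis)

lemma grad_mult: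
  assumes "smooth \<phi>" "smooth \<psi>"
  shows "grad (\<lambda>x. \<phi> x * \<psi> x) x = \<phi> x *\<^sub>R grad \<psi> x + \<psi> x *\<^sub>R grad \<phi> x"
  by (rule grad_eqI)
     (use has_derivative_mult[OF smooth_deriv_direction[OF assms(1)] smooth_deriv_direction[OF assms(2)], of x]
      in \<open>simp add: inner_add_left mult.commute\<close>)

lemma grad_lincomb:
  assumes "smooth \<phi>" "smooth \<psi>"
  shows "grad (\<lambda>x. a * \<phi> x + b * \<psi> x) x = a *\<^sub>R grad \<phi> x + b *\<^sub>R grad \<psi> x"
  by (rule grad_eqI)
     (use has_derivative_add[OF has_derivative_mult_right[OF smooth_deriv_direction[OF assms(1)], of a]
         has_derivative_mult_right[OF smooth_deriv_direction[OF assms(2)], of b]]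
      in \<open>simp add: inner_add_left\<close>)

lemma test_smooth: "\<phi> \<in> test_functions U \<Longrightarrow> smooth \<phi>"
  by (simp add: test_functions_def)

lemma test_support:
  assumes "\<phi> \<in> test_functions U"
  shows "\<exists>K. compact K \<and> K \<subseteq> U \<and> (\<forall>x. x \<notin> K \<longrightarrow> \<phi> x = 0 \<and> grad \<phi> x = (0::real^'n))"
proof -
  obtain K where K: "compact K" "K \<subseteq> U" "\<And>x. x \<notin> K \<Longrightarrow> \<phi> x = 0"
    using assms unfolding test_functions_def by blast
  have "grad \<phi> x = 0" if "x \<notin> K" for x
  proof (rule grad_eqI)
    have "((\<lambda>x. 0::real) has_derivative (\<lambda>h. 0 \<bullet> h)) (at x)" by simp
    then show "(\<phi> has_derivative (\<lambda>h. 0 \<bullet> h)) (at x)"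
      by (rule has_derivative_transform_within_open[where s = "- K"])
         (use K that in \<open>auto simp: compact_imp_closed open_Compl\<close>)
  qed
  with K show ?thesis by blast
qed

lemma test_grad_component:
  assumes "\<phi> \<in> test_functions U"
  shows "(\<lambda>x. grad \<phi> x $ i) \<in> test_functions U"
proof -
  obtain K where K: "compact K" "K \<subseteq> U" "\<And>x. x \<notin> K \<Longrightarrow> \<phi> x = 0"
    "\<And>x. x \<notin> K \<Longrightarrow> grad \<phi> x = 0"
    using test_support[OF assms] by blast
  show ?thesis
    by (rule test_functionsI[OF smooth_grad_component[OF test_smooth[OF assms]] K(1,2)]) (simp add: K)
qed

lemma test_lincomb:
  assumes "\<phi> \<in> test_functions U" "\<psi> \<in> test_functions U"
  shows "(\<lambda>x. a * \<phi> x + b * \<psi> x) \<in> test_functions U"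
proof -
  obtain K where K: "compact K" "K \<subseteq> U" "\<And>x. x \<notin> K \<Longrightarrow> \<phi> x = 0"
    using assms(1) unfolding test_functions_def by blast
  obtain K' where K': "compact K'" "K' \<subseteq> U" "\<And>x. x \<notin> K' \<Longrightarrow> \<psi> x = 0"
    using assms(2) unfolding test_functions_def by blast
  show ?thesis
  proof (rule test_functionsI[of _ "K \<union> K'"])
    show "smooth (\<lambda>x. a * \<phi> x + b * \<psi> x)"
      by (intro smooth_add smooth_mult smooth_const test_smooth[OF assms(1)] test_smooth[OF assms(2)])
  qed (use K K' in auto)
qed

section \<open>Square integrable functions\<close>

lemma L2_measurable: "f \<in> L2 \<Omega> \<Longrightarrow> f \<in> borel_measurable (lebesgue_on \<Omega>)"
  by (simp add: L2_def)

lemma L2_norm2_integrable: "f \<in> L2 \<Omega> \<Longrightarrow> integrable (lebesgue_on \<Omega>) (\<lambda>x. (norm (f x))\<^sup>2)"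
  by (simp add: L2_def)

lemma two_mult_le_sum_squares: "2 * (a * b) \<le> a\<^sup>2 + (b::real)\<^sup>2"
  using zero_le_power2[of "a - b"] by (simp add: power2_diff)

lemma L2_inner_integrable:
  assumes "f \<in> L2 \<Omega>" "h \<in> L2 \<Omega>"
  shows "integrable (lebesgue_on \<Omega>) (\<lambda>x. f x \<bullet> h x)"
proof (rule Bochner_Integration.integrable_bound)
  show "integrable (lebesgue_on \<Omega>) (\<lambda>x. (norm (f x))\<^sup>2 + (norm (h x))\<^sup>2)"
    using assms by (auto intro: L2_norm2_integrable)
  show "(\<lambda>x. f x \<bullet> h x) \<in> borel_measurable (lebesgue_on \<Omega>)"
    using assms[THEN L2_measurable] by measurable
  have "\<bar>f x \<bullet> h x\<bar> \<le> (norm (f x))\<^sup>2 + (norm (h x))\<^sup>2" for x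
    using Cauchy_Schwarz_ineq2[of "f x" "h x"] two_mult_le_sum_squares[of "norm (f x)" "norm (h x)"]
      mult_nonneg_nonneg[of "norm (f x)" "norm (h x)"] by simp
  then show "AE x in lebesgue_on \<Omega>. norm (f x \<bullet> h x) \<le> norm ((norm (f x))\<^sup>2 + (norm (h x))\<^sup>2)"
    by (intro AE_I2) (auto simp: abs_of_nonneg)
qed

lemma L2_lincomb:
  assumes "f \<in> L2 \<Omega>" "h \<in> L2 \<Omega>"
  shows "(\<lambda>x. a *\<^sub>R f x + b *\<^sub>R h x) \<in> L2 \<Omega>"
proof -
  have "(norm (a *\<^sub>R f x + b *\<^sub>R h x))\<^sup>2
      = a\<^sup>2 * (norm (f x))\<^sup>2 + 2 * a * b * (f x \<bullet> h x) + b\<^sup>2 * (norm (h x))\<^sup>2" for x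
    unfolding power2_norm_eq_inner by (simp add: inner_simps algebra_simps inner_commute power2_eq_square)
  then have "integrable (lebesgue_on \<Omega>) (\<lambda>x. (norm (a *\<^sub>R f x + b *\<^sub>R h x))\<^sup>2)"
    using L2_norm2_integrable[OF assms(1)] L2_norm2_integrable[OF assms(2)] L2_inner_integrable[OF assms]
    by simp
  moreover have "(\<lambda>x. a *\<^sub>R f x + b *\<^sub>R h x) \<in> borel_measurable (lebesgue_on \<Omega>)"
    using assms[THEN L2_measurable] by measurable
  ultimately show ?thesis by (simp add: L2_def)
qed

lemma L2_diff: "f \<in> L2 \<Omega> \<Longrightarrow> h \<in> L2 \<Omega> \<Longrightarrow> (\<lambda>x. f x - h x) \<in> L2 \<Omega>"
  using L2_lincomb[of f \<Omega> h 1 "-1"] by simp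

lemma L2_lincomb_real:
  fixes f h :: "real^'n \<Rightarrow> real"
  assumes "f \<in> L2 \<Omega>" "h \<in> L2 \<Omega>"
  shows "(\<lambda>x. a * f x + b * h x) \<in> L2 \<Omega>"
  using L2_lincomb[OF assms, of a b] by simp

lemma l2_inner_commute: "l2_inner \<Omega> f h = l2_inner \<Omega> h f"
  by (simp add: l2_inner_def inner_commute)

lemma l2_inner_lincomb_left:
  assumes "f \<in> L2 \<Omega>" "h \<in> L2 \<Omega>" "w \<in> L2 \<Omega>"
  shows "l2_inner \<Omega> (\<lambda>x. a *\<^sub>R f x + b *\<^sub>R h x) w = a * l2_inner \<Omega> f w + b * l2_inner \<Omega> h w"
  using L2_inner_integrable[OF assms(1,3)] L2_inner_integrable[OF assms(2,3)]
  by (simp add: l2_inner_def inner_simps)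

lemma l2_inner_lincomb_right:
  assumes "f \<in> L2 \<Omega>" "h \<in> L2 \<Omega>" "w \<in> L2 \<Omega>"
  shows "l2_inner \<Omega> w (\<lambda>x. a *\<^sub>R f x + b *\<^sub>R h x) = a * l2_inner \<Omega> w f + b * l2_inner \<Omega> w h"
  using l2_inner_lincomb_left[OF assms] by (simp add: l2_inner_commute)

lemma l2_inner_diff_left:
  assumes "f \<in> L2 \<Omega>" "h \<in> L2 \<Omega>" "w \<in> L2 \<Omega>"
  shows "l2_inner \<Omega> (\<lambda>x. f x - h x) w = l2_inner \<Omega> f w - l2_inner \<Omega> h w"
  using l2_inner_lincomb_left[OF assms, of 1 "-1"] by simp

lemma l2_inner_diff_right:
  assumes "f \<in> L2 \<Omega>" "h \<in> L2 \<Omega>" "w \<in> L2 \<Omega>"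
  shows "l2_inner \<Omega> w (\<lambda>x. f x - h x) = l2_inner \<Omega> w f - l2_inner \<Omega> w h"
  using l2_inner_lincomb_right[OF assms, of 1 "-1"] by simp

lemma l2_norm_nonneg [simp]: "0 \<le> l2_norm \<Omega> f"
  by (simp add: l2_norm_def)

lemma l2_norm_sq: "(l2_norm \<Omega> f)\<^sup>2 = l2_inner \<Omega> f f"
  by (simp add: l2_norm_def l2_inner_def power2_norm_eq_inner)

lemma l2_norm_sq_lincomb:
  assumes "f \<in> L2 \<Omega>" "h \<in> L2 \<Omega>"
  shows "(l2_norm \<Omega> (\<lambda>x. a *\<^sub>R f x + b *\<^sub>R h x))\<^sup>2
       = a\<^sup>2 * (l2_norm \<Omega> f)\<^sup>2 + 2 * a * b * l2_inner \<Omega> f h + b\<^sup>2 * (l2_norm \<Omega> h)\<^sup>2"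
  using assms L2_lincomb[OF assms, of a b]
  by (simp only: l2_norm_sq l2_inner_lincomb_left l2_inner_lincomb_right l2_inner_commute[of _ h f])
     (simp add: algebra_simps power2_eq_square)

lemma l2_Cauchy_Schwarz:
  assumes "f \<in> L2 \<Omega>" "h \<in> L2 \<Omega>"
  shows "\<bar>l2_inner \<Omega> f h\<bar> \<le> l2_norm \<Omega> f * l2_norm \<Omega> h"
proof -
  let ?a = "(l2_norm \<Omega> f)\<^sup>2" and ?b = "(l2_norm \<Omega> h)\<^sup>2" and ?c = "l2_inner \<Omega> f h"
  have pos: "0 \<le> s\<^sup>2 * ?a + 2 * s * t * ?c + t\<^sup>2 * ?b" for s t
    using l2_norm_sq_lincomb[OF assms, of s t] zero_le_power2 by metis
  have "?c\<^sup>2 \<le> ?a * ?b"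
  proof (cases "?b = 0")
    case True
    have "?c = 0"
    proof (rule ccontr)
      assume "?c \<noteq> 0"
      then show False
        using pos[of 1 "- (?a + 1) / (2 * ?c)"] True by (simp add: field_simps)
    qed
    then show ?thesis by simp
  next
    case False
    then have "?b > 0" by simp
    then have "0 \<le> ?b * (?a * ?b - ?c\<^sup>2)"
      using pos[of ?b "- ?c"] by (simp add: algebra_simps power2_eq_square)
    with \<open>?b > 0\<close> show ?thesis by (simp add: zero_le_mult_iff)
  qed
  then have "?c\<^sup>2 \<le> (l2_norm \<Omega> f * l2_norm \<Omega> h)\<^sup>2" by (simp add: power_mult_distrib)
  then show ?thesis by (rule abs_le_square_iff[THEN iffD2, of ?c "l2_norm \<Omega> f * l2_norm \<Omega> h", unfolded abs_mult, simplified])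
qed

lemma l2_norm_scale: "l2_norm \<Omega> (\<lambda>x. a *\<^sub>R f x) = \<bar>a\<bar> * l2_norm \<Omega> f"
  by (simp add: l2_norm_def power_mult_distrib real_sqrt_mult)

lemma l2_norm_triangle:
  assumes "f \<in> L2 \<Omega>" "h \<in> L2 \<Omega>"
  shows "l2_norm \<Omega> (\<lambda>x. f x + h x) \<le> l2_norm \<Omega> f + l2_norm \<Omega> h"
proof -
  have "(l2_norm \<Omega> (\<lambda>x. f x + h x))\<^sup>2 \<le> (l2_norm \<Omega> f + l2_norm \<Omega> h)\<^sup>2"
    using l2_norm_sq_lincomb[OF assms, of 1 1] l2_Cauchy_Schwarz[OF assms]
    by (simp add: power2_sum)
  then show ?thesis by (rule power2_le_imp_le) simp
qed

lemma l2_norm_minus_commute: "l2_norm \<Omega> (\<lambda>x. f x - h x) = l2_norm \<Omega> (\<lambda>x. h x - f x)"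
  by (simp add: l2_norm_def norm_minus_commute)

lemma l2_norm_triangle_diff:
  assumes "f \<in> L2 \<Omega>" "h \<in> L2 \<Omega>" "w \<in> L2 \<Omega>"
  shows "l2_norm \<Omega> (\<lambda>x. f x - w x) \<le> l2_norm \<Omega> (\<lambda>x. f x - h x) + l2_norm \<Omega> (\<lambda>x. h x - w x)"
  using l2_norm_triangle[OF L2_diff[OF assms(1,2)] L2_diff[OF assms(2,3)]] by simp

lemma l2_norm_diff_ge:
  assumes "f \<in> L2 \<Omega>" "h \<in> L2 \<Omega>"
  shows "\<bar>l2_norm \<Omega> f - l2_norm \<Omega> h\<bar> \<le> l2_norm \<Omega> (\<lambda>x. f x - h x)"
  using l2_norm_triangle[OF L2_diff[OF assms] assms(2)]
    l2_norm_triangle[OF L2_diff[OF assms(2,1)] assms(1)]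
  by (simp add: l2_norm_minus_commute[of \<Omega> h f])

lemma l2_norm_cong_AE:
  assumes "f \<in> L2 \<Omega>" "h \<in> L2 \<Omega>" "AE x in lebesgue_on \<Omega>. f x = h x"
  shows "l2_norm \<Omega> f = l2_norm \<Omega> h"
proof -
  have "(LINT x|lebesgue_on \<Omega>. (norm (f x))\<^sup>2) = (LINT x|lebesgue_on \<Omega>. (norm (h x))\<^sup>2)"
    by (rule integral_cong_AE) (use assms in \<open>auto dest: L2_norm2_integrable\<close>)
  then show ?thesis by (simp add: l2_norm_def)
qed

lemma l2_inner_cong_AE:
  assumes "f \<in> L2 \<Omega>" "f' \<in> L2 \<Omega>" "h \<in> L2 \<Omega>" "h' \<in> L2 \<Omega>"
    "AE x in lebesgue_on \<Omega>. f x = f' x" "AE x in lebesgue_on \<Omega>. h x = h' x"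
  shows "l2_inner \<Omega> f h = l2_inner \<Omega> f' h'"
  unfolding l2_inner_def
proof (rule integral_cong_AE)
  show "AE x in lebesgue_on \<Omega>. f x \<bullet> h x = f' x \<bullet> h' x" using assms(5,6) by auto
qed (use assms L2_inner_integrable in blast)+

lemma l2_norm_zero_AE:
  assumes "f \<in> L2 \<Omega>" "l2_norm \<Omega> f = 0"
  shows "AE x in lebesgue_on \<Omega>. f x = 0"
proof -
  have "(LINT x|lebesgue_on \<Omega>. (norm (f x))\<^sup>2) = 0"
    using assms(2) by (simp add: l2_norm_def)
  then have "AE x in lebesgue_on \<Omega>. (norm (f x))\<^sup>2 = 0"
    using integral_nonneg_eq_0_iff_AE[OF L2_norm2_integrable[OF assms(1)]] by simp
  then show ?thesis by simp
qed

lemma l2_norm_tendsto: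
  assumes "\<And>k. f k \<in> L2 \<Omega>" "F \<in> L2 \<Omega>" "((\<lambda>k. l2_norm \<Omega> (\<lambda>x. f k x - F x)) \<longlongrightarrow> 0) A"
  shows "((\<lambda>k. l2_norm \<Omega> (f k)) \<longlongrightarrow> l2_norm \<Omega> F) A"
proof (rule LIM_zero_cancel, rule Lim_null_comparison[OF _ assms(3)])
  show "\<forall>\<^sub>F k in A. norm (l2_norm \<Omega> (f k) - l2_norm \<Omega> F) \<le> l2_norm \<Omega> (\<lambda>x. f k x - F x)"
    using l2_norm_diff_ge[OF assms(1,2)] by (simp add: always_eventually)
qed

lemma l2_inner_tendsto:
  assumes "\<And>k. f k \<in> L2 \<Omega>" "F \<in> L2 \<Omega>" "\<And>k. h k \<in> L2 \<Omega>" "G \<in> L2 \<Omega>"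
    "((\<lambda>k. l2_norm \<Omega> (\<lambda>x. f k x - F x)) \<longlongrightarrow> 0) A"
    "((\<lambda>k. l2_norm \<Omega> (\<lambda>x. h k x - G x)) \<longlongrightarrow> 0) A"
  shows "((\<lambda>k. l2_inner \<Omega> (f k) (h k)) \<longlongrightarrow> l2_inner \<Omega> F G) A"
proof (rule LIM_zero_cancel, rule Lim_null_comparison)
  show "\<forall>\<^sub>F k in A. norm (l2_inner \<Omega> (f k) (h k) - l2_inner \<Omega> F G)
      \<le> l2_norm \<Omega> (\<lambda>x. f k x - F x) * l2_norm \<Omega> (h k) + l2_norm \<Omega> F * l2_norm \<Omega> (\<lambda>x. h k x - G x)"
  proof (rule always_eventually, rule allI)
    fix k
    have "l2_inner \<Omega> (f k) (h k) - l2_inner \<Omega> F G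
        = l2_inner \<Omega> (\<lambda>x. f k x - F x) (h k) + l2_inner \<Omega> F (\<lambda>x. h k x - G x)"
      using assms by (simp add: l2_inner_diff_left l2_inner_diff_right)
    then show "norm (l2_inner \<Omega> (f k) (h k) - l2_inner \<Omega> F G)
      \<le> l2_norm \<Omega> (\<lambda>x. f k x - F x) * l2_norm \<Omega> (h k) + l2_norm \<Omega> F * l2_norm \<Omega> (\<lambda>x. h k x - G x)"
      using l2_Cauchy_Schwarz[OF L2_diff[OF assms(1,2), of k] assms(3)[of k]]
        l2_Cauchy_Schwarz[OF assms(2) L2_diff[OF assms(3,4), of k]] by simp
  qed
  show "((\<lambda>k. l2_norm \<Omega> (\<lambda>x. f k x - F x) * l2_norm \<Omega> (h k)
      + l2_norm \<Omega> F * l2_norm \<Omega> (\<lambda>x. h k x - G x)) \<longlongrightarrow> 0) A"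
    using tendsto_add[OF tendsto_mult[OF assms(5) l2_norm_tendsto[OF assms(3,4,6)]]
        tendsto_mult[OF tendsto_const assms(6)]] by simp
qed

lemma L2_AE_subseq:
  fixes f :: "nat \<Rightarrow> real^'n \<Rightarrow> 'b::euclidean_space"
  assumes "\<And>k. f k \<in> L2 \<Omega>" "F \<in> L2 \<Omega>" "(\<lambda>k. l2_norm \<Omega> (\<lambda>x. f k x - F x)) \<longlonglongrightarrow> 0"
  shows "\<exists>r. strict_mono r \<and> (AE x in lebesgue_on \<Omega>. (\<lambda>k. f (r k) x) \<longlonglongrightarrow> F x)"
proof -
  let ?u = "\<lambda>k x. (norm (f k x - F x))\<^sup>2"
  have "(\<lambda>k. (l2_norm \<Omega> (\<lambda>x. f k x - F x))\<^sup>2) \<longlonglongrightarrow> 0"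
    using tendsto_power[OF assms(3), of 2] by simp
  then have "(\<lambda>k. LINT x|lebesgue_on \<Omega>. norm (?u k x)) \<longlonglongrightarrow> 0"
    by (simp add: l2_norm_def)
  with L2_norm2_integrable[OF L2_diff[OF assms(1,2)]]
  obtain r where r: "strict_mono r" "AE x in lebesgue_on \<Omega>. (\<lambda>k. ?u (r k) x) \<longlonglongrightarrow> 0"
    using tendsto_L1_AE_subseq[of "lebesgue_on \<Omega>" ?u] by auto
  have "AE x in lebesgue_on \<Omega>. (\<lambda>k. f (r k) x) \<longlonglongrightarrow> F x"
    using r(2)
  proof eventually_elim
    case (elim x)
    have "(\<lambda>k. sqrt (?u (r k) x)) \<longlonglongrightarrow> sqrt 0" by (rule tendsto_real_sqrt[OF elim])
    then have "(\<lambda>k. norm (f (r k) x - F x)) \<longlonglongrightarrow> 0" by simp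
    then show ?case using tendsto_norm_zero_iff LIM_zero_cancel by blast
  qed
  with r(1) show ?thesis by blast
qed

text \<open>On a set of finite measure a rapidly convergent subsequence has summable increments in
  \<open>L\<^sup>1\<close>, hence converges almost everywhere, and Fatou's lemma identifies the limit.\<close>

lemma L2_complete:
  fixes f :: "nat \<Rightarrow> real^'n \<Rightarrow> 'b::euclidean_space"
  assumes fin: "finite_measure (lebesgue_on \<Omega>)"
    and f: "\<And>k. f k \<in> L2 \<Omega>"
    and Cauchy: "\<And>e. e > 0 \<Longrightarrow> \<exists>N. \<forall>m\<ge>N. \<forall>k\<ge>N. l2_norm \<Omega> (\<lambda>x. f m x - f k x) < e"
  shows "\<exists>F\<in>L2 \<Omega>. (\<lambda>k. l2_norm \<Omega> (\<lambda>x. f k x - F x)) \<longlonglongrightarrow> 0"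
proof -
  let ?M = "lebesgue_on \<Omega>"
  interpret finite_measure ?M by (rule fin)
  have "\<forall>j. \<exists>N. \<forall>m\<ge>N. \<forall>k\<ge>N. l2_norm \<Omega> (\<lambda>x. f m x - f k x) < (1/2) ^ j"
    using Cauchy by simp
  then obtain N where N: "\<And>j m k. m \<ge> N j \<Longrightarrow> k \<ge> N j \<Longrightarrow> l2_norm \<Omega> (\<lambda>x. f m x - f k x) < (1/2) ^ j"
    by metis
  define r where "r = (\<lambda>k. \<Sum>i\<le>k. N i + 1)"
  have r_N: "r k \<ge> N k" for k
  proof -
    have "N k + 1 \<le> r k" unfolding r_def by (rule member_le_sum) auto
    then show ?thesis by simp
  qed
  have r_Suc: "r k \<le> r (Suc k)" for k by (simp add: r_def)
  have r_ge: "k \<le> r k" for k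
    by (induction k) (auto simp: r_def)
  define g where "g = (\<lambda>k. f (r k))"
  define d where "d = (\<lambda>k x. g (Suc k) x - g k x)"
  have g: "g k \<in> L2 \<Omega>" for k by (simp add: g_def f)
  have g_meas[measurable]: "g k \<in> borel_measurable ?M" for k by (rule L2_measurable[OF g])
  have d: "d k \<in> L2 \<Omega>" for k unfolding d_def by (rule L2_diff[OF g g])
  have d_meas[measurable]: "d k \<in> borel_measurable ?M" for k by (rule L2_measurable[OF d])
  have d_small: "l2_norm \<Omega> (d k) < (1/2) ^ k" for k
    unfolding d_def g_def by (rule N) (use r_N r_Suc le_trans in blast)+
  \<comment> \<open>The norm of the constant \<open>1\<close> converts \<open>L\<^sup>2\<close> bounds into \<open>L\<^sup>1\<close> bounds.\<close>
  define c where "c = l2_norm \<Omega> (\<lambda>x. 1 :: real)"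
  have one: "(\<lambda>x. 1 :: real) \<in> L2 \<Omega>" by (simp add: L2_def)
  have nd: "(\<lambda>x. norm (d k x)) \<in> L2 \<Omega>" for k
    using d[of k] by (simp add: L2_def borel_measurable_norm)
  have int_d: "integrable ?M (\<lambda>x. norm (d k x))" for k
    using L2_inner_integrable[OF nd one] by simp
  have "(LINT x|?M. norm (d k x)) \<le> c * (1/2) ^ k" for k
  proof -
    have "(LINT x|?M. norm (d k x)) \<le> l2_norm \<Omega> (\<lambda>x. norm (d k x)) * c"
      using l2_Cauchy_Schwarz[OF nd[of k] one] by (simp add: l2_inner_def c_def)
    also have "l2_norm \<Omega> (\<lambda>x. norm (d k x)) = l2_norm \<Omega> (d k)" by (simp add: l2_norm_def)
    also have "\<dots> * c \<le> (1/2) ^ k * c"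
      using d_small[of k] by (intro mult_right_mono) (auto simp: c_def)
    finally show ?thesis by (simp add: mult.commute)
  qed
  then have bound: "(\<integral>\<^sup>+x. ennreal (norm (d k x)) \<partial>?M) \<le> ennreal (c * (1/2) ^ k)" for k
    by (subst nn_integral_eq_integral[OF int_d]) (auto intro: ennreal_leI)
  have "(\<integral>\<^sup>+x. (\<Sum>k. ennreal (norm (d k x))) \<partial>?M) = (\<Sum>k. \<integral>\<^sup>+x. ennreal (norm (d k x)) \<partial>?M)"
    by (rule nn_integral_suminf) measurable
  also have "\<dots> \<le> (\<Sum>k. ennreal (c * (1/2) ^ k))"
    by (intro suminf_le bound) auto
  also have "\<dots> = ennreal (\<Sum>k. c * (1/2) ^ k)"
    by (rule suminf_ennreal2) (auto simp: c_def intro!: summable_mult summable_geometric)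
  finally have "(\<integral>\<^sup>+x. (\<Sum>k. ennreal (norm (d k x))) \<partial>?M) \<noteq> \<infinity>"
    by (auto simp: top_unique)
  then have "AE x in ?M. (\<Sum>k. ennreal (norm (d k x))) \<noteq> \<infinity>"
    by (intro nn_integral_noteq_infinite) measurable
  then have conv: "AE x in ?M. (\<lambda>k. g k x) \<longlonglongrightarrow> lim (\<lambda>k. g k x)"
  proof eventually_elim
    case (elim x)
    then have "summable (\<lambda>k. norm (d k x))"
      by (intro summable_suminf_not_top) simp_all
    then have "summable (\<lambda>k. d k x)" by (rule summable_norm_cancel)
    then have "convergent (\<lambda>n. \<Sum>k<n. d k x)" by (simp add: summable_iff_convergent)
    then have "convergent (\<lambda>n. g n x - g 0 x)"
      by (simp add: d_def sum_lessThan_telescope[of "\<lambda>k. g k x"])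
    then have "convergent (\<lambda>n. (g n x - g 0 x) + g 0 x)"
      by (intro convergent_add convergent_const)
    then show ?case by (simp add: convergent_LIMSEQ_iff)
  qed
  define F where "F = (\<lambda>x. lim (\<lambda>k. g k x))"
  have F_meas[measurable]: "F \<in> borel_measurable ?M"
    unfolding F_def by measurable
  have f_meas[measurable]: "f k \<in> borel_measurable ?M" for k by (rule L2_measurable[OF f])
  \<comment> \<open>All terms of the sequence beyond \<open>K\<close>, hence also their limit, stay within \<open>e\<close> of \<open>f m\<close>.\<close>
  have fatou: "(\<integral>\<^sup>+x. ennreal ((norm (f m x - F x))\<^sup>2) \<partial>?M) \<le> ennreal (e\<^sup>2)"
    if e: "e > 0" and m: "\<And>k. k \<ge> K \<Longrightarrow> l2_norm \<Omega> (\<lambda>x. f m x - f k x) < e" for m e K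
  proof -
    have "(\<integral>\<^sup>+x. ennreal ((norm (f m x - F x))\<^sup>2) \<partial>?M)
        = (\<integral>\<^sup>+x. liminf (\<lambda>k. ennreal ((norm (f m x - g k x))\<^sup>2)) \<partial>?M)"
    proof (rule nn_integral_cong_AE)
      show "AE x in ?M. ennreal ((norm (f m x - F x))\<^sup>2) = liminf (\<lambda>k. ennreal ((norm (f m x - g k x))\<^sup>2))"
        using conv
      proof eventually_elim
        case (elim x)
        have "(\<lambda>k. ennreal ((norm (f m x - g k x))\<^sup>2)) \<longlonglongrightarrow> ennreal ((norm (f m x - F x))\<^sup>2)"
          unfolding F_def by (intro tendsto_ennrealI tendsto_intros elim)
        then show ?case by (rule lim_imp_Liminf[OF sequentially_bot, symmetric])
      qed
    qed
    also have "\<dots> \<le> liminf (\<lambda>k. \<integral>\<^sup>+x. ennreal ((norm (f m x - g k x))\<^sup>2) \<partial>?M)"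
      by (rule nn_integral_liminf) measurable
    also have "\<dots> \<le> liminf (\<lambda>k. ennreal (e\<^sup>2))"
    proof (rule Liminf_mono)
      show "\<forall>\<^sub>F k in sequentially. (\<integral>\<^sup>+x. ennreal ((norm (f m x - g k x))\<^sup>2) \<partial>?M) \<le> ennreal (e\<^sup>2)"
      proof (rule eventually_sequentiallyI[of K])
        fix k assume "K \<le> k"
        then have "r k \<ge> K" using r_ge[of k] by simp
        then have "l2_norm \<Omega> (\<lambda>x. f m x - g k x) < e" using m by (simp add: g_def)
        then have "(l2_norm \<Omega> (\<lambda>x. f m x - g k x))\<^sup>2 \<le> e\<^sup>2" by (intro power_mono) auto
        then show "(\<integral>\<^sup>+x. ennreal ((norm (f m x - g k x))\<^sup>2) \<partial>?M) \<le> ennreal (e\<^sup>2)"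
          by (subst nn_integral_eq_integral[OF L2_norm2_integrable[OF L2_diff[OF f g]]])
             (auto simp: l2_norm_def intro: ennreal_leI)
      qed
    qed
    also have "\<dots> = ennreal (e\<^sup>2)" by (simp add: Liminf_const)
    finally show ?thesis .
  qed
  have diff: "(\<lambda>x. f m x - F x) \<in> L2 \<Omega>" "l2_norm \<Omega> (\<lambda>x. f m x - F x) \<le> e"
    if e: "e > 0" and m: "\<And>k. k \<ge> K \<Longrightarrow> l2_norm \<Omega> (\<lambda>x. f m x - f k x) < e" for m e K
  proof -
    have 1: "integrable ?M (\<lambda>x. (norm (f m x - F x))\<^sup>2)"
    proof (rule integrableI_nonneg)
      show "(\<integral>\<^sup>+x. ennreal ((norm (f m x - F x))\<^sup>2) \<partial>?M) < \<infinity>"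
        by (rule le_less_trans[OF fatou[OF that]]) auto
    qed auto
    then show "(\<lambda>x. f m x - F x) \<in> L2 \<Omega>" by (simp add: L2_def)
    have "(LINT x|?M. (norm (f m x - F x))\<^sup>2) \<le> e\<^sup>2"
      using fatou[OF that] nn_integral_eq_integral[OF 1] by (simp add: ennreal_le_iff)
    then have "l2_norm \<Omega> (\<lambda>x. f m x - F x) \<le> sqrt (e\<^sup>2)"
      unfolding l2_norm_def by (rule real_sqrt_le_mono)
    with e show "l2_norm \<Omega> (\<lambda>x. f m x - F x) \<le> e" by simp
  qed
  have "F \<in> L2 \<Omega>"
  proof -
    have "(\<lambda>x. f (N 0) x - F x) \<in> L2 \<Omega>"
      by (rule diff(1)[of 1 "N 0"]) (use N[of 0 "N 0"] in simp_all)
    from L2_diff[OF f[of "N 0"] this] show ?thesis by simp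
  qed
  moreover have "(\<lambda>k. l2_norm \<Omega> (\<lambda>x. f k x - F x)) \<longlonglongrightarrow> 0"
  proof (rule LIMSEQ_I)
    fix e :: real assume "0 < e"
    then obtain K where K: "\<And>m k. m \<ge> K \<Longrightarrow> k \<ge> K \<Longrightarrow> l2_norm \<Omega> (\<lambda>x. f m x - f k x) < e / 2"
      using Cauchy[of "e / 2"] by auto
    show "\<exists>no. \<forall>k\<ge>no. norm (l2_norm \<Omega> (\<lambda>x. f k x - F x) - 0) < e"
    proof (intro exI[of _ K] allI impI)
      fix k assume "K \<le> k"
      then have "l2_norm \<Omega> (\<lambda>x. f k x - F x) \<le> e / 2"
        using \<open>0 < e\<close> K by (intro diff(2)[of _ K]) auto
      with \<open>0 < e\<close> show "norm (l2_norm \<Omega> (\<lambda>x. f k x - F x) - 0) < e" by simp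
    qed
  qed
  ultimately show ?thesis by blast
qed

section \<open>Weak gradients and the space of functions vanishing on the boundary\<close>

text \<open>The positive and the negative part have the same integral over every box, and boxes generate the
  Borel sets.\<close>

lemma borel_integrable_AE_zero_of_boxes:
  fixes K :: "'a::euclidean_space \<Rightarrow> real"
  assumes K: "integrable lborel K"
    and boxes: "\<And>a b. (LINT x|lborel. K x * indicator (box a b) x) = 0"
  shows "AE x in lborel. K x = 0"
proof -
  have [measurable]: "K \<in> borel_measurable borel" using K by auto
  have fin: "(\<integral>\<^sup>+x. ennreal (s * K x) \<partial>lborel) \<noteq> \<infinity>" if "\<bar>s\<bar> = 1" for s
  proof -
    have "(\<integral>\<^sup>+x. ennreal (s * K x) \<partial>lborel) \<le> (\<integral>\<^sup>+x. ennreal (norm (K x)) \<partial>lborel)"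
      using that by (intro nn_integral_mono ennreal_leI) (auto simp: abs_mult[symmetric] abs_if split: if_splits)
    also have "\<dots> < \<infinity>" using K by (simp add: integrable_iff_bounded)
    finally show ?thesis by simp
  qed
  have "density lborel (\<lambda>x. ennreal (K x)) = density lborel (\<lambda>x. ennreal (- K x))"
  proof (rule measure_eqI_generator_eq[where E = "range (\<lambda>(a, b). box a b)" and \<Omega> = UNIV
        and A = "\<lambda>n. box (- real n *\<^sub>R One) (real n *\<^sub>R One)"])
    show "Int_stable (range (\<lambda>(a, b). box a b :: 'a set))"
      by (auto simp: Int_stable_def box_Int_box)
    show "sets (density lborel (\<lambda>x. ennreal (K x))) = sigma_sets UNIV (range (\<lambda>(a, b). box a b))"
      "sets (density lborel (\<lambda>x. ennreal (- K x))) = sigma_sets UNIV (range (\<lambda>(a, b). box a b))"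
      by (simp_all add: borel_eq_box)
    show "(\<Union>n. box (- real n *\<^sub>R One) (real n *\<^sub>R One)) = (UNIV :: 'a set)"
      using UN_box_eq_UNIV by auto
    show "emeasure (density lborel (\<lambda>x. ennreal (K x))) (box (- real n *\<^sub>R One) (real n *\<^sub>R One)) \<noteq> \<infinity>" for n
    proof -
      have "emeasure (density lborel (\<lambda>x. ennreal (K x))) (box (- real n *\<^sub>R One) (real n *\<^sub>R One))
          \<le> emeasure (density lborel (\<lambda>x. ennreal (K x))) (space (density lborel (\<lambda>x. ennreal (K x))))"
        by (rule emeasure_space)
      also have "\<dots> < \<infinity>" using fin[of 1] by (simp add: emeasure_density less_top)
      finally show ?thesis by simp
    qed
    fix X :: "'a set" assume "X \<in> range (\<lambda>(a, b). box a b)"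
    then obtain a b where X: "X = box a b" by auto
    have int: "integrable lborel (\<lambda>x. K x * indicator X x)"
      unfolding X by (rule integrable_mult_indicator[OF _ K, of "box a b", simplified mult.commute real_scaleR_def]) simp
    have e: "ennreal (s * K x) * indicator X x = ennreal (s * (K x * indicator X x))" for x s
      by (simp add: indicator_def)
    have "enn2real (\<integral>\<^sup>+x. ennreal (K x * indicator X x) \<partial>lborel)
        = enn2real (\<integral>\<^sup>+x. ennreal (- (K x * indicator X x)) \<partial>lborel)"
      using boxes[of a b] real_lebesgue_integral_def[OF int] by (simp add: X)
    moreover have "(\<integral>\<^sup>+x. ennreal (K x * indicator X x) \<partial>lborel) < \<infinity>"
      "(\<integral>\<^sup>+x. ennreal (- (K x * indicator X x)) \<partial>lborel) < \<infinity>"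
      using int by (auto simp: real_integrable_def less_top)
    ultimately have "(\<integral>\<^sup>+x. ennreal (K x * indicator X x) \<partial>lborel)
        = (\<integral>\<^sup>+x. ennreal (- (K x * indicator X x)) \<partial>lborel)"
      by (metis ennreal_enn2real infinity_ennreal_def)
    then show "emeasure (density lborel (\<lambda>x. ennreal (K x))) X = emeasure (density lborel (\<lambda>x. ennreal (- K x))) X"
      using e[of 1] e[of "-1"] by (simp add: X emeasure_density)
  qed auto
  then have "AE x in lborel. ennreal (K x) = ennreal (- K x)"
    by (subst (asm) finite_density_unique) (use fin[of 1] in auto)
  then show ?thesis
  proof eventually_elim
    case (elim x)
    then show ?case
      by (cases "K x \<ge> 0") (auto simp: ennreal_neg ennreal_eq_0_iff)
  qed
qed

locale domain =
  fixes \<Omega> :: "(real^'n) set"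
  assumes open_domain: "open \<Omega>" and bounded_domain: "bounded \<Omega>" and nonempty_domain: "\<Omega> \<noteq> {}"
begin

lemma domain_sets [measurable, simp]: "\<Omega> \<in> sets lebesgue" "\<Omega> \<in> sets borel"
  using open_domain by auto

lemma domain_lmeasurable: "\<Omega> \<in> lmeasurable"
  using bounded_domain open_domain bounded_set_imp_lmeasurable domain_sets by blast

lemma finite_measure_domain: "finite_measure (lebesgue_on \<Omega>)"
  by (rule finite_measure_lebesgue_on[OF domain_lmeasurable])

lemma AE_domain: "(AE x in lebesgue_on \<Omega>. P x) \<longleftrightarrow> (AE x in lebesgue. x \<in> \<Omega> \<longrightarrow> P x)"
  by (simp add: AE_restrict_space_iff)

lemma domain_not_negligible: "\<not> (AE x in lebesgue_on \<Omega>. False)"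
proof
  assume "AE x in lebesgue_on \<Omega>. False"
  then have "AE x in lebesgue. x \<notin> \<Omega>" by (simp add: AE_domain)
  then have "negligible \<Omega>"
    by (subst negligible_iff_null_sets) (simp add: AE_iff_null_sets[symmetric])
  then show False using open_domain nonempty_domain open_not_negligible by blast
qed

lemma integrable_mult_test:
  assumes "integrable (lebesgue_on \<Omega>) h" "continuous_on UNIV \<phi>" "\<And>x. \<bar>\<phi> x\<bar> \<le> B"
  shows "integrable (lebesgue_on \<Omega>) (\<lambda>x. h x * \<phi> x :: real)"
proof (rule Bochner_Integration.integrable_bound)
  show "integrable (lebesgue_on \<Omega>) (\<lambda>x. B * h x)" using assms(1) by simp
  have [measurable]: "\<phi> \<in> borel_measurable (lebesgue_on \<Omega>)"
    by (rule continuous_imp_measurable_on_sets_lebesgue) (auto intro: continuous_on_subset[OF assms(2)])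
  show "(\<lambda>x. h x * \<phi> x) \<in> borel_measurable (lebesgue_on \<Omega>)"
    using assms(1) by measurable
  have "0 \<le> B" using assms(3) abs_ge_zero order_trans by blast
  then show "AE x in lebesgue_on \<Omega>. norm (h x * \<phi> x) \<le> norm (B * h x)"
    using assms(3) by (auto simp: abs_mult mult.commute intro!: AE_I2 mult_right_mono)
qed

text \<open>Testing with the cut-offs of a box inside the domain gives that the integral over every such
  box vanishes.\<close>

lemma fundamental_lemma:
  assumes h: "integrable (lebesgue_on \<Omega>) (h :: real^'n \<Rightarrow> real)"
    and test: "\<And>\<phi>. \<phi> \<in> test_functions \<Omega> \<Longrightarrow> (LINT x|lebesgue_on \<Omega>. h x * \<phi> x) = 0"
  shows "AE x in lebesgue_on \<Omega>. h x = 0"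
proof -
  have box_zero: "(LINT x|lebesgue_on \<Omega>. h x * indicator (box a b) x) = 0" if ab: "box a b \<subseteq> \<Omega>" for a b
  proof -
    obtain \<phi> where \<phi>: "\<And>m::nat. \<phi> m \<in> test_functions \<Omega>" "\<And>m x. 0 \<le> \<phi> m x \<and> \<phi> m x \<le> 1"
      "\<And>x. (\<lambda>m. \<phi> m x) \<longlonglongrightarrow> indicator (box a b) x"
      using box_cutoffs[OF ab] by blast
    have "(\<lambda>m. LINT x|lebesgue_on \<Omega>. h x * \<phi> m x) \<longlonglongrightarrow> (LINT x|lebesgue_on \<Omega>. h x * indicator (box a b) x)"
    proof (rule integral_dominated_convergence[where w = "\<lambda>x. \<bar>h x\<bar>"])
      have [measurable]: "h \<in> borel_measurable (lebesgue_on \<Omega>)" using h by auto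
      have "box a b \<in> sets (lebesgue_on \<Omega>)"
        using ab by (auto simp: sets_restrict_space_iff)
      then show "(\<lambda>x. h x * indicator (box a b) x) \<in> borel_measurable (lebesgue_on \<Omega>)" by measurable
      show "(\<lambda>x. h x * \<phi> m x) \<in> borel_measurable (lebesgue_on \<Omega>)" for m
        using \<phi>(2)[of m]
        by (intro borel_measurable_integrable integrable_mult_test[OF h, of _ 1]
            smooth_continuous_on[OF test_smooth[OF \<phi>(1)]]) (auto simp: abs_of_nonneg)
      show "AE x in lebesgue_on \<Omega>. (\<lambda>m. h x * \<phi> m x) \<longlonglongrightarrow> h x * indicator (box a b) x"
        by (intro AE_I2 tendsto_intros \<phi>(3))
      show "AE x in lebesgue_on \<Omega>. norm (h x * \<phi> m x) \<le> \<bar>h x\<bar>" for m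
        using \<phi>(2)[of m] by (intro AE_I2) (auto simp: abs_mult intro!: mult_left_le)
    qed (use h in auto)
    then show ?thesis using test[OF \<phi>(1)] by (simp add: LIMSEQ_const_iff)
  qed
  define H where "H = (\<lambda>x. indicator \<Omega> x * h x)"
  have H: "integrable lebesgue H"
    using h by (simp add: H_def integrable_restrict_space)
  then obtain H' where [measurable]: "H' \<in> borel_measurable lborel" and HH': "AE x in lborel. H x = H' x"
    using completion_ex_borel_measurable_real[of H lborel] by auto
  have HH'2: "AE x in lebesgue. H x = H' x" using HH' by (rule AE_completion)
  have H': "integrable lborel H'"
  proof -
    have "integrable lebesgue H'"
      using H HH'2 by (subst (asm) integrable_cong_AE[of _ _ H']) (auto intro: measurable_completion borel_measurable_integrable[OF H])
    then show ?thesis by (simp add: integrable_completion)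
  qed
  have box_zero': "(LINT x|lborel. H' x * indicator (box a b) x) = 0" if "box a b \<subseteq> \<Omega>" for a b
  proof -
    have "(LINT x|lborel. H' x * indicator (box a b) x) = (LINT x|lebesgue. H' x * indicator (box a b) x)"
      by (rule integral_completion[symmetric]) measurable
    also have "\<dots> = (LINT x|lebesgue. indicator \<Omega> x *\<^sub>R (h x * indicator (box a b) x))"
    proof (rule integral_cong_AE)
      show "(\<lambda>x. H' x * indicator (box a b) x) \<in> borel_measurable lebesgue"
        by (rule measurable_completion) measurable
      have "(\<lambda>x. H x * indicator (box a b) x) \<in> borel_measurable lebesgue"
        using borel_measurable_integrable[OF H]
        by (intro borel_measurable_times borel_measurable_indicator) auto
      then show "(\<lambda>x. indicator \<Omega> x *\<^sub>R (h x * indicator (box a b) x)) \<in> borel_measurable lebesgue"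
        by (simp add: H_def mult.assoc)
      show "AE x in lebesgue. H' x * indicator (box a b) x = indicator \<Omega> x *\<^sub>R (h x * indicator (box a b) x)"
        using HH'2 by eventually_elim (simp add: H_def)
    qed
    also have "\<dots> = (LINT x|lebesgue_on \<Omega>. h x * indicator (box a b) x)"
      by (subst integral_restrict_space) auto
    finally show ?thesis using box_zero[OF that] by simp
  qed
  obtain \<D> where \<D>: "countable \<D>" "\<D> \<subseteq> Pow \<Omega>" "\<And>X. X \<in> \<D> \<Longrightarrow> \<exists>a b. X = box a b" "\<Union>\<D> = \<Omega>"
    using open_countable_Union_open_box[OF open_domain] by blast
  have "AE x in lborel. x \<in> X \<longrightarrow> H' x = 0" if X: "X \<in> \<D>" for X
  proof -
    obtain a b where ab: "X = box a b" using \<D>(3)[OF X] by blast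
    have sub: "box a b \<subseteq> \<Omega>" using \<D>(2) X ab by blast
    have "AE x in lborel. H' x * indicator (box a b) x = 0"
    proof (rule borel_integrable_AE_zero_of_boxes)
      show "integrable lborel (\<lambda>x. H' x * indicator (box a b) x)"
        using integrable_mult_indicator[OF _ H', of "box a b"] by (simp add: mult.commute)
      fix c d
      obtain a' b' where "box a b \<inter> box c d = box a' b'" by (simp add: box_Int_box)
      then have eq: "(\<lambda>x. H' x * indicator (box a b) x * indicator (box c d) x)
          = (\<lambda>x. H' x * indicator (box a' b') x)" and "box a' b' \<subseteq> \<Omega>"
        using sub by (simp_all add: mult.assoc indicator_inter_arith[symmetric]) blast
      then show "(LINT x|lborel. H' x * indicator (box a b) x * indicator (box c d) x) = 0"
        unfolding eq by (intro box_zero')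
    qed
    then show ?thesis unfolding ab by eventually_elim (auto simp: indicator_def split: if_splits)
  qed
  then have "AE x in lborel. \<forall>X\<in>\<D>. x \<in> X \<longrightarrow> H' x = 0"
    by (subst AE_ball_countable[OF \<D>(1)]) blast
  with HH' have "AE x in lborel. x \<in> \<Omega> \<longrightarrow> h x = 0"
  proof eventually_elim
    case (elim x)
    show ?case
    proof
      assume x: "x \<in> \<Omega>"
      then have "H' x = 0" using elim(2) \<D>(4) by blast
      then show "h x = 0" using elim(1) x by (simp add: H_def)
    qed
  qed
  then show ?thesis unfolding AE_domain by (rule AE_completion)
qed

lemma L2_integrable:
  assumes "f \<in> L2 \<Omega>"
  shows "integrable (lebesgue_on \<Omega>) (f :: real^'n \<Rightarrow> real)"
proof -
  interpret finite_measure "lebesgue_on \<Omega>" by (rule finite_measure_domain)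
  have "(\<lambda>x. 1 :: real) \<in> L2 \<Omega>" by (simp add: L2_def)
  from L2_inner_integrable[OF assms this] show ?thesis by simp
qed

lemma L2_component:
  fixes w :: "real^'n \<Rightarrow> real^'n"
  assumes "w \<in> L2 \<Omega>"
  shows "(\<lambda>x. w x $ i) \<in> L2 \<Omega>"
proof -
  have [measurable]: "w \<in> borel_measurable (lebesgue_on \<Omega>)" by (rule L2_measurable[OF assms])
  have "(\<lambda>x. w x \<bullet> axis i 1) \<in> borel_measurable (lebesgue_on \<Omega>)" by measurable
  then have [measurable]: "(\<lambda>x. w x $ i) \<in> borel_measurable (lebesgue_on \<Omega>)"
    by (simp add: inner_axis)
  have "integrable (lebesgue_on \<Omega>) (\<lambda>x. (norm (w x $ i))\<^sup>2)"
  proof (rule Bochner_Integration.integrable_bound[OF L2_norm2_integrable[OF assms]])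
    show "AE x in lebesgue_on \<Omega>. norm ((norm (w x $ i))\<^sup>2) \<le> norm ((norm (w x))\<^sup>2)"
    proof (rule AE_I2)
      fix x
      have "(norm (w x $ i))\<^sup>2 \<le> (norm (w x))\<^sup>2"
        by (rule power_mono) (simp_all add: component_le_norm_cart)
      then show "norm ((norm (w x $ i))\<^sup>2) \<le> norm ((norm (w x))\<^sup>2)" by simp
    qed
  qed measurable
  then show ?thesis by (simp add: L2_def)
qed

lemma continuous_compact_support_L2:
  fixes f :: "real^'n \<Rightarrow> 'b::euclidean_space"
  assumes "continuous_on UNIV f" "compact K" "\<And>x. x \<notin> K \<Longrightarrow> f x = 0"
  shows "f \<in> L2 \<Omega>"
proof -
  interpret finite_measure "lebesgue_on \<Omega>" by (rule finite_measure_domain)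
  have "bounded (f ` K)"
    using assms by (intro compact_imp_bounded compact_continuous_image) (auto intro: continuous_on_subset)
  then obtain B where B: "\<And>x. x \<in> K \<Longrightarrow> norm (f x) \<le> B" by (auto simp: bounded_iff)
  have B': "norm (f x) \<le> max B 0" for x
    using B[of x] assms(3)[of x] by (cases "x \<in> K") (auto simp: le_max_iff_disj)
  have [measurable]: "f \<in> borel_measurable (lebesgue_on \<Omega>)"
    by (rule continuous_imp_measurable_on_sets_lebesgue) (auto intro: continuous_on_subset[OF assms(1)])
  have "integrable (lebesgue_on \<Omega>) (\<lambda>x. (norm (f x))\<^sup>2)"
  proof (rule integrable_const_bound[where B = "(max B 0)\<^sup>2"])
    show "AE x in lebesgue_on \<Omega>. norm ((norm (f x))\<^sup>2) \<le> (max B 0)\<^sup>2"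
      using B' by (intro AE_I2) (auto intro: power_mono)
  qed measurable
  then show ?thesis by (simp add: L2_def)
qed

lemma
  assumes "\<phi> \<in> test_functions \<Omega>"
  shows test_L2: "\<phi> \<in> L2 \<Omega>" and test_grad_L2: "grad \<phi> \<in> L2 \<Omega>"
proof -
  obtain K where K: "compact K" "\<And>x. x \<notin> K \<Longrightarrow> \<phi> x = 0" "\<And>x. x \<notin> K \<Longrightarrow> grad \<phi> x = 0"
    using test_support[OF assms] by blast
  show "\<phi> \<in> L2 \<Omega>"
    by (rule continuous_compact_support_L2[OF smooth_continuous_on[OF test_smooth[OF assms]] K(1,2)])
  show "grad \<phi> \<in> L2 \<Omega>"
    by (rule continuous_compact_support_L2[OF continuous_on_grad[OF test_smooth[OF assms]] K(1,3)])
qed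

lemma integrable_mult_test_function:
  "f \<in> L2 \<Omega> \<Longrightarrow> \<phi> \<in> test_functions \<Omega> \<Longrightarrow> integrable (lebesgue_on \<Omega>) (\<lambda>x. f x * \<phi> x)"
  using L2_inner_integrable[OF _ test_L2] by fastforce

lemma weak_grad_pairing:
  assumes "has_weak_grad \<Omega> u w" "\<phi> \<in> test_functions \<Omega>"
  shows "l2_inner \<Omega> u (\<lambda>x. grad \<phi> x $ i) = - l2_inner \<Omega> (\<lambda>x. w x $ i) \<phi>"
  using assms by (simp add: has_weak_grad_def l2_inner_def)

lemma weak_grad_unique:
  assumes "has_weak_grad \<Omega> u w" "has_weak_grad \<Omega> u w'"
  shows "AE x in lebesgue_on \<Omega>. w x = w' x"
proof -
  have w: "w \<in> L2 \<Omega>" "w' \<in> L2 \<Omega>" using assms by (auto simp: has_weak_grad_def)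
  have "AE x in lebesgue_on \<Omega>. w x $ i - w' x $ i = 0" for i
  proof (rule fundamental_lemma)
    show "integrable (lebesgue_on \<Omega>) (\<lambda>x. w x $ i - w' x $ i)"
      by (intro Bochner_Integration.integrable_diff L2_integrable L2_component w)
    fix \<phi> assume \<phi>: "\<phi> \<in> test_functions \<Omega>"
    have "(LINT x|lebesgue_on \<Omega>. w x $ i * \<phi> x) = (LINT x|lebesgue_on \<Omega>. w' x $ i * \<phi> x)"
      using assms \<phi> by (simp add: has_weak_grad_def)
    then show "(LINT x|lebesgue_on \<Omega>. (w x $ i - w' x $ i) * \<phi> x) = 0"
      using integrable_mult_test_function[OF L2_component[OF w(1)] \<phi>, of i]
        integrable_mult_test_function[OF L2_component[OF w(2)] \<phi>, of i]
      by (simp add: left_diff_distrib)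
  qed
  then have "AE x in lebesgue_on \<Omega>. \<forall>i. w x $ i - w' x $ i = 0"
    by (subst AE_all_countable) auto
  then show ?thesis by eventually_elim (simp add: vec_eq_iff)
qed

text \<open>The integral of a partial derivative of a test function vanishes, because it is the limit of
  difference quotients, whose integrals vanish by translation invariance.\<close>

lemma integral_grad_component_zero:
  assumes "\<theta> \<in> test_functions (UNIV :: (real^'n) set)"
  shows "(LINT x|lborel. grad \<theta> x $ i) = 0"
proof -
  obtain K where K: "compact K" "\<And>x. x \<notin> K \<Longrightarrow> \<theta> x = 0" "\<And>x. x \<notin> K \<Longrightarrow> grad \<theta> x = 0"
    using test_support[OF assms] by blast
  have sm: "smooth \<theta>" by (rule test_smooth[OF assms])
  have cont: "continuous_on UNIV \<theta>" by (rule smooth_continuous_on[OF sm])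
  have [measurable]: "\<theta> \<in> borel_measurable borel" using cont by (rule borel_measurable_continuous_onI)
  have [measurable]: "(\<lambda>x. grad \<theta> x $ i) \<in> borel_measurable borel"
    by (intro borel_measurable_continuous_onI smooth_continuous_on smooth_grad_component sm)
  have "bounded (grad \<theta> ` K)"
    by (intro compact_imp_bounded compact_continuous_image continuous_on_grad sm K)
  then obtain B0 where "\<And>x. x \<in> K \<Longrightarrow> norm (grad \<theta> x) \<le> B0" by (auto simp: bounded_iff)
  then have B: "norm (grad \<theta> x) \<le> max B0 0" for x
    using K(3) by (cases "x \<in> K") (auto simp: le_max_iff_disj)
  obtain R where R: "\<And>x. x \<in> K \<Longrightarrow> norm x \<le> R" using compact_imp_bounded[OF K(1)] by (auto simp: bounded_iff)
  let ?e = "axis i 1 :: real^'n"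
  let ?h = "\<lambda>k. inverse (real (Suc k))"
  let ?q = "\<lambda>k x. (\<theta> (x + ?h k *\<^sub>R ?e) - \<theta> x) / ?h k"
  have int\<theta>: "integrable lborel \<theta>"
  proof -
    have "integrable lborel (\<lambda>x. indicator K x *\<^sub>R \<theta> x)"
      by (rule borel_integrable_compact) (auto intro: K continuous_on_subset[OF cont])
    also have "(\<lambda>x. indicator K x *\<^sub>R \<theta> x) = \<theta>"
    proof
      show "indicator K x *\<^sub>R \<theta> x = \<theta> x" for x using K(2)[of x] by (cases "x \<in> K") auto
    qed
    finally show ?thesis .
  qed
  have "(\<lambda>k. LINT x|lborel. ?q k x) \<longlonglongrightarrow> (LINT x|lborel. grad \<theta> x $ i)"
  proof (rule integral_dominated_convergence[where w = "\<lambda>x. max B0 0 * indicator (cball 0 (R + 1)) x"])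
    show "integrable lborel (\<lambda>x. max B0 0 * indicator (cball 0 (R + 1)) x)"
      by (auto intro!: integrable_mult_right emeasure_bounded_finite)
    show "AE x in lborel. (\<lambda>k. ?q k x) \<longlonglongrightarrow> grad \<theta> x $ i"
    proof (rule AE_I2)
      fix x
      have "((\<lambda>s. \<theta> (x + s *\<^sub>R ?e)) has_derivative (\<lambda>s. grad \<theta> x \<bullet> (s *\<^sub>R ?e))) (at 0)"
        by (rule has_derivative_compose[where g = \<theta>, of "\<lambda>s. x + s *\<^sub>R ?e" "\<lambda>s. s *\<^sub>R ?e"])
           (use smooth_deriv_direction[OF sm, of x] in \<open>auto intro!: derivative_eq_intros\<close>)
      then have "((\<lambda>s. \<theta> (x + s *\<^sub>R ?e)) has_real_derivative grad \<theta> x $ i) (at 0)"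
        by (simp add: has_field_derivative_def inner_axis mult_commute_abs)
      then have "((\<lambda>s. (\<theta> (x + s *\<^sub>R ?e) - \<theta> x) / s) \<longlongrightarrow> grad \<theta> x $ i) (at 0)"
        by (simp add: DERIV_def)
      moreover have "filterlim ?h (at 0) sequentially"
        using LIMSEQ_inverse_real_of_nat by (simp add: filterlim_at del: of_nat_Suc)
      ultimately show "(\<lambda>k. ?q k x) \<longlonglongrightarrow> grad \<theta> x $ i"
        by (rule filterlim_compose)
    qed
    show "AE x in lborel. norm (?q k x) \<le> max B0 0 * indicator (cball 0 (R + 1)) x" for k
    proof (rule AE_I2)
      fix x
      have h: "0 < ?h k" "?h k \<le> 1" by (auto simp: field_simps)
      show "norm (?q k x) \<le> max B0 0 * indicator (cball 0 (R + 1)) x"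
      proof (cases "x \<in> cball 0 (R + 1)")
        case True
        have "norm (\<theta> (x + ?h k *\<^sub>R ?e) - \<theta> x) \<le> max B0 0 * norm (x + ?h k *\<^sub>R ?e - x)"
        proof (rule differentiable_bound[of UNIV \<theta> "\<lambda>y h. grad \<theta> y \<bullet> h"])
          show "(\<theta> has_derivative (\<bullet>) (grad \<theta> y)) (at y within UNIV)" for y
            using smooth_deriv_direction[OF sm] by simp
          show "onorm ((\<bullet>) (grad \<theta> y)) \<le> max B0 0" for y
          proof (rule onorm_bound)
            fix h :: "real^'n"
            have "norm (grad \<theta> y \<bullet> h) \<le> norm (grad \<theta> y) * norm h"
              using Cauchy_Schwarz_ineq2 by simp
            also have "\<dots> \<le> max B0 0 * norm h" by (rule mult_right_mono[OF B]) simp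
            finally show "norm (grad \<theta> y \<bullet> h) \<le> max B0 0 * norm h" .
          qed simp
        qed auto
        then show ?thesis using True h by (simp add: divide_le_eq norm_axis_1 mult.commute abs_mult)
      next
        case False
        then have "norm x > R + 1" by simp
        moreover have "norm (x + ?h k *\<^sub>R ?e) \<ge> norm x - norm (?h k *\<^sub>R ?e)"
          using norm_diff_ineq by blast
        ultimately have "x \<notin> K" "x + ?h k *\<^sub>R ?e \<notin> K"
          using R[of x] R[of "x + ?h k *\<^sub>R ?e"] h by (auto simp: norm_axis_1)
        then show ?thesis using K(2) by simp
      qed
    qed
  qed measurable
  moreover have "(LINT x|lborel. ?q k x) = 0" for k
  proof -
    have "integrable lborel (\<lambda>x. \<theta> (c + x))" and "(LINT x|lborel. \<theta> (c + x)) = (LINT x|lborel. \<theta> x)" for c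
      using lborel_distr_plus[of c] int\<theta> integral_distr[of "(+) c" lborel borel \<theta>]
        integrable_distr_eq[of "(+) c" lborel borel \<theta>] by simp_all
    from this[of "?h k *\<^sub>R ?e"] int\<theta> show ?thesis by (simp add: add.commute)
  qed
  ultimately show ?thesis by (simp add: LIMSEQ_const_iff)
qed

lemma lebesgue_on_integral_support:
  fixes f :: "real^'n \<Rightarrow> 'b::euclidean_space"
  assumes "continuous_on UNIV f" "\<And>x. x \<notin> \<Omega> \<Longrightarrow> f x = 0"
  shows "(LINT x|lebesgue_on \<Omega>. f x) = (LINT x|lborel. f x)"
proof -
  have "(LINT x|lebesgue_on \<Omega>. f x) = (LINT x|lebesgue. indicator \<Omega> x *\<^sub>R f x)"
    by (subst integral_restrict_space) auto
  also have "(\<lambda>x. indicator \<Omega> x *\<^sub>R f x) = f" using assms(2) by (auto simp: indicator_def)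
  also have "integral\<^sup>L lebesgue f = integral\<^sup>L lborel f"
    by (rule integral_completion) (use assms(1) borel_measurable_continuous_onI in simp)
  finally show ?thesis .
qed

lemma test_mono: "\<phi> \<in> test_functions U \<Longrightarrow> U \<subseteq> U' \<Longrightarrow> \<phi> \<in> test_functions U'"
  by (auto simp: test_functions_def)

text \<open>Integration by parts: the partial derivatives of the product of two test functions integrate to zero.\<close>

lemma test_has_weak_grad:
  assumes \<phi>: "\<phi> \<in> test_functions \<Omega>"
  shows "has_weak_grad \<Omega> \<phi> (grad \<phi>)"
proof -
  have "(LINT x|lebesgue_on \<Omega>. \<phi> x * grad \<psi> x $ i) = - (LINT x|lebesgue_on \<Omega>. grad \<phi> x $ i * \<psi> x)"
    if \<psi>: "\<psi> \<in> test_functions \<Omega>" for \<psi> i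
  proof -
    let ?\<theta> = "\<lambda>x. \<phi> x * \<psi> x"
    obtain K where K: "compact K" "K \<subseteq> \<Omega>" "\<forall>x. x \<notin> K \<longrightarrow> \<phi> x = 0"
      using test_support[OF \<phi>] by blast
    have \<theta>: "?\<theta> \<in> test_functions \<Omega>"
      by (rule test_functionsI[of _ K]) (use K in \<open>auto intro!: smooth_mult test_smooth[OF \<phi>] test_smooth[OF \<psi>]\<close>)
    have "0 = (LINT x|lborel. grad ?\<theta> x $ i)"
      using integral_grad_component_zero[OF test_mono[OF \<theta>]] by simp
    also have "\<dots> = (LINT x|lebesgue_on \<Omega>. grad ?\<theta> x $ i)"
    proof (rule lebesgue_on_integral_support[symmetric])
      show "continuous_on UNIV (\<lambda>x. grad ?\<theta> x $ i)"
        by (rule smooth_continuous_on[OF test_smooth[OF test_grad_component[OF \<theta>]]])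
      show "grad ?\<theta> x $ i = 0" if "x \<notin> \<Omega>" for x
        using test_support[OF \<theta>] that by (metis subsetD zero_index)
    qed
    also have "\<dots> = (LINT x|lebesgue_on \<Omega>. \<phi> x * grad \<psi> x $ i + grad \<phi> x $ i * \<psi> x)"
      by (simp add: grad_mult[OF test_smooth[OF \<phi>] test_smooth[OF \<psi>]] mult.commute)
    also have "\<dots> = (LINT x|lebesgue_on \<Omega>. \<phi> x * grad \<psi> x $ i) + (LINT x|lebesgue_on \<Omega>. grad \<phi> x $ i * \<psi> x)"
      by (intro Bochner_Integration.integral_add integrable_mult_test_function test_L2
          test_grad_component \<phi> \<psi>)
    finally show ?thesis by simp
  qed
  then show ?thesis using \<phi> by (simp add: has_weak_grad_def test_L2 test_grad_L2)
qed

lemma H01_weak_grad: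
  assumes "u \<in> H01 \<Omega>"
  shows "has_weak_grad \<Omega> u (weak_grad \<Omega> u)"
proof -
  have "\<exists>w. has_weak_grad \<Omega> u w" using assms unfolding H01_def by blast
  then show ?thesis unfolding weak_grad_def by (rule someI_ex)
qed

lemma H01_L2: "u \<in> H01 \<Omega> \<Longrightarrow> u \<in> L2 \<Omega>"
  and weak_grad_L2: "u \<in> H01 \<Omega> \<Longrightarrow> weak_grad \<Omega> u \<in> L2 \<Omega>"
  using H01_weak_grad by (auto simp: has_weak_grad_def)

lemma weak_grad_AE:
  "u \<in> H01 \<Omega> \<Longrightarrow> has_weak_grad \<Omega> u w \<Longrightarrow> AE x in lebesgue_on \<Omega>. weak_grad \<Omega> u x = w x"
  by (rule weak_grad_unique[OF H01_weak_grad])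

text \<open>The weak gradient is a choice among representatives that agree almost everywhere, so it may replace
  the one in the definition.\<close>

lemma H01_approx:
  assumes "u \<in> H01 \<Omega>"
  obtains \<phi> where "\<And>k::nat. \<phi> k \<in> test_functions \<Omega>"
    "(\<lambda>k. l2_norm \<Omega> (\<lambda>x. \<phi> k x - u x)) \<longlonglongrightarrow> 0"
    "(\<lambda>k. l2_norm \<Omega> (\<lambda>x. grad (\<phi> k) x - weak_grad \<Omega> u x)) \<longlonglongrightarrow> 0"
proof -
  obtain w \<phi> where w: "has_weak_grad \<Omega> u w" and \<phi>: "\<And>k::nat. \<phi> k \<in> test_functions \<Omega>"
    "(\<lambda>k. l2_norm \<Omega> (\<lambda>x. \<phi> k x - u x)) \<longlonglongrightarrow> 0"
    "(\<lambda>k. l2_norm \<Omega> (\<lambda>x. grad (\<phi> k) x - w x)) \<longlonglongrightarrow> 0"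
    using assms by (auto simp: H01_def)
  have "l2_norm \<Omega> (\<lambda>x. grad (\<phi> k) x - w x) = l2_norm \<Omega> (\<lambda>x. grad (\<phi> k) x - weak_grad \<Omega> u x)" for k
  proof (rule l2_norm_cong_AE)
    show "AE x in lebesgue_on \<Omega>. grad (\<phi> k) x - w x = grad (\<phi> k) x - weak_grad \<Omega> u x"
      using weak_grad_AE[OF assms w] by eventually_elim simp
  qed (use w \<phi>(1) assms in \<open>auto intro!: L2_diff test_grad_L2 weak_grad_L2 simp: has_weak_grad_def\<close>)
  then have "(\<lambda>k. l2_norm \<Omega> (\<lambda>x. grad (\<phi> k) x - weak_grad \<Omega> u x)) \<longlonglongrightarrow> 0"
    using \<phi>(3) by simp
  with \<phi>(1,2) show ?thesis by (rule that)
qed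

text \<open>Both sides of the defining identity of the weak gradient are continuous in \<open>L\<^sup>2\<close>.\<close>

lemma H01_limit:
  assumes \<phi>: "\<And>k::nat. \<phi> k \<in> test_functions \<Omega>" and "u \<in> L2 \<Omega>" "w \<in> L2 \<Omega>"
    and lim: "(\<lambda>k. l2_norm \<Omega> (\<lambda>x. \<phi> k x - u x)) \<longlonglongrightarrow> 0"
      "(\<lambda>k. l2_norm \<Omega> (\<lambda>x. grad (\<phi> k) x - w x)) \<longlonglongrightarrow> 0"
  shows "u \<in> H01 \<Omega>" "AE x in lebesgue_on \<Omega>. weak_grad \<Omega> u x = w x"
proof -
  have "has_weak_grad \<Omega> u w"
    unfolding has_weak_grad_def
  proof (intro conjI ballI allI)
    fix \<psi> i assume \<psi>: "\<psi> \<in> test_functions \<Omega>"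
    have const: "(\<lambda>k::nat. l2_norm \<Omega> (\<lambda>x. h x - h x :: real)) \<longlonglongrightarrow> 0" for h :: "real^'n \<Rightarrow> real"
      by (simp add: l2_norm_def)
    have comp: "(\<lambda>k. l2_norm \<Omega> (\<lambda>x. grad (\<phi> k) x $ i - w x $ i)) \<longlonglongrightarrow> 0"
    proof (rule Lim_null_comparison[OF always_eventually lim(2)], rule allI)
      fix k
      have "(LINT x|lebesgue_on \<Omega>. (norm (grad (\<phi> k) x $ i - w x $ i))\<^sup>2)
          \<le> (LINT x|lebesgue_on \<Omega>. (norm (grad (\<phi> k) x - w x))\<^sup>2)"
      proof (rule integral_mono)
        show "(norm (grad (\<phi> k) x $ i - w x $ i))\<^sup>2 \<le> (norm (grad (\<phi> k) x - w x))\<^sup>2" for x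
          using component_le_norm_cart[of "grad (\<phi> k) x - w x" i] by (intro power_mono) auto
      qed (intro L2_norm2_integrable L2_diff L2_component test_grad_L2 \<phi> assms)+
      then show "norm (l2_norm \<Omega> (\<lambda>x. grad (\<phi> k) x $ i - w x $ i)) \<le> l2_norm \<Omega> (\<lambda>x. grad (\<phi> k) x - w x)"
        by (simp add: l2_norm_def)
    qed
    have "(\<lambda>k. l2_inner \<Omega> (\<phi> k) (\<lambda>x. grad \<psi> x $ i)) \<longlonglongrightarrow> l2_inner \<Omega> u (\<lambda>x. grad \<psi> x $ i)"
      by (intro l2_inner_tendsto test_L2 test_grad_component \<phi> \<psi> assms const)
    moreover have "(\<lambda>k. - l2_inner \<Omega> (\<lambda>x. grad (\<phi> k) x $ i) \<psi>) \<longlonglongrightarrow> - l2_inner \<Omega> (\<lambda>x. w x $ i) \<psi>"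
      by (intro tendsto_minus l2_inner_tendsto L2_component test_L2 test_grad_L2 \<phi> \<psi> assms const comp)
    ultimately have "l2_inner \<Omega> u (\<lambda>x. grad \<psi> x $ i) = - l2_inner \<Omega> (\<lambda>x. w x $ i) \<psi>"
      using weak_grad_pairing[OF test_has_weak_grad[OF \<phi>] \<psi>, of _ i] LIMSEQ_unique by auto
    then show "(LINT x|lebesgue_on \<Omega>. u x * grad \<psi> x $ i) = - (LINT x|lebesgue_on \<Omega>. w x $ i * \<psi> x)"
      by (simp add: l2_inner_def)
  qed fact+
  with \<phi> lim show "u \<in> H01 \<Omega>" by (auto simp: H01_def)
  then show "AE x in lebesgue_on \<Omega>. weak_grad \<Omega> u x = w x"
    by (rule weak_grad_AE) fact
qed

lemma l2_norm_zero: "l2_norm \<Omega> (\<lambda>x. 0 :: 'b::euclidean_space) = 0"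
  by (simp add: l2_norm_def)

lemma test_H01:
  assumes "\<phi> \<in> test_functions \<Omega>"
  shows "\<phi> \<in> H01 \<Omega>" "AE x in lebesgue_on \<Omega>. weak_grad \<Omega> \<phi> x = grad \<phi> x"
  using H01_limit[of "\<lambda>k. \<phi>" \<phi> "grad \<phi>"] assms by (auto simp: l2_norm_zero test_L2 test_grad_L2)

lemma H01_lincomb:
  assumes u: "u \<in> H01 \<Omega>" and v: "v \<in> H01 \<Omega>"
  shows "(\<lambda>x. a * u x + b * v x) \<in> H01 \<Omega>"
    "AE x in lebesgue_on \<Omega>. weak_grad \<Omega> (\<lambda>x. a * u x + b * v x) x
       = a *\<^sub>R weak_grad \<Omega> u x + b *\<^sub>R weak_grad \<Omega> v x"
proof -
  obtain \<phi> where \<phi>: "\<And>k::nat. \<phi> k \<in> test_functions \<Omega>"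
    "(\<lambda>k. l2_norm \<Omega> (\<lambda>x. \<phi> k x - u x)) \<longlonglongrightarrow> 0"
    "(\<lambda>k. l2_norm \<Omega> (\<lambda>x. grad (\<phi> k) x - weak_grad \<Omega> u x)) \<longlonglongrightarrow> 0"
    using H01_approx[OF u] by blast
  obtain \<psi> where \<psi>: "\<And>k::nat. \<psi> k \<in> test_functions \<Omega>"
    "(\<lambda>k. l2_norm \<Omega> (\<lambda>x. \<psi> k x - v x)) \<longlonglongrightarrow> 0"
    "(\<lambda>k. l2_norm \<Omega> (\<lambda>x. grad (\<psi> k) x - weak_grad \<Omega> v x)) \<longlonglongrightarrow> 0"
    using H01_approx[OF v] by blast
  have lim: "(\<lambda>k. l2_norm \<Omega> (\<lambda>x. (a *\<^sub>R f k x + b *\<^sub>R h k x) - (a *\<^sub>R F x + b *\<^sub>R G x))) \<longlonglongrightarrow> 0"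
    if "\<And>k::nat. f k \<in> L2 \<Omega>" "F \<in> L2 \<Omega>" "\<And>k. h k \<in> L2 \<Omega>" "G \<in> L2 \<Omega>"
      "(\<lambda>k. l2_norm \<Omega> (\<lambda>x. f k x - F x)) \<longlonglongrightarrow> 0" "(\<lambda>k. l2_norm \<Omega> (\<lambda>x. h k x - G x)) \<longlonglongrightarrow> 0"
    for f h and F G :: "real^'n \<Rightarrow> 'b::euclidean_space"
  proof (rule Lim_null_comparison[OF always_eventually], rule allI)
    fix k
    have eq: "(\<lambda>x. (a *\<^sub>R f k x + b *\<^sub>R h k x) - (a *\<^sub>R F x + b *\<^sub>R G x))
        = (\<lambda>x. a *\<^sub>R (f k x - F x) + b *\<^sub>R (h k x - G x))" by (auto simp: algebra_simps)
    have "l2_norm \<Omega> (\<lambda>x. a *\<^sub>R (f k x - F x) + b *\<^sub>R (h k x - G x))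
        \<le> l2_norm \<Omega> (\<lambda>x. a *\<^sub>R (f k x - F x)) + l2_norm \<Omega> (\<lambda>x. b *\<^sub>R (h k x - G x))"
      using L2_lincomb[OF L2_diff[OF that(1)[of k] that(2)] L2_diff[OF that(1)[of k] that(2)], of a 0]
        L2_lincomb[OF L2_diff[OF that(3)[of k] that(4)] L2_diff[OF that(3)[of k] that(4)], of b 0]
      by (intro l2_norm_triangle) simp_all
    then show "norm (l2_norm \<Omega> (\<lambda>x. (a *\<^sub>R f k x + b *\<^sub>R h k x) - (a *\<^sub>R F x + b *\<^sub>R G x)))
        \<le> \<bar>a\<bar> * l2_norm \<Omega> (\<lambda>x. f k x - F x) + \<bar>b\<bar> * l2_norm \<Omega> (\<lambda>x. h k x - G x)"
      unfolding eq by (simp add: l2_norm_scale)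
  next
    show "(\<lambda>k. \<bar>a\<bar> * l2_norm \<Omega> (\<lambda>x. f k x - F x) + \<bar>b\<bar> * l2_norm \<Omega> (\<lambda>x. h k x - G x)) \<longlonglongrightarrow> 0"
      using tendsto_add[OF tendsto_mult_left[OF that(5), of "\<bar>a\<bar>"] tendsto_mult_left[OF that(6), of "\<bar>b\<bar>"]]
      by simp
  qed
  have 1: "(\<lambda>x. a * \<phi> k x + b * \<psi> k x) \<in> test_functions \<Omega>" for k
    by (rule test_lincomb[OF \<phi>(1) \<psi>(1)])
  have 2: "(\<lambda>k. l2_norm \<Omega> (\<lambda>x. (a * \<phi> k x + b * \<psi> k x) - (a * u x + b * v x))) \<longlonglongrightarrow> 0"
    using lim[OF test_L2[OF \<phi>(1)] H01_L2[OF u] test_L2[OF \<psi>(1)] H01_L2[OF v] \<phi>(2) \<psi>(2)] by simp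
  have 3: "(\<lambda>k. l2_norm \<Omega> (\<lambda>x. grad (\<lambda>x. a * \<phi> k x + b * \<psi> k x) x
      - (a *\<^sub>R weak_grad \<Omega> u x + b *\<^sub>R weak_grad \<Omega> v x))) \<longlonglongrightarrow> 0"
    using lim[OF test_grad_L2[OF \<phi>(1)] weak_grad_L2[OF u] test_grad_L2[OF \<psi>(1)] weak_grad_L2[OF v] \<phi>(3) \<psi>(3)]
    by (simp add: grad_lincomb[OF test_smooth[OF \<phi>(1)] test_smooth[OF \<psi>(1)]])
  note H = H01_limit[OF 1 _ _ 2 3]
  show "(\<lambda>x. a * u x + b * v x) \<in> H01 \<Omega>"
    "AE x in lebesgue_on \<Omega>. weak_grad \<Omega> (\<lambda>x. a * u x + b * v x) x
       = a *\<^sub>R weak_grad \<Omega> u x + b *\<^sub>R weak_grad \<Omega> v x"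
    using L2_lincomb_real[OF H01_L2[OF u] H01_L2[OF v]] L2_lincomb[OF weak_grad_L2[OF u] weak_grad_L2[OF v]]
    by (auto intro!: H)
qed

lemma weak_grad_cong:
  assumes "u \<in> H01 \<Omega>" "v \<in> H01 \<Omega>" "AE x in lebesgue_on \<Omega>. u x = v x"
  shows "AE x in lebesgue_on \<Omega>. weak_grad \<Omega> u x = weak_grad \<Omega> v x"
proof (rule weak_grad_AE[OF assms(1)])
  have "(LINT x|lebesgue_on \<Omega>. u x * grad \<phi> x $ i) = (LINT x|lebesgue_on \<Omega>. v x * grad \<phi> x $ i)"
    if "\<phi> \<in> test_functions \<Omega>" for \<phi> i
    using assms(3) that
    by (intro integral_cong_AE borel_measurable_integrable integrable_mult_test_function
        test_grad_component H01_L2 assms) auto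
  then show "has_weak_grad \<Omega> u (weak_grad \<Omega> v)"
    using H01_weak_grad[OF assms(2)] H01_L2[OF assms(1)] by (simp add: has_weak_grad_def)
qed

lemma weak_grad_diff:
  assumes "u \<in> H01 \<Omega>" "v \<in> H01 \<Omega>"
  shows "(\<lambda>x. u x - v x) \<in> H01 \<Omega>"
    "AE x in lebesgue_on \<Omega>. weak_grad \<Omega> (\<lambda>x. u x - v x) x = weak_grad \<Omega> u x - weak_grad \<Omega> v x"
  using H01_lincomb[OF assms, of 1 "-1"] by simp_all

lemma V_norm_diff:
  assumes "u \<in> H01 \<Omega>" "v \<in> H01 \<Omega>"
  shows "V_norm \<Omega> (u - v) = l2_norm \<Omega> (\<lambda>x. weak_grad \<Omega> u x - weak_grad \<Omega> v x)"
proof -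
  have "u - v = (\<lambda>x. u x - v x)" by (simp add: fun_eq_iff)
  then show ?thesis
    using l2_norm_cong_AE[OF weak_grad_L2[OF weak_grad_diff(1)[OF assms]]
        L2_diff[OF weak_grad_L2[OF assms(1)] weak_grad_L2[OF assms(2)]] weak_grad_diff(2)[OF assms]]
    by (simp add: V_norm_def)
qed

lemma l2_inner_weak_grad_lincomb:
  assumes "u \<in> H01 \<Omega>" "v \<in> H01 \<Omega>" "w \<in> L2 \<Omega>"
  shows "l2_inner \<Omega> w (weak_grad \<Omega> (\<lambda>x. a * u x + b * v x))
    = a * l2_inner \<Omega> w (weak_grad \<Omega> u) + b * l2_inner \<Omega> w (weak_grad \<Omega> v)"
proof -
  have "l2_inner \<Omega> w (weak_grad \<Omega> (\<lambda>x. a * u x + b * v x))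
      = l2_inner \<Omega> w (\<lambda>x. a *\<^sub>R weak_grad \<Omega> u x + b *\<^sub>R weak_grad \<Omega> v x)"
    by (rule l2_inner_cong_AE)
       (use assms H01_lincomb[OF assms(1,2)] in \<open>auto intro!: weak_grad_L2 L2_lincomb\<close>)
  then show ?thesis using assms by (simp add: l2_inner_lincomb_right weak_grad_L2)
qed

end

section \<open>Cube averages of test functions\<close>

lemma integral_square_le:
  fixes f :: "'a::euclidean_space \<Rightarrow> real"
  assumes "measure lborel (cbox a b) = 1" "continuous_on (cbox a b) f"
  shows "(integral (cbox a b) f)\<^sup>2 \<le> integral (cbox a b) (\<lambda>x. (f x)\<^sup>2)"
proof -
  let ?m = "integral (cbox a b) f"
  have f: "f integrable_on cbox a b" "(\<lambda>x. (f x)\<^sup>2) integrable_on cbox a b"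
    using assms(2) by (auto intro!: integrable_continuous continuous_intros)
  have "0 \<le> integral (cbox a b) (\<lambda>x. (f x - ?m)\<^sup>2)"
    by (rule integral_nonneg) (use assms(2) in \<open>auto intro!: integrable_continuous continuous_intros\<close>)
  also have "(\<lambda>x. (f x - ?m)\<^sup>2) = (\<lambda>x. (f x)\<^sup>2 - 2 * ?m * f x + ?m\<^sup>2)"
    by (auto simp: power2_diff)
  also have "integral (cbox a b) (\<lambda>x. (f x)\<^sup>2 - 2 * ?m * f x + ?m\<^sup>2)
      = integral (cbox a b) (\<lambda>x. (f x)\<^sup>2) - 2 * ?m * ?m + ?m\<^sup>2"
    using f assms(1)
    by (subst Henstock_Kurzweil_Integration.integral_add Henstock_Kurzweil_Integration.integral_diff,
        auto intro!: integrable_diff integrable_on_mult_right)+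
  finally show ?thesis by (simp add: power2_eq_square)
qed

lemma ennreal_integral_continuous:
  fixes f :: "'a::euclidean_space \<Rightarrow> real"
  assumes "continuous_on (cbox a b) f" "\<And>x. x \<in> cbox a b \<Longrightarrow> 0 \<le> f x"
  shows "ennreal (integral (cbox a b) f) = (\<integral>\<^sup>+x. ennreal (f x) * indicator (cbox a b) x \<partial>lborel)"
proof -
  have int: "set_integrable lborel (cbox a b) f"
    unfolding set_integrable_def by (rule borel_integrable_compact) (auto intro: assms)
  have "integral (cbox a b) f = (LINT x:cbox a b|lborel. f x)"
    by (rule set_borel_integral_eq_integral(2)[OF int, symmetric])
  also have "ennreal \<dots> = (\<integral>\<^sup>+x. ennreal (indicator (cbox a b) x *\<^sub>R f x) \<partial>lborel)"
    unfolding set_lebesgue_integral_def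
    by (rule nn_integral_eq_integral[symmetric])
       (use int assms(2) in \<open>auto simp: set_integrable_def indicator_def\<close>)
  also have "\<dots> = (\<integral>\<^sup>+x. ennreal (f x) * indicator (cbox a b) x \<partial>lborel)"
    by (intro nn_integral_cong) (auto simp: indicator_def)
  finally show ?thesis .
qed

lemma nn_integral_affine:
  fixes f :: "real^'n \<Rightarrow> ennreal"
  assumes [measurable]: "f \<in> borel_measurable borel" and "c > 0"
  shows "(\<integral>\<^sup>+y. f (t + c *\<^sub>R y) \<partial>lborel) = ennreal (1 / c ^ CARD('n)) * (\<integral>\<^sup>+y. f y \<partial>lborel)"
proof -
  have "(\<integral>\<^sup>+y. f y \<partial>lborel) = (\<integral>\<^sup>+y. ennreal (\<bar>c\<bar> ^ DIM(real^'n)) * f (t + c *\<^sub>R y) \<partial>lborel)"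
    using \<open>c > 0\<close>
    by (subst lborel_affine[of c t]) (auto simp: nn_integral_density nn_integral_distr)
  also have "\<dots> = ennreal (c ^ CARD('n)) * (\<integral>\<^sup>+y. f (t + c *\<^sub>R y) \<partial>lborel)"
    using \<open>c > 0\<close> by (subst nn_integral_cmult) auto
  finally show ?thesis
    using \<open>c > 0\<close> by (simp add: mult.assoc[symmetric] ennreal_mult[symmetric])
qed

lemma nn_integral_translate:
  fixes f :: "real^'n \<Rightarrow> ennreal"
  assumes "f \<in> borel_measurable borel"
  shows "(\<integral>\<^sup>+y. f (y + t) \<partial>lborel) = (\<integral>\<^sup>+y. f y \<partial>lborel)"
  using nn_integral_affine[OF assms, of 1 t] by (simp add: add.commute)

text \<open>Fundamental theorem of calculus along the segment, and the Cauchy-Schwarz inequality.\<close>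

lemma segment_estimate:
  fixes \<phi> :: "real^'n \<Rightarrow> real"
  assumes sm: "smooth \<phi>"
  shows "ennreal ((\<phi> b - \<phi> a)\<^sup>2) \<le> ennreal ((norm (b - a))\<^sup>2) *
    (\<integral>\<^sup>+s. ennreal ((norm (grad \<phi> (a + s *\<^sub>R (b - a))))\<^sup>2) * indicator {0..1} s \<partial>lborel)"
proof -
  let ?g = "\<lambda>s. grad \<phi> (a + s *\<^sub>R (b - a)) \<bullet> (b - a)"
  let ?h = "\<lambda>s. norm (grad \<phi> (a + s *\<^sub>R (b - a)))"
  have cg: "continuous_on S (\<lambda>s::real. grad \<phi> (a + s *\<^sub>R (b - a)))" for S
    by (rule continuous_on_compose2[OF continuous_on_grad[OF sm, of UNIV]]) (auto intro!: continuous_intros)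
  have "((\<lambda>s. \<phi> (a + s *\<^sub>R (b - a))) has_real_derivative ?g s) (at s within {0..1})" for s
  proof -
    have "((\<lambda>s. \<phi> (a + s *\<^sub>R (b - a))) has_derivative (\<lambda>h. grad \<phi> (a + s *\<^sub>R (b - a)) \<bullet> (h *\<^sub>R (b - a))))
        (at s within {0..1})"
      by (rule has_derivative_compose[where f = "\<lambda>s. a + s *\<^sub>R (b - a)", OF _ smooth_deriv_direction[OF sm]])
         (auto intro!: derivative_eq_intros)
    then show ?thesis by (simp add: has_field_derivative_def mult_commute_abs)
  qed
  then have "(?g has_integral \<phi> (a + 1 *\<^sub>R (b - a)) - \<phi> (a + 0 *\<^sub>R (b - a))) {0..1}"
    by (intro fundamental_theorem_of_calculus) (auto simp: has_real_derivative_iff_has_vector_derivative)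
  then have ftc: "\<phi> b - \<phi> a = integral {0..1} ?g" by (simp add: integral_unique)
  have "\<bar>\<phi> b - \<phi> a\<bar> \<le> integral {0..1} (\<lambda>s. ?h s * norm (b - a))"
    unfolding ftc real_norm_def[symmetric]
    by (rule integral_norm_bound_integral)
       (auto intro!: integrable_continuous_real continuous_intros cg Cauchy_Schwarz_ineq2)
  also have "\<dots> = integral {0..1} ?h * norm (b - a)" by simp
  finally have "(\<phi> b - \<phi> a)\<^sup>2 \<le> (integral {0..1} ?h * norm (b - a))\<^sup>2"
    using abs_le_square_iff by fastforce
  also have "\<dots> = (norm (b - a))\<^sup>2 * (integral (cbox 0 1) ?h)\<^sup>2"
    by (simp add: power_mult_distrib mult.commute)
  also have "\<dots> \<le> (norm (b - a))\<^sup>2 * integral (cbox 0 1) (\<lambda>s. (?h s)\<^sup>2)"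
    by (intro mult_left_mono integral_square_le) (auto intro!: continuous_intros cg)
  finally have "ennreal ((\<phi> b - \<phi> a)\<^sup>2) \<le> ennreal ((norm (b - a))\<^sup>2 * integral (cbox 0 1) (\<lambda>s. (?h s)\<^sup>2))"
    by (rule ennreal_leI)
  also have "\<dots> = ennreal ((norm (b - a))\<^sup>2) * ennreal (integral (cbox 0 1) (\<lambda>s. (?h s)\<^sup>2))"
    by (rule ennreal_mult') simp
  also have "ennreal (integral (cbox 0 1) (\<lambda>s. (?h s)\<^sup>2))
      = (\<integral>\<^sup>+s. ennreal ((?h s)\<^sup>2) * indicator (cbox 0 1) s \<partial>lborel)"
    by (rule ennreal_integral_continuous) (auto intro!: continuous_intros cg)
  finally show ?thesis by simp
qed

definition avg :: "real \<Rightarrow> (real^'n \<Rightarrow> real) \<Rightarrow> real^'n \<Rightarrow> real" where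
  "avg c \<phi> p = integral (cbox 0 One) (\<lambda>y. \<phi> (p + c *\<^sub>R y))"

lemma content_unit_cube: "measure lborel (cbox 0 One :: (real^'n) set) = 1"
  by (simp add: content_cbox_if)

lemma norm_unit_cube:
  assumes "y \<in> cbox 0 (One :: real^'n)"
  shows "norm y \<le> CARD('n)"
proof -
  have "norm y \<le> (\<Sum>b\<in>Basis. \<bar>y \<bullet> b\<bar>)" by (rule norm_le_l1)
  also have "\<dots> \<le> (\<Sum>b\<in>(Basis :: (real^'n) set). 1)"
    using assms by (intro sum_mono) (auto simp: mem_box)
  finally show ?thesis by simp
qed

lemma avg_0: "avg 0 \<phi> p = (\<phi> p :: real)" for p :: "real^'n"
  by (simp add: avg_def content_unit_cube)

lemma continuous_on_affine:
  fixes \<phi> :: "real^'n \<Rightarrow> real"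
  assumes "smooth \<phi>"
  shows "continuous_on S (\<lambda>y. \<phi> (p + c *\<^sub>R y))"
  by (rule continuous_on_compose2[OF smooth_continuous_on[OF assms, of UNIV]]) (auto intro!: continuous_intros)

text \<open>The mean of \<open>\<phi>\<close> over the cube with corner \<open>p\<close> and side \<open>c\<close>, written as an integral over the unit cube, is
  compared pointwise along the segment joining \<open>p + c y\<close> to \<open>p' + c' y\<close>. For \<open>c = 0\<close> the mean is the value
  at \<open>p\<close>, so one estimate covers the growth of the means, their modulus of continuity, and the distance
  of a function from its means.\<close>

lemma avg_diff_estimate:
  fixes \<phi> :: "real^'n \<Rightarrow> real"
  assumes sm: "smooth \<phi>"
  defines "\<Gamma> \<equiv> \<lambda>z. ennreal ((norm (grad \<phi> z))\<^sup>2)"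
  shows "ennreal ((avg c' \<phi> p' - avg c \<phi> p)\<^sup>2)
    \<le> ennreal ((norm (p' - p) + \<bar>c' - c\<bar> * CARD('n))\<^sup>2) *
       (\<integral>\<^sup>+s. (\<integral>\<^sup>+y. \<Gamma> ((p + s *\<^sub>R (p' - p)) + (c + s * (c' - c)) *\<^sub>R y)
           * indicator (cbox 0 One) y \<partial>lborel) * indicator {0..1} s \<partial>lborel)"
proof -
  let ?Q = "cbox 0 One :: (real^'n) set"
  let ?z = "\<lambda>s y. (p + s *\<^sub>R (p' - p)) + (c + s * (c' - c)) *\<^sub>R y"
  let ?\<delta> = "norm (p' - p) + \<bar>c' - c\<bar> * CARD('n)"
  have [measurable]: "\<Gamma> \<in> borel_measurable borel"
  proof -
    have "grad \<phi> \<in> borel_measurable borel"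
      by (rule borel_measurable_continuous_onI[OF continuous_on_grad[OF sm]])
    then show ?thesis unfolding \<Gamma>_def by measurable
  qed
  have "avg c' \<phi> p' - avg c \<phi> p = integral ?Q (\<lambda>y. \<phi> (p' + c' *\<^sub>R y) - \<phi> (p + c *\<^sub>R y))"
    unfolding avg_def
    by (rule Henstock_Kurzweil_Integration.integral_diff[symmetric])
       (auto intro!: integrable_continuous continuous_on_affine sm)
  then have "(avg c' \<phi> p' - avg c \<phi> p)\<^sup>2 \<le> integral ?Q (\<lambda>y. (\<phi> (p' + c' *\<^sub>R y) - \<phi> (p + c *\<^sub>R y))\<^sup>2)"
    by (simp only:) (intro integral_square_le[OF content_unit_cube] continuous_intros continuous_on_affine sm)
  then have "ennreal ((avg c' \<phi> p' - avg c \<phi> p)\<^sup>2)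
      \<le> ennreal (integral ?Q (\<lambda>y. (\<phi> (p' + c' *\<^sub>R y) - \<phi> (p + c *\<^sub>R y))\<^sup>2))"
    by (rule ennreal_leI)
  also have "\<dots> = (\<integral>\<^sup>+y. ennreal ((\<phi> (p' + c' *\<^sub>R y) - \<phi> (p + c *\<^sub>R y))\<^sup>2) * indicator ?Q y \<partial>lborel)"
    by (rule ennreal_integral_continuous) (auto intro!: continuous_intros continuous_on_affine sm)
  also have "\<dots> \<le> (\<integral>\<^sup>+y. (ennreal (?\<delta>\<^sup>2) * (\<integral>\<^sup>+s. \<Gamma> (?z s y) * indicator {0..1} s \<partial>lborel)) * indicator ?Q y \<partial>lborel)"
  proof (intro nn_integral_mono)
    fix y :: "real^'n"
    show "ennreal ((\<phi> (p' + c' *\<^sub>R y) - \<phi> (p + c *\<^sub>R y))\<^sup>2) * indicator ?Q y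
        \<le> (ennreal (?\<delta>\<^sup>2) * (\<integral>\<^sup>+s. \<Gamma> (?z s y) * indicator {0..1} s \<partial>lborel)) * indicator ?Q y"
    proof (cases "y \<in> ?Q")
      case True
      have seg: "(p + c *\<^sub>R y) + s *\<^sub>R ((p' + c' *\<^sub>R y) - (p + c *\<^sub>R y)) = ?z s y" for s
        by (simp add: algebra_simps)
      have "norm ((p' + c' *\<^sub>R y) - (p + c *\<^sub>R y)) = norm ((p' - p) + (c' - c) *\<^sub>R y)"
        by (simp add: algebra_simps)
      also have "\<dots> \<le> norm (p' - p) + \<bar>c' - c\<bar> * norm y"
        using norm_triangle_ineq[of "p' - p" "(c' - c) *\<^sub>R y"] by simp
      also have "\<dots> \<le> ?\<delta>" using norm_unit_cube[OF True] by (intro add_left_mono mult_left_mono) auto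
      finally have "(norm ((p' + c' *\<^sub>R y) - (p + c *\<^sub>R y)))\<^sup>2 \<le> ?\<delta>\<^sup>2" by (intro power_mono) auto
      then have "ennreal ((\<phi> (p' + c' *\<^sub>R y) - \<phi> (p + c *\<^sub>R y))\<^sup>2)
          \<le> ennreal (?\<delta>\<^sup>2) * (\<integral>\<^sup>+s. \<Gamma> (?z s y) * indicator {0..1} s \<partial>lborel)"
        unfolding \<Gamma>_def
        by (intro order_trans[OF segment_estimate[OF sm, of "p' + c' *\<^sub>R y" "p + c *\<^sub>R y", unfolded seg]]
            mult_right_mono ennreal_leI) auto
      then show ?thesis using True by simp
    qed simp
  qed
  also have "\<dots> = (\<integral>\<^sup>+y. ennreal (?\<delta>\<^sup>2) * (\<integral>\<^sup>+s. \<Gamma> (?z s y) * indicator {0..1} s * indicator ?Q y \<partial>lborel) \<partial>lborel)"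
    by (intro nn_integral_cong) (auto simp: indicator_def)
  also have "\<dots> = ennreal (?\<delta>\<^sup>2) * (\<integral>\<^sup>+y. (\<integral>\<^sup>+s. \<Gamma> (?z s y) * indicator {0..1} s * indicator ?Q y \<partial>lborel) \<partial>lborel)"
    by (rule nn_integral_cmult) measurable
  also have "(\<integral>\<^sup>+y. (\<integral>\<^sup>+s. \<Gamma> (?z s y) * indicator {0..1} s * indicator ?Q y \<partial>lborel) \<partial>lborel)
      = (\<integral>\<^sup>+s. (\<integral>\<^sup>+y. \<Gamma> (?z s y) * indicator {0..1} s * indicator ?Q y \<partial>lborel) \<partial>lborel)"
    by (rule lborel_pair.Fubini') measurable
  also have "\<dots> = (\<integral>\<^sup>+s. (\<integral>\<^sup>+y. \<Gamma> (?z s y) * indicator ?Q y \<partial>lborel) * indicator {0..1} s \<partial>lborel)"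
    by (intro nn_integral_cong) (auto simp: indicator_def)
  finally show ?thesis .
qed

context domain
begin

lemma nn_integral_grad:
  assumes \<phi>: "\<phi> \<in> test_functions \<Omega>"
  shows "(\<integral>\<^sup>+z. ennreal ((norm (grad \<phi> z))\<^sup>2) \<partial>lborel) = ennreal ((l2_norm \<Omega> (grad \<phi>))\<^sup>2)"
proof -
  have cont: "continuous_on UNIV (\<lambda>z. (norm (grad \<phi> z))\<^sup>2)"
    by (intro continuous_intros continuous_on_grad test_smooth[OF \<phi>])
  obtain K where K: "compact K" "K \<subseteq> \<Omega>" "\<And>x. x \<notin> K \<Longrightarrow> grad \<phi> x = 0"
    using test_support[OF \<phi>] by blast
  have "integrable lborel (\<lambda>z. indicator K z *\<^sub>R (norm (grad \<phi> z))\<^sup>2)"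
    by (rule borel_integrable_compact) (auto intro: K continuous_on_subset[OF cont])
  also have "(\<lambda>z. indicator K z *\<^sub>R (norm (grad \<phi> z))\<^sup>2) = (\<lambda>z. (norm (grad \<phi> z))\<^sup>2)"
  proof
    show "indicator K z *\<^sub>R (norm (grad \<phi> z))\<^sup>2 = (norm (grad \<phi> z))\<^sup>2" for z
      using K(3)[of z] by (cases "z \<in> K") auto
  qed
  finally have "(\<integral>\<^sup>+z. ennreal ((norm (grad \<phi> z))\<^sup>2) \<partial>lborel) = ennreal (LINT z|lborel. (norm (grad \<phi> z))\<^sup>2)"
    by (rule nn_integral_eq_integral) auto
  also have "(LINT z|lborel. (norm (grad \<phi> z))\<^sup>2) = (LINT z|lebesgue_on \<Omega>. (norm (grad \<phi> z))\<^sup>2)"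
    by (rule lebesgue_on_integral_support[symmetric, OF cont]) (use K in auto)
  finally show ?thesis by (simp add: l2_norm_def)
qed

text \<open>Pointwise, the inner integral of the preceding estimate is at most the full Dirichlet energy divided
  by the volume of the smallest cube met on the way.\<close>

lemma avg_diff_sup:
  assumes \<phi>: "\<phi> \<in> test_functions \<Omega>" and m: "0 < m" "m \<le> c" "m \<le> c'"
  shows "(avg c' \<phi> p' - avg c \<phi> p)\<^sup>2
    \<le> (norm (p' - p) + \<bar>c' - c\<bar> * CARD('n))\<^sup>2 * (1 / m ^ CARD('n)) * (l2_norm \<Omega> (grad \<phi>))\<^sup>2"
proof -
  let ?\<delta> = "norm (p' - p) + \<bar>c' - c\<bar> * CARD('n)"
  let ?G = "(l2_norm \<Omega> (grad \<phi>))\<^sup>2"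
  let ?\<Gamma> = "\<lambda>z. ennreal ((norm (grad \<phi> z))\<^sup>2)"
  have [measurable]: "grad \<phi> \<in> borel_measurable borel"
    by (rule borel_measurable_continuous_onI[OF continuous_on_grad[OF test_smooth[OF \<phi>]]])
  have "(\<integral>\<^sup>+s. (\<integral>\<^sup>+y. ?\<Gamma> ((p + s *\<^sub>R (p' - p)) + (c + s * (c' - c)) *\<^sub>R y)
           * indicator (cbox 0 One) y \<partial>lborel) * indicator {0..1} s \<partial>lborel)
      \<le> (\<integral>\<^sup>+s. ennreal (1 / m ^ CARD('n) * ?G) * indicator {0..1::real} s \<partial>lborel)"
  proof (rule nn_integral_mono)
    fix s :: real
    show "(\<integral>\<^sup>+y. ?\<Gamma> ((p + s *\<^sub>R (p' - p)) + (c + s * (c' - c)) *\<^sub>R y) * indicator (cbox 0 One) y \<partial>lborel)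
        * indicator {0..1} s \<le> ennreal (1 / m ^ CARD('n) * ?G) * indicator {0..1} s"
    proof (cases "s \<in> {0..1}")
      case True
      let ?c = "c + s * (c' - c)"
      have "?c = (1 - s) * c + s * c'" by (simp add: algebra_simps)
      also have "\<dots> \<ge> (1 - s) * m + s * m" using True m by (intro add_mono mult_left_mono) auto
      finally have c: "m \<le> ?c" by (simp add: algebra_simps)
      have "(\<integral>\<^sup>+y. ?\<Gamma> ((p + s *\<^sub>R (p' - p)) + ?c *\<^sub>R y) * indicator (cbox 0 One) y \<partial>lborel)
          \<le> (\<integral>\<^sup>+y. ?\<Gamma> ((p + s *\<^sub>R (p' - p)) + ?c *\<^sub>R y) \<partial>lborel)"
        by (intro nn_integral_mono) (auto simp: indicator_def)
      also have "\<dots> = ennreal (1 / ?c ^ CARD('n)) * ennreal ?G"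
        using c m by (subst nn_integral_affine) (auto simp: nn_integral_grad[OF \<phi>])
      also have "\<dots> = ennreal (1 / ?c ^ CARD('n) * ?G)"
        using c m by (intro ennreal_mult[symmetric]) auto
      also have "\<dots> \<le> ennreal (1 / m ^ CARD('n) * ?G)"
        using c m by (intro ennreal_leI mult_right_mono divide_left_mono power_mono) auto
      finally show ?thesis using True by simp
    qed simp
  qed
  also have "\<dots> = ennreal (1 / m ^ CARD('n) * ?G)"
    by (subst nn_integral_cmult_indicator) auto
  finally have "ennreal ((avg c' \<phi> p' - avg c \<phi> p)\<^sup>2) \<le> ennreal (?\<delta>\<^sup>2) * ennreal (1 / m ^ CARD('n) * ?G)"
    using avg_diff_estimate[OF test_smooth[OF \<phi>], of c' p' c p]
    by (elim order_trans) (intro mult_left_mono, auto)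
  also have "\<dots> = ennreal (?\<delta>\<^sup>2 * (1 / m ^ CARD('n) * ?G))"
    using m by (intro ennreal_mult[symmetric]) auto
  finally show ?thesis using m by (simp add: mult.assoc)
qed

lemma continuous_avg:
  assumes \<phi>: "\<phi> \<in> test_functions \<Omega>" and c: "0 < c"
  shows "continuous_on UNIV (avg c \<phi>)"
proof -
  let ?L = "sqrt (1 / c ^ CARD('n)) * l2_norm \<Omega> (grad \<phi>)"
  have "dist (avg c \<phi> p') (avg c \<phi> p) \<le> ?L * dist p' p" for p p'
  proof -
    have "(avg c \<phi> p' - avg c \<phi> p)\<^sup>2 \<le> (?L * norm (p' - p))\<^sup>2"
      using avg_diff_sup[OF \<phi> c, of c c p' p] c
      by (simp add: power_mult_distrib real_sqrt_pow2 power_divide mult_ac)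
    then have "\<bar>avg c \<phi> p' - avg c \<phi> p\<bar> \<le> ?L * norm (p' - p)"
      using c by (subst power2_le_iff_abs_le[symmetric]) simp_all
    then show ?thesis by (simp add: dist_norm)
  qed
  then have "?L-lipschitz_on UNIV (avg c \<phi>)"
    using c by (intro lipschitz_onI) auto
  then show ?thesis by (rule lipschitz_on_continuous_on)
qed

text \<open>In the mean over \<open>x\<close> the inner integral is the Dirichlet energy by translation invariance, with
  no loss for small cubes.\<close>

lemma avg_L2_error:
  assumes \<phi>: "\<phi> \<in> test_functions \<Omega>" and c: "0 < c"
  shows "(\<integral>\<^sup>+x. ennreal ((\<phi> x - avg c \<phi> x)\<^sup>2) \<partial>lborel) \<le> ennreal ((c * CARD('n) * l2_norm \<Omega> (grad \<phi>))\<^sup>2)"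
proof -
  let ?G = "(l2_norm \<Omega> (grad \<phi>))\<^sup>2"
  let ?\<Gamma> = "\<lambda>z. ennreal ((norm (grad \<phi> z))\<^sup>2)"
  let ?Q = "cbox 0 One :: (real^'n) set"
  have [measurable]: "grad \<phi> \<in> borel_measurable borel"
    by (rule borel_measurable_continuous_onI[OF continuous_on_grad[OF test_smooth[OF \<phi>]]])
  have "(\<integral>\<^sup>+x. ennreal ((\<phi> x - avg c \<phi> x)\<^sup>2) \<partial>lborel)
      \<le> (\<integral>\<^sup>+x. ennreal ((c * CARD('n))\<^sup>2) *
          (\<integral>\<^sup>+s. (\<integral>\<^sup>+y. ?\<Gamma> (x + (c - s * c) *\<^sub>R y) * indicator ?Q y \<partial>lborel) * indicator {0..1} s \<partial>lborel) \<partial>lborel)"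
  proof (rule nn_integral_mono)
    fix x
    show "ennreal ((\<phi> x - avg c \<phi> x)\<^sup>2) \<le> ennreal ((c * CARD('n))\<^sup>2) *
        (\<integral>\<^sup>+s. (\<integral>\<^sup>+y. ?\<Gamma> (x + (c - s * c) *\<^sub>R y) * indicator ?Q y \<partial>lborel) * indicator {0..1} s \<partial>lborel)"
      using avg_diff_estimate[OF test_smooth[OF \<phi>], of 0 x c x] c by (simp add: avg_0)
  qed
  also have "\<dots> = ennreal ((c * CARD('n))\<^sup>2) *
      (\<integral>\<^sup>+x. (\<integral>\<^sup>+s. (\<integral>\<^sup>+y. ?\<Gamma> (x + (c - s * c) *\<^sub>R y) * indicator ?Q y \<partial>lborel) * indicator {0..1} s \<partial>lborel) \<partial>lborel)"
    by (rule nn_integral_cmult) measurable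
  also have "(\<integral>\<^sup>+x. (\<integral>\<^sup>+s. (\<integral>\<^sup>+y. ?\<Gamma> (x + (c - s * c) *\<^sub>R y) * indicator ?Q y \<partial>lborel) * indicator {0..1} s \<partial>lborel) \<partial>lborel)
      = (\<integral>\<^sup>+s. (\<integral>\<^sup>+x. (\<integral>\<^sup>+y. ?\<Gamma> (x + (c - s * c) *\<^sub>R y) * indicator ?Q y \<partial>lborel) * indicator {0..1} s \<partial>lborel) \<partial>lborel)"
    by (rule lborel_pair.Fubini') measurable
  also have "\<dots> = (\<integral>\<^sup>+s. (\<integral>\<^sup>+x. (\<integral>\<^sup>+y. ?\<Gamma> (x + (c - s * c) *\<^sub>R y) * indicator ?Q y \<partial>lborel) \<partial>lborel) * indicator {0..1} s \<partial>lborel)"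
    by (intro nn_integral_cong nn_integral_multc) measurable
  also have "\<dots> = (\<integral>\<^sup>+s. ennreal ?G * indicator {0..1::real} s \<partial>lborel)"
  proof (intro nn_integral_cong arg_cong2[where f = "(*)"] refl)
    fix s :: real
    have "(\<integral>\<^sup>+x. (\<integral>\<^sup>+y. ?\<Gamma> (x + (c - s * c) *\<^sub>R y) * indicator ?Q y \<partial>lborel) \<partial>lborel)
        = (\<integral>\<^sup>+y. (\<integral>\<^sup>+x. ?\<Gamma> (x + (c - s * c) *\<^sub>R y) * indicator ?Q y \<partial>lborel) \<partial>lborel)"
      by (rule lborel_pair.Fubini') measurable
    also have "\<dots> = (\<integral>\<^sup>+y. (\<integral>\<^sup>+x. ?\<Gamma> (x + (c - s * c) *\<^sub>R y) \<partial>lborel) * indicator ?Q y \<partial>lborel)"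
      by (intro nn_integral_cong nn_integral_multc) measurable
    also have "\<dots> = (\<integral>\<^sup>+y. ennreal ?G * indicator ?Q y \<partial>lborel)"
      by (simp add: nn_integral_translate[of ?\<Gamma>] nn_integral_grad[OF \<phi>])
    also have "\<dots> = ennreal ?G"
      by (subst nn_integral_cmult_indicator) (auto simp: emeasure_lborel_cbox_eq inner_diff_left)
    finally show "(\<integral>\<^sup>+x. (\<integral>\<^sup>+y. ?\<Gamma> (x + (c - s * c) *\<^sub>R y) * indicator ?Q y \<partial>lborel) \<partial>lborel) = ennreal ?G" .
  qed
  also have "\<dots> = ennreal ?G" by (subst nn_integral_cmult_indicator) auto
  also have "ennreal ((c * CARD('n))\<^sup>2) * ennreal ?G = ennreal ((c * CARD('n) * l2_norm \<Omega> (grad \<phi>))\<^sup>2)"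
    by (simp add: ennreal_mult[symmetric] power_mult_distrib)
  finally show ?thesis .
qed

lemma nn_integral_domain_le:
  assumes "f \<in> borel_measurable borel"
  shows "(\<integral>\<^sup>+x. f x \<partial>lebesgue_on \<Omega>) \<le> (\<integral>\<^sup>+x. f x \<partial>(lborel :: (real^'n) measure))"
proof -
  have "(\<integral>\<^sup>+x. f x \<partial>lebesgue_on \<Omega>) = (\<integral>\<^sup>+x. f x * indicator \<Omega> x \<partial>lebesgue)"
    by (rule nn_integral_restrict_space) simp
  also have "\<dots> \<le> (\<integral>\<^sup>+x. f x \<partial>lebesgue)"
    by (intro nn_integral_mono) (auto simp: indicator_def)
  finally show ?thesis by (simp add: nn_integral_completion)
qed

lemma l2_norm_le_of_nn_integral:
  assumes "f \<in> L2 \<Omega>" "(\<integral>\<^sup>+x. ennreal ((norm (f x))\<^sup>2) \<partial>lebesgue_on \<Omega>) \<le> ennreal (b\<^sup>2)" "0 \<le> b"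
  shows "l2_norm \<Omega> f \<le> b"
proof -
  have "ennreal ((l2_norm \<Omega> f)\<^sup>2) \<le> ennreal (b\<^sup>2)"
    using assms(2) nn_integral_eq_integral[OF L2_norm2_integrable[OF assms(1)]] by (simp add: l2_norm_def)
  then show ?thesis using assms(3) by (simp add: power2_le_iff_abs_le)
qed

text \<open>A translation by more than the diameter moves the domain off itself, so a test function is a
  difference of its values along segments of that length.\<close>

lemma Poincare_test:
  obtains r where "r > 0"
    "\<And>\<phi>. \<phi> \<in> test_functions \<Omega> \<Longrightarrow>
      (\<integral>\<^sup>+x. ennreal ((\<phi> x)\<^sup>2) \<partial>lborel) \<le> ennreal ((r * l2_norm \<Omega> (grad \<phi>))\<^sup>2)"
proof -
  obtain R where R: "R > 0" "\<And>x. x \<in> \<Omega> \<Longrightarrow> norm x \<le> R"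
    using bounded_domain bounded_pos by blast
  define r where "r = 2 * R + 1"
  have r: "r > 0" using R by (simp add: r_def)
  define e :: "real^'n" where "e = r *\<^sub>R axis undefined 1"
  have norm_e: "norm e = r" using r by (simp add: e_def norm_axis_1)
  have "(\<integral>\<^sup>+x. ennreal ((\<phi> x)\<^sup>2) \<partial>lborel) \<le> ennreal ((r * l2_norm \<Omega> (grad \<phi>))\<^sup>2)"
    if \<phi>: "\<phi> \<in> test_functions \<Omega>" for \<phi>
  proof -
    let ?\<Gamma> = "\<lambda>z. ennreal ((norm (grad \<phi> z))\<^sup>2)"
    let ?G = "(l2_norm \<Omega> (grad \<phi>))\<^sup>2"
    have [measurable]: "grad \<phi> \<in> borel_measurable borel"
      by (rule borel_measurable_continuous_onI[OF continuous_on_grad[OF test_smooth[OF \<phi>]]])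
    obtain K where K: "K \<subseteq> \<Omega>" "\<And>x. x \<notin> K \<Longrightarrow> \<phi> x = 0"
      using test_support[OF \<phi>] by blast
    have pt: "ennreal ((\<phi> x)\<^sup>2) \<le> ennreal (r\<^sup>2) * (\<integral>\<^sup>+s. ?\<Gamma> (x + s *\<^sub>R e) * indicator {0..1} s \<partial>lborel)" for x
    proof (cases "x \<in> \<Omega>")
      case True
      have "norm (x + e) > R"
        using norm_diff_ineq[of e x] norm_e R(2)[OF True] R(1) by (simp add: add.commute r_def)
      then have "x + e \<notin> \<Omega>" using R(2) by fastforce
      then have "\<phi> (x + e) = 0" using K by blast
      then show ?thesis
        using segment_estimate[OF test_smooth[OF \<phi>], of "x + e" x] by (simp add: norm_e)
    next
      case False
      then have "\<phi> x = 0" using K by blast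
      then show ?thesis by simp
    qed
    have "(\<integral>\<^sup>+x. ennreal ((\<phi> x)\<^sup>2) \<partial>lborel)
        \<le> (\<integral>\<^sup>+x. ennreal (r\<^sup>2) * (\<integral>\<^sup>+s. ?\<Gamma> (x + s *\<^sub>R e) * indicator {0..1} s \<partial>lborel) \<partial>lborel)"
      by (intro nn_integral_mono pt)
    also have "\<dots> = ennreal (r\<^sup>2) * (\<integral>\<^sup>+x. (\<integral>\<^sup>+s. ?\<Gamma> (x + s *\<^sub>R e) * indicator {0..1} s \<partial>lborel) \<partial>lborel)"
      by (rule nn_integral_cmult) measurable
    also have "(\<integral>\<^sup>+x. (\<integral>\<^sup>+s. ?\<Gamma> (x + s *\<^sub>R e) * indicator {0..1} s \<partial>lborel) \<partial>lborel)
        = (\<integral>\<^sup>+s. (\<integral>\<^sup>+x. ?\<Gamma> (x + s *\<^sub>R e) * indicator {0..1} s \<partial>lborel) \<partial>lborel)"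
      by (rule lborel_pair.Fubini') measurable
    also have "\<dots> = (\<integral>\<^sup>+s. (\<integral>\<^sup>+x. ?\<Gamma> (x + s *\<^sub>R e) \<partial>lborel) * indicator {0..1} s \<partial>lborel)"
      by (intro nn_integral_cong nn_integral_multc) measurable
    also have "\<dots> = (\<integral>\<^sup>+s. ennreal ?G * indicator {0..1::real} s \<partial>lborel)"
      by (simp add: nn_integral_translate[of ?\<Gamma>] nn_integral_grad[OF \<phi>])
    also have "\<dots> = ennreal ?G" by (subst nn_integral_cmult_indicator) auto
    also have "ennreal (r\<^sup>2) * ennreal ?G = ennreal ((r * l2_norm \<Omega> (grad \<phi>))\<^sup>2)"
      by (simp add: ennreal_mult[symmetric] power_mult_distrib)
    finally show ?thesis .
  qed
  with r that show ?thesis by blast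
qed

lemma avg_sup:
  assumes \<phi>: "\<phi> \<in> test_functions \<Omega>" and c: "0 < c"
    and P: "(\<integral>\<^sup>+x. ennreal ((\<phi> x)\<^sup>2) \<partial>lborel) \<le> ennreal (b\<^sup>2)"
  shows "(avg c \<phi> p)\<^sup>2 \<le> 1 / c ^ CARD('n) * b\<^sup>2"
proof -
  have [measurable]: "\<phi> \<in> borel_measurable borel"
    by (rule borel_measurable_continuous_onI[OF smooth_continuous_on[OF test_smooth[OF \<phi>]]])
  have cont: "continuous_on S (\<lambda>y. \<phi> (p + c *\<^sub>R y))" for S
    by (rule continuous_on_affine[OF test_smooth[OF \<phi>]])
  have "(avg c \<phi> p)\<^sup>2 \<le> integral (cbox 0 One) (\<lambda>y. (\<phi> (p + c *\<^sub>R y))\<^sup>2)"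
    unfolding avg_def by (rule integral_square_le[OF content_unit_cube cont])
  then have "ennreal ((avg c \<phi> p)\<^sup>2) \<le> ennreal (integral (cbox 0 One) (\<lambda>y. (\<phi> (p + c *\<^sub>R y))\<^sup>2))"
    by (rule ennreal_leI)
  also have "\<dots> = (\<integral>\<^sup>+y. ennreal ((\<phi> (p + c *\<^sub>R y))\<^sup>2) * indicator (cbox 0 One) y \<partial>lborel)"
    by (rule ennreal_integral_continuous) (auto intro!: continuous_intros cont)
  also have "\<dots> \<le> (\<integral>\<^sup>+y. ennreal ((\<phi> (p + c *\<^sub>R y))\<^sup>2) \<partial>lborel)"
    by (intro nn_integral_mono) (auto simp: indicator_def)
  also have "\<dots> = ennreal (1 / c ^ CARD('n)) * (\<integral>\<^sup>+y. ennreal ((\<phi> y)\<^sup>2) \<partial>lborel)"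
    by (rule nn_integral_affine[where f = "\<lambda>z. ennreal ((\<phi> z)\<^sup>2)"]) (use c in measurable)
  also have "\<dots> \<le> ennreal (1 / c ^ CARD('n)) * ennreal (b\<^sup>2)"
    by (intro mult_left_mono P) auto
  also have "\<dots> = ennreal (1 / c ^ CARD('n) * b\<^sup>2)"
    using c by (intro ennreal_mult[symmetric]) auto
  finally show ?thesis using c by simp
qed

end

section \<open>Sobolev and Rellich theorems\<close>

context domain
begin

text \<open>The averages over cubes of side \<open>2\<^sup>-\<^sup>k\<close> grow at most like \<open>2 powr (\<gamma> k)\<close>, by telescoping. Where
  \<open>\<bar>\<phi>\<bar>\<close> exceeds twice that bound it is comparable to the averaging error, which is of size
  \<open>2\<^sup>-\<^sup>k\<close> in \<open>L\<^sup>2\<close>. Below the critical exponent the gain outweighs the loss, and the contributions of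
  the levels form a convergent geometric series.\<close>

lemma Sobolev_test:
  assumes \<gamma>: "0 < \<gamma>" "CARD('n) / 2 - 1 \<le> \<gamma>" "\<gamma> * (q - 2) < 2" and q: "2 < q"
  obtains K where "K \<ge> 0"
    "\<And>\<phi>. \<phi> \<in> test_functions \<Omega> \<Longrightarrow>
      (\<integral>\<^sup>+x. ennreal (\<bar>\<phi> x\<bar> powr q) \<partial>lebesgue_on \<Omega>) \<le> ennreal (K * l2_norm \<Omega> (grad \<phi>) powr q)"
proof -
  obtain r where r: "r > 0" and P: "\<And>\<phi>. \<phi> \<in> test_functions \<Omega> \<Longrightarrow>
      (\<integral>\<^sup>+x. ennreal ((\<phi> x)\<^sup>2) \<partial>lborel) \<le> ennreal ((r * l2_norm \<Omega> (grad \<phi>))\<^sup>2)"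
    using Poincare_test by blast
  define n where "n = real CARD('n)"
  define h :: "nat \<Rightarrow> real" where "h = (\<lambda>k. 2 powr (- real k))"
  have n: "n \<ge> 1" by (simp add: n_def Suc_leI)
  have h: "h k > 0" "h k = 2 * h (Suc k)" for k
  proof -
    show "h k > 0" by (simp add: h_def)
    have "h k = 2 powr (1 + - real (Suc k))" by (simp add: h_def)
    also have "\<dots> = 2 * h (Suc k)" unfolding h_def by (subst powr_add) simp
    finally show "h k = 2 * h (Suc k)" .
  qed
  \<comment> \<open>The factor \<open>1 - 2 powr (- \<gamma>)\<close> is what one level leaves free in the telescoping induction below.\<close>
  define c where "c = max r (n / (1 - 2 powr (- \<gamma>)))"
  have two\<gamma>: "2 powr (- \<gamma>) < 1" using \<gamma> by (simp add: powr_less_one)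
  have c: "c > 0" "r \<le> c" "n \<le> c * (1 - 2 powr (- \<gamma>))"
  proof -
    show "r \<le> c" by (simp add: c_def)
    with r show "c > 0" by simp
    have "n / (1 - 2 powr (- \<gamma>)) \<le> c" by (simp add: c_def)
    then show "n \<le> c * (1 - 2 powr (- \<gamma>))" using two\<gamma> by (simp add: field_simps)
  qed
  \<comment> \<open>The ratio of the geometric series: level \<open>k\<close> loses \<open>2 powr (\<gamma> k (q - 2))\<close> and gains \<open>2 powr (- 2 k)\<close>.\<close>
  define \<rho> where "\<rho> = 2 powr (\<gamma> * (q - 2) - 2)"
  have \<rho>: "0 \<le> \<rho>" "\<rho> < 1" using \<gamma> by (auto simp: \<rho>_def powr_less_one)
  define K where "K = (2 * c) powr (q - 2) * (r\<^sup>2 + 2 powr (\<gamma> * (q - 2)) * 4 * n\<^sup>2 / (1 - \<rho>))"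
  have "K \<ge> 0" using \<rho> by (auto simp: K_def)
  moreover have "(\<integral>\<^sup>+x. ennreal (\<bar>\<phi> x\<bar> powr q) \<partial>lebesgue_on \<Omega>) \<le> ennreal (K * l2_norm \<Omega> (grad \<phi>) powr q)"
    if \<phi>: "\<phi> \<in> test_functions \<Omega>" for \<phi>
  proof -
    define G where "G = l2_norm \<Omega> (grad \<phi>)"
    have meas[measurable]: "\<phi> \<in> borel_measurable borel"
      by (rule borel_measurable_continuous_onI[OF smooth_continuous_on[OF test_smooth[OF \<phi>]]])
    have avg_meas[measurable]: "avg (h k) \<phi> \<in> borel_measurable borel" for k
      by (rule borel_measurable_continuous_onI[OF continuous_avg[OF \<phi> h(1)]])
    have le: "(\<integral>\<^sup>+x. ennreal (\<bar>\<phi> x\<bar> powr q) \<partial>lebesgue_on \<Omega>) \<le> (\<integral>\<^sup>+x. ennreal (\<bar>\<phi> x\<bar> powr q) \<partial>lborel)"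
      by (rule nn_integral_domain_le) measurable
    show ?thesis
    proof (cases "G = 0")
      case True
      then have "(\<integral>\<^sup>+x. ennreal ((\<phi> x)\<^sup>2) \<partial>lborel) = 0" using P[OF \<phi>] by (simp add: G_def)
      then have "AE x in lborel. ennreal ((\<phi> x)\<^sup>2) = 0" by (subst (asm) nn_integral_0_iff_AE) auto
      then have "AE x in lborel. ennreal (\<bar>\<phi> x\<bar> powr q) = 0" by eventually_elim (auto simp: ennreal_eq_0_iff)
      then have "(\<integral>\<^sup>+x. ennreal (\<bar>\<phi> x\<bar> powr q) \<partial>lborel) = 0" by (subst nn_integral_0_iff_AE) auto
      with le show ?thesis by simp
    next
      case False
      then have G: "G > 0" using l2_norm_nonneg[of \<Omega> "grad \<phi>"] unfolding G_def by linarith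
      have avg_bound: "\<bar>avg (h k) \<phi> x\<bar> \<le> c * 2 powr (\<gamma> * k) * G" for k x
      proof (induction k)
        case 0
        have "(avg (h 0) \<phi> x)\<^sup>2 \<le> (r * G)\<^sup>2"
          using avg_sup[OF \<phi> _ P[OF \<phi>], of 1 x] by (simp add: h_def G_def)
        then have "\<bar>avg (h 0) \<phi> x\<bar> \<le> r * G" using r G by (subst (asm) power2_le_iff_abs_le) auto
        also have "\<dots> \<le> c * G" using c G by (intro mult_right_mono) auto
        finally show ?case by simp
      next
        case (Suc k)
        let ?t = "2 powr (\<gamma> * Suc k)"
        have "(h (Suc k))\<^sup>2 * (1 / h (Suc k) ^ CARD('n)) \<le> ?t\<^sup>2"
        proof -
          have "(h (Suc k))\<^sup>2 * (1 / h (Suc k) ^ CARD('n)) = 2 powr ((n - 2) * Suc k)"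
            unfolding h_def by (simp add: powr_power divide_inverse powr_minus[symmetric] powr_add[symmetric] n_def algebra_simps)
          also have "\<dots> \<le> 2 powr (2 * (\<gamma> * Suc k))"
            using \<gamma>(2) by (intro powr_mono) (auto simp: n_def mult.assoc[symmetric] simp del: of_nat_Suc intro!: mult_right_mono)
          also have "\<dots> = ?t\<^sup>2" by (simp add: powr_power)
          finally show ?thesis .
        qed
        then have "n\<^sup>2 * ((h (Suc k))\<^sup>2 * (1 / h (Suc k) ^ CARD('n))) * G\<^sup>2 \<le> n\<^sup>2 * ?t\<^sup>2 * G\<^sup>2"
          by (intro mult_right_mono mult_left_mono) auto
        moreover have "(avg (h (Suc k)) \<phi> x - avg (h k) \<phi> x)\<^sup>2
            \<le> (h (Suc k) * n)\<^sup>2 * (1 / h (Suc k) ^ CARD('n)) * G\<^sup>2"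
          using avg_diff_sup[OF \<phi> h(1)[of "Suc k"], of "h k" "h (Suc k)" x x] h[of k] h(1)[of "Suc k"]
          by (simp add: G_def n_def)
        ultimately have "(avg (h (Suc k)) \<phi> x - avg (h k) \<phi> x)\<^sup>2 \<le> (n * ?t * G)\<^sup>2"
          by (simp add: power_mult_distrib mult_ac)
        then have "\<bar>avg (h (Suc k)) \<phi> x - avg (h k) \<phi> x\<bar> \<le> n * ?t * G"
          using n G by (subst (asm) power2_le_iff_abs_le) auto
        also have "\<dots> \<le> c * (1 - 2 powr (- \<gamma>)) * ?t * G"
          using c(3) G by (intro mult_right_mono) auto
        finally have "\<bar>avg (h (Suc k)) \<phi> x\<bar> \<le> c * 2 powr (\<gamma> * k) * G + c * (1 - 2 powr (- \<gamma>)) * ?t * G"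
          using Suc.IH by linarith
        also have "2 powr (\<gamma> * k) = 2 powr (- \<gamma>) * ?t"
          by (simp add: powr_add[symmetric] algebra_simps)
        finally show ?case by (simp add: algebra_simps)
      qed
      define b where "b = (\<lambda>k. 2 * c * G * 2 powr (\<gamma> * real k))"
      have b: "b k > 0" for k using c G by (simp add: b_def)
      have powr_split: "t powr q = t powr (q - 2) * t\<^sup>2" if "t \<ge> 0" for t :: real
      proof (cases "t = 0")
        case False
        then have "t powr (q - 2) * t powr 2 = t powr q" by (subst powr_add[symmetric]) simp
        then show ?thesis using that by simp
      qed (use q in simp)
      have pointwise: "ennreal (\<bar>\<phi> x\<bar> powr q) \<le> ennreal (b 0 powr (q - 2)) * ennreal ((\<phi> x)\<^sup>2)
          + (\<Sum>k. ennreal (b (Suc k) powr (q - 2) * 4) * ennreal ((\<phi> x - avg (h k) \<phi> x)\<^sup>2))" for x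
      proof (cases "\<bar>\<phi> x\<bar> \<le> b 0")
        case True
        have "\<bar>\<phi> x\<bar> powr q \<le> b 0 powr (q - 2) * (\<phi> x)\<^sup>2"
          using True q by (subst powr_split) (auto intro!: mult_right_mono powr_mono2)
        then have "ennreal (\<bar>\<phi> x\<bar> powr q) \<le> ennreal (b 0 powr (q - 2)) * ennreal ((\<phi> x)\<^sup>2)"
          by (simp add: ennreal_mult[symmetric] ennreal_leI)
        then show ?thesis by (rule order_trans) simp
      next
        case False
        have "\<exists>k. \<bar>\<phi> x\<bar> \<le> b k"
        proof -
          obtain k :: nat where "\<bar>\<phi> x\<bar> / (2 * c * G) < (2 powr \<gamma>) ^ k"
            using real_arch_pow[of "2 powr \<gamma>" "\<bar>\<phi> x\<bar> / (2 * c * G)"] \<gamma> by auto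
          then have "\<bar>\<phi> x\<bar> \<le> b k"
            using c G by (simp add: b_def powr_power field_simps)
          then show ?thesis ..
        qed
        \<comment> \<open>The first level that dominates \<open>\<bar>\<phi> x\<bar>\<close>: the mean of the level before it is at most half of \<open>\<bar>\<phi> x\<bar>\<close>.\<close>
        define k where "k = (LEAST k. \<bar>\<phi> x\<bar> \<le> b k)"
        have k: "\<bar>\<phi> x\<bar> \<le> b k" unfolding k_def by (rule LeastI_ex) fact
        with False have "k \<noteq> 0" by (cases k) auto
        then obtain j where j: "k = Suc j" by (cases k) auto
        have "\<not> \<bar>\<phi> x\<bar> \<le> b j" using not_less_Least[of j "\<lambda>k. \<bar>\<phi> x\<bar> \<le> b k"] j by (simp add: k_def)
        then have "\<bar>avg (h j) \<phi> x\<bar> \<le> \<bar>\<phi> x\<bar> / 2" using avg_bound[of j x] by (simp add: b_def mult_ac)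
        then have "\<bar>\<phi> x\<bar> \<le> 2 * \<bar>\<phi> x - avg (h j) \<phi> x\<bar>"
        proof -
          have aux: "s \<le> 2 * d" if "a \<le> s / 2" "s - a \<le> d" for s a d :: real
            using that by linarith
          show ?thesis if "\<bar>avg (h j) \<phi> x\<bar> \<le> \<bar>\<phi> x\<bar> / 2"
            by (rule aux[OF that abs_triangle_ineq2])
        qed
        then have "\<bar>\<phi> x\<bar>\<^sup>2 \<le> (2 * \<bar>\<phi> x - avg (h j) \<phi> x\<bar>)\<^sup>2" by (intro power_mono) auto
        then have sq: "\<bar>\<phi> x\<bar>\<^sup>2 \<le> 4 * (\<phi> x - avg (h j) \<phi> x)\<^sup>2" by (simp add: power_mult_distrib)
        have "\<bar>\<phi> x\<bar> powr q = \<bar>\<phi> x\<bar> powr (q - 2) * \<bar>\<phi> x\<bar>\<^sup>2" by (rule powr_split) simp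
        also have "\<dots> \<le> b (Suc j) powr (q - 2) * (4 * (\<phi> x - avg (h j) \<phi> x)\<^sup>2)"
          using k j q sq by (intro mult_mono powr_mono2) auto
        finally have "ennreal (\<bar>\<phi> x\<bar> powr q) \<le> ennreal (b (Suc j) powr (q - 2) * 4) * ennreal ((\<phi> x - avg (h j) \<phi> x)\<^sup>2)"
          by (simp add: ennreal_mult[symmetric] ennreal_leI mult.assoc)
        also have "\<dots> \<le> (\<Sum>k. ennreal (b (Suc k) powr (q - 2) * 4) * ennreal ((\<phi> x - avg (h k) \<phi> x)\<^sup>2))"
          using sum_le_suminf[of "\<lambda>k. ennreal (b (Suc k) powr (q - 2) * 4) * ennreal ((\<phi> x - avg (h k) \<phi> x)\<^sup>2)" "{j}"]
          by simp
        finally show ?thesis by (rule order_trans) simp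
      qed
      define D where "D = (2 * c) powr (q - 2) * 2 powr (\<gamma> * (q - 2)) * 4 * n\<^sup>2 * G powr q"
      have "D \<ge> 0" by (simp add: D_def)
      have Gq: "G powr (q - 2) * G\<^sup>2 = G powr q" using powr_split[of G] G by simp
      have term_eq: "b (Suc k) powr (q - 2) * 4 * (h k * n * G)\<^sup>2 = D * \<rho> ^ k" for k
      proof -
        have 1: "b (Suc k) powr (q - 2) = (2 * c) powr (q - 2) * G powr (q - 2) * 2 powr (\<gamma> * Suc k * (q - 2))"
          using c G by (simp add: b_def powr_mult powr_powr)
        have 2: "2 powr (\<gamma> * Suc k * (q - 2)) * (h k)\<^sup>2 = 2 powr (\<gamma> * (q - 2)) * \<rho> ^ k"
          unfolding h_def \<rho>_def by (simp add: powr_power powr_add[symmetric] algebra_simps)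
        have "b (Suc k) powr (q - 2) * 4 * (h k * n * G)\<^sup>2
            = (2 * c) powr (q - 2) * (2 powr (\<gamma> * Suc k * (q - 2)) * (h k)\<^sup>2) * 4 * n\<^sup>2 * (G powr (q - 2) * G\<^sup>2)"
          unfolding 1 by (simp add: power_mult_distrib mult_ac)
        then show ?thesis unfolding 2 Gq D_def by (simp add: mult_ac)
      qed
      have "(\<integral>\<^sup>+x. ennreal (\<bar>\<phi> x\<bar> powr q) \<partial>lborel)
          \<le> (\<integral>\<^sup>+x. ennreal (b 0 powr (q - 2)) * ennreal ((\<phi> x)\<^sup>2)
          + (\<Sum>k. ennreal (b (Suc k) powr (q - 2) * 4) * ennreal ((\<phi> x - avg (h k) \<phi> x)\<^sup>2)) \<partial>lborel)"
        by (intro nn_integral_mono pointwise)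
      also have "\<dots> = ennreal (b 0 powr (q - 2)) * (\<integral>\<^sup>+x. ennreal ((\<phi> x)\<^sup>2) \<partial>lborel)
          + (\<Sum>k. ennreal (b (Suc k) powr (q - 2) * 4) * (\<integral>\<^sup>+x. ennreal ((\<phi> x - avg (h k) \<phi> x)\<^sup>2) \<partial>lborel))"
        by (subst nn_integral_add, measurable, subst nn_integral_suminf, measurable,
            subst (1 2) nn_integral_cmult, measurable)
      also have "\<dots> \<le> ennreal (b 0 powr (q - 2)) * ennreal ((r * G)\<^sup>2)
          + (\<Sum>k. ennreal (b (Suc k) powr (q - 2) * 4) * ennreal ((h k * n * G)\<^sup>2))"
        using P[OF \<phi>] avg_L2_error[OF \<phi> h(1)]
        by (intro add_mono mult_left_mono suminf_le) (auto simp: G_def n_def)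
      also have "(\<Sum>k. ennreal (b (Suc k) powr (q - 2) * 4) * ennreal ((h k * n * G)\<^sup>2))
          = (\<Sum>k. ennreal (D * \<rho> ^ k))"
        by (simp add: ennreal_mult[symmetric] term_eq)
      also have "\<dots> = ennreal (\<Sum>k. D * \<rho> ^ k)"
        using \<rho> \<open>D \<ge> 0\<close> by (intro suminf_ennreal2) (auto intro!: summable_mult summable_geometric)
      also have "(\<Sum>k. D * \<rho> ^ k) = D / (1 - \<rho>)"
        using \<rho> by (simp add: suminf_mult suminf_geometric summable_geometric)
      also have "ennreal (b 0 powr (q - 2)) * ennreal ((r * G)\<^sup>2) + ennreal (D / (1 - \<rho>))
          = ennreal (b 0 powr (q - 2) * (r * G)\<^sup>2 + D / (1 - \<rho>))"
        using \<rho> \<open>D \<ge> 0\<close> by (subst ennreal_plus) (auto intro: ennreal_mult[symmetric])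
      also have "b 0 powr (q - 2) * (r * G)\<^sup>2 + D / (1 - \<rho>) = K * G powr q"
        using c G Gq[symmetric] by (simp add: b_def K_def D_def powr_mult power_mult_distrib algebra_simps)
      finally show ?thesis using le by (simp add: G_def)
    qed
  qed
  ultimately show ?thesis by (rule that)
qed

text \<open>The means over cubes of a fixed side are bounded and equicontinuous, so the theorem of Arzela and Ascoli
  applies to them; a diagonal subsequence serves all sides \<open>h m = 1 / (m + 1)\<close>, and the \<open>L\<^sup>2\<close> distance of a
  function from its means is \<open>O (h m)\<close> uniformly along the sequence.\<close>

lemma Rellich_test:
  fixes \<phi> :: "nat \<Rightarrow> real^'n \<Rightarrow> real"
  assumes \<phi>: "\<And>k. \<phi> k \<in> test_functions \<Omega>" and M: "\<And>k. l2_norm \<Omega> (grad (\<phi> k)) \<le> M"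
  shows "\<exists>s :: nat \<Rightarrow> nat. strict_mono s \<and>
    (\<forall>e>0. \<exists>N. \<forall>i\<ge>N. \<forall>j\<ge>N. l2_norm \<Omega> (\<lambda>x. \<phi> (s i) x - \<phi> (s j) x) < e)"
proof -
  obtain r where r: "r > 0" and P: "\<And>\<phi>. \<phi> \<in> test_functions \<Omega> \<Longrightarrow>
      (\<integral>\<^sup>+x. ennreal ((\<phi> x)\<^sup>2) \<partial>lborel) \<le> ennreal ((r * l2_norm \<Omega> (grad \<phi>))\<^sup>2)"
    using Poincare_test by blast
  have M0: "M \<ge> 0" using M[of 0] l2_norm_nonneg order_trans by blast
  define h :: "nat \<Rightarrow> real" where "h = (\<lambda>m. 1 / real (Suc m))"
  have h: "h m > 0" for m by (simp add: h_def)
  \<comment> \<open>\<open>C m s\<close>: along \<open>s\<close> the means of side \<open>h m\<close> are eventually within \<open>h m\<close> of each other. This weak form of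
  the Cauchy property is inherited by subsequences and suffices, as \<open>m\<close> is arbitrary.\<close>
  define C where "C = (\<lambda>m (s :: nat \<Rightarrow> nat). \<exists>N. \<forall>i\<ge>N. \<forall>j\<ge>N. \<forall>x\<in>\<Omega>. \<bar>avg (h m) (\<phi> (s i)) x - avg (h m) (\<phi> (s j)) x\<bar> \<le> h m)"
  have sub: "\<exists>r'. strict_mono r' \<and> C m (s \<circ> r')" if "strict_mono s" for m and s :: "nat \<Rightarrow> nat"
  proof -
    let ?F = "\<lambda>k. avg (h m) (\<phi> (s k))"
    let ?w = "sqrt (1 / h m ^ CARD('n))"
    have w: "?w > 0" using h[of m] by simp
    have bound: "norm (?F k x) \<le> ?w * (r * M)" for k x
    proof -
      have "(?F k x)\<^sup>2 \<le> 1 / h m ^ CARD('n) * (r * l2_norm \<Omega> (grad (\<phi> (s k))))\<^sup>2"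
        by (rule avg_sup[OF \<phi> h P[OF \<phi>]])
      also have "\<dots> \<le> 1 / h m ^ CARD('n) * (r * M)\<^sup>2"
        using h[of m] r M by (intro mult_left_mono power_mono) auto
      also have "\<dots> = (?w * (r * M))\<^sup>2" using h[of m] by (simp add: power_mult_distrib real_sqrt_pow2 power_divide)
      finally show ?thesis using w r M0 by (subst (asm) power2_le_iff_abs_le) auto
    qed
    have lip: "norm (?F k x - ?F k y) \<le> ?w * M * norm (x - y)" for k x y
    proof -
      have "(?F k x - ?F k y)\<^sup>2 \<le> (norm (x - y))\<^sup>2 * (1 / h m ^ CARD('n)) * (l2_norm \<Omega> (grad (\<phi> (s k))))\<^sup>2"
        using avg_diff_sup[OF \<phi>[of "s k"] h[of m] order_refl order_refl, of x y] by simp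
      also have "\<dots> \<le> (norm (x - y))\<^sup>2 * (1 / h m ^ CARD('n)) * M\<^sup>2"
        using h[of m] M by (intro mult_left_mono power_mono) auto
      also have "\<dots> = (?w * M * norm (x - y))\<^sup>2"
        using h[of m] by (simp add: power_mult_distrib real_sqrt_pow2 power_divide)
      finally show ?thesis using w M0 by (subst (asm) power2_le_iff_abs_le) auto
    qed
    have equi: "\<exists>d. 0 < d \<and> (\<forall>k y. y \<in> closure \<Omega> \<and> norm (x - y) < d \<longrightarrow> norm (?F k x - ?F k y) < e)"
      if "e > 0" for x e
    proof (intro exI conjI allI impI)
      let ?d = "e / (?w * M + 1)"
      have pos: "?w * M + 1 > 0" using w M0 by (simp add: add_nonneg_pos)
      then show "0 < ?d" using that by simp
      fix k y assume "y \<in> closure \<Omega> \<and> norm (x - y) < ?d"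
      then have "(?w * M + 1) * norm (x - y) < e" using pos by (simp add: field_simps)
      moreover have "?w * M * norm (x - y) \<le> (?w * M + 1) * norm (x - y)"
        by (intro mult_right_mono) auto
      ultimately show "norm (?F k x - ?F k y) < e" using lip[of k x y] by linarith
    qed
    obtain F r' where r': "strict_mono (r' :: nat \<Rightarrow> nat)"
      "\<And>e. 0 < e \<Longrightarrow> \<exists>N. \<forall>k x. k \<ge> N \<and> x \<in> closure \<Omega> \<longrightarrow> norm (?F (r' k) x - F x) < e"
    proof (rule Arzela_Ascoli[of "closure \<Omega>" ?F "?w * (r * M)"])
      show "compact (closure \<Omega>)" using bounded_domain by simp
    qed (use bound equi in auto)
    obtain N where N: "\<And>k x. k \<ge> N \<Longrightarrow> x \<in> closure \<Omega> \<Longrightarrow> norm (?F (r' k) x - F x) < h m / 2"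
      using r'(2)[of "h m / 2"] h[of m] by auto
    have "C m (s \<circ> r')"
      unfolding C_def
    proof (intro exI allI impI ballI)
      fix i j x assume "N \<le> i" "N \<le> j" "x \<in> \<Omega>"
      then have "norm (?F (r' i) x - F x) < h m / 2" "norm (?F (r' j) x - F x) < h m / 2"
        using N closure_subset by blast+
      then show "\<bar>avg (h m) (\<phi> ((s \<circ> r') i)) x - avg (h m) (\<phi> ((s \<circ> r') j)) x\<bar> \<le> h m"
        unfolding real_norm_def comp_def by linarith
    qed
    with r'(1) show ?thesis by blast
  qed
  interpret subseqs C by unfold_locales (rule sub)
  have C_diag: "C m diagseq" for m
  proof -
    have stable: "C l (s \<circ> r')" if r': "strict_mono (r' :: nat \<Rightarrow> nat)" and s: "C l s" for r' s l
    proof -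
      obtain N where N: "\<And>i j x. N \<le> i \<Longrightarrow> N \<le> j \<Longrightarrow> x \<in> \<Omega> \<Longrightarrow>
          \<bar>avg (h l) (\<phi> (s i)) x - avg (h l) (\<phi> (s j)) x\<bar> \<le> h l"
        using s by (auto simp: C_def)
      show ?thesis
        unfolding C_def comp_def
        using N seq_suble[OF r'] by (meson le_trans)
    qed
    have "C m (diagseq \<circ> ((+) (Suc m)))"
      by (rule diagseq_holds) (rule stable)
    then obtain N where "\<And>i j x. N \<le> i \<Longrightarrow> N \<le> j \<Longrightarrow> x \<in> \<Omega> \<Longrightarrow>
        \<bar>avg (h m) (\<phi> (diagseq (Suc m + i))) x - avg (h m) (\<phi> (diagseq (Suc m + j))) x\<bar> \<le> h m"
      by (auto simp: C_def)
    note N = this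
    have C_I: "C m s" if "\<And>i j x. N \<le> i \<Longrightarrow> N \<le> j \<Longrightarrow> x \<in> \<Omega> \<Longrightarrow>
        \<bar>avg (h m) (\<phi> (s i)) x - avg (h m) (\<phi> (s j)) x\<bar> \<le> h m" for s N
      using that unfolding C_def by blast
    show ?thesis
    proof (rule C_I[of "Suc m + N"])
      fix i j x assume "Suc m + N \<le> i" "Suc m + N \<le> j" "x \<in> \<Omega>"
      then show "\<bar>avg (h m) (\<phi> (diagseq i)) x - avg (h m) (\<phi> (diagseq j)) x\<bar> \<le> h m"
        using N[of "i - Suc m" "j - Suc m" x] by simp
    qed
  qed
  have err: "(\<lambda>x. \<phi> k x - avg (h m) (\<phi> k) x) \<in> L2 \<Omega>"
    "l2_norm \<Omega> (\<lambda>x. \<phi> k x - avg (h m) (\<phi> k) x) \<le> h m * CARD('n) * M"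
    "(\<lambda>x. avg (h m) (\<phi> k) x) \<in> L2 \<Omega>" for k m
  proof -
    have [measurable]: "\<phi> k \<in> borel_measurable borel"
      by (rule borel_measurable_continuous_onI[OF smooth_continuous_on[OF test_smooth[OF \<phi>]]])
    have ameas[measurable]: "avg (h m) (\<phi> k) \<in> borel_measurable borel"
      by (rule borel_measurable_continuous_onI[OF continuous_avg[OF \<phi> h]])
    let ?f = "\<lambda>x. \<phi> k x - avg (h m) (\<phi> k) x"
    have "(\<integral>\<^sup>+x. ennreal ((norm (?f x))\<^sup>2) \<partial>lebesgue_on \<Omega>) \<le> (\<integral>\<^sup>+x. ennreal ((norm (?f x))\<^sup>2) \<partial>lborel)"
      by (rule nn_integral_domain_le) measurable
    also have "\<dots> \<le> ennreal ((h m * CARD('n) * l2_norm \<Omega> (grad (\<phi> k)))\<^sup>2)"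
      using avg_L2_error[OF \<phi> h] by simp
    also have "\<dots> \<le> ennreal ((h m * CARD('n) * M)\<^sup>2)"
      using h[of m] M by (intro ennreal_leI power_mono mult_left_mono) auto
    finally have nn: "(\<integral>\<^sup>+x. ennreal ((norm (?f x))\<^sup>2) \<partial>lebesgue_on \<Omega>) \<le> ennreal ((h m * CARD('n) * M)\<^sup>2)" .
    have fmeas: "?f \<in> borel_measurable (lebesgue_on \<Omega>)"
      by (intro measurable_restrict_space1 measurable_completion) measurable
    have "integrable (lebesgue_on \<Omega>) (\<lambda>x. (norm (?f x))\<^sup>2)"
    proof (rule integrableI_nonneg)
      show "(\<integral>\<^sup>+x. ennreal ((norm (?f x))\<^sup>2) \<partial>lebesgue_on \<Omega>) < \<infinity>"
        by (rule le_less_trans[OF nn]) simp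
      show "(\<lambda>x. (norm (?f x))\<^sup>2) \<in> borel_measurable (lebesgue_on \<Omega>)"
        by (rule measurable_compose[OF fmeas]) measurable
    qed auto
    then show f: "?f \<in> L2 \<Omega>" using fmeas by (simp add: L2_def)
    show "l2_norm \<Omega> ?f \<le> h m * CARD('n) * M"
      by (rule l2_norm_le_of_nn_integral[OF f nn]) (use h[of m] M0 in auto)
    show "(\<lambda>x. avg (h m) (\<phi> k) x) \<in> L2 \<Omega>" using L2_diff[OF test_L2[OF \<phi>[of k]] f] by simp
  qed
  let ?c = "l2_norm \<Omega> (\<lambda>x. 1 :: real)"
  interpret fm: finite_measure "lebesgue_on \<Omega>" by (rule finite_measure_domain)
  have one: "(\<lambda>x. c :: real) \<in> L2 \<Omega>" for c by (simp add: L2_def)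
  have est: "l2_norm \<Omega> (\<lambda>x. \<phi> i x - \<phi> j x) \<le> h m * (2 * CARD('n) * M + ?c)"
    if *: "\<And>x. x \<in> \<Omega> \<Longrightarrow> \<bar>avg (h m) (\<phi> i) x - avg (h m) (\<phi> j) x\<bar> \<le> h m" for i j m
  proof -
    let ?A = "\<lambda>k x. avg (h m) (\<phi> k) x"
    have "l2_norm \<Omega> (\<lambda>x. ?A i x - ?A j x) \<le> l2_norm \<Omega> (\<lambda>x. h m *\<^sub>R (1::real))"
      unfolding l2_norm_def
    proof (intro real_sqrt_le_mono integral_mono)
      show "integrable (lebesgue_on \<Omega>) (\<lambda>x. (norm (?A i x - ?A j x))\<^sup>2)"
        by (intro L2_norm2_integrable L2_diff err)
      show "(norm (?A i x - ?A j x))\<^sup>2 \<le> (norm (h m *\<^sub>R (1::real)))\<^sup>2" if "x \<in> space (lebesgue_on \<Omega>)" for x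
        using *[of x] that h[of m] by (intro power_mono) auto
    qed simp
    also have "\<dots> = h m * ?c" using h[of m] by (subst l2_norm_scale) simp
    finally have 1: "l2_norm \<Omega> (\<lambda>x. ?A i x - ?A j x) \<le> h m * ?c" .
    have "l2_norm \<Omega> (\<lambda>x. \<phi> i x - \<phi> j x)
        \<le> l2_norm \<Omega> (\<lambda>x. \<phi> i x - ?A i x) + l2_norm \<Omega> (\<lambda>x. ?A i x - \<phi> j x)"
      by (intro l2_norm_triangle_diff test_L2 \<phi> err)
    also have "l2_norm \<Omega> (\<lambda>x. ?A i x - \<phi> j x)
        \<le> l2_norm \<Omega> (\<lambda>x. ?A i x - ?A j x) + l2_norm \<Omega> (\<lambda>x. ?A j x - \<phi> j x)"
      by (intro l2_norm_triangle_diff test_L2 \<phi> err)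
    finally show ?thesis
      using 1 err(2)[of i m] err(2)[of j m]
      by (simp add: l2_norm_minus_commute[of \<Omega> "?A j" "\<phi> j"] algebra_simps)
  qed
  have "\<exists>N. \<forall>i\<ge>N. \<forall>j\<ge>N. l2_norm \<Omega> (\<lambda>x. \<phi> (diagseq i) x - \<phi> (diagseq j) x) < e" if "e > 0" for e
  proof -
    let ?B = "2 * CARD('n) * M + ?c"
    have B: "?B \<ge> 0" using M0 by simp
    obtain m :: nat where m: "?B / e < real m" using reals_Archimedean2 by blast
    have small: "h m * ?B < e"
    proof -
      have "?B < real (Suc m) * e" using m that by (simp add: field_simps)
      then show ?thesis by (simp add: h_def field_simps)
    qed
    obtain N where "\<And>i j x. N \<le> i \<Longrightarrow> N \<le> j \<Longrightarrow> x \<in> \<Omega> \<Longrightarrow>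
        \<bar>avg (h m) (\<phi> (diagseq i)) x - avg (h m) (\<phi> (diagseq j)) x\<bar> \<le> h m"
      using C_diag[of m] by (auto simp: C_def)
    then show ?thesis using est small by (meson le_less_trans)
  qed
  with subseq_diagseq show ?thesis by blast
qed

end

text \<open>The first variation at a minimizer vanishes.\<close>

lemma linear_coeff_zero:
  fixes b c :: real
  assumes quad: "\<And>t. 0 \<le> 2 * t * c + t\<^sup>2 * b" and "0 \<le> b"
  shows "c = 0"
proof -
  define t where "t = - c / (b + 1)"
  have t: "(b + 1) * t = - c" using \<open>0 \<le> b\<close> by (simp add: t_def)
  have "0 \<le> (b + 1)\<^sup>2 * (2 * t * c + t\<^sup>2 * b)"
    by (intro mult_nonneg_nonneg quad) simp
  also have "\<dots> = 2 * (b + 1) * ((b + 1) * t) * c + ((b + 1) * t)\<^sup>2 * b"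
    by (simp add: algebra_simps power2_eq_square)
  also have "\<dots> = - (c\<^sup>2 * (b + 2))"
    unfolding t by (simp add: algebra_simps power2_eq_square)
  finally have "c\<^sup>2 * (b + 2) \<le> 0" by simp
  then show ?thesis using \<open>0 \<le> b\<close> by (simp add: mult_le_0_iff)
qed

context domain
begin

text \<open>Fatou's lemma along an approximating sequence of test functions.\<close>

lemma Sobolev_H01:
  assumes \<gamma>: "0 < \<gamma>" "CARD('n) / 2 - 1 \<le> \<gamma>" "\<gamma> * (q - 2) < 2" and q: "2 < q"
  obtains K where "K \<ge> 0"
    "\<And>z. z \<in> H01 \<Omega> \<Longrightarrow> integrable (lebesgue_on \<Omega>) (\<lambda>x. \<bar>z x\<bar> powr q)"
    "\<And>z. z \<in> H01 \<Omega> \<Longrightarrow>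
      (LINT x|lebesgue_on \<Omega>. \<bar>z x\<bar> powr q) \<le> K * l2_norm \<Omega> (weak_grad \<Omega> z) powr q"
proof -
  obtain K where K: "K \<ge> 0" "\<And>\<phi>. \<phi> \<in> test_functions \<Omega> \<Longrightarrow>
      (\<integral>\<^sup>+x. ennreal (\<bar>\<phi> x\<bar> powr q) \<partial>lebesgue_on \<Omega>) \<le> ennreal (K * l2_norm \<Omega> (grad \<phi>) powr q)"
    using Sobolev_test[OF assms] by blast
  have *: "(\<integral>\<^sup>+x. ennreal (\<bar>z x\<bar> powr q) \<partial>lebesgue_on \<Omega>) \<le> ennreal (K * l2_norm \<Omega> (weak_grad \<Omega> z) powr q)"
    if z: "z \<in> H01 \<Omega>" for z
  proof -
    obtain \<phi> where \<phi>: "\<And>k::nat. \<phi> k \<in> test_functions \<Omega>"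
      "(\<lambda>k. l2_norm \<Omega> (\<lambda>x. \<phi> k x - z x)) \<longlonglongrightarrow> 0"
      "(\<lambda>k. l2_norm \<Omega> (\<lambda>x. grad (\<phi> k) x - weak_grad \<Omega> z x)) \<longlonglongrightarrow> 0"
      using H01_approx[OF z] by blast
    obtain s where s: "strict_mono s" "AE x in lebesgue_on \<Omega>. (\<lambda>k. \<phi> (s k) x) \<longlonglongrightarrow> z x"
      using L2_AE_subseq[OF test_L2[OF \<phi>(1)] H01_L2[OF z] \<phi>(2)] by blast
    have [measurable]: "\<phi> k \<in> borel_measurable (lebesgue_on \<Omega>)" for k
      by (rule L2_measurable[OF test_L2[OF \<phi>(1)]])
    have lim: "(\<lambda>k. l2_norm \<Omega> (grad (\<phi> k))) \<longlonglongrightarrow> l2_norm \<Omega> (weak_grad \<Omega> z)"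
      by (rule l2_norm_tendsto[OF test_grad_L2[OF \<phi>(1)] weak_grad_L2[OF z] \<phi>(3)])
    have "(\<integral>\<^sup>+x. ennreal (\<bar>z x\<bar> powr q) \<partial>lebesgue_on \<Omega>)
        = (\<integral>\<^sup>+x. liminf (\<lambda>k. ennreal (\<bar>\<phi> (s k) x\<bar> powr q)) \<partial>lebesgue_on \<Omega>)"
    proof (rule nn_integral_cong_AE)
      show "AE x in lebesgue_on \<Omega>. ennreal (\<bar>z x\<bar> powr q) = liminf (\<lambda>k. ennreal (\<bar>\<phi> (s k) x\<bar> powr q))"
        using s(2)
      proof eventually_elim
        case (elim x)
        have "(\<lambda>k. \<bar>\<phi> (s k) x\<bar> powr q) \<longlonglongrightarrow> \<bar>z x\<bar> powr q"
          by (rule tendsto_powr') (use q elim in \<open>auto intro: tendsto_rabs\<close>)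
        then have "(\<lambda>k. ennreal (\<bar>\<phi> (s k) x\<bar> powr q)) \<longlonglongrightarrow> ennreal (\<bar>z x\<bar> powr q)"
          by (rule tendsto_ennrealI)
        then show ?case by (rule lim_imp_Liminf[OF sequentially_bot, symmetric])
      qed
    qed
    also have "\<dots> \<le> liminf (\<lambda>k. \<integral>\<^sup>+x. ennreal (\<bar>\<phi> (s k) x\<bar> powr q) \<partial>lebesgue_on \<Omega>)"
      by (rule nn_integral_liminf) measurable
    also have "\<dots> \<le> liminf (\<lambda>k. ennreal (K * l2_norm \<Omega> (grad (\<phi> (s k))) powr q))"
      by (intro Liminf_mono always_eventually allI K \<phi>)
    also have "\<dots> = ennreal (K * l2_norm \<Omega> (weak_grad \<Omega> z) powr q)"
    proof (rule lim_imp_Liminf[OF sequentially_bot tendsto_ennrealI])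
      have "(\<lambda>k. l2_norm \<Omega> (grad (\<phi> (s k)))) \<longlonglongrightarrow> l2_norm \<Omega> (weak_grad \<Omega> z)"
        using LIMSEQ_subseq_LIMSEQ[OF lim s(1)] by (simp add: comp_def)
      then have "(\<lambda>k. l2_norm \<Omega> (grad (\<phi> (s k))) powr q) \<longlonglongrightarrow> l2_norm \<Omega> (weak_grad \<Omega> z) powr q"
        by (rule tendsto_powr') (use q in auto)
      then show "(\<lambda>k. K * l2_norm \<Omega> (grad (\<phi> (s k))) powr q) \<longlonglongrightarrow> K * l2_norm \<Omega> (weak_grad \<Omega> z) powr q"
        by (rule tendsto_mult_left)
    qed
    finally show ?thesis .
  qed
  have int: "integrable (lebesgue_on \<Omega>) (\<lambda>x. \<bar>z x\<bar> powr q)" if z: "z \<in> H01 \<Omega>" for z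
  proof (rule integrableI_nonneg)
    have [measurable]: "z \<in> borel_measurable (lebesgue_on \<Omega>)" by (rule L2_measurable[OF H01_L2[OF z]])
    show "(\<lambda>x. \<bar>z x\<bar> powr q) \<in> borel_measurable (lebesgue_on \<Omega>)" by measurable
    show "(\<integral>\<^sup>+x. ennreal (\<bar>z x\<bar> powr q) \<partial>lebesgue_on \<Omega>) < \<infinity>"
      by (rule le_less_trans[OF *[OF z]]) simp
  qed simp
  have "(LINT x|lebesgue_on \<Omega>. \<bar>z x\<bar> powr q) \<le> K * l2_norm \<Omega> (weak_grad \<Omega> z) powr q"
    if z: "z \<in> H01 \<Omega>" for z
    using *[OF z] nn_integral_eq_integral[OF int[OF z]] K(1) by simp
  with K(1) int show ?thesis by (rule that)
qed

lemma nonzero_test_exists: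
  obtains \<phi> where "\<phi> \<in> test_functions \<Omega>" "l2_norm \<Omega> \<phi> > 0"
proof -
  have "\<exists>\<phi>\<in>test_functions \<Omega>. l2_norm \<Omega> \<phi> \<noteq> 0"
  proof (rule ccontr)
    assume neg: "\<not> ?thesis"
    interpret finite_measure "lebesgue_on \<Omega>" by (rule finite_measure_domain)
    have one: "(\<lambda>x. 1 :: real) \<in> L2 \<Omega>" by (simp add: L2_def)
    have "AE x in lebesgue_on \<Omega>. (1::real) = 0"
    proof (rule fundamental_lemma)
      fix \<phi> assume \<phi>: "\<phi> \<in> test_functions \<Omega>"
      have "\<bar>l2_inner \<Omega> (\<lambda>x. 1) \<phi>\<bar> \<le> l2_norm \<Omega> (\<lambda>x. 1 :: real) * l2_norm \<Omega> \<phi>"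
        by (rule l2_Cauchy_Schwarz[OF one test_L2[OF \<phi>]])
      then show "(LINT x|lebesgue_on \<Omega>. 1 * \<phi> x) = 0" using neg \<phi> by (simp add: l2_inner_def)
    qed simp
    then show False using domain_not_negligible by simp
  qed
  then obtain \<phi> where "\<phi> \<in> test_functions \<Omega>" "l2_norm \<Omega> \<phi> \<noteq> 0" by blast
  with that l2_norm_nonneg[of \<Omega> \<phi>] show ?thesis by (metis less_eq_real_def)
qed

text \<open>A minimising sequence of the Rayleigh quotient consists of normalised test functions. By
  Rellich's theorem a subsequence converges in \<open>L\<^sup>2\<close>, and by the parallelogram law its gradients
  then form a Cauchy sequence; the limit is an eigenfunction for the infimum of the quotient, which
  is a lower bound of every eigenvalue.\<close>

theorem lambda1_Poincare:
  shows "lambda1 \<Omega> > 0"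
    and "z \<in> H01 \<Omega> \<Longrightarrow> lambda1 \<Omega> * (l2_norm \<Omega> z)\<^sup>2 \<le> (l2_norm \<Omega> (weak_grad \<Omega> z))\<^sup>2"
proof -
  \<comment> \<open>The Rayleigh quotients of test functions, restricted to unit norm.\<close>
  define R where "R = {(l2_norm \<Omega> (grad \<phi>))\<^sup>2 |\<phi>. \<phi> \<in> test_functions \<Omega> \<and> l2_norm \<Omega> \<phi> = 1}"
  define m where "m = Inf R"
  obtain r where r: "r > 0" and P: "\<And>\<phi>. \<phi> \<in> test_functions \<Omega> \<Longrightarrow>
      (\<integral>\<^sup>+x. ennreal ((\<phi> x)\<^sup>2) \<partial>lborel) \<le> ennreal ((r * l2_norm \<Omega> (grad \<phi>))\<^sup>2)"
    using Poincare_test by blast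
  have P': "l2_norm \<Omega> \<phi> \<le> r * l2_norm \<Omega> (grad \<phi>)" if \<phi>: "\<phi> \<in> test_functions \<Omega>" for \<phi>
  proof (rule l2_norm_le_of_nn_integral[OF test_L2[OF \<phi>]])
    have [measurable]: "\<phi> \<in> borel_measurable borel"
      by (rule borel_measurable_continuous_onI[OF smooth_continuous_on[OF test_smooth[OF \<phi>]]])
    have "(\<integral>\<^sup>+x. ennreal ((norm (\<phi> x))\<^sup>2) \<partial>lebesgue_on \<Omega>) \<le> (\<integral>\<^sup>+x. ennreal ((norm (\<phi> x))\<^sup>2) \<partial>lborel)"
      by (rule nn_integral_domain_le) measurable
    also have "\<dots> \<le> ennreal ((r * l2_norm \<Omega> (grad \<phi>))\<^sup>2)" using P[OF \<phi>] by simp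
    finally show "(\<integral>\<^sup>+x. ennreal ((norm (\<phi> x))\<^sup>2) \<partial>lebesgue_on \<Omega>) \<le> ennreal ((r * l2_norm \<Omega> (grad \<phi>))\<^sup>2)" .
  qed (use r in simp)
  have scale: "(\<lambda>x. a * \<phi> x) \<in> test_functions \<Omega>" "l2_norm \<Omega> (grad (\<lambda>x. a * \<phi> x)) = \<bar>a\<bar> * l2_norm \<Omega> (grad \<phi>)"
    "l2_norm \<Omega> (\<lambda>x. a * \<phi> x) = \<bar>a\<bar> * l2_norm \<Omega> \<phi>"
    if \<phi>: "\<phi> \<in> test_functions \<Omega>" for \<phi> and a :: real
  proof -
    show "(\<lambda>x. a * \<phi> x) \<in> test_functions \<Omega>" using test_lincomb[OF \<phi> \<phi>, of a 0] by simp
    have "grad (\<lambda>x. a * \<phi> x) = (\<lambda>x. a *\<^sub>R grad \<phi> x)"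
      using grad_lincomb[OF test_smooth[OF \<phi>] test_smooth[OF \<phi>], of a 0] by auto
    then show "l2_norm \<Omega> (grad (\<lambda>x. a * \<phi> x)) = \<bar>a\<bar> * l2_norm \<Omega> (grad \<phi>)" by (simp add: l2_norm_scale)
    show "l2_norm \<Omega> (\<lambda>x. a * \<phi> x) = \<bar>a\<bar> * l2_norm \<Omega> \<phi>"
      using l2_norm_scale[of \<Omega> a \<phi>] by simp
  qed
  have bdd: "1 / r\<^sup>2 \<le> y" if y: "y \<in> R" for y
  proof -
    obtain \<phi> where \<phi>: "\<phi> \<in> test_functions \<Omega>" "l2_norm \<Omega> \<phi> = 1" "y = (l2_norm \<Omega> (grad \<phi>))\<^sup>2"
      using y by (auto simp: R_def)
    have "1\<^sup>2 \<le> (r * l2_norm \<Omega> (grad \<phi>))\<^sup>2" using P'[OF \<phi>(1)] \<phi>(2) by (intro power_mono) auto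
    then show ?thesis using r by (simp add: \<phi>(3) power_mult_distrib field_simps)
  qed
  then have bdd_below: "bdd_below R" by (auto simp: bdd_below_def)
  have nonempty: "R \<noteq> {}"
  proof -
    obtain \<phi> where \<phi>: "\<phi> \<in> test_functions \<Omega>" "l2_norm \<Omega> \<phi> > 0" by (rule nonzero_test_exists)
    let ?a = "1 / l2_norm \<Omega> \<phi>"
    have "l2_norm \<Omega> (\<lambda>x. ?a * \<phi> x) = 1" using scale(3)[OF \<phi>(1), of ?a] \<phi>(2) by simp
    with scale(1)[OF \<phi>(1), of ?a] show ?thesis unfolding R_def by blast
  qed
  have "1 / r\<^sup>2 \<le> m" unfolding m_def using bdd nonempty by (rule cInf_greatest[rotated])
  with r have m_pos: "m > 0" by (simp add: less_le_trans[of 0 "1 / r\<^sup>2"])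
  have Rayleigh_test: "m * (l2_norm \<Omega> \<phi>)\<^sup>2 \<le> (l2_norm \<Omega> (grad \<phi>))\<^sup>2" if \<phi>: "\<phi> \<in> test_functions \<Omega>" for \<phi>
  proof (cases "l2_norm \<Omega> \<phi> = 0")
    case False
    then have pos: "l2_norm \<Omega> \<phi> > 0" using l2_norm_nonneg[of \<Omega> \<phi>] by linarith
    let ?a = "1 / l2_norm \<Omega> \<phi>"
    have "l2_norm \<Omega> (\<lambda>x. ?a * \<phi> x) = 1" using scale(3)[OF \<phi>, of ?a] pos by simp
    then have "(l2_norm \<Omega> (grad (\<lambda>x. ?a * \<phi> x)))\<^sup>2 \<in> R"
      unfolding R_def using scale(1)[OF \<phi>, of ?a] by blast
    then have "m \<le> (l2_norm \<Omega> (grad (\<lambda>x. ?a * \<phi> x)))\<^sup>2"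
      unfolding m_def by (rule cInf_lower[OF _ bdd_below])
    also have "\<dots> = (l2_norm \<Omega> (grad \<phi>))\<^sup>2 / (l2_norm \<Omega> \<phi>)\<^sup>2"
      using pos by (subst scale(2)[OF \<phi>]) (simp add: power_divide)
    finally show ?thesis using pos by (simp add: field_simps)
  qed simp
  have Rayleigh: "m * (l2_norm \<Omega> z)\<^sup>2 \<le> (l2_norm \<Omega> (weak_grad \<Omega> z))\<^sup>2" if z: "z \<in> H01 \<Omega>" for z
  proof -
    obtain \<phi> where \<phi>: "\<And>k::nat. \<phi> k \<in> test_functions \<Omega>"
      "(\<lambda>k. l2_norm \<Omega> (\<lambda>x. \<phi> k x - z x)) \<longlonglongrightarrow> 0"
      "(\<lambda>k. l2_norm \<Omega> (\<lambda>x. grad (\<phi> k) x - weak_grad \<Omega> z x)) \<longlonglongrightarrow> 0"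
      using H01_approx[OF z] by blast
    have "(\<lambda>k. m * (l2_norm \<Omega> (\<phi> k))\<^sup>2) \<longlonglongrightarrow> m * (l2_norm \<Omega> z)\<^sup>2"
      by (intro tendsto_intros l2_norm_tendsto[OF test_L2[OF \<phi>(1)] H01_L2[OF z] \<phi>(2)])
    moreover have "(\<lambda>k. (l2_norm \<Omega> (grad (\<phi> k)))\<^sup>2) \<longlonglongrightarrow> (l2_norm \<Omega> (weak_grad \<Omega> z))\<^sup>2"
      by (intro tendsto_intros l2_norm_tendsto[OF test_grad_L2[OF \<phi>(1)] weak_grad_L2[OF z] \<phi>(3)])
    ultimately show ?thesis
      by (rule LIMSEQ_le) (use Rayleigh_test[OF \<phi>(1)] in blast)
  qed
  have "\<exists>\<phi>. \<phi> \<in> test_functions \<Omega> \<and> l2_norm \<Omega> \<phi> = 1 \<and> (l2_norm \<Omega> (grad \<phi>))\<^sup>2 < m + 1 / real (Suc k)" for k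
  proof -
    have "Inf R < m + 1 / real (Suc k)" unfolding m_def[symmetric] by simp
    then obtain y where "y \<in> R" "y < m + 1 / real (Suc k)"
      using cInf_lessD[OF nonempty] by blast
    then show ?thesis by (auto simp: R_def)
  qed
  then obtain \<phi> where \<phi>: "\<And>k. \<phi> k \<in> test_functions \<Omega>" "\<And>k. l2_norm \<Omega> (\<phi> k) = 1"
    "\<And>k. (l2_norm \<Omega> (grad (\<phi> k)))\<^sup>2 < m + 1 / real (Suc k)" by metis
  have grad_bound: "l2_norm \<Omega> (grad (\<phi> k)) \<le> sqrt (m + 1)" for k
  proof (rule real_le_rsqrt)
    have "1 / real (Suc k) \<le> 1" by simp
    then show "(l2_norm \<Omega> (grad (\<phi> k)))\<^sup>2 \<le> m + 1" using \<phi>(3)[of k] by linarith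
  qed
  from Rellich_test[of \<phi>, OF \<phi>(1) grad_bound] obtain s :: "nat \<Rightarrow> nat" where ss: "strict_mono s \<and>
      (\<forall>e>0. \<exists>N. \<forall>i\<ge>N. \<forall>j\<ge>N. l2_norm \<Omega> (\<lambda>x. \<phi> (s i) x - \<phi> (s j) x) < e)" ..
  note s = ss[THEN conjunct1] ss[THEN conjunct2, rule_format]
  define f where "f k = \<phi> (s k)" for k
  have f: "f k \<in> test_functions \<Omega>" "l2_norm \<Omega> (f k) = 1" for k using \<phi> by (auto simp: f_def)
  have f3: "(l2_norm \<Omega> (grad (f k)))\<^sup>2 < m + 1 / real (Suc k)" for k
  proof -
    have "1 / real (Suc (s k)) \<le> 1 / real (Suc k)"
      using seq_suble[OF s(1), of k] by (simp add: frac_le)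
    then show ?thesis using \<phi>(3)[of "s k"] by (simp add: f_def)
  qed
  \<comment> \<open>Parallelogram law: the sum of two normalised minimisers has quotient at least \<open>m\<close>.\<close>
  have grad_diff: "(l2_norm \<Omega> (\<lambda>x. grad (f i) x - grad (f j) x))\<^sup>2
      \<le> 2 / real (Suc i) + 2 / real (Suc j) + m * (l2_norm \<Omega> (\<lambda>x. f i x - f j x))\<^sup>2" for i j
  proof -
    have sum: "m * (l2_norm \<Omega> (\<lambda>x. 1 * f i x + 1 * f j x))\<^sup>2 \<le> (l2_norm \<Omega> (\<lambda>x. 1 *\<^sub>R grad (f i) x + 1 *\<^sub>R grad (f j) x))\<^sup>2"
    proof -
      have "grad (\<lambda>x. 1 * f i x + 1 * f j x) = (\<lambda>x. 1 *\<^sub>R grad (f i) x + 1 *\<^sub>R grad (f j) x)"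
        by (rule ext) (rule grad_lincomb[OF test_smooth[OF f(1)] test_smooth[OF f(1)]])
      then show ?thesis
        using Rayleigh_test[OF test_lincomb[OF f(1)[of i] f(1)[of j], of 1 1]] by simp
    qed
    have e1: "(l2_norm \<Omega> (\<lambda>x. grad (f i) x - grad (f j) x))\<^sup>2
        = (l2_norm \<Omega> (grad (f i)))\<^sup>2 - 2 * l2_inner \<Omega> (grad (f i)) (grad (f j)) + (l2_norm \<Omega> (grad (f j)))\<^sup>2"
      using l2_norm_sq_lincomb[OF test_grad_L2[OF f(1)[of i]] test_grad_L2[OF f(1)[of j]], of 1 "-1"] by simp
    have e2: "(l2_norm \<Omega> (\<lambda>x. grad (f i) x + grad (f j) x))\<^sup>2
        = (l2_norm \<Omega> (grad (f i)))\<^sup>2 + 2 * l2_inner \<Omega> (grad (f i)) (grad (f j)) + (l2_norm \<Omega> (grad (f j)))\<^sup>2"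
      using l2_norm_sq_lincomb[OF test_grad_L2[OF f(1)[of i]] test_grad_L2[OF f(1)[of j]], of 1 1] by simp
    have e3: "(l2_norm \<Omega> (\<lambda>x. f i x - f j x))\<^sup>2 = 2 - 2 * l2_inner \<Omega> (f i) (f j)"
      using l2_norm_sq_lincomb[OF test_L2[OF f(1)[of i]] test_L2[OF f(1)[of j]], of 1 "-1"] by (simp add: f)
    have e4: "(l2_norm \<Omega> (\<lambda>x. f i x + f j x))\<^sup>2 = 2 + 2 * l2_inner \<Omega> (f i) (f j)"
      using l2_norm_sq_lincomb[OF test_L2[OF f(1)[of i]] test_L2[OF f(1)[of j]], of 1 1] by (simp add: f)
    show ?thesis
      using sum f3[of i] f3[of j] unfolding e1 e3
      by (simp add: e2 e4 algebra_simps del: of_nat_Suc)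
  qed
  have grad_Cauchy: "\<exists>N. \<forall>i\<ge>N. \<forall>j\<ge>N. l2_norm \<Omega> (\<lambda>x. grad (f i) x - grad (f j) x) < e"
    if e: "e > 0" for e
  proof -
    obtain N1 where N1: "\<And>i j. i \<ge> N1 \<Longrightarrow> j \<ge> N1 \<Longrightarrow> l2_norm \<Omega> (\<lambda>x. f i x - f j x) < e / sqrt (2 * m)"
      using s(2)[of "e / sqrt (2 * m)"] e m_pos by (auto simp: f_def)
    obtain N2 :: nat where N2: "8 / e\<^sup>2 < real N2" using reals_Archimedean2 by blast
    have small: "2 / real (Suc i) < e\<^sup>2 / 4" if "i \<ge> N2" for i
    proof -
      have "8 / e\<^sup>2 < real (Suc i)" using N2 that by linarith
      then show ?thesis using e by (simp add: field_simps)
    qed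
    have "l2_norm \<Omega> (\<lambda>x. grad (f i) x - grad (f j) x) < e" if "i \<ge> max N1 N2" "j \<ge> max N1 N2" for i j
    proof -
      have "(l2_norm \<Omega> (\<lambda>x. f i x - f j x))\<^sup>2 \<le> (e / sqrt (2 * m))\<^sup>2"
        using N1[of i j] that by (intro power_mono) auto
      then have "m * (l2_norm \<Omega> (\<lambda>x. f i x - f j x))\<^sup>2 \<le> e\<^sup>2 / 2"
        using m_pos by (simp add: power_divide field_simps)
      then have "(l2_norm \<Omega> (\<lambda>x. grad (f i) x - grad (f j) x))\<^sup>2 < e\<^sup>2"
        using grad_diff[of i j] small[of i] small[of j] that by simp
      then show ?thesis using e by (simp add: power2_less_imp_less)
    qed
    then show ?thesis by blast
  qed
  obtain w where w: "w \<in> L2 \<Omega>" "(\<lambda>k. l2_norm \<Omega> (\<lambda>x. grad (f k) x - w x)) \<longlonglongrightarrow> 0"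
    using L2_complete[of \<Omega> "\<lambda>k. grad (f k)", OF finite_measure_domain test_grad_L2[OF f(1)] grad_Cauchy]
    by blast
  obtain z where z: "z \<in> L2 \<Omega>" "(\<lambda>k. l2_norm \<Omega> (\<lambda>x. f k x - z x)) \<longlonglongrightarrow> 0"
    using L2_complete[of \<Omega> f, OF finite_measure_domain test_L2[OF f(1)] s(2)[folded f_def]] by blast
  note zH = H01_limit[OF f(1) z(1) w(1) z(2) w(2)]
  have norm_z: "l2_norm \<Omega> z = 1"
    using l2_norm_tendsto[OF test_L2[OF f(1)] z] f(2) by (simp add: LIMSEQ_const_iff)
  have "(l2_norm \<Omega> w)\<^sup>2 \<le> m"
  proof (rule LIMSEQ_le)
    show "(\<lambda>k. (l2_norm \<Omega> (grad (f k)))\<^sup>2) \<longlonglongrightarrow> (l2_norm \<Omega> w)\<^sup>2"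
      by (intro tendsto_intros l2_norm_tendsto[OF test_grad_L2[OF f(1)] w])
    show "(\<lambda>k. m + 1 / real (Suc k)) \<longlonglongrightarrow> m"
      using tendsto_add[OF tendsto_const[of m] LIMSEQ_inverse_real_of_nat] by (simp add: inverse_eq_divide)
    show "\<exists>N. \<forall>k\<ge>N. (l2_norm \<Omega> (grad (f k)))\<^sup>2 \<le> m + 1 / real (Suc k)"
      using f3 less_imp_le by blast
  qed
  moreover have wz: "l2_norm \<Omega> (weak_grad \<Omega> z) = l2_norm \<Omega> w"
    by (rule l2_norm_cong_AE[OF weak_grad_L2[OF zH(1)] w(1) zH(2)])
  ultimately have energy_z: "(l2_norm \<Omega> (weak_grad \<Omega> z))\<^sup>2 = m"
    using Rayleigh[OF zH(1)] norm_z by simp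
  have "dirichlet_eigenvalue \<Omega> m"
    unfolding dirichlet_eigenvalue_def
  proof (intro bexI[OF _ zH(1)] conjI ballI notI)
    assume "AE x in lebesgue_on \<Omega>. z x = 0"
    then have "l2_norm \<Omega> z = l2_norm \<Omega> (\<lambda>x. 0 :: real)"
      by (intro l2_norm_cong_AE z) (auto simp: L2_def)
    with norm_z show False by (simp add: l2_norm_zero)
  next
    fix v assume v: "v \<in> H01 \<Omega>"
    let ?c = "l2_inner \<Omega> (weak_grad \<Omega> z) (weak_grad \<Omega> v) - m * l2_inner \<Omega> z v"
    let ?b = "(l2_norm \<Omega> (weak_grad \<Omega> v))\<^sup>2 - m * (l2_norm \<Omega> v)\<^sup>2"
    have b: "?b \<ge> 0" using Rayleigh[OF v] by simp
    have quad: "0 \<le> 2 * t * ?c + t\<^sup>2 * ?b" for t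
    proof -
      let ?y = "\<lambda>x. 1 * z x + t * v x"
      have y: "?y \<in> H01 \<Omega>" by (rule H01_lincomb(1)[OF zH(1) v])
      have "(l2_norm \<Omega> (weak_grad \<Omega> ?y))\<^sup>2 = (l2_norm \<Omega> (\<lambda>x. 1 *\<^sub>R weak_grad \<Omega> z x + t *\<^sub>R weak_grad \<Omega> v x))\<^sup>2"
        using l2_norm_cong_AE[OF weak_grad_L2[OF y] L2_lincomb[OF weak_grad_L2[OF zH(1)] weak_grad_L2[OF v]]
            H01_lincomb(2)[OF zH(1) v]] by simp
      also have "\<dots> = m + 2 * t * l2_inner \<Omega> (weak_grad \<Omega> z) (weak_grad \<Omega> v) + t\<^sup>2 * (l2_norm \<Omega> (weak_grad \<Omega> v))\<^sup>2"
        by (subst l2_norm_sq_lincomb) (auto intro: weak_grad_L2 zH(1) v simp: energy_z)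
      finally have 1: "(l2_norm \<Omega> (weak_grad \<Omega> ?y))\<^sup>2
          = m + 2 * t * l2_inner \<Omega> (weak_grad \<Omega> z) (weak_grad \<Omega> v) + t\<^sup>2 * (l2_norm \<Omega> (weak_grad \<Omega> v))\<^sup>2" .
      have "(l2_norm \<Omega> ?y)\<^sup>2 = 1 + 2 * t * l2_inner \<Omega> z v + t\<^sup>2 * (l2_norm \<Omega> v)\<^sup>2"
        using l2_norm_sq_lincomb[OF z(1) H01_L2[OF v], of 1 t] norm_z by simp
      then show ?thesis using Rayleigh[OF y] 1 by (simp add: algebra_simps)
    qed
    have "?c = 0" by (rule linear_coeff_zero[OF quad b])
    then show "l2_inner \<Omega> (weak_grad \<Omega> z) (weak_grad \<Omega> v) = m * l2_inner \<Omega> z v" by simp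
  qed
  moreover have "m \<le> \<mu>" if \<mu>: "dirichlet_eigenvalue \<Omega> \<mu>" for \<mu>
  proof -
    obtain y where y: "y \<in> H01 \<Omega>" "\<not> (AE x in lebesgue_on \<Omega>. y x = 0)"
      "l2_inner \<Omega> (weak_grad \<Omega> y) (weak_grad \<Omega> y) = \<mu> * l2_inner \<Omega> y y"
      using \<mu> by (auto simp: dirichlet_eigenvalue_def)
    have "l2_norm \<Omega> y \<noteq> 0" using l2_norm_zero_AE[OF H01_L2[OF y(1)]] y(2) by blast
    then have "(l2_norm \<Omega> y)\<^sup>2 > 0" by simp
    moreover have "m * (l2_norm \<Omega> y)\<^sup>2 \<le> \<mu> * (l2_norm \<Omega> y)\<^sup>2"
      using Rayleigh[OF y(1)] y(3) by (simp add: l2_norm_sq)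
    ultimately show ?thesis by simp
  qed
  ultimately have "lambda1 \<Omega> = m"
    unfolding lambda1_def by (rule Least_equality)
  then show "lambda1 \<Omega> > 0" "z \<in> H01 \<Omega> \<Longrightarrow> lambda1 \<Omega> * (l2_norm \<Omega> z)\<^sup>2 \<le> (l2_norm \<Omega> (weak_grad \<Omega> z))\<^sup>2" for z
    using m_pos Rayleigh by auto
qed

end

section \<open>Absolutely continuous functions and weak time derivatives\<close>

text \<open>A gauge that straddles differentiability points off a null set, and that stays inside an open
  set of small measure on the null set: on the second kind of intervals absolute continuity makes
  the total increment small.\<close>

lemma abs_continuous_increment_le:
  fixes F k D :: "real \<Rightarrow> real"
  assumes ab: "a < b" and ac: "abs_continuous_on a b F" and k: "k integrable_on {a..b}"
    and der: "AE t in lebesgue. a < t \<and> t < b \<longrightarrow> (F has_real_derivative D t) (at t) \<and> D t \<le> k t"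
  shows "F b - F a \<le> integral {a..b} k"
proof (rule field_le_epsilon)
  fix e :: real assume "e > 0"
  define c where "c = e / (2 + (b - a))"
  have c: "c > 0" using \<open>e > 0\<close> ab by (simp add: c_def)
  define N where "N = {t \<in> {a..b}. \<not> (a < t \<and> t < b \<and> (F has_real_derivative D t) (at t) \<and> D t \<le> k t)}"
  have negl: "negligible N"
  proof -
    have "{t. \<not> (a < t \<and> t < b \<longrightarrow> (F has_real_derivative D t) (at t) \<and> D t \<le> k t)} \<in> null_sets lebesgue"
      using der by (subst (asm) completion.AE_iff_null_sets) simp
    then have "negligible {t. \<not> (a < t \<and> t < b \<longrightarrow> (F has_real_derivative D t) (at t) \<and> D t \<le> k t)}"
      by (simp add: negligible_iff_null_sets)
    then have "negligible ({t. \<not> (a < t \<and> t < b \<longrightarrow> (F has_real_derivative D t) (at t) \<and> D t \<le> k t)} \<union> {a, b})"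
      by (intro negligible_Un) auto
    then show ?thesis by (rule negligible_subset) (auto simp: N_def)
  qed
  \<comment> \<open>Changing \<open>k\<close> to zero on the exceptional set keeps its integral and removes the tags in \<open>N\<close> from the Riemann sum.\<close>
  define k' where "k' = (\<lambda>t. if t \<in> N then 0 else k t)"
  have k': "(k' has_integral integral {a..b} k) {a..b}"
    by (rule has_integral_spike[OF negl _ integrable_integral[OF k]]) (auto simp: k'_def)
  from k'[unfolded has_integral_real, rule_format, OF c]
  obtain \<gamma>1 where \<gamma>1: "gauge \<gamma>1 \<and> (\<forall>p. p tagged_division_of {a..b} \<and> \<gamma>1 fine p \<longrightarrow>
      norm ((\<Sum>(x,K)\<in>p. measure lborel K *\<^sub>R k' x) - integral {a..b} k) < c)" ..
  from ac[unfolded abs_continuous_on_def, rule_format, OF c]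
  obtain \<delta> where "\<delta> > 0 \<and> (\<forall>I. finite I \<and> (\<forall>(s, t)\<in>I. a \<le> s \<and> s \<le> t \<and> t \<le> b) \<and>
      disjoint_family_on (\<lambda>(s, t). {s<..<t}) I \<and> (\<Sum>(s, t)\<in>I. t - s) < \<delta> \<longrightarrow>
      (\<Sum>(s, t)\<in>I. \<bar>F t - F s\<bar>) < c)" ..
  then have \<delta>: "\<delta> > 0" and AC: "\<forall>I. finite I \<and> (\<forall>(s, t)\<in>I. a \<le> s \<and> s \<le> t \<and> t \<le> b) \<and>
      disjoint_family_on (\<lambda>(s, t). {s<..<t}) I \<and> (\<Sum>(s, t)\<in>I. t - s) < \<delta> \<longrightarrow>
      (\<Sum>(s, t)\<in>I. \<bar>F t - F s\<bar>) < c" by simp_all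
  have N_sets: "N \<in> sets lebesgue" using negl negligible_imp_sets by blast
  obtain U where U: "open U" "N \<subseteq> U" "U - N \<in> lmeasurable" "emeasure lebesgue (U - N) < ennreal \<delta>"
    using sets_lebesgue_outer_open[OF N_sets \<delta>] by blast
  have N0: "N \<in> null_sets lebesgue" using negl by (simp add: negligible_iff_null_sets)
  have emU: "emeasure lebesgue U = emeasure lebesgue (U - N)"
    using emeasure_Diff_null_set[OF N0, of U] U(1) by simp
  have Ulm: "U \<in> lmeasurable"
    using U(1,4) emU by (auto simp: fmeasurable_def intro: order.strict_trans)
  have Um: "measure lebesgue U < \<delta>"
  proof -
    have "ennreal (measure lebesgue U) < ennreal \<delta>"
      using U(4) emU emeasure_eq_measure2[OF Ulm] by simp
    then show ?thesis by (simp add: ennreal_less_iff)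
  qed
  have "\<exists>d>0. t \<in> {a..b} - N \<longrightarrow> (\<forall>y. \<bar>y - t\<bar> < d \<longrightarrow> \<bar>F y - F t - D t * (y - t)\<bar> \<le> c * \<bar>y - t\<bar>)" for t
  proof (cases "t \<in> {a..b} - N")
    case True
    then have "(F has_derivative (\<lambda>h. D t * h)) (at t)"
      by (auto simp: N_def has_field_derivative_def)
    then show ?thesis using c unfolding has_derivative_at_alt real_norm_def by blast
  next
    case False
    then show ?thesis using zero_less_one by blast
  qed
  then obtain d where d: "\<And>t. d t > 0"
    "\<And>t y. t \<in> {a..b} - N \<Longrightarrow> \<bar>y - t\<bar> < d t \<Longrightarrow> \<bar>F y - F t - D t * (y - t)\<bar> \<le> c * \<bar>y - t\<bar>"
    by metis
  define \<gamma>2 where "\<gamma>2 = (\<lambda>t. if t \<in> N then U else ball t (d t))"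
  have "gauge \<gamma>2" using U d by (auto simp: gauge_def \<gamma>2_def)
  then have "gauge (\<lambda>x. \<gamma>1 x \<inter> \<gamma>2 x)" using \<gamma>1 by (intro gauge_Int) simp_all
  then obtain p where p: "p tagged_division_of {a..b}" "(\<lambda>x. \<gamma>1 x \<inter> \<gamma>2 x) fine p"
    by (rule fine_division_exists_real)
  have fine: "\<gamma>1 fine p" "\<gamma>2 fine p" using p(2) by (auto simp: fine_Int)
  have finp: "finite p" using p(1) by blast
  have K: "Inf K \<le> x \<and> x \<le> Sup K \<and> a \<le> Inf K \<and> Sup K \<le> b \<and> K = {Inf K..Sup K} \<and> x \<in> {a..b}
      \<and> measure lborel K = Sup K - Inf K \<and> K \<subseteq> \<gamma>2 x" if xKp: "(x, K) \<in> p" for x K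
  proof -
    obtain u v where uv: "K = cbox u v" using tagged_division_ofD(4)[OF p(1) xKp] by blast
    have xK: "x \<in> K" "K \<subseteq> {a..b}" using tagged_division_ofD(2,3)[OF p(1) that] by auto
    then have "u \<le> v" using uv by auto
    then have "K = {u..v}" "Inf K = u" "Sup K = v" using uv by auto
    then show ?thesis using xK \<open>u \<le> v\<close> fine(2) that by (auto simp: fine_def)
  qed
  \<comment> \<open>The degenerate intervals are left out because they carry no increment and would spoil the injectivity of \<open>g\<close>.\<close>
  define q where "q = {(x, K) \<in> p. x \<in> N \<and> Inf K < Sup K}"
  have qp: "q \<subseteq> p" by (auto simp: q_def)
  then have finq: "finite q" using finp finite_subset by blast
  define g where "g = (\<lambda>(x :: real, K :: real set). (Inf K, Sup K))"
  have disj_q: "{Inf K<..<Sup K} \<inter> {Inf K'<..<Sup K'} = {}"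
    if "(x, K) \<in> p" "(x', K') \<in> p" "(x, K) \<noteq> (x', K')" for x K x' K'
  proof -
    have "interior K = {Inf K<..<Sup K}" if "(x, K) \<in> p" for x K
      using K[OF that] interior_atLeastAtMost_real by metis
    then show ?thesis using tagged_division_ofD(5)[OF p(1) that] that by metis
  qed
  have inj: "inj_on g q"
  proof (rule inj_onI, rule ccontr)
    fix y y' assume y: "y \<in> q" "y' \<in> q" "g y = g y'" "y \<noteq> y'"
    obtain x K x' K' where yy: "y = (x, K)" "y' = (x', K')" by (metis surj_pair)
    have "{Inf K<..<Sup K} = {}"
      using disj_q[of x K x' K'] y qp unfolding yy g_def by auto
    then show False using y(1) unfolding yy q_def by auto
  qed
  let ?I = "g ` q"
  have sumI: "(\<Sum>(s, t)\<in>?I. h s t) = (\<Sum>(x, K)\<in>q. h (Inf K) (Sup K))" for h :: "real \<Rightarrow> real \<Rightarrow> real"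
    using inj by (simp add: sum.reindex) (simp add: g_def case_prod_beta)
  have disjI: "disjoint_family_on (\<lambda>(s, t). {s<..<t}) ?I"
    unfolding disjoint_family_on_def
  proof (intro ballI impI)
    fix m n assume mn: "m \<in> ?I" "n \<in> ?I" "m \<noteq> n"
    then obtain x K x' K' where "m = (Inf K, Sup K)" "n = (Inf K', Sup K')" "(x, K) \<in> q" "(x', K') \<in> q"
      by (auto simp: g_def)
    then show "(\<lambda>(s, t). {s<..<t}) m \<inter> (\<lambda>(s, t). {s<..<t}) n = {}"
      using disj_q[of x K x' K'] mn(3) qp by auto
  qed
  have small: "(\<Sum>(s, t)\<in>?I. t - s) < \<delta>"
  proof -
    have "(\<Sum>(s, t)\<in>?I. t - s) = (\<Sum>z\<in>?I. measure lebesgue ((\<lambda>(s, t). {s<..<t}) z))"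
      by (rule sum.cong) (auto simp: g_def q_def)
    also have "\<dots> = measure lebesgue (\<Union>z\<in>?I. (\<lambda>(s, t). {s<..<t}) z)"
    proof -
      have "emeasure lborel {x<..<y :: real} \<noteq> top" for x y
        using emeasure_bounded_finite[of "{x<..<y}"] by simp
      then show ?thesis using finq disjI by (intro measure_finite_Union[symmetric]) auto
    qed
    also have "\<dots> \<le> measure lebesgue U"
    proof (rule measure_mono_fmeasurable[OF _ _ Ulm])
      show "(\<Union>z\<in>?I. (\<lambda>(s, t). {s<..<t}) z) \<subseteq> U"
      proof (rule UN_least)
        fix z assume "z \<in> ?I"
        then obtain x K where xK: "(x, K) \<in> p" "x \<in> N" "z = (Inf K, Sup K)"
          by (auto simp: g_def q_def)
        have "{Inf K<..<Sup K} \<subseteq> K" using K[OF xK(1)] greaterThanLessThan_subseteq_atLeastAtMost_iff by (metis order_refl)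
        then show "(\<lambda>(s, t). {s<..<t}) z \<subseteq> U" using K[OF xK(1)] xK by (auto simp: \<gamma>2_def)
      qed
      show "(\<Union>z\<in>?I. (\<lambda>(s, t). {s<..<t}) z) \<in> sets lebesgue"
        using finq by (intro sets.finite_UN) auto
    qed
    also have "\<dots> < \<delta>" by (rule Um)
    finally show ?thesis .
  qed
  have sum_q: "(\<Sum>(x, K)\<in>q. \<bar>F (Sup K) - F (Inf K)\<bar>) < c"
  proof -
    have "\<forall>(s, t)\<in>?I. a \<le> s \<and> s \<le> t \<and> t \<le> b"
    proof
      fix z assume "z \<in> ?I"
      then obtain x K where "(x, K) \<in> p" "z = (Inf K, Sup K)" using qp by (auto simp: g_def)
      then show "case z of (s, t) \<Rightarrow> a \<le> s \<and> s \<le> t \<and> t \<le> b" using K[of x K] by auto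
    qed
    then have "(\<Sum>(s, t)\<in>?I. \<bar>F t - F s\<bar>) < c"
      using AC[rule_format, of ?I] finq disjI small by blast
    then show ?thesis unfolding sumI[of "\<lambda>s t. \<bar>F t - F s\<bar>"] .
  qed
  have "F b - F a = (\<Sum>(x, K)\<in>p. F (Sup K) - F (Inf K))"
    using additive_tagged_division_1[OF less_imp_le[OF ab] p(1), of F] by simp
  also have "\<dots> \<le> (\<Sum>z\<in>p. (case z of (x, K) \<Rightarrow> measure lborel K *\<^sub>R k' x) + c * (case z of (x, K) \<Rightarrow> Sup K - Inf K)
      + (if z \<in> q then (case z of (x, K) \<Rightarrow> \<bar>F (Sup K) - F (Inf K)\<bar>) else 0))"
  proof (rule sum_mono)
    fix z assume zp: "z \<in> p"
    obtain x K where z: "z = (x, K)" by (metis surj_pair)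
    let ?u = "Inf K" and ?v = "Sup K"
    have xK: "?u \<le> x" "x \<le> ?v" "a \<le> ?u" "?v \<le> b" "K = {?u..?v}" "x \<in> {a..b}" "measure lborel K = ?v - ?u" "K \<subseteq> \<gamma>2 x"
      using K zp z by blast+
    have uv: "?u \<in> K" "?v \<in> K"
    proof -
      have "?u \<in> {?u..?v}" "?v \<in> {?u..?v}" using xK(1,2) by auto
      then show "?u \<in> K" "?v \<in> K" using xK(5) by simp_all
    qed
    have "F ?v - F ?u \<le> measure lborel K * k' x + c * (?v - ?u) + (if z \<in> q then \<bar>F ?v - F ?u\<bar> else 0)"
    proof (cases "x \<in> N")
      case True
      have "c * (?v - ?u) \<ge> 0" using c xK(1,2) by simp
      moreover have "F ?v - F ?u \<le> (if z \<in> q then \<bar>F ?v - F ?u\<bar> else 0)"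
        using True zp xK(1,2) z by (cases "?u = ?v") (auto simp: q_def)
      ultimately show ?thesis using True by (simp add: k'_def)
    next
      case False
      have "?u \<in> ball x (d x)" "?v \<in> ball x (d x)" using uv xK(8) False by (auto simp: \<gamma>2_def)
      then have d': "\<bar>?u - x\<bar> < d x" "\<bar>?v - x\<bar> < d x" by (auto simp: dist_real_def)
      have "\<bar>F ?u - F x - D x * (?u - x)\<bar> \<le> c * \<bar>?u - x\<bar>" "\<bar>F ?v - F x - D x * (?v - x)\<bar> \<le> c * \<bar>?v - x\<bar>"
        using d(2)[of x ?u] d(2)[of x ?v] d' False xK(6) by blast+
      then have "F ?v - F ?u \<le> D x * (?v - x) - D x * (?u - x) + c * (?v - x) + c * (x - ?u)"
        using xK(1,2) by (auto simp: abs_le_iff)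
      then have "F ?v - F ?u \<le> D x * (?v - ?u) + c * (?v - ?u)" by (simp add: algebra_simps)
      moreover have "D x * (?v - ?u) \<le> k x * (?v - ?u)"
        using False xK by (intro mult_right_mono) (auto simp: N_def)
      moreover have "z \<notin> q" using False z by (auto simp: q_def)
      ultimately show ?thesis using False xK(7) by (simp add: k'_def mult.commute)
    qed
    then show "(case z of (x, K) \<Rightarrow> F (Sup K) - F (Inf K)) \<le> (case z of (x, K) \<Rightarrow> measure lborel K *\<^sub>R k' x)
        + c * (case z of (x, K) \<Rightarrow> Sup K - Inf K)
        + (if z \<in> q then (case z of (x, K) \<Rightarrow> \<bar>F (Sup K) - F (Inf K)\<bar>) else 0)"
      unfolding z prod.case real_scaleR_def .
  qed
  also have "\<dots> = (\<Sum>(x, K)\<in>p. measure lborel K *\<^sub>R k' x) + c * (\<Sum>(x, K)\<in>p. Sup K - Inf K)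
      + (\<Sum>(x, K)\<in>q. \<bar>F (Sup K) - F (Inf K)\<bar>)"
    unfolding sum.distrib sum_distrib_left[symmetric]
    using sum.mono_neutral_cong_left[OF finp qp, of "\<lambda>z. if z \<in> q then (case z of (x, K) \<Rightarrow> \<bar>F (Sup K) - F (Inf K)\<bar>) else 0"
        "\<lambda>z. case z of (x, K) \<Rightarrow> \<bar>F (Sup K) - F (Inf K)\<bar>"] by auto
  also have "(\<Sum>(x, K)\<in>p. Sup K - Inf K) = b - a"
    using additive_tagged_division_1[OF less_imp_le[OF ab] p(1), of "\<lambda>x. x"] by simp
  also have "(\<Sum>(x, K)\<in>p. measure lborel K *\<^sub>R k' x) \<le> integral {a..b} k + c"
    using \<gamma>1 p(1) fine(1) by (force simp: abs_less_iff)
  also have "integral {a..b} k + c + c * (b - a) + (\<Sum>(x, K)\<in>q. \<bar>F (Sup K) - F (Inf K)\<bar>)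
      \<le> integral {a..b} k + (c + c * (b - a) + c)" using sum_q by simp
  also have "c + c * (b - a) + c = c * (2 + (b - a))" by (simp add: algebra_simps)
  also have "\<dots> = e" using ab by (simp add: c_def)
  finally show "F b - F a \<le> integral {a..b} k + e" by simp
qed

lemma borel_measurable_lebesgue_on_AE:
  fixes f g :: "real \<Rightarrow> real"
  assumes S: "S \<in> sets lebesgue" and f: "f \<in> borel_measurable (lebesgue_on S)"
    and eq: "AE x in lebesgue_on S. f x = g x"
  shows "g \<in> borel_measurable (lebesgue_on S)"
proof -
  have "(\<lambda>x. indicator S x *\<^sub>R f x) \<in> borel_measurable lebesgue"
    using f S by (subst (asm) borel_measurable_restrict_space_iff) auto
  moreover have "AE x in lebesgue. indicator S x *\<^sub>R f x = indicator S x *\<^sub>R g x"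
    using eq S by (subst (asm) AE_restrict_space_iff) (auto simp: indicator_def)
  ultimately have "(\<lambda>x. indicator S x *\<^sub>R g x) \<in> borel_measurable lebesgue"
    by (rule borel_measurable_AE)
  then show ?thesis using S by (subst borel_measurable_restrict_space_iff) auto
qed

lemma integrable_lebesgue_on_subset:
  fixes f :: "real \<Rightarrow> real"
  assumes "integrable (lebesgue_on S) f" "A \<subseteq> S" "A \<in> sets lebesgue" "S \<in> sets lebesgue"
  shows "integrable (lebesgue_on A) f"
proof -
  have "set_integrable lebesgue S f"
    using assms(1,4) by (simp add: set_integrable_def integrable_restrict_space)
  then have "set_integrable lebesgue A f"
    by (rule set_integrable_subset) (use assms in auto)
  then show ?thesis using assms(3) by (simp add: set_integrable_def integrable_restrict_space)
qed

text \<open>Testing with differences of steepening smooth steps, whose derivatives are approximate point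
  masses.\<close>

lemma weak_time_deriv_increment:
  fixes a b :: "real \<Rightarrow> real"
  assumes w: "weak_time_deriv T a b" and cont: "continuous_on {0..T} a"
    and int: "integrable (lebesgue_on {0<..<T}) b" and st: "0 < s" "s < t" "t < T"
  shows "a t - a s = (LINT r|lebesgue_on {s..t}. b r)"
proof -
  obtain S S' :: "real \<Rightarrow> real" where SS: "smooth S"
    "\<And>x. (S has_real_derivative S' x) (at x)" "continuous_on UNIV S'" "\<And>x. 0 \<le> S' x"
    "\<And>x. x \<le> 0 \<Longrightarrow> S x = 0" "\<And>x. x \<ge> 1 \<Longrightarrow> S x = 1" "\<And>x. 0 \<le> S x \<and> S x \<le> 1"
    "\<And>x. x \<le> 0 \<or> x \<ge> 1 \<Longrightarrow> S' x = 0"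
    by (rule smooth_step_exists) blast
  let ?M = "lebesgue_on {0<..<T}"
  define st where "st = (\<lambda>(m::nat) c x. S (real (Suc m) * x + - real (Suc m) * c))"
  define \<phi> where "\<phi> = (\<lambda>m x. st m s x + (-1) * st m t x)"
  \<comment> \<open>The derivative of the step at \<open>c\<close>: a unit mass concentrated on \<open>[c, c + 1 / (m + 1)]\<close>.\<close>
  define \<mu> where "\<mu> = (\<lambda>(m::nat) c x. real (Suc m) * S' (real (Suc m) * (x - c)))"
  have st_deriv: "(st m c has_real_derivative \<mu> m c x) (at x)" for m c x
  proof -
    have "((\<lambda>x. S (real (Suc m) * x + - real (Suc m) * c)) has_real_derivative
        S' (real (Suc m) * x + - real (Suc m) * c) * real (Suc m)) (at x)"
      by (rule DERIV_chain2[OF SS(2)]) (auto intro!: derivative_eq_intros)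
    then show ?thesis by (simp add: st_def \<mu>_def algebra_simps)
  qed
  have \<phi>_deriv: "deriv (\<phi> m) x = \<mu> m s x - \<mu> m t x" for m x
  proof (rule DERIV_imp_deriv)
    show "(\<phi> m has_real_derivative \<mu> m s x - \<mu> m t x) (at x)"
      unfolding \<phi>_def using DERIV_add[OF st_deriv[of m s x] DERIV_cmult[OF st_deriv[of m t x], of "-1"]] by simp
  qed
  have \<mu>_cont: "continuous_on A (\<mu> m c)" for A m c
    unfolding \<mu>_def by (intro continuous_intros continuous_on_compose2[OF SS(3)]) auto
  have \<mu>_supp: "\<mu> m c x = 0" if "x \<le> c \<or> c + 1 / real (Suc m) \<le> x" for m c x
  proof -
    have "real (Suc m) * (x - c) \<le> 0 \<or> real (Suc m) * (x - c) \<ge> 1"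
      using that by (auto simp: field_simps mult_le_0_iff simp del: of_nat_Suc)
    then show ?thesis using SS(8) by (simp add: \<mu>_def)
  qed
  have mass: "(\<mu> m c has_integral 1) {c..c + 1 / real (Suc m)}" for m c
  proof -
    have "(\<mu> m c has_integral st m c (c + 1 / real (Suc m)) - st m c c) {c..c + 1 / real (Suc m)}"
      by (rule fundamental_theorem_of_calculus)
         (auto intro!: has_vector_derivative_at_within[OF st_deriv[unfolded has_real_derivative_iff_has_vector_derivative]])
    moreover have "st m c (c + 1 / real (Suc m)) = 1" "st m c c = 0"
      using SS(5)[of 0] SS(6)[of 1] by (simp_all add: st_def algebra_simps add_divide_distrib[symmetric] del: of_nat_Suc)
    ultimately show ?thesis by simp
  qed
  have point: "(\<lambda>m. LINT x|?M. a x * \<mu> m c x) \<longlonglongrightarrow> a c"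
    and point_int: "\<forall>\<^sub>F m in sequentially. integrable ?M (\<lambda>x. a x * \<mu> m c x)" if c: "0 < c" "c < T" for c
  proof -
    have ev: "\<forall>\<^sub>F m in sequentially. 1 / real (Suc m) < y" if "y > 0" for y :: real
      using order_tendstoD(2)[OF LIMSEQ_inverse_real_of_nat that] by (simp add: inverse_eq_divide)
    have int_all: "integrable ?M (\<lambda>x. a x * \<mu> m c x)" for m
      by (rule integrable_lebesgue_on_subset[of "{0..T}"])
         (auto intro!: continuous_imp_integrable_real continuous_intros cont \<mu>_cont)
    then show "\<forall>\<^sub>F m in sequentially. integrable ?M (\<lambda>x. a x * \<mu> m c x)" by simp
    show "(\<lambda>m. LINT x|?M. a x * \<mu> m c x) \<longlonglongrightarrow> a c"
    proof (rule LIM_zero_cancel, rule tendstoI)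
      fix e :: real assume "e > 0"
      have "isCont a c"
        using cont c by (intro continuous_on_interior[of "{0..T}"]) auto
      then obtain d where d: "d > 0" "\<And>x. \<bar>x - c\<bar> < d \<Longrightarrow> \<bar>a x - a c\<bar> < e / 2"
        using \<open>e > 0\<close> unfolding continuous_at_eps_delta by (metis dist_real_def half_gt_zero)
      have "\<forall>\<^sub>F m in sequentially. 1 / real (Suc m) < min d (T - c)"
        using ev[of d] ev[of "T - c"] c d(1) by (simp add: eventually_conj_iff)
      then show "\<forall>\<^sub>F m in sequentially. dist ((LINT x|?M. a x * \<mu> m c x) - a c) 0 < e"
      proof eventually_elim
        case (elim m)
        let ?J = "{c..c + 1 / real (Suc m)}"
        have J: "?J \<subseteq> {0<..<T}" "?J \<subseteq> {0..T}" using elim c by auto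
        have "(LINT x|?M. a x * \<mu> m c x) = integral {0<..<T} (\<lambda>x. a x * \<mu> m c x)"
          by (rule lebesgue_integral_eq_integral[OF int_all]) simp
        also have "\<dots> = integral ?J (\<lambda>x. a x * \<mu> m c x)"
          by (rule integral_spike_set) (use J \<mu>_supp in \<open>auto intro!: negligible_subset[of "{}"]\<close>)
        finally have 1: "(LINT x|?M. a x * \<mu> m c x) = integral ?J (\<lambda>x. a x * \<mu> m c x)" .
        have cJ: "continuous_on ?J a" using cont J(2) continuous_on_subset by blast
        have "integral ?J (\<lambda>x. a x * \<mu> m c x) - a c = integral ?J (\<lambda>x. a x * \<mu> m c x - a c * \<mu> m c x)"
          using mass[of m c] cJ
          by (subst Henstock_Kurzweil_Integration.integral_diff)
             (auto intro!: integrable_continuous_real continuous_intros \<mu>_cont simp: integral_unique)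
        also have "norm \<dots> \<le> integral ?J (\<lambda>x. e / 2 * \<mu> m c x)"
        proof (rule integral_norm_bound_integral)
          show "(\<lambda>x. a x * \<mu> m c x - a c * \<mu> m c x) integrable_on ?J" "(\<lambda>x. e / 2 * \<mu> m c x) integrable_on ?J"
            using cJ by (auto intro!: integrable_continuous_real continuous_intros \<mu>_cont)
          fix x assume x: "x \<in> ?J"
          then have "\<bar>x - c\<bar> < d" using elim by auto
          then have "\<bar>a x - a c\<bar> * \<mu> m c x \<le> e / 2 * \<mu> m c x"
            using d(2)[of x] SS(4) by (intro mult_right_mono) (auto simp: \<mu>_def)
          then show "norm (a x * \<mu> m c x - a c * \<mu> m c x) \<le> e / 2 * \<mu> m c x"
            using SS(4) by (simp add: left_diff_distrib[symmetric] abs_mult \<mu>_def)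
        qed
        also have "\<dots> = e / 2" using mass[of m c] by (simp add: integral_unique)
        finally show ?case using 1 \<open>e > 0\<close> by (simp add: dist_real_def)
      qed
    qed
  qed
  have lim1: "(\<lambda>m. LINT x|?M. a x * deriv (\<phi> m) x) \<longlonglongrightarrow> a s - a t"
  proof (rule Lim_transform_eventually)
    show "(\<lambda>m. (LINT x|?M. a x * \<mu> m s x) - (LINT x|?M. a x * \<mu> m t x)) \<longlonglongrightarrow> a s - a t"
      using st by (intro tendsto_diff point) auto
    have "\<forall>\<^sub>F m in sequentially. integrable ?M (\<lambda>x. a x * \<mu> m s x) \<and> integrable ?M (\<lambda>x. a x * \<mu> m t x)"
      using st by (intro eventually_conj point_int) auto
    then show "\<forall>\<^sub>F m in sequentially. (LINT x|?M. a x * \<mu> m s x) - (LINT x|?M. a x * \<mu> m t x)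
        = (LINT x|?M. a x * deriv (\<phi> m) x)"
      by eventually_elim (simp add: \<phi>_deriv right_diff_distrib)
  qed
  have \<phi>_cont: "continuous_on A (\<phi> m)" for A m
    unfolding \<phi>_def st_def
    by (intro continuous_intros continuous_on_compose2[OF smooth_continuous_on[OF SS(1), of UNIV]]) auto
  have lim2: "(\<lambda>m. LINT x|?M. b x * \<phi> m x) \<longlonglongrightarrow> (LINT x|?M. b x * indicator {s<..t} x)"
  proof (rule integral_dominated_convergence[where w = "\<lambda>x. \<bar>b x\<bar>"])
    have b[measurable]: "b \<in> borel_measurable ?M" using int by auto
    have "\<phi> m \<in> borel_measurable ?M" for m
      by (intro continuous_imp_measurable_on_sets_lebesgue \<phi>_cont) auto
    with b show "(\<lambda>x. b x * \<phi> m x) \<in> borel_measurable ?M" for m by (intro borel_measurable_times)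
    have "(indicator {s<..t} :: real \<Rightarrow> real) \<in> borel_measurable ?M"
      by (intro borel_measurable_indicator) (use st in \<open>auto simp: sets_restrict_space_iff\<close>)
    with b show "(\<lambda>x. b x * indicator {s<..t} x) \<in> borel_measurable ?M" by (intro borel_measurable_times)
    show "integrable ?M (\<lambda>x. \<bar>b x\<bar>)" using int by simp
    have lim_st: "(\<lambda>m. st m c x) \<longlonglongrightarrow> (if x \<le> c then 0 else 1)" for c x
    proof (cases "x \<le> c")
      case True
      then have "real (Suc m) * x + - real (Suc m) * c \<le> 0" for m
        by (simp add: mult_left_mono del: of_nat_Suc)
      then show ?thesis using True SS(5) by (simp add: st_def)
    next
      case False
      then have "0 < x - c" by simp
      then have "\<forall>\<^sub>F m in sequentially. inverse (real (Suc m)) < x - c"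
        by (rule order_tendstoD(2)[OF LIMSEQ_inverse_real_of_nat])
      then have "\<forall>\<^sub>F m in sequentially. st m c x = 1"
      proof eventually_elim
        case (elim m)
        then have "1 \<le> real (Suc m) * x + - real (Suc m) * c"
          by (simp add: field_simps del: of_nat_Suc)
        then show ?case using SS(6) by (simp add: st_def)
      qed
      then show ?thesis using False by (simp add: tendsto_eventually)
    qed
    have "(\<lambda>m. \<phi> m x) \<longlonglongrightarrow> indicator {s<..t} x" for x
    proof -
      have "(\<lambda>m. \<phi> m x) \<longlonglongrightarrow> (if x \<le> s then 0 else 1) + (-1) * (if x \<le> t then 0 else 1)"
        unfolding \<phi>_def by (intro tendsto_intros lim_st)
      also have "(if x \<le> s then 0 else 1) + (-1) * (if x \<le> t then 0 else 1) = (indicator {s<..t} x :: real)"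
        using st by (auto simp: indicator_def)
      finally show ?thesis .
    qed
    then show "AE x in ?M. (\<lambda>m. b x * \<phi> m x) \<longlonglongrightarrow> b x * indicator {s<..t} x"
      by (intro AE_I2 tendsto_mult tendsto_const)
    have "\<bar>\<phi> m x\<bar> \<le> 1" for m x
      using SS(7) unfolding \<phi>_def st_def abs_le_iff
      by (auto simp: add_increasing add_increasing2 diff_le_eq intro: order_trans)
    then show "AE x in ?M. norm (b x * \<phi> m x) \<le> \<bar>b x\<bar>" for m
      by (intro AE_I2) (auto simp: abs_mult mult_left_le)
  qed
  have test: "\<forall>\<^sub>F m in sequentially. \<phi> m \<in> test_functions {0<..<T}"
  proof -
    have "\<forall>\<^sub>F m in sequentially. inverse (real (Suc m)) < T - t"
      by (rule order_tendstoD(2)[OF LIMSEQ_inverse_real_of_nat]) (use st in simp)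
    then show ?thesis
    proof eventually_elim
      case (elim m)
      show ?case
      proof (rule test_functionsI[of _ "{s..t + inverse (real (Suc m))}"])
        show "smooth (\<phi> m)" unfolding \<phi>_def st_def
          by (intro smooth_add smooth_mult smooth_const smooth_affine SS
              bounded_linear_const_mult bounded_linear_ident)
        show "{s..t + inverse (real (Suc m))} \<subseteq> {0<..<T}" using st elim by auto
        fix x assume "x \<notin> {s..t + inverse (real (Suc m))}"
        then consider "x < s" | "x > t + inverse (real (Suc m))" by fastforce
        then show "\<phi> m x = 0"
        proof cases
          case 1
          then have "real (Suc m) * x + - real (Suc m) * s \<le> 0" "real (Suc m) * x + - real (Suc m) * t \<le> 0"
            using st by (auto simp del: of_nat_Suc intro!: mult_left_mono)
          then show ?thesis using SS(5) by (simp add: \<phi>_def st_def)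
        next
          case 2
          then have 1: "1 \<le> real (Suc m) * x + - real (Suc m) * t"
            by (simp add: field_simps del: of_nat_Suc)
          moreover have "real (Suc m) * s \<le> real (Suc m) * t" using st by (intro mult_left_mono) auto
          ultimately have "1 \<le> real (Suc m) * x + - real (Suc m) * s" by linarith
          with 1 show ?thesis using SS(6) by (simp add: \<phi>_def st_def)
        qed
      qed simp
    qed
  qed
  have "(\<lambda>m. - (LINT x|?M. b x * \<phi> m x)) \<longlonglongrightarrow> a s - a t"
  proof (rule Lim_transform_eventually[OF lim1])
    show "\<forall>\<^sub>F m in sequentially. (LINT x|?M. a x * deriv (\<phi> m) x) = - (LINT x|?M. b x * \<phi> m x)"
      using test by eventually_elim (use w in \<open>simp add: weak_time_deriv_def\<close>)
  qed
  then have "a s - a t = - (LINT x|?M. b x * indicator {s<..t} x)"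
    using tendsto_minus[OF lim2] LIMSEQ_unique by blast
  moreover have "(LINT x|?M. b x * indicator {s<..t} x) = (LINT r|lebesgue_on {s..t}. b r)"
  proof -
    have "(LINT x|?M. b x * indicator {s<..t} x) = (LINT x|lebesgue. indicator {0<..<T} x *\<^sub>R (b x * indicator {s<..t} x))"
      by (rule integral_restrict_space) simp
    also have "(\<lambda>x. indicator {0<..<T} x *\<^sub>R (b x * indicator {s<..t} x)) = (\<lambda>x. indicator {s<..t} x *\<^sub>R b x)"
      using st by (auto simp: indicator_def)
    also have "(LINT x|lebesgue. indicator {s<..t} x *\<^sub>R b x) = (LINT x|lebesgue. indicator {s..t} x *\<^sub>R b x)"
    proof (rule integral_cong_AE)
      have m: "(\<lambda>x. indicator A x *\<^sub>R b x) \<in> borel_measurable lebesgue" if "A \<in> {{s<..t}, {s..t}}" for A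
      proof -
        have "A \<subseteq> {0<..<T}" "A \<in> sets lebesgue" using that st by auto
        then have "integrable (lebesgue_on A) b"
          using integrable_lebesgue_on_subset[OF int] by auto
        then show ?thesis
          using \<open>A \<in> sets lebesgue\<close> by (subst (asm) integrable_restrict_space) auto
      qed
      show "(\<lambda>x. indicator {s<..t} x *\<^sub>R b x) \<in> borel_measurable lebesgue"
        "(\<lambda>x. indicator {s..t} x *\<^sub>R b x) \<in> borel_measurable lebesgue" using m by blast+
      have "AE x in lebesgue. x \<noteq> s" by (rule AE_completion) (rule AE_lborel_singleton)
      then show "AE x in lebesgue. indicator {s<..t} x *\<^sub>R b x = indicator {s..t} x *\<^sub>R b x"
        by eventually_elim (auto simp: indicator_def)
    qed
    also have "\<dots> = (LINT r|lebesgue_on {s..t}. b r)" by (rule integral_restrict_space[symmetric]) simp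
    finally show ?thesis .
  qed
  ultimately show ?thesis by simp
qed

section \<open>The logarithmic source term\<close>

lemma abs_mult_ln_le_1:
  assumes "0 < x" "x \<le> (1::real)"
  shows "x * \<bar>ln x\<bar> \<le> 1"
proof -
  have "ln (1 / x) \<le> 1 / x - 1" using assms by (intro ln_le_minus_one) simp
  then have "- ln x \<le> 1 / x - 1" using assms by (simp add: ln_div)
  then have "x * (- ln x) \<le> x * (1 / x - 1)" using assms by (intro mult_left_mono) auto
  also have "\<dots> \<le> 1" using assms by (simp add: right_diff_distrib)
  finally show ?thesis using assms by (simp add: abs_of_nonpos)
qed

text \<open>The logarithm is absorbed by the gap between \<open>pp\<close> and \<open>q\<close> for large \<open>r\<close> and by one power of \<open>r\<close> for
  small \<open>r\<close>.\<close>

lemma source_growth: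
  assumes "2 < P" "P \<le> pp" "pp < q"
  shows "\<bar>source P r\<bar> \<le> 1 + \<bar>r\<bar> powr (q - 1) / (q - pp)"
proof -
  have nn: "0 \<le> \<bar>r\<bar> powr (q - 1) / (q - pp)" using assms by simp
  consider "r = 0" | "r \<noteq> 0" "\<bar>r\<bar> \<le> 1" | "1 < \<bar>r\<bar>" by linarith
  then show ?thesis
  proof cases
    case 2
    have "\<bar>r\<bar> powr (P - 2) \<le> 1" using 2 assms by (intro powr_le1) auto
    moreover have "\<bar>r\<bar> * \<bar>ln \<bar>r\<bar>\<bar> \<le> 1" using 2 by (intro abs_mult_ln_le_1) auto
    ultimately have "\<bar>r\<bar> powr (P - 2) * (\<bar>r\<bar> * \<bar>ln \<bar>r\<bar>\<bar>) \<le> 1 * 1"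
      by (rule mult_mono[OF _ _ zero_le_one mult_nonneg_nonneg[OF abs_ge_zero abs_ge_zero]])
    then show ?thesis using 2 nn by (simp add: source_def abs_mult mult.assoc)
  next
    case 3
    have "ln \<bar>r\<bar> \<le> \<bar>r\<bar> powr (q - pp) / (q - pp)" using 3 assms by (intro ln_powr_bound) auto
    then have "\<bar>r\<bar> powr (P - 1) * ln \<bar>r\<bar> \<le> \<bar>r\<bar> powr (pp - 1) * (\<bar>r\<bar> powr (q - pp) / (q - pp))"
      using 3 assms by (intro mult_mono powr_mono) auto
    also have "\<dots> = \<bar>r\<bar> powr (q - 1) / (q - pp)" by (simp add: powr_add[symmetric])
    finally have "\<bar>r\<bar> powr (P - 1) * ln \<bar>r\<bar> \<le> \<bar>r\<bar> powr (q - 1) / (q - pp)" .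
    moreover have "\<bar>source P r\<bar> = \<bar>r\<bar> powr (P - 1) * ln \<bar>r\<bar>"
      using 3 powr_add[of "\<bar>r\<bar>" "P - 2" 1] by (simp add: source_def abs_mult mult.assoc)
    ultimately show ?thesis by simp
  qed (use nn in \<open>simp add: source_def\<close>)
qed

lemma source_mult_bound:
  assumes "2 < P" "P \<le> pp" "pp < q"
  shows "\<bar>source P r * z\<bar> \<le> (1 + 1 / (q - pp)) * (1 + \<bar>r\<bar> powr q + \<bar>z\<bar> powr q)"
proof -
  have q: "1 \<le> q" using assms by simp
  have z1: "\<bar>z\<bar> \<le> 1 + \<bar>z\<bar> powr q"
  proof (cases "\<bar>z\<bar> \<le> 1")
    case False
    then have "\<bar>z\<bar> powr 1 \<le> \<bar>z\<bar> powr q" using q by (intro powr_mono) auto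
    then show ?thesis using False by simp
  qed (simp add: add_increasing2)
  have rz: "\<bar>r\<bar> powr (q - 1) * \<bar>z\<bar> \<le> \<bar>r\<bar> powr q + \<bar>z\<bar> powr q"
  proof -
    define m where "m = max \<bar>r\<bar> \<bar>z\<bar>"
    have m: "0 \<le> m" "\<bar>r\<bar> \<le> m" "\<bar>z\<bar> \<le> m" by (auto simp: m_def)
    have "\<bar>r\<bar> powr (q - 1) * \<bar>z\<bar> \<le> m powr (q - 1) * m"
      using m q by (intro mult_mono powr_mono2) auto
    also have "\<dots> = m powr q" using m powr_add[of m "q - 1" 1] by (cases "m = 0") auto
    also have "\<dots> \<le> \<bar>r\<bar> powr q + \<bar>z\<bar> powr q" by (auto simp: m_def max_def)
    finally show ?thesis .
  qed
  have "\<bar>source P r * z\<bar> \<le> (1 + \<bar>r\<bar> powr (q - 1) / (q - pp)) * \<bar>z\<bar>"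
    unfolding abs_mult by (intro mult_right_mono source_growth assms) simp
  also have "\<dots> = \<bar>z\<bar> + (1 / (q - pp)) * (\<bar>r\<bar> powr (q - 1) * \<bar>z\<bar>)" by (simp add: algebra_simps)
  also have "\<dots> \<le> (1 + \<bar>r\<bar> powr q + \<bar>z\<bar> powr q) + (1 / (q - pp)) * (1 + \<bar>r\<bar> powr q + \<bar>z\<bar> powr q)"
    using assms z1 rz by (intro add_mono mult_left_mono) (auto intro: order_trans[OF z1] order_trans[OF rz])
  finally show ?thesis by (simp add: distrib_right)
qed

lemma source_primitive_eq:
  assumes "0 < P"
  shows "source_primitive P r = source P r * r / P - \<bar>r\<bar> powr P / P\<^sup>2"
proof (cases "r = 0")
  case False
  have "\<bar>r\<bar> powr (P - 2) * r * r = \<bar>r\<bar> powr P"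
  proof -
    have "\<bar>r\<bar> powr (P - 2) * \<bar>r\<bar> powr 2 = \<bar>r\<bar> powr P" by (subst powr_add[symmetric]) simp
    then show ?thesis by (simp add: power2_eq_square mult.assoc)
  qed
  then have "source P r * r = \<bar>r\<bar> powr P * ln \<bar>r\<bar>"
    using False by (simp add: source_def mult_ac)
  then show ?thesis using False by (simp add: source_primitive_def)
qed (simp add: source_def source_primitive_def)

lemma powr_le_1_powr:
  fixes P q r :: real
  assumes "0 < P" "P \<le> q"
  shows "\<bar>r\<bar> powr P \<le> 1 + \<bar>r\<bar> powr q"
proof (cases "\<bar>r\<bar> \<le> 1")
  case True
  then have "\<bar>r\<bar> powr P \<le> 1" using assms by (intro powr_le1) auto
  then show ?thesis by (simp add: add_increasing2)
next
  case False
  then have "\<bar>r\<bar> powr P \<le> \<bar>r\<bar> powr q" using assms by (intro powr_mono) auto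
  then show ?thesis by simp
qed

text \<open>For \<open>P > pm\<close> the difference is the function \<open>a y ln y + b y\<close> of \<open>y = \<bar>r\<bar> powr P\<close> with
  \<open>a = (P - pm) / P\<^sup>2\<close> and \<open>b = pm / P\<^sup>2\<close>, whose minimum is \<open>- c_shift pm P\<close>.\<close>

lemma source_ge_primitive:
  assumes pm: "0 < pm" "pm \<le> P"
  shows "pm * source_primitive P r - c_shift pm P \<le> source P r * r"
proof (cases "r = 0")
  case True
  have "c_shift pm P \<ge> 0" using pm by (simp add: c_shift_def)
  with True show ?thesis by (simp add: source_def source_primitive_def)
next
  case False
  define y where "y = \<bar>r\<bar> powr P"
  have y: "y > 0" using False by (simp add: y_def)
  have lny: "ln y = P * ln \<bar>r\<bar>" using False by (simp add: y_def ln_powr)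
  have P: "P > 0" using pm by simp
  have "\<bar>r\<bar> powr (P - 2) * \<bar>r\<bar> powr 2 = y" unfolding y_def by (subst powr_add[symmetric]) simp
  then have sr: "source P r * r = y * ln \<bar>r\<bar>"
    using False by (simp add: source_def power2_eq_square mult_ac)
  have prim: "source_primitive P r = y / P * ln \<bar>r\<bar> - y / P\<^sup>2"
    using False by (simp add: source_primitive_def y_def)
  have "P\<^sup>2 * (source P r * r - pm * source_primitive P r) = (P - pm) * (y * ln y) + pm * y"
    unfolding sr prim lny using P by (simp add: field_simps power2_eq_square)
  moreover have "- (P\<^sup>2 * c_shift pm P) \<le> (P - pm) * (y * ln y) + pm * y"
  proof (cases "P > pm")
    case True
    define a where "a = P - pm"
    have a: "a > 0" using True by (simp add: a_def)
    \<comment> \<open>The minimizer of \<open>a y ln y + pm y\<close>; the tangent inequality for the logarithm at \<open>y0\<close> is the convexity bound.\<close>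
    define y0 where "y0 = exp (- P / a)"
    have y0: "y0 > 0" "ln y0 = - P / a" by (simp_all add: y0_def)
    have "ln (y0 / y) \<le> y0 / y - 1" using y y0 by (intro ln_le_minus_one) simp
    then have "y * (ln y0 - ln y) \<le> y * (y0 / y - 1)"
      using y y0 by (intro mult_left_mono) (auto simp: ln_div)
    also have "\<dots> = y0 - y" using y by (simp add: right_diff_distrib)
    finally have "a * (y * (ln y0 - ln y)) \<le> a * (y0 - y)" using a by (intro mult_left_mono) auto
    moreover have "a * (y * (ln y0 - ln y)) = - P * y - a * (y * ln y)"
      using a by (simp add: y0(2) algebra_simps)
    ultimately have "- (a * y0) \<le> a * (y * ln y) + P * y - a * y" by (simp add: algebra_simps)
    moreover have "P\<^sup>2 * c_shift pm P = a * y0"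
      using True P by (simp add: c_shift_def a_def y0_def)
    ultimately show ?thesis by (simp add: a_def algebra_simps)
  next
    case False
    then show ?thesis using pm y by (simp add: c_shift_def)
  qed
  ultimately have "P\<^sup>2 * (pm * source_primitive P r - c_shift pm P) \<le> P\<^sup>2 * (source P r * r)"
    by (simp add: algebra_simps)
  then show ?thesis using P by simp
qed

lemma abs_add_powr_le:
  fixes a b :: real
  assumes "0 < q"
  shows "\<bar>a + b\<bar> powr q \<le> 2 powr q * (\<bar>a\<bar> powr q + \<bar>b\<bar> powr q)"
proof -
  define m where "m = max \<bar>a\<bar> \<bar>b\<bar>"
  have m: "\<bar>a + b\<bar> \<le> 2 * m" "0 \<le> m" by (auto simp: m_def)
  have "\<bar>a + b\<bar> powr q \<le> (2 * m) powr q" using assms m by (intro powr_mono2) auto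
  also have "\<dots> = 2 powr q * m powr q" using m by (simp add: powr_mult)
  also have "\<dots> \<le> 2 powr q * (\<bar>a\<bar> powr q + \<bar>b\<bar> powr q)" by (auto simp: m_def max_def)
  finally show ?thesis .
qed

lemma LIMSEQ_by_subsequences:
  fixes x :: "nat \<Rightarrow> real"
  assumes "\<And>s :: nat \<Rightarrow> nat. strict_mono s \<Longrightarrow> \<exists>r. strict_mono r \<and> (\<lambda>k. x (s (r k))) \<longlonglongrightarrow> l"
  shows "x \<longlonglongrightarrow> l"
proof (rule ccontr)
  assume "\<not> x \<longlonglongrightarrow> l"
  then obtain e where e: "e > 0" "\<not> (\<forall>\<^sub>F n in sequentially. dist (x n) l < e)"
    unfolding tendsto_iff by blast
  then have "infinite {n. \<not> dist (x n) l < e}"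
    by (simp add: eventually_cofinite cofinite_eq_sequentially[symmetric])
  then obtain s :: "nat \<Rightarrow> nat" where s: "strict_mono s" "\<And>n. s n \<in> {n. \<not> dist (x n) l < e}"
    using infinite_enumerate by blast
  obtain r where r: "strict_mono r" "(\<lambda>k. x (s (r k))) \<longlonglongrightarrow> l" using assms[OF s(1)] by blast
  have "\<forall>\<^sub>F k in sequentially. dist (x (s (r k))) l < e" using r(2) e(1) by (rule tendstoD)
  then show False using s(2) by (auto simp: eventually_sequentially)
qed

lemma (in domain) Poincare_norm:
  assumes "z \<in> H01 \<Omega>"
  shows "l2_norm \<Omega> z \<le> l2_norm \<Omega> (weak_grad \<Omega> z) / sqrt (lambda1 \<Omega>)"
proof -
  have "(sqrt (lambda1 \<Omega>) * l2_norm \<Omega> z)\<^sup>2 \<le> (l2_norm \<Omega> (weak_grad \<Omega> z))\<^sup>2"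
    using lambda1_Poincare(2)[OF assms] lambda1_Poincare(1) by (simp add: power_mult_distrib)
  then have "sqrt (lambda1 \<Omega>) * l2_norm \<Omega> z \<le> l2_norm \<Omega> (weak_grad \<Omega> z)"
    by (rule power2_le_imp_le) simp
  then show ?thesis using lambda1_Poincare(1) by (simp add: field_simps)
qed

lemma (in domain) H01_tendsto_L2:
  assumes w: "\<And>k. w k \<in> H01 \<Omega>" "W \<in> H01 \<Omega>"
    and lim: "((\<lambda>k. l2_norm \<Omega> (\<lambda>x. weak_grad \<Omega> (w k) x - weak_grad \<Omega> W x)) \<longlongrightarrow> 0) F"
  shows "((\<lambda>k. l2_norm \<Omega> (\<lambda>x. w k x - W x)) \<longlongrightarrow> 0) F"
proof (rule Lim_null_comparison)
  show "((\<lambda>k. l2_norm \<Omega> (\<lambda>x. weak_grad \<Omega> (w k) x - weak_grad \<Omega> W x) / sqrt (lambda1 \<Omega>)) \<longlongrightarrow> 0) F"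
    using tendsto_divide[OF lim tendsto_const[of "sqrt (lambda1 \<Omega>)"]] lambda1_Poincare(1) by simp
  have "l2_norm \<Omega> (\<lambda>x. w k x - W x) \<le> l2_norm \<Omega> (\<lambda>x. weak_grad \<Omega> (w k) x - weak_grad \<Omega> W x) / sqrt (lambda1 \<Omega>)" for k
    using Poincare_norm[OF weak_grad_diff(1)[OF w]]
      l2_norm_cong_AE[OF weak_grad_L2[OF weak_grad_diff(1)[OF w]]
        L2_diff[OF weak_grad_L2[OF w(1)] weak_grad_L2[OF w(2)]] weak_grad_diff(2)[OF w]] by simp
  then show "\<forall>\<^sub>F k in F. norm (l2_norm \<Omega> (\<lambda>x. w k x - W x))
      \<le> l2_norm \<Omega> (\<lambda>x. weak_grad \<Omega> (w k) x - weak_grad \<Omega> W x) / sqrt (lambda1 \<Omega>)"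
    by (intro always_eventually allI) simp
qed

locale variable_exponent = domain \<Omega> for \<Omega> :: "(real^'n) set" +
  fixes p :: "real^'n \<Rightarrow> real"
  assumes exponent: "H1 \<Omega> p"
begin

abbreviation pm :: real where "pm \<equiv> p_minus \<Omega> p"

text \<open>The exponent \<open>q\<close> lies strictly between the essential supremum of \<open>p\<close> and the critical exponent, and \<open>\<gamma>\<close> is
  the growth rate of cube averages for which the embedding into \<open>L\<^sup>q\<close> holds. In dimensions one and two
  every positive \<open>\<gamma>\<close> is admissible, and a small one is taken.\<close>

lemma exponent_bounds:
  obtains pp q \<gamma> where "2 < pm" "AE x in lebesgue_on \<Omega>. pm \<le> p x \<and> p x \<le> pp" "pp < q"
    "0 < \<gamma>" "CARD('n) / 2 - 1 \<le> \<gamma>" "\<gamma> * (q - 2) < 2" "2 < q"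
proof -
  have H: "2 < p_essinf \<Omega> p"
    "AE x in lebesgue_on \<Omega>. p_essinf \<Omega> p \<le> ereal (p x) \<and> ereal (p x) \<le> p_esssup \<Omega> p"
    "p_esssup \<Omega> p < two_star CARD('n)"
    using exponent by (auto simp: H1_def)
  have "\<exists>x. p_essinf \<Omega> p \<le> ereal (p x) \<and> ereal (p x) \<le> p_esssup \<Omega> p"
  proof (rule ccontr)
    assume neg: "\<not> ?thesis"
    have "AE x in lebesgue_on \<Omega>. False" by (rule eventually_mono[OF H(2)]) (use neg in blast)
    then show False using domain_not_negligible by simp
  qed
  then obtain x0 where x0: "p_essinf \<Omega> p \<le> ereal (p x0)" "ereal (p x0) \<le> p_esssup \<Omega> p" by blast
  have inf_eq: "p_essinf \<Omega> p = ereal pm"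
    using H(1) x0(1) unfolding p_minus_def by (cases "p_essinf \<Omega> p") auto
  have sup_fin: "p_esssup \<Omega> p < \<infinity>" using H(3) by (rule less_le_trans) simp
  then obtain pp where sup_eq: "p_esssup \<Omega> p = ereal pp"
    using x0(2) by (cases "p_esssup \<Omega> p") auto
  have pm2: "2 < pm" using H(1) unfolding inf_eq by (simp add: numeral_eq_ereal)
  have pmpp: "pm \<le> pp" using x0 unfolding inf_eq sup_eq by simp
  have AE: "AE x in lebesgue_on \<Omega>. pm \<le> p x \<and> p x \<le> pp"
    using H(2) unfolding inf_eq sup_eq by simp
  show ?thesis
  proof (cases "CARD('n) \<ge> 3")
    case True
    let ?n = "real CARD('n)"
    have n: "?n \<ge> 3" using True by simp
    have pp: "pp < 2 * ?n / (?n - 2)" using H(3) True unfolding sup_eq by (simp add: two_star_def)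
    define q where "q = (pp + 2 * ?n / (?n - 2)) / 2"
    have q: "pp < q" "q < 2 * ?n / (?n - 2)" using pp by (auto simp: q_def)
    have "(?n / 2 - 1) * (q - 2) < 2"
    proof -
      have "q * (?n - 2) < 2 * ?n" using q(2) n by (simp add: field_simps)
      then show ?thesis by (simp add: algebra_simps)
    qed
    then show ?thesis using that[of pp q "?n / 2 - 1"] pm2 AE q(1) pmpp n by simp
  next
    case False
    then have "real CARD('n) / 2 - 1 \<le> 0" by simp
    also have "0 \<le> 1 / (pp - 1)" using pm2 pmpp by simp
    finally show ?thesis using that[of pp "pp + 1" "1 / (pp - 1)"] pm2 AE pmpp by simp
  qed
qed

lemma pm_gt_2: "2 < pm"
  using exponent_bounds by blast

lemma p_measurable: "p \<in> borel_measurable (lebesgue_on \<Omega>)"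
  using exponent by (simp add: H1_def)

lemma source_measurable:
  assumes v: "v \<in> borel_measurable (lebesgue_on \<Omega>)"
  shows "(\<lambda>x. source (p x) (v x)) \<in> borel_measurable (lebesgue_on \<Omega>)"
    "(\<lambda>x. source_primitive (p x) (v x)) \<in> borel_measurable (lebesgue_on \<Omega>)"
proof -
  note [measurable] = v p_measurable
  show "(\<lambda>x. source (p x) (v x)) \<in> borel_measurable (lebesgue_on \<Omega>)"
    "(\<lambda>x. source_primitive (p x) (v x)) \<in> borel_measurable (lebesgue_on \<Omega>)"
    unfolding source_def source_primitive_def by measurable
qed

lemma source_integrable:
  assumes v: "v \<in> H01 \<Omega>" and z: "z \<in> H01 \<Omega>"
  shows "integrable (lebesgue_on \<Omega>) (\<lambda>x. source (p x) (v x) * z x)"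
    "integrable (lebesgue_on \<Omega>) (\<lambda>x. source_primitive (p x) (v x))"
proof -
  obtain pp q \<gamma> where e: "2 < pm" "AE x in lebesgue_on \<Omega>. pm \<le> p x \<and> p x \<le> pp" "pp < q"
    "0 < \<gamma>" "CARD('n) / 2 - 1 \<le> \<gamma>" "\<gamma> * (q - 2) < 2" "2 < q" by (rule exponent_bounds)
  obtain K where K: "\<And>z. z \<in> H01 \<Omega> \<Longrightarrow> integrable (lebesgue_on \<Omega>) (\<lambda>x. \<bar>z x\<bar> powr q)"
    using Sobolev_H01[OF e(4-7)] by blast
  interpret finite_measure "lebesgue_on \<Omega>" by (rule finite_measure_domain)
  note [measurable] = L2_measurable[OF H01_L2[OF v]] L2_measurable[OF H01_L2[OF z]]
    source_measurable[OF L2_measurable[OF H01_L2[OF v]]] p_measurable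
  have int: "integrable (lebesgue_on \<Omega>) (\<lambda>x. source (p x) (v x) * z x)"
    if z: "z \<in> H01 \<Omega>" for z
  proof (rule Bochner_Integration.integrable_bound)
    show "integrable (lebesgue_on \<Omega>) (\<lambda>x. (1 + 1 / (q - pp)) * (1 + \<bar>v x\<bar> powr q + \<bar>z x\<bar> powr q))"
      using K[OF v] K[OF z] by simp
    show "(\<lambda>x. source (p x) (v x) * z x) \<in> borel_measurable (lebesgue_on \<Omega>)"
      using L2_measurable[OF H01_L2[OF z]] by measurable
    show "AE x in lebesgue_on \<Omega>. norm (source (p x) (v x) * z x)
        \<le> norm ((1 + 1 / (q - pp)) * (1 + \<bar>v x\<bar> powr q + \<bar>z x\<bar> powr q))"
      using e(2)
    proof eventually_elim
      case (elim x)
      then show ?case using source_mult_bound[of "p x" pp q "v x" "z x"] e(1,3) by auto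
    qed
  qed
  show "integrable (lebesgue_on \<Omega>) (\<lambda>x. source (p x) (v x) * z x)" by (rule int[OF z])
  show "integrable (lebesgue_on \<Omega>) (\<lambda>x. source_primitive (p x) (v x))"
  proof (rule Bochner_Integration.integrable_bound)
    show "integrable (lebesgue_on \<Omega>) (\<lambda>x. \<bar>source (p x) (v x) * v x\<bar> + (1 + \<bar>v x\<bar> powr q))"
      using int[OF v] K[OF v] by simp
    show "(\<lambda>x. source_primitive (p x) (v x)) \<in> borel_measurable (lebesgue_on \<Omega>)" by measurable
    show "AE x in lebesgue_on \<Omega>. norm (source_primitive (p x) (v x))
        \<le> norm (\<bar>source (p x) (v x) * v x\<bar> + (1 + \<bar>v x\<bar> powr q))"
      using e(2)
    proof eventually_elim
      case (elim x)
      then have P: "1 \<le> p x" "p x \<le> q" using e(1,3) by auto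
      have "\<bar>source (p x) (v x) * v x / p x\<bar> \<le> \<bar>source (p x) (v x) * v x\<bar>"
        using divide_left_mono[of 1 "p x" "\<bar>source (p x) (v x) * v x\<bar>"] P by simp
      moreover have "\<bar>\<bar>v x\<bar> powr p x / (p x)\<^sup>2\<bar> \<le> 1 + \<bar>v x\<bar> powr q"
      proof -
        have "1 \<le> (p x)\<^sup>2" using P by (simp add: one_le_power)
        then have "\<bar>v x\<bar> powr p x / (p x)\<^sup>2 \<le> \<bar>v x\<bar> powr p x / 1"
          by (intro divide_left_mono) auto
        then show ?thesis using powr_le_1_powr[of "p x" q "v x"] P by simp
      qed
      ultimately have "\<bar>source_primitive (p x) (v x)\<bar> \<le> \<bar>source (p x) (v x) * v x\<bar> + (1 + \<bar>v x\<bar> powr q)"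
        using P abs_triangle_ineq4[of "source (p x) (v x) * v x / p x" "\<bar>v x\<bar> powr p x / (p x)\<^sup>2"]
        by (subst source_primitive_eq) linarith+
      then show ?case by simp
    qed
  qed
qed

text \<open>Up to a subsequence the integrands converge almost everywhere, and they exceed a fixed
  integrable function at most by an amount that tends to zero in \<open>L\<^sup>1\<close>; truncate at that function.\<close>

lemma source_tendsto:
  assumes v: "\<And>k. v k \<in> H01 \<Omega>" "V \<in> H01 \<Omega>" and z: "\<And>k. z k \<in> H01 \<Omega>" "Z \<in> H01 \<Omega>"
    and vV: "(\<lambda>k::nat. l2_norm \<Omega> (\<lambda>x. weak_grad \<Omega> (v k) x - weak_grad \<Omega> V x)) \<longlonglongrightarrow> 0"
    and zZ: "(\<lambda>k. l2_norm \<Omega> (\<lambda>x. weak_grad \<Omega> (z k) x - weak_grad \<Omega> Z x)) \<longlonglongrightarrow> 0"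
  shows "(\<lambda>k. LINT x|lebesgue_on \<Omega>. source (p x) (v k x) * z k x)
      \<longlonglongrightarrow> (LINT x|lebesgue_on \<Omega>. source (p x) (V x) * Z x)"
proof -
  let ?M = "lebesgue_on \<Omega>"
  obtain pp q \<gamma> where e: "2 < pm" "AE x in ?M. pm \<le> p x \<and> p x \<le> pp" "pp < q"
    "0 < \<gamma>" "CARD('n) / 2 - 1 \<le> \<gamma>" "\<gamma> * (q - 2) < 2" "2 < q" by (rule exponent_bounds)
  obtain K where K: "K \<ge> 0" "\<And>z. z \<in> H01 \<Omega> \<Longrightarrow> integrable ?M (\<lambda>x. \<bar>z x\<bar> powr q)"
    "\<And>z. z \<in> H01 \<Omega> \<Longrightarrow> (LINT x|?M. \<bar>z x\<bar> powr q) \<le> K * l2_norm \<Omega> (weak_grad \<Omega> z) powr q"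
    using Sobolev_H01[OF e(4-7)] by blast
  interpret finite_measure ?M by (rule finite_measure_domain)
  have conv: "\<exists>s. strict_mono s \<and> (AE x in ?M. (\<lambda>k. w (r (s k)) x) \<longlonglongrightarrow> W x)"
    and convq: "(\<lambda>k. LINT x|?M. \<bar>w k x - W x\<bar> powr q) \<longlonglongrightarrow> 0"
    if w: "\<And>k. w k \<in> H01 \<Omega>" "W \<in> H01 \<Omega>" and r: "strict_mono r"
      and lim: "(\<lambda>k::nat. l2_norm \<Omega> (\<lambda>x. weak_grad \<Omega> (w k) x - weak_grad \<Omega> W x)) \<longlonglongrightarrow> 0"
    for w W and r :: "nat \<Rightarrow> nat"
  proof -
    have d: "(\<lambda>x. w k x - W x) \<in> H01 \<Omega>"
      "l2_norm \<Omega> (weak_grad \<Omega> (\<lambda>x. w k x - W x)) = l2_norm \<Omega> (\<lambda>x. weak_grad \<Omega> (w k) x - weak_grad \<Omega> W x)" for k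
    proof -
      show 1: "(\<lambda>x. w k x - W x) \<in> H01 \<Omega>" by (rule weak_grad_diff(1)[OF w])
      show "l2_norm \<Omega> (weak_grad \<Omega> (\<lambda>x. w k x - W x)) = l2_norm \<Omega> (\<lambda>x. weak_grad \<Omega> (w k) x - weak_grad \<Omega> W x)"
        by (rule l2_norm_cong_AE[OF weak_grad_L2[OF 1] L2_diff[OF weak_grad_L2[OF w(1)] weak_grad_L2[OF w(2)]]
              weak_grad_diff(2)[OF w]])
    qed
    have "(\<lambda>k. l2_norm \<Omega> (\<lambda>x. w k x - W x)) \<longlonglongrightarrow> 0"
      by (rule H01_tendsto_L2[OF w lim])
    then have "(\<lambda>k. l2_norm \<Omega> (\<lambda>x. w (r k) x - W x)) \<longlonglongrightarrow> 0"
      using LIMSEQ_subseq_LIMSEQ[OF _ r] by (fastforce simp: comp_def)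
    then show "\<exists>s. strict_mono s \<and> (AE x in ?M. (\<lambda>k. w (r (s k)) x) \<longlonglongrightarrow> W x)"
      by (intro L2_AE_subseq[of "\<lambda>k. w (r k)"] H01_L2 w)
    show "(\<lambda>k. LINT x|?M. \<bar>w k x - W x\<bar> powr q) \<longlonglongrightarrow> 0"
    proof (rule Lim_null_comparison)
      show "\<forall>\<^sub>F k in sequentially. norm (LINT x|?M. \<bar>w k x - W x\<bar> powr q)
          \<le> K * l2_norm \<Omega> (\<lambda>x. weak_grad \<Omega> (w k) x - weak_grad \<Omega> W x) powr q"
        using K(3)[OF d(1)] by (intro always_eventually allI) (simp add: d(2))
      have "(\<lambda>k. l2_norm \<Omega> (\<lambda>x. weak_grad \<Omega> (w k) x - weak_grad \<Omega> W x) powr q) \<longlonglongrightarrow> 0 powr q"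
        by (rule tendsto_powr'[OF lim tendsto_const]) (use e(7) in auto)
      then show "(\<lambda>k. K * l2_norm \<Omega> (\<lambda>x. weak_grad \<Omega> (w k) x - weak_grad \<Omega> W x) powr q) \<longlonglongrightarrow> 0"
        using tendsto_mult_left by fastforce
    qed
  qed
  define A where "A = 1 + 1 / (q - pp)"
  have A: "A > 0" using e(3) by (simp add: A_def add_pos_pos)
  define G where "G = (\<lambda>x. A * (1 + 2 powr q * (\<bar>V x\<bar> powr q + \<bar>Z x\<bar> powr q)))"
  define \<epsilon> where "\<epsilon> = (\<lambda>k x. A * 2 powr q * (\<bar>v k x - V x\<bar> powr q + \<bar>z k x - Z x\<bar> powr q))"
  define f where "f = (\<lambda>k x. source (p x) (v k x) * z k x)"
  define F where "F = (\<lambda>x. source (p x) (V x) * Z x)"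
  define h where "h = (\<lambda>k x. max (- G x) (min (G x) (f k x)))"
  note meas[measurable] = L2_measurable[OF H01_L2[OF v(1)]] L2_measurable[OF H01_L2[OF v(2)]]
    L2_measurable[OF H01_L2[OF z(1)]] L2_measurable[OF H01_L2[OF z(2)]] p_measurable
    source_measurable(1)[OF L2_measurable[OF H01_L2[OF v(1)]]] source_measurable(1)[OF L2_measurable[OF H01_L2[OF v(2)]]]
  have f_int: "integrable ?M (f k)" for k unfolding f_def by (rule source_integrable(1)[OF v(1) z(1)])
  have G_int: "integrable ?M G"
    unfolding G_def using K(2)[OF v(2)] K(2)[OF z(2)] by simp
  have \<epsilon>_int: "integrable ?M (\<epsilon> k)" for k
    unfolding \<epsilon>_def using K(2)[OF weak_grad_diff(1)[OF v(1)[of k] v(2)]] K(2)[OF weak_grad_diff(1)[OF z(1)[of k] z(2)]] by simp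
  have h_meas: "h k \<in> borel_measurable ?M" for k
    unfolding h_def f_def G_def by measurable
  have h_int: "integrable ?M (h k)" for k
    by (rule Bochner_Integration.integrable_bound[OF G_int h_meas])
       (use A in \<open>auto simp: h_def G_def abs_le_iff intro!: AE_I2\<close>)
  have G0: "G x \<ge> 0" for x using A by (simp add: G_def)
  have fh: "AE x in ?M. \<bar>f k x - h k x\<bar> \<le> \<epsilon> k x" for k
    using e(2)
  proof eventually_elim
    case (elim x)
    have "\<bar>f k x\<bar> \<le> A * (1 + \<bar>v k x\<bar> powr q + \<bar>z k x\<bar> powr q)"
      unfolding f_def A_def using elim e(1,3) by (intro source_mult_bound) auto
    also have "\<dots> \<le> A * (1 + 2 powr q * (\<bar>V x\<bar> powr q + \<bar>v k x - V x\<bar> powr q)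
        + 2 powr q * (\<bar>Z x\<bar> powr q + \<bar>z k x - Z x\<bar> powr q))"
      using A e(7) abs_add_powr_le[of q "V x" "v k x - V x"] abs_add_powr_le[of q "Z x" "z k x - Z x"]
      by (intro mult_left_mono add_mono) auto
    also have "\<dots> = G x + \<epsilon> k x" by (simp add: G_def \<epsilon>_def algebra_simps)
    finally have fG: "\<bar>f k x\<bar> \<le> G x + \<epsilon> k x" .
    moreover have "\<epsilon> k x \<ge> 0" using A by (simp add: \<epsilon>_def)
    ultimately show ?case using G0[of x] by (auto simp: h_def max_def min_def abs_le_iff)
  qed
  have FG: "AE x in ?M. \<bar>F x\<bar> \<le> G x"
    using e(2)
  proof eventually_elim
    case (elim x)
    have "\<bar>F x\<bar> \<le> A * (1 + 1 * (\<bar>V x\<bar> powr q + \<bar>Z x\<bar> powr q))"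
      using source_mult_bound[of "p x" pp q "V x" "Z x"] elim e(1,3) by (simp add: F_def A_def add.assoc)
    also have "\<dots> \<le> G x"
      unfolding G_def using A e(7) by (intro mult_left_mono add_mono mult_right_mono ge_one_powr_ge_zero) auto
    finally show ?case .
  qed
  have \<epsilon>_lim: "(\<lambda>k. LINT x|?M. \<epsilon> k x) \<longlonglongrightarrow> 0"
  proof -
    have "(LINT x|?M. \<epsilon> k x) = A * 2 powr q * ((LINT x|?M. \<bar>v k x - V x\<bar> powr q) + (LINT x|?M. \<bar>z k x - Z x\<bar> powr q))" for k
      unfolding \<epsilon>_def using K(2)[OF weak_grad_diff(1)[OF v(1)[of k] v(2)]] K(2)[OF weak_grad_diff(1)[OF z(1)[of k] z(2)]] by simp
    moreover have "(\<lambda>k. A * 2 powr q * ((LINT x|?M. \<bar>v k x - V x\<bar> powr q) + (LINT x|?M. \<bar>z k x - Z x\<bar> powr q))) \<longlonglongrightarrow> A * 2 powr q * (0 + 0)"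
      by (intro tendsto_mult_left tendsto_add convq[OF v strict_mono_id vV] convq[OF z strict_mono_id zZ])
    ultimately show ?thesis by simp
  qed
  have diff_lim: "(\<lambda>k. (LINT x|?M. f k x) - (LINT x|?M. h k x)) \<longlonglongrightarrow> 0"
  proof (rule Lim_null_comparison[OF always_eventually \<epsilon>_lim], rule allI)
    fix k
    have "norm ((LINT x|?M. f k x) - (LINT x|?M. h k x)) = norm (LINT x|?M. f k x - h k x)"
      using f_int h_int by simp
    also have "\<dots> \<le> (LINT x|?M. norm (f k x - h k x))" by (rule integral_norm_bound)
    also have "\<dots> \<le> (LINT x|?M. \<epsilon> k x)"
      by (rule integral_mono_AE) (use f_int h_int \<epsilon>_int fh in auto)
    finally show "norm ((LINT x|?M. f k x) - (LINT x|?M. h k x)) \<le> (LINT x|?M. \<epsilon> k x)" .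
  qed
  have h_lim: "(\<lambda>k. LINT x|?M. h k x) \<longlonglongrightarrow> (LINT x|?M. F x)"
  proof (rule LIMSEQ_by_subsequences)
    fix r :: "nat \<Rightarrow> nat" assume r: "strict_mono r"
    obtain s1 where s1: "strict_mono s1" "AE x in ?M. (\<lambda>k. v (r (s1 k)) x) \<longlonglongrightarrow> V x"
      using conv[OF v r vV] by blast
    have r1: "strict_mono (\<lambda>k. r (s1 k))" using strict_mono_o[OF r s1(1)] by (simp add: comp_def)
    obtain s2 where s2: "strict_mono s2" "AE x in ?M. (\<lambda>k. z (r (s1 (s2 k))) x) \<longlonglongrightarrow> Z x"
      using conv[OF z r1 zZ] by blast
    let ?s = "\<lambda>k. s1 (s2 k)"
    have "(\<lambda>k. LINT x|?M. h (r (?s k)) x) \<longlonglongrightarrow> (LINT x|?M. F x)"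
    proof (rule integral_dominated_convergence[where w = G])
      show "F \<in> borel_measurable ?M" unfolding F_def by measurable
      show "AE x in ?M. norm (h (r (?s k)) x) \<le> G x" for k
        using G0 by (intro AE_I2) (auto simp: h_def abs_le_iff)
      show "AE x in ?M. (\<lambda>k. h (r (?s k)) x) \<longlonglongrightarrow> F x"
        using s1(2) s2(2) FG e(2)
      proof eventually_elim
        case (elim x)
        have vk: "(\<lambda>k. v (r (?s k)) x) \<longlonglongrightarrow> V x"
          using LIMSEQ_subseq_LIMSEQ[OF elim(1) s2(1)] by (simp add: comp_def)
        have src: "isCont (source (p x)) (V x)"
        proof -
          have P: "p x > 2" using elim(4) e(1) by simp
          show ?thesis
          proof (cases "V x = 0")
            case False
            have "isCont (\<lambda>r. \<bar>r\<bar> powr (p x - 2) * r * ln \<bar>r\<bar>) (V x)"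
              using False by (intro continuous_intros) auto
            moreover have "\<forall>\<^sub>F r in nhds (V x). source (p x) r = \<bar>r\<bar> powr (p x - 2) * r * ln \<bar>r\<bar>"
              using False by (intro eventually_mono[OF t1_space_nhds[of "V x" 0]]) (auto simp: source_def)
            ultimately show ?thesis by (simp add: isCont_cong)
          next
            case True
            have "(source (p x) \<longlongrightarrow> 0) (at 0)"
            proof (rule Lim_null_comparison)
              show "((\<lambda>r. \<bar>r\<bar> powr (p x - 2)) \<longlongrightarrow> 0) (at 0)"
                using P by (auto intro!: tendsto_eq_intros)
              have "\<forall>\<^sub>F r in at (0::real). \<bar>r\<bar> < 1 \<and> r \<noteq> 0"
                by (auto simp: eventually_at intro!: exI[of _ 1])
              then show "\<forall>\<^sub>F r in at 0. norm (source (p x) r) \<le> \<bar>r\<bar> powr (p x - 2)"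
              proof eventually_elim
                case (elim r)
                have "\<bar>r\<bar> powr (p x - 2) * (\<bar>r\<bar> * \<bar>ln \<bar>r\<bar>\<bar>) \<le> \<bar>r\<bar> powr (p x - 2) * 1"
                  using elim by (intro mult_left_mono abs_mult_ln_le_1) auto
                then show ?case using elim by (simp add: source_def abs_mult mult.assoc)
              qed
            qed
            then show ?thesis using True by (simp add: isCont_def source_def)
          qed
        qed
        have "(\<lambda>k. f (r (?s k)) x) \<longlonglongrightarrow> F x"
          unfolding f_def F_def by (intro tendsto_mult isCont_tendsto_compose[OF src vk] elim(2))
        then have "(\<lambda>k. h (r (?s k)) x) \<longlonglongrightarrow> max (- G x) (min (G x) (F x))"
          unfolding h_def by (intro tendsto_intros)
        also have "max (- G x) (min (G x) (F x)) = F x" using elim(3) by (auto simp: abs_le_iff)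
        finally show ?case .
      qed
    qed (use h_meas G_int in auto)
    moreover have "strict_mono ?s" using strict_mono_o[OF s1(1) s2(1)] by (simp add: comp_def)
    ultimately show "\<exists>s. strict_mono s \<and> (\<lambda>k. LINT x|?M. h (r (s k)) x) \<longlonglongrightarrow> (LINT x|?M. F x)" by blast
  qed
  show ?thesis using tendsto_add[OF diff_lim h_lim] by (simp add: f_def F_def)
qed

text \<open>The shift is at most \<open>1\<close> on a domain of finite measure, so the pointwise comparison may be integrated.\<close>

lemma source_energy_ge:
  assumes v: "v \<in> H01 \<Omega>"
  shows "pm * (LINT x|lebesgue_on \<Omega>. source_primitive (p x) (v x)) - C_star \<Omega> p
    \<le> (LINT x|lebesgue_on \<Omega>. source (p x) (v x) * v x)"
    and "C_star \<Omega> p \<ge> 0"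
proof -
  interpret finite_measure "lebesgue_on \<Omega>" by (rule finite_measure_domain)
  obtain pp where pp: "AE x in lebesgue_on \<Omega>. pm \<le> p x \<and> p x \<le> pp" using exponent_bounds by blast
  note [measurable] = p_measurable
  have c_nonneg: "c_shift pm q \<ge> 0" for q
    by (auto simp: c_shift_def)
  have int: "integrable (lebesgue_on \<Omega>) (\<lambda>x. c_shift pm (p x))"
  proof (rule integrable_const_bound[where B = 1])
    show "(\<lambda>x. c_shift pm (p x)) \<in> borel_measurable (lebesgue_on \<Omega>)"
      unfolding c_shift_def by measurable
    show "AE x in lebesgue_on \<Omega>. norm (c_shift pm (p x)) \<le> 1"
    proof (rule AE_I2)
      fix x
      show "norm (c_shift pm (p x)) \<le> 1"
      proof (cases "p x > pm")
        case True
        have P: "p x > 2" using True pm_gt_2 by simp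
        have "(p x - pm) / (p x)\<^sup>2 \<le> 1"
        proof -
          have "p x - pm \<le> p x * 1" using pm_gt_2 by simp
          also have "\<dots> \<le> p x * p x" using P by (intro mult_left_mono) auto
          finally show ?thesis using P by (simp add: power2_eq_square divide_le_eq)
        qed
        moreover have "exp (- p x / (p x - pm)) \<le> 1" using True P by simp
        moreover have "0 \<le> (p x - pm) / (p x)\<^sup>2" using True by simp
        ultimately have "(p x - pm) / (p x)\<^sup>2 * exp (- p x / (p x - pm)) \<le> 1 * 1"
          by (intro mult_mono) auto
        then show ?thesis using True c_nonneg[of "p x"] by (simp add: c_shift_def)
      qed (simp add: c_shift_def)
    qed
  qed
  have "(LINT x|lebesgue_on \<Omega>. pm * source_primitive (p x) (v x) - c_shift pm (p x))
      \<le> (LINT x|lebesgue_on \<Omega>. source (p x) (v x) * v x)"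
  proof (rule integral_mono_AE)
    show "AE x in lebesgue_on \<Omega>. pm * source_primitive (p x) (v x) - c_shift pm (p x) \<le> source (p x) (v x) * v x"
      using pp by eventually_elim (use pm_gt_2 in \<open>auto intro!: source_ge_primitive\<close>)
  qed (use int source_integrable[OF v v] in auto)
  then show "pm * (LINT x|lebesgue_on \<Omega>. source_primitive (p x) (v x)) - C_star \<Omega> p
    \<le> (LINT x|lebesgue_on \<Omega>. source (p x) (v x) * v x)"
    using int source_integrable[OF v v] by (simp add: C_star_def)
  show "C_star \<Omega> p \<ge> 0" unfolding C_star_def using c_nonneg by simp
qed

end

section \<open>Time derivatives along an energy solution\<close>

lemma near_of_sequential:
  fixes K :: "real \<Rightarrow> real \<Rightarrow> real \<Rightarrow> real"
  assumes seq: "\<And>r s t. (\<And>k::nat. r k \<in> A \<and> s k \<in> A \<and> t k \<in> A) \<Longrightarrow> r \<longlonglongrightarrow> t0 \<Longrightarrow> s \<longlonglongrightarrow> t0 \<Longrightarrow>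
      t \<longlonglongrightarrow> t0 \<Longrightarrow> (\<lambda>k. K (r k) (s k) (t k)) \<longlonglongrightarrow> H" and "e > 0"
  shows "\<exists>d>0. \<forall>r\<in>A. \<forall>s\<in>A. \<forall>t\<in>A. \<bar>r - t0\<bar> < d \<and> \<bar>s - t0\<bar> < d \<and> \<bar>t - t0\<bar> < d \<longrightarrow> \<bar>K r s t - H\<bar> < e"
proof (rule ccontr)
  assume neg: "\<not> ?thesis"
  have "\<exists>r s t. (r \<in> A \<and> s \<in> A \<and> t \<in> A) \<and> (\<bar>r - t0\<bar> < inverse (real (Suc k)) \<and>
      \<bar>s - t0\<bar> < inverse (real (Suc k)) \<and> \<bar>t - t0\<bar> < inverse (real (Suc k))) \<and> \<not> \<bar>K r s t - H\<bar> < e" for k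
  proof -
    have "inverse (real (Suc k)) > 0" by simp
    then show ?thesis using neg by blast
  qed
  then obtain r s t where rst: "\<And>k. r k \<in> A \<and> s k \<in> A \<and> t k \<in> A"
    "\<And>k. \<bar>r k - t0\<bar> < inverse (real (Suc k)) \<and> \<bar>s k - t0\<bar> < inverse (real (Suc k))
      \<and> \<bar>t k - t0\<bar> < inverse (real (Suc k))"
    "\<And>k. \<not> \<bar>K (r k) (s k) (t k) - H\<bar> < e" by metis
  have lim: "f \<longlonglongrightarrow> t0" if "\<And>k. \<bar>f k - t0\<bar> < inverse (real (Suc k))" for f :: "nat \<Rightarrow> real"
  proof (rule LIM_zero_cancel, rule Lim_null_comparison[OF _ LIMSEQ_inverse_real_of_nat])
    show "\<forall>\<^sub>F k in sequentially. norm (f k - t0) \<le> inverse (real (Suc k))"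
      using that by (intro always_eventually allI) (simp add: less_imp_le del: of_nat_Suc)
  qed
  have "(\<lambda>k. K (r k) (s k) (t k)) \<longlonglongrightarrow> H"
    using rst by (intro seq lim) blast+
  then have "\<forall>\<^sub>F k in sequentially. dist (K (r k) (s k) (t k)) H < e" using \<open>e > 0\<close> by (rule tendstoD)
  then show False using rst(3) by (auto simp: dist_real_def eventually_sequentially)
qed

text \<open>Near \<open>t0\<close> the density is uniformly close to its value \<open>H\<close> on the diagonal, and so are the difference
  quotients, whichever side of \<open>t0\<close> they are taken on.\<close>

lemma deriv_of_increment:
  fixes Y :: "real \<Rightarrow> real" and K :: "real \<Rightarrow> real \<Rightarrow> real \<Rightarrow> real"
  assumes t0: "a < t0" "t0 < b"
    and incr: "\<And>s t. a < s \<Longrightarrow> s < t \<Longrightarrow> t < b \<Longrightarrow> Y t - Y s = (LINT r|lebesgue_on {s..t}. K r s t)"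
    and cont: "\<And>s t. a < s \<Longrightarrow> s < t \<Longrightarrow> t < b \<Longrightarrow> continuous_on {s..t} (\<lambda>r. K r s t)"
    and seq: "\<And>r s t. (\<And>k::nat. r k \<in> {a<..<b} \<and> s k \<in> {a<..<b} \<and> t k \<in> {a<..<b}) \<Longrightarrow> r \<longlonglongrightarrow> t0 \<Longrightarrow>
      s \<longlonglongrightarrow> t0 \<Longrightarrow> t \<longlonglongrightarrow> t0 \<Longrightarrow> (\<lambda>k. K (r k) (s k) (t k)) \<longlonglongrightarrow> H"
  shows "(Y has_real_derivative H) (at t0)"
  unfolding has_field_derivative_def has_derivative_at_alt
proof (intro conjI allI impI)
  show "bounded_linear ((*) H)" by (rule bounded_linear_mult_right)
  fix e :: real assume e: "e > 0"
  obtain d where d: "d > 0" "\<And>r s t. r \<in> {a<..<b} \<Longrightarrow> s \<in> {a<..<b} \<Longrightarrow> t \<in> {a<..<b} \<Longrightarrow>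
      \<bar>r - t0\<bar> < d \<Longrightarrow> \<bar>s - t0\<bar> < d \<Longrightarrow> \<bar>t - t0\<bar> < d \<Longrightarrow> \<bar>K r s t - H\<bar> < e"
    using near_of_sequential[of "{a<..<b}" t0 K H, OF seq e] by blast
  have main: "\<bar>Y t - Y s - H * (t - s)\<bar> \<le> e * (t - s)"
    if st: "a < s" "s < t" "t < b" "\<bar>s - t0\<bar> < d" "\<bar>t - t0\<bar> < d" for s t
  proof -
    have c: "continuous_on {s..t} (\<lambda>r. K r s t)" by (rule cont[OF st(1-3)])
    have "Y t - Y s = integral {s..t} (\<lambda>r. K r s t)"
      unfolding incr[OF st(1-3)]
      by (rule lebesgue_integral_eq_integral) (auto intro: continuous_imp_integrable_real c)
    moreover have "H * (t - s) = integral {s..t} (\<lambda>r. H)" using st by simp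
    ultimately have "Y t - Y s - H * (t - s) = integral {s..t} (\<lambda>r. K r s t - H)"
      using c by (simp add: Henstock_Kurzweil_Integration.integral_diff integrable_continuous_real)
    also have "norm \<dots> \<le> integral {s..t} (\<lambda>r. e)"
    proof (rule integral_norm_bound_integral)
      show "(\<lambda>r. K r s t - H) integrable_on {s..t}"
        by (intro integrable_continuous_real continuous_intros c)
      show "norm (K r s t - H) \<le> e" if "r \<in> {s..t}" for r
        using d(2)[of r s t] st that by (auto simp: abs_less_iff intro: less_imp_le)
    qed (rule integrable_const_ivl)
    finally show ?thesis using st by (simp add: mult.commute)
  qed
  show "\<exists>d>0. \<forall>y. norm (y - t0) < d \<longrightarrow> norm (Y y - Y t0 - H * (y - t0)) \<le> e * norm (y - t0)"
  proof (intro exI[of _ "min d (min (t0 - a) (b - t0))"] conjI allI impI)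
    show "0 < min d (min (t0 - a) (b - t0))" using d t0 by simp
    fix y assume y: "norm (y - t0) < min d (min (t0 - a) (b - t0))"
    consider "y < t0" | "y = t0" | "t0 < y" by linarith
    then show "norm (Y y - Y t0 - H * (y - t0)) \<le> e * norm (y - t0)"
    proof cases
      case 1
      then have "\<bar>Y t0 - Y y - H * (t0 - y)\<bar> \<le> e * (t0 - y)"
        using y t0 d by (intro main) auto
      moreover have "Y y - Y t0 - H * (y - t0) = - (Y t0 - Y y - H * (t0 - y))" by (simp add: algebra_simps)
      ultimately show ?thesis using 1 by (simp only: real_norm_def abs_minus_cancel) simp
    next
      case 3
      then have "\<bar>Y y - Y t0 - H * (y - t0)\<bar> \<le> e * (y - t0)"
        using y t0 d by (intro main) auto
      then show ?thesis using 3 by simp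
    qed simp
  qed
qed

locale energy_flow = variable_exponent \<Omega> p for \<Omega> :: "(real^'n) set" and p +
  fixes g :: "real \<Rightarrow> real" and u0 u1 :: "real^'n \<Rightarrow> real" and T :: real
    and u ut :: "real \<Rightarrow> real^'n \<Rightarrow> real"
  assumes kernel: "H2 g" and T_pos: "0 < T"
    and solves: "energy_solution \<Omega> p g u0 u1 T u ut"
begin

lemma u_H01: "t \<in> {0..T} \<Longrightarrow> u t \<in> H01 \<Omega>"
  and ut_L2: "t \<in> {0..T} \<Longrightarrow> ut t \<in> L2 \<Omega>"
  using solves by (auto simp: energy_solution_def cont_time_def)

lemmas u_L2 = H01_L2[OF u_H01]
lemmas gradu_L2 = weak_grad_L2[OF u_H01]

lemma gradu_tendsto:
  assumes r: "\<And>k. r k \<in> {0..T}" and t: "t \<in> {0..T}" and lim: "r \<longlonglongrightarrow> t"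
  shows "(\<lambda>k. l2_norm \<Omega> (\<lambda>x. weak_grad \<Omega> (u (r k)) x - weak_grad \<Omega> (u t) x)) \<longlonglongrightarrow> 0"
proof -
  let ?f = "\<lambda>s. V_norm \<Omega> (u s - u t)"
  have ft: "?f t = 0" by (simp add: V_norm_diff[OF u_H01[OF t] u_H01[OF t]] l2_norm_zero)
  have "(?f \<longlongrightarrow> ?f t) (at t within {0..T})"
    using solves t unfolding ft by (auto simp: energy_solution_def cont_time_def)
  then have "continuous (at t within {0..T}) ?f" by (simp add: continuous_within)
  from continuous_within_tendsto_compose[OF this always_eventually lim] r
  have "(\<lambda>k. ?f (r k)) \<longlonglongrightarrow> ?f t" by blast
  then show ?thesis unfolding ft by (simp add: V_norm_diff[OF u_H01[OF r] u_H01[OF t]])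
qed

lemma u_tendsto:
  assumes r: "\<And>k. r k \<in> {0..T}" and t: "t \<in> {0..T}" and lim: "r \<longlonglongrightarrow> t"
  shows "(\<lambda>k. l2_norm \<Omega> (\<lambda>x. u (r k) x - u t x)) \<longlonglongrightarrow> 0"
  by (rule H01_tendsto_L2[OF u_H01[OF r] u_H01[OF t] gradu_tendsto[OF r t lim]])

lemma ut_tendsto:
  assumes r: "\<And>k. r k \<in> {0..T}" and t: "t \<in> {0..T}" and lim: "r \<longlonglongrightarrow> t"
  shows "(\<lambda>k. l2_norm \<Omega> (\<lambda>x. ut (r k) x - ut t x)) \<longlonglongrightarrow> 0"
proof -
  let ?f = "\<lambda>s. l2_norm \<Omega> (ut s - ut t)"
  have ft: "?f t = 0" by (simp add: fun_diff_def l2_norm_zero)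
  have "(?f \<longlongrightarrow> ?f t) (at t within {0..T})"
    using solves t unfolding ft by (auto simp: energy_solution_def cont_time_def)
  then have "continuous (at t within {0..T}) ?f" by (simp add: continuous_within)
  from continuous_within_tendsto_compose[OF this always_eventually lim] r
  have "(\<lambda>k. ?f (r k)) \<longlonglongrightarrow> ?f t" by blast
  then show ?thesis unfolding ft by (simp add: fun_diff_def)
qed

lemma const_tendsto: "(\<lambda>k::nat. l2_norm \<Omega> (\<lambda>x. w x - w x :: 'b::euclidean_space)) \<longlonglongrightarrow> 0"
  by (simp add: l2_norm_zero)

lemma continuous_on_inner:
  "z \<in> L2 \<Omega> \<Longrightarrow> continuous_on {0..T} (\<lambda>t. l2_inner \<Omega> (u t) z)"
  "z \<in> L2 \<Omega> \<Longrightarrow> continuous_on {0..T} (\<lambda>t. l2_inner \<Omega> (ut t) z)"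
  "w \<in> L2 \<Omega> \<Longrightarrow> continuous_on {0..T} (\<lambda>t. l2_inner \<Omega> (weak_grad \<Omega> (u t)) w)"
  unfolding continuous_on_sequentially comp_def
  by (intro allI ballI impI l2_inner_tendsto u_L2 ut_L2 gradu_L2 u_tendsto ut_tendsto gradu_tendsto
      const_tendsto; blast)+

lemma continuous_on_pair:
  "continuous_on {0..T} (\<lambda>t. l2_inner \<Omega> (u t) (ut t))"
  "continuous_on {0..T} (\<lambda>t. l2_norm \<Omega> (u t))"
  "continuous_on {0..T} (\<lambda>t. l2_norm \<Omega> (ut t))"
  "continuous_on {0..T} (\<lambda>t. l2_norm \<Omega> (weak_grad \<Omega> (u t)))"
  unfolding continuous_on_sequentially comp_def
  by (intro allI ballI impI l2_inner_tendsto l2_norm_tendsto u_L2 ut_L2 gradu_L2 u_tendsto ut_tendsto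
      gradu_tendsto; blast)+

lemma gradu_bounded:
  obtains B where "B \<ge> 0" "\<And>t. t \<in> {0..T} \<Longrightarrow> l2_norm \<Omega> (weak_grad \<Omega> (u t)) \<le> B"
    "\<And>t. t \<in> {0..T} \<Longrightarrow> l2_norm \<Omega> (ut t) \<le> B"
proof -
  have "bounded ((\<lambda>t. l2_norm \<Omega> (weak_grad \<Omega> (u t))) ` {0..T})" and b2: "bounded ((\<lambda>t. l2_norm \<Omega> (ut t)) ` {0..T})"
    by (intro compact_imp_bounded compact_continuous_image continuous_on_pair compact_Icc)+
  then obtain B1 where B1: "\<forall>t\<in>{0..T}. l2_norm \<Omega> (weak_grad \<Omega> (u t)) \<le> B1" by (auto simp: bounded_iff)
  obtain B2 where B2: "\<forall>t\<in>{0..T}. l2_norm \<Omega> (ut t) \<le> B2" using b2 by (auto simp: bounded_iff)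
  show ?thesis
    by (rule that[of "max 0 (max B1 B2)"]) (use B1 B2 in \<open>auto simp: le_max_iff_disj\<close>)
qed

lemma kernel_continuous: "continuous_on {0..} g" and kernel_nonneg: "s \<ge> 0 \<Longrightarrow> g s \<ge> 0"
  using kernel by (auto simp: H2_def differentiable_imp_continuous_on)

definition memory :: "real \<Rightarrow> (real^'n \<Rightarrow> real) \<Rightarrow> real" where
  "memory r z = (LINT s|lebesgue_on {0..r}. g (r - s) * l2_inner \<Omega> (weak_grad \<Omega> (u s)) (weak_grad \<Omega> z))"

text \<open>The right-hand side of the weak equation without the strong damping.\<close>

definition force :: "real \<Rightarrow> (real^'n \<Rightarrow> real) \<Rightarrow> real" where
  "force r z = - l2_inner \<Omega> (weak_grad \<Omega> (u r)) (weak_grad \<Omega> z) + memory r z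
     + (LINT x|lebesgue_on \<Omega>. source (p x) (u r x) * z x)"

text \<open>The integration interval depends on time; extended by zero to \<open>[0, T]\<close> the integrands converge except at
  the endpoint \<open>t\<close> and are uniformly bounded.\<close>

lemma memory_tendsto:
  assumes r: "\<And>k::nat. r k \<in> {0..T}" "t \<in> {0..T}" "r \<longlonglongrightarrow> t" and z: "\<And>k. z k \<in> H01 \<Omega>" "Z \<in> H01 \<Omega>"
    and zZ: "(\<lambda>k. l2_norm \<Omega> (\<lambda>x. weak_grad \<Omega> (z k) x - weak_grad \<Omega> Z x)) \<longlonglongrightarrow> 0"
  shows "(\<lambda>k. memory (r k) (z k)) \<longlonglongrightarrow> memory t Z"
proof -
  let ?M = "lebesgue_on {0..T}"
  let ?h = "\<lambda>r z s. indicator {0..r} s * (g (r - s) * l2_inner \<Omega> (weak_grad \<Omega> (u s)) (weak_grad \<Omega> z))"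
  have mem_eq: "memory r z = (LINT s|?M. ?h r z s)" and h_meas: "?h r z \<in> borel_measurable ?M"
    if rz: "r \<in> {0..T}" "z \<in> H01 \<Omega>" for r z
  proof -
    let ?c = "\<lambda>s. g (r - s) * l2_inner \<Omega> (weak_grad \<Omega> (u s)) (weak_grad \<Omega> z)"
    have "continuous_on {0..r} ?c"
      using rz
      by (intro continuous_on_mult continuous_on_compose2[OF kernel_continuous]
          continuous_on_subset[OF continuous_on_inner(3)[OF weak_grad_L2]]) (auto intro!: continuous_intros)
    then have int: "integrable (lebesgue_on {0..r}) ?c" by (rule continuous_imp_integrable_real)
    then have int2: "integrable lebesgue (\<lambda>s. indicator {0..r} s *\<^sub>R ?c s)"
      by (simp add: integrable_restrict_space)
    have eq: "indicator {0..T} s *\<^sub>R ?h r z s = indicator {0..r} s *\<^sub>R ?c s" for s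
      using rz by (auto simp: indicator_def)
    have "integrable ?M (?h r z)"
      using int2 by (subst integrable_restrict_space) (auto simp only: eq, simp)
    then show "?h r z \<in> borel_measurable ?M" by simp
    show "memory r z = (LINT s|?M. ?h r z s)"
      unfolding memory_def by (subst (1 2) integral_restrict_space) (simp_all only: eq, simp_all)
  qed
  obtain B where B: "B \<ge> 0" "\<And>t. t \<in> {0..T} \<Longrightarrow> l2_norm \<Omega> (weak_grad \<Omega> (u t)) \<le> B"
    "\<And>t. t \<in> {0..T} \<Longrightarrow> l2_norm \<Omega> (ut t) \<le> B" by (rule gradu_bounded) blast
  have "bounded (g ` {0..T})"
    by (intro compact_imp_bounded compact_continuous_image compact_Icc continuous_on_subset[OF kernel_continuous]) auto
  then obtain Cg where Cg': "\<forall>y\<in>g ` {0..T}. norm y \<le> Cg" unfolding bounded_iff by blast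
  have Cg: "g s \<le> Cg" if "s \<in> {0..T}" for s
  proof -
    have "norm (g s) \<le> Cg" using Cg' that by blast
    then show ?thesis by (simp add: abs_le_iff)
  qed
  have Cg0: "Cg \<ge> 0" using Cg[of 0] kernel_nonneg[of 0] T_pos by simp
  have "Bseq (\<lambda>k. l2_norm \<Omega> (weak_grad \<Omega> (z k)))"
    using l2_norm_tendsto[OF weak_grad_L2[OF z(1)] weak_grad_L2[OF z(2)] zZ]
    by (intro convergent_imp_Bseq) (auto simp: convergent_def)
  then obtain Cz where Cz: "\<And>k. l2_norm \<Omega> (weak_grad \<Omega> (z k)) \<le> Cz"
    by (auto simp: Bseq_def)
  have Cz0: "Cz \<ge> 0" using Cz[of 0] l2_norm_nonneg order_trans by blast
  have "(\<lambda>k. LINT s|?M. ?h (r k) (z k) s) \<longlonglongrightarrow> (LINT s|?M. ?h t Z s)"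
  proof (rule integral_dominated_convergence[where w = "\<lambda>s. Cg * (B * Cz)"])
    show "AE s in ?M. norm (?h (r k) (z k) s) \<le> Cg * (B * Cz)" for k
    proof (rule AE_I2)
      fix s assume "s \<in> space ?M"
      then have s: "s \<in> {0..T}" by simp
      show "norm (?h (r k) (z k) s) \<le> Cg * (B * Cz)"
      proof (cases "s \<le> r k")
        case True
        have "\<bar>l2_inner \<Omega> (weak_grad \<Omega> (u s)) (weak_grad \<Omega> (z k))\<bar> \<le> B * Cz"
          using l2_Cauchy_Schwarz[OF gradu_L2[OF s] weak_grad_L2[OF z(1)[of k]]] B(1) B(2)[OF s] Cz[of k]
          by (elim order_trans) (intro mult_mono, auto)
        moreover have "\<bar>g (r k - s)\<bar> \<le> Cg"
          using Cg[of "r k - s"] kernel_nonneg[of "r k - s"] True s r(1)[of k] by auto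
        ultimately have "\<bar>g (r k - s)\<bar> * \<bar>l2_inner \<Omega> (weak_grad \<Omega> (u s)) (weak_grad \<Omega> (z k))\<bar> \<le> Cg * (B * Cz)"
          using Cg0 by (intro mult_mono) auto
        then show ?thesis using True s by (simp add: abs_mult)
      next
        case False
        then show ?thesis using Cg0 B(1) Cz0 by simp
      qed
    qed
    have "AE s in lebesgue. s \<noteq> t" by (rule AE_completion) (rule AE_lborel_singleton)
    then have "AE s in ?M. s \<noteq> t" by (subst AE_restrict_space_iff) auto
    moreover have "AE s in ?M. s \<in> {0..T}" by (rule AE_I2) simp
    ultimately show "AE s in ?M. (\<lambda>k. ?h (r k) (z k) s) \<longlonglongrightarrow> ?h t Z s"
    proof eventually_elim
      case (elim s)
      have inner: "(\<lambda>k. l2_inner \<Omega> (weak_grad \<Omega> (u s)) (weak_grad \<Omega> (z k))) \<longlonglongrightarrow> l2_inner \<Omega> (weak_grad \<Omega> (u s)) (weak_grad \<Omega> Z)"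
        by (intro l2_inner_tendsto gradu_L2 weak_grad_L2 z zZ const_tendsto elim)
      show ?case
      proof (cases "s < t")
        case True
        then have ev: "\<forall>\<^sub>F k in sequentially. s < r k" by (rule order_tendstoD(1)[OF r(3)])
        have "(\<lambda>k. g (r k - s)) \<longlonglongrightarrow> g (t - s)"
        proof (rule continuous_on_tendsto_compose[OF kernel_continuous])
          show "(\<lambda>k. r k - s) \<longlonglongrightarrow> t - s" by (intro tendsto_intros r)
          show "\<forall>\<^sub>F k in sequentially. r k - s \<in> {0..}" using ev by eventually_elim simp
        qed (use True in simp)
        then have "(\<lambda>k. g (r k - s) * l2_inner \<Omega> (weak_grad \<Omega> (u s)) (weak_grad \<Omega> (z k)))
            \<longlonglongrightarrow> ?h t Z s"
          using tendsto_mult[OF _ inner] True elim(2) by simp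
        then show ?thesis
          by (rule Lim_transform_eventually) (use ev elim(2) in \<open>auto elim!: eventually_mono\<close>)
      next
        case False
        then have "t < s" using elim(1) by simp
        then have "\<forall>\<^sub>F k in sequentially. r k < s" by (rule order_tendstoD(2)[OF r(3)])
        then have "\<forall>\<^sub>F k in sequentially. ?h (r k) (z k) s = 0" by eventually_elim simp
        moreover have z0: "?h t Z s = 0" using \<open>t < s\<close> by simp
        ultimately show ?thesis unfolding z0 by (rule_tac tendsto_eventually)
      qed
    qed
  qed (use h_meas r z in auto)
  then show ?thesis using mem_eq r z by simp
qed

lemma force_tendsto:
  assumes r: "\<And>k::nat. r k \<in> {0..T}" "t \<in> {0..T}" "r \<longlonglongrightarrow> t" and z: "\<And>k. z k \<in> H01 \<Omega>" "Z \<in> H01 \<Omega>"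
    and zZ: "(\<lambda>k. l2_norm \<Omega> (\<lambda>x. weak_grad \<Omega> (z k) x - weak_grad \<Omega> Z x)) \<longlonglongrightarrow> 0"
  shows "(\<lambda>k. force (r k) (z k)) \<longlonglongrightarrow> force t Z"
  unfolding force_def
  by (intro tendsto_add tendsto_minus memory_tendsto source_tendsto l2_inner_tendsto gradu_L2 weak_grad_L2
      u_H01 gradu_tendsto r z zZ)

lemma continuous_on_force: "z \<in> H01 \<Omega> \<Longrightarrow> continuous_on {0..T} (\<lambda>r. force r z)"
  unfolding continuous_on_sequentially comp_def
  by (intro allI ballI impI force_tendsto const_tendsto; blast)

lemma integrable_open_interval:
  fixes f :: "real \<Rightarrow> real"
  assumes "continuous_on {0..T} f"
  shows "integrable (lebesgue_on {0<..<T}) f"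
  by (rule integrable_lebesgue_on_subset[OF continuous_imp_integrable_real[OF assms]]) auto

lemma integrable_sub:
  fixes f :: "real \<Rightarrow> real"
  assumes "integrable (lebesgue_on {0<..<T}) f" "0 < s" "t < T"
  shows "integrable (lebesgue_on {s..t}) f"
  by (rule integrable_lebesgue_on_subset[OF assms(1)]) (use assms in auto)

lemma AE_sub:
  assumes "AE r in lebesgue_on {0<..<T}. P r" "0 < s" "t < T"
  shows "AE r in lebesgue_on {s..t}. P r"
proof -
  have "AE r in lebesgue. r \<in> {0<..<T} \<longrightarrow> P r" using assms(1) by (simp add: AE_restrict_space_iff)
  then have "AE r in lebesgue. r \<in> {s..t} \<longrightarrow> P r" by eventually_elim (use assms in auto)
  then show ?thesis by (simp add: AE_restrict_space_iff)
qed

lemma u_increment: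
  assumes z: "z \<in> H01 \<Omega>" and st: "0 < s" "s < t" "t < T"
  shows "l2_inner \<Omega> (u t) z - l2_inner \<Omega> (u s) z = (LINT r|lebesgue_on {s..t}. l2_inner \<Omega> (ut r) z)"
  by (rule weak_time_deriv_increment[OF _ _ _ st])
     (use solves z H01_L2[OF z] in \<open>auto simp: energy_solution_def intro!: continuous_on_inner integrable_open_interval\<close>)

lemma ut_H01_AE: "AE r in lebesgue_on {0<..<T}. ut r \<in> H01 \<Omega>"
  using solves by (simp add: energy_solution_def L2_time_def)

text \<open>The velocity belongs to \<open>H01 \<Omega>\<close> at almost every time, so at every time it is a limit in
  \<open>L\<^sup>2\<close> of admissible test functions.\<close>

lemma u_increment_velocity:
  assumes t0: "0 < t0" "t0 < T" and st: "0 < s" "s < t" "t < T"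
  shows "l2_inner \<Omega> (u t) (ut t0) - l2_inner \<Omega> (u s) (ut t0) = (LINT r|lebesgue_on {s..t}. l2_inner \<Omega> (ut r) (ut t0))"
proof -
  have "\<exists>r. r \<in> {0<..<T} \<and> \<bar>r - t0\<bar> < inverse (real (Suc k)) \<and> ut r \<in> H01 \<Omega>" for k
  proof (rule ccontr)
    let ?I = "{0<..<T} \<inter> ball t0 (inverse (real (Suc k)))"
    assume "\<not> ?thesis"
    then have neg: "r \<in> ?I \<Longrightarrow> ut r \<notin> H01 \<Omega>" for r by (auto simp: dist_real_def abs_minus_commute)
    have "AE r in lebesgue. r \<in> {0<..<T} \<longrightarrow> ut r \<in> H01 \<Omega>" using ut_H01_AE by (simp add: AE_restrict_space_iff)
    then have "AE r in lebesgue. r \<notin> ?I" by eventually_elim (use neg in auto)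
    then have "?I \<in> null_sets lebesgue" by (subst AE_iff_null_sets) simp_all
    then have "negligible ?I" by (simp add: negligible_iff_null_sets)
    moreover have "open ?I" "t0 \<in> ?I" using t0 by auto
    ultimately show False using open_not_negligible by blast
  qed
  then obtain r where r: "\<And>k. r k \<in> {0<..<T}" "\<And>k. \<bar>r k - t0\<bar> < inverse (real (Suc k))" "\<And>k. ut (r k) \<in> H01 \<Omega>"
    by metis
  have r_lim: "r \<longlonglongrightarrow> t0"
  proof (rule LIM_zero_cancel, rule Lim_null_comparison[OF _ LIMSEQ_inverse_real_of_nat])
    show "\<forall>\<^sub>F k in sequentially. norm (r k - t0) \<le> inverse (real (Suc k))"
      using r(2) by (intro always_eventually allI) (simp add: less_imp_le del: of_nat_Suc)
  qed
  have mem: "r k \<in> {0..T}" "t0 \<in> {0..T}" "s \<in> {0..T}" "t \<in> {0..T}" for k using r(1)[of k] t0 st by auto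
  have utlim: "(\<lambda>k. l2_norm \<Omega> (\<lambda>x. ut (r k) x - ut t0 x)) \<longlonglongrightarrow> 0" by (rule ut_tendsto[OF mem(1,2) r_lim])
  have 1: "(\<lambda>k. l2_inner \<Omega> (u t) (ut (r k)) - l2_inner \<Omega> (u s) (ut (r k)))
      \<longlonglongrightarrow> l2_inner \<Omega> (u t) (ut t0) - l2_inner \<Omega> (u s) (ut t0)"
    by (intro tendsto_diff l2_inner_tendsto u_L2 ut_L2 mem const_tendsto utlim)
  obtain B where B0: "B \<ge> 0" "\<And>t. t \<in> {0..T} \<Longrightarrow> l2_norm \<Omega> (weak_grad \<Omega> (u t)) \<le> B"
    "\<And>t. t \<in> {0..T} \<Longrightarrow> l2_norm \<Omega> (ut t) \<le> B" by (rule gradu_bounded) blast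
  note B = B0(1,3)
  have int: "integrable (lebesgue_on {s..t}) (\<lambda>y. l2_inner \<Omega> (ut y) (ut t'))" if "t' \<in> {0..T}" for t'
    by (rule integrable_sub[OF integrable_open_interval[OF continuous_on_inner(2)[OF ut_L2[OF that]]] st(1,3)])
  have 2: "(\<lambda>k. LINT y|lebesgue_on {s..t}. l2_inner \<Omega> (ut y) (ut (r k))) \<longlonglongrightarrow> (LINT y|lebesgue_on {s..t}. l2_inner \<Omega> (ut y) (ut t0))"
  proof (rule integral_dominated_convergence[where w = "\<lambda>y. B * B"])
    show "AE y in lebesgue_on {s..t}. (\<lambda>k. l2_inner \<Omega> (ut y) (ut (r k))) \<longlonglongrightarrow> l2_inner \<Omega> (ut y) (ut t0)"
    proof (rule AE_I2)
      fix y assume "y \<in> space (lebesgue_on {s..t})"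
      then have "y \<in> {0..T}" using st by auto
      then show "(\<lambda>k. l2_inner \<Omega> (ut y) (ut (r k))) \<longlonglongrightarrow> l2_inner \<Omega> (ut y) (ut t0)"
        by (intro l2_inner_tendsto ut_L2 mem const_tendsto utlim)
    qed
    show "AE y in lebesgue_on {s..t}. norm (l2_inner \<Omega> (ut y) (ut (r k))) \<le> B * B" for k
    proof (rule AE_I2)
      fix y assume "y \<in> space (lebesgue_on {s..t})"
      then have y: "y \<in> {0..T}" using st by auto
      have "\<bar>l2_inner \<Omega> (ut y) (ut (r k))\<bar> \<le> l2_norm \<Omega> (ut y) * l2_norm \<Omega> (ut (r k))"
        by (rule l2_Cauchy_Schwarz[OF ut_L2[OF y] ut_L2[OF mem(1)]])
      also have "\<dots> \<le> B * B" using B y mem(1) by (intro mult_mono) auto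
      finally show "norm (l2_inner \<Omega> (ut y) (ut (r k))) \<le> B * B" by simp
    qed
  qed (use int mem in auto)
  show ?thesis
    using LIMSEQ_unique[OF 1] 2 u_increment[OF r(3) st] by simp
qed

lemma grad_velocity_integrable:
  "integrable (lebesgue_on {0<..<T}) (\<lambda>r. (l2_norm \<Omega> (weak_grad \<Omega> (ut r)))\<^sup>2)"
  "integrable (lebesgue_on {0<..<T}) (\<lambda>r. l2_norm \<Omega> (weak_grad \<Omega> (ut r)))"
proof -
  show sq: "integrable (lebesgue_on {0<..<T}) (\<lambda>r. (l2_norm \<Omega> (weak_grad \<Omega> (ut r)))\<^sup>2)"
    using solves by (simp add: energy_solution_def L2_time_def V_norm_def)
  interpret finite_measure "lebesgue_on {0<..<T}"
    by (rule finite_measure_lebesgue_on) auto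
  have "(\<lambda>r. sqrt ((l2_norm \<Omega> (weak_grad \<Omega> (ut r)))\<^sup>2)) \<in> borel_measurable (lebesgue_on {0<..<T})"
    by (rule measurable_compose[OF borel_measurable_integrable[OF sq] borel_measurable_sqrt])
  then have meas: "(\<lambda>r. l2_norm \<Omega> (weak_grad \<Omega> (ut r))) \<in> borel_measurable (lebesgue_on {0<..<T})" by simp
  show "integrable (lebesgue_on {0<..<T}) (\<lambda>r. l2_norm \<Omega> (weak_grad \<Omega> (ut r)))"
  proof (rule Bochner_Integration.integrable_bound[OF _ meas])
    show "integrable (lebesgue_on {0<..<T}) (\<lambda>r. 1 + (l2_norm \<Omega> (weak_grad \<Omega> (ut r)))\<^sup>2)" using sq by simp
    show "AE r in lebesgue_on {0<..<T}. norm (l2_norm \<Omega> (weak_grad \<Omega> (ut r))) \<le> norm (1 + (l2_norm \<Omega> (weak_grad \<Omega> (ut r)))\<^sup>2)"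
    proof (rule AE_I2)
      fix r
      have "l2_norm \<Omega> (weak_grad \<Omega> (ut r)) \<le> 1\<^sup>2 + (l2_norm \<Omega> (weak_grad \<Omega> (ut r)))\<^sup>2"
        using two_mult_le_sum_squares[of 1 "l2_norm \<Omega> (weak_grad \<Omega> (ut r))"] l2_norm_nonneg[of \<Omega> "weak_grad \<Omega> (ut r)"]
        by linarith
      then show "norm (l2_norm \<Omega> (weak_grad \<Omega> (ut r))) \<le> norm (1 + (l2_norm \<Omega> (weak_grad \<Omega> (ut r)))\<^sup>2)"
        by simp
    qed
  qed
qed

text \<open>For a test function the gradients can be moved onto it as a Laplacian, which is again a test
  function; general elements of \<open>H01 \<Omega>\<close> are limits of test functions.\<close>

lemma gradient_increment:
  assumes z: "z \<in> H01 \<Omega>" and st: "0 < s" "s < t" "t < T"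
  shows "integrable (lebesgue_on {0<..<T}) (\<lambda>r. l2_inner \<Omega> (weak_grad \<Omega> (ut r)) (weak_grad \<Omega> z))"
    and "l2_inner \<Omega> (weak_grad \<Omega> (u t)) (weak_grad \<Omega> z) - l2_inner \<Omega> (weak_grad \<Omega> (u s)) (weak_grad \<Omega> z)
      = (LINT r|lebesgue_on {s..t}. l2_inner \<Omega> (weak_grad \<Omega> (ut r)) (weak_grad \<Omega> z))"
proof -
  let ?M = "lebesgue_on {0<..<T}"
  obtain \<psi> where \<psi>: "\<And>k::nat. \<psi> k \<in> test_functions \<Omega>"
    "(\<lambda>k. l2_norm \<Omega> (\<lambda>x. \<psi> k x - z x)) \<longlonglongrightarrow> 0"
    "(\<lambda>k. l2_norm \<Omega> (\<lambda>x. grad (\<psi> k) x - weak_grad \<Omega> z x)) \<longlonglongrightarrow> 0"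
    using H01_approx[OF z] by blast
  \<comment> \<open>The Laplacian of \<open>\<psi> k\<close>.\<close>
  define L where "L = (\<lambda>k x. \<Sum>i\<in>UNIV. grad (\<lambda>y. grad (\<psi> k) y $ i) x $ i)"
  have comp: "(\<lambda>x. grad (\<lambda>y. grad (\<psi> k) y $ i) x $ i) \<in> test_functions \<Omega>" for k i
    by (intro test_grad_component \<psi>)
  have sum_test: "(\<lambda>x. \<Sum>i\<in>I. f i x) \<in> test_functions \<Omega>"
    if "finite I" "\<And>i. i \<in> I \<Longrightarrow> f i \<in> test_functions \<Omega>" for I :: "'n set" and f :: "'n \<Rightarrow> real^'n \<Rightarrow> real"
    using that
  proof (induction I rule: finite_induct)
    case empty
    show ?case by (rule test_functionsI[of _ "{}"]) (auto intro: smooth_const)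
  next
    case (insert i I)
    then have "(\<lambda>x. 1 * f i x + 1 * (\<Sum>i\<in>I. f i x)) \<in> test_functions \<Omega>"
      by (intro test_lincomb) auto
    then show ?case using insert by simp
  qed
  have L_test: "L k \<in> test_functions \<Omega>" for k unfolding L_def by (rule sum_test[OF finite comp])
  have parts: "l2_inner \<Omega> (weak_grad \<Omega> v) (grad (\<psi> k)) = - l2_inner \<Omega> v (L k)" if v: "v \<in> H01 \<Omega>" for v k
  proof -
    have "l2_inner \<Omega> (weak_grad \<Omega> v) (grad (\<psi> k)) = (LINT x|lebesgue_on \<Omega>. (\<Sum>i\<in>UNIV. weak_grad \<Omega> v x $ i * grad (\<psi> k) x $ i))"
      by (simp add: l2_inner_def inner_vec_def)
    also have "\<dots> = (\<Sum>i\<in>UNIV. LINT x|lebesgue_on \<Omega>. weak_grad \<Omega> v x $ i * grad (\<psi> k) x $ i)"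
      by (intro Bochner_Integration.integral_sum integrable_mult_test_function L2_component weak_grad_L2 v
          test_grad_component \<psi>)
    also have "\<dots> = (\<Sum>i\<in>UNIV. - (LINT x|lebesgue_on \<Omega>. v x * grad (\<lambda>y. grad (\<psi> k) y $ i) x $ i))"
      using H01_weak_grad[OF v] test_grad_component[OF \<psi>(1)] by (simp add: has_weak_grad_def)
    also have "\<dots> = - (LINT x|lebesgue_on \<Omega>. (\<Sum>i\<in>UNIV. v x * grad (\<lambda>y. grad (\<psi> k) y $ i) x $ i))"
      unfolding sum_negf
      by (subst Bochner_Integration.integral_sum) (auto intro!: integrable_mult_test_function H01_L2 v comp)
    finally show ?thesis by (simp add: l2_inner_def L_def sum_distrib_left)
  qed
  let ?I = "\<lambda>r. l2_inner \<Omega> (weak_grad \<Omega> (ut r)) (weak_grad \<Omega> z)"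
  let ?Ik = "\<lambda>k r. - l2_inner \<Omega> (ut r) (L k)"
  let ?m = "\<lambda>r. l2_norm \<Omega> (weak_grad \<Omega> (ut r))"
  have Ik: "AE r in ?M. \<forall>k. ?Ik k r = l2_inner \<Omega> (weak_grad \<Omega> (ut r)) (grad (\<psi> k)) \<and> ut r \<in> H01 \<Omega>"
    using ut_H01_AE by eventually_elim (simp add: parts)
  have Ik_int: "integrable ?M (?Ik k)" for k
    by (intro Bochner_Integration.integrable_minus integrable_open_interval continuous_on_inner test_L2 L_test)
  have lim: "AE r in ?M. (\<lambda>k. ?Ik k r) \<longlonglongrightarrow> ?I r"
    using Ik
  proof eventually_elim
    case (elim r)
    have "(\<lambda>k. l2_inner \<Omega> (weak_grad \<Omega> (ut r)) (grad (\<psi> k))) \<longlonglongrightarrow> ?I r"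
      using elim by (intro l2_inner_tendsto weak_grad_L2 test_grad_L2 \<psi> z const_tendsto) auto
    then show ?case using elim by simp
  qed
  have "Bseq (\<lambda>k. l2_norm \<Omega> (grad (\<psi> k)))"
    using l2_norm_tendsto[OF test_grad_L2[OF \<psi>(1)] weak_grad_L2[OF z] \<psi>(3)]
    by (intro convergent_imp_Bseq) (auto simp: convergent_def)
  then obtain C where C: "C > 0" "\<And>k. l2_norm \<Omega> (grad (\<psi> k)) \<le> C" by (auto simp: Bseq_def)
  have bound: "AE r in ?M. \<forall>k. norm (?Ik k r) \<le> C * ?m r"
    using Ik
  proof eventually_elim
    case (elim r)
    show ?case
    proof
      fix k
      have "\<bar>l2_inner \<Omega> (weak_grad \<Omega> (ut r)) (grad (\<psi> k))\<bar> \<le> ?m r * l2_norm \<Omega> (grad (\<psi> k))"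
        using elim by (intro l2_Cauchy_Schwarz weak_grad_L2 test_grad_L2 \<psi>) auto
      also have "\<dots> \<le> ?m r * C" using C by (intro mult_left_mono) auto
      finally show "norm (?Ik k r) \<le> C * ?m r" using elim by (simp add: mult.commute)
    qed
  qed
  have I_meas: "?I \<in> borel_measurable ?M"
  proof (rule borel_measurable_lebesgue_on_AE)
    show "(\<lambda>r. lim (\<lambda>k. ?Ik k r)) \<in> borel_measurable ?M"
      by (rule borel_measurable_lim_metric) (rule borel_measurable_integrable[OF Ik_int])
    show "AE r in ?M. lim (\<lambda>k. ?Ik k r) = ?I r" using lim by eventually_elim (rule limI)
  qed simp
  have m_int: "integrable ?M (\<lambda>r. C * ?m r)" using grad_velocity_integrable(2) by simp
  show I_int: "integrable ?M ?I"
  proof (rule integrable_dominated_convergence[OF I_meas borel_measurable_integrable[OF Ik_int] m_int lim])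
    show "AE r in ?M. norm (?Ik k r) \<le> C * ?m r" for k using bound by eventually_elim blast
  qed
  have mem: "s \<in> {0..T}" "t \<in> {0..T}" using st by auto
  have "(\<lambda>k. LINT r|lebesgue_on {s..t}. ?Ik k r) \<longlonglongrightarrow> (LINT r|lebesgue_on {s..t}. ?I r)"
  proof (rule integral_dominated_convergence)
    show "?I \<in> borel_measurable (lebesgue_on {s..t})"
      by (rule borel_measurable_integrable[OF integrable_sub[OF I_int st(1,3)]])
    show "?Ik k \<in> borel_measurable (lebesgue_on {s..t})" for k
      by (rule borel_measurable_integrable[OF integrable_sub[OF Ik_int st(1,3)]])
    show "integrable (lebesgue_on {s..t}) (\<lambda>r. C * ?m r)" by (rule integrable_sub[OF m_int st(1,3)])
    show "AE r in lebesgue_on {s..t}. (\<lambda>k. ?Ik k r) \<longlonglongrightarrow> ?I r" by (rule AE_sub[OF lim st(1,3)])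
    show "AE r in lebesgue_on {s..t}. norm (?Ik k r) \<le> C * ?m r" for k
      using AE_sub[OF bound st(1,3)] by eventually_elim blast
  qed
  moreover have "(LINT r|lebesgue_on {s..t}. ?Ik k r)
      = l2_inner \<Omega> (weak_grad \<Omega> (u t)) (grad (\<psi> k)) - l2_inner \<Omega> (weak_grad \<Omega> (u s)) (grad (\<psi> k))" for k
    unfolding Bochner_Integration.integral_minus
    using u_increment[OF test_H01(1)[OF L_test[of k]] st] parts[OF u_H01[OF mem(1)], of k]
      parts[OF u_H01[OF mem(2)], of k] by linarith
  moreover have "(\<lambda>k. l2_inner \<Omega> (weak_grad \<Omega> (u t)) (grad (\<psi> k)) - l2_inner \<Omega> (weak_grad \<Omega> (u s)) (grad (\<psi> k)))
      \<longlonglongrightarrow> l2_inner \<Omega> (weak_grad \<Omega> (u t)) (weak_grad \<Omega> z) - l2_inner \<Omega> (weak_grad \<Omega> (u s)) (weak_grad \<Omega> z)"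
    by (intro tendsto_diff l2_inner_tendsto gradu_L2 weak_grad_L2 test_grad_L2 \<psi> z mem const_tendsto)
  ultimately show "l2_inner \<Omega> (weak_grad \<Omega> (u t)) (weak_grad \<Omega> z) - l2_inner \<Omega> (weak_grad \<Omega> (u s)) (weak_grad \<Omega> z)
      = (LINT r|lebesgue_on {s..t}. ?I r)"
    using LIMSEQ_unique by simp
qed

text \<open>The weak equation, integrated in time; the strong damping term integrates to the increment of the
  gradient.\<close>

lemma velocity_increment:
  assumes z: "z \<in> H01 \<Omega>" and st: "0 < s" "s < t" "t < T"
  shows "l2_inner \<Omega> (ut t) z - l2_inner \<Omega> (ut s) z
      + (l2_inner \<Omega> (weak_grad \<Omega> (u t)) (weak_grad \<Omega> z) - l2_inner \<Omega> (weak_grad \<Omega> (u s)) (weak_grad \<Omega> z))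
      = (LINT r|lebesgue_on {s..t}. force r z)"
proof -
  let ?M = "lebesgue_on {0<..<T}"
  obtain utt where wd: "weak_time_deriv T (\<lambda>t. l2_inner \<Omega> (ut t) z) (\<lambda>t. utt t z)"
    and eq: "AE t in ?M. has_bochner_integral (lebesgue_on \<Omega>) (\<lambda>x. source (p x) (u t x) * z x)
             (utt t z + l2_inner \<Omega> (weak_grad \<Omega> (u t)) (weak_grad \<Omega> z)
              + l2_inner \<Omega> (weak_grad \<Omega> (ut t)) (weak_grad \<Omega> z)
              - (LINT s|lebesgue_on {0..t}. g (t - s) * l2_inner \<Omega> (weak_grad \<Omega> (u s)) (weak_grad \<Omega> z)))"
    using solves z unfolding energy_solution_def by blast
  let ?I = "\<lambda>r. l2_inner \<Omega> (weak_grad \<Omega> (ut r)) (weak_grad \<Omega> z)"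
  have F_int: "integrable ?M (\<lambda>r. force r z)" by (rule integrable_open_interval[OF continuous_on_force[OF z]])
  note I_int = gradient_increment(1)[OF z st]
  have utt: "AE r in ?M. force r z - ?I r = utt r z"
    using eq
  proof eventually_elim
    case (elim r)
    from has_bochner_integral_integral_eq[OF elim] show ?case by (simp add: force_def memory_def)
  qed
  have utt_int: "integrable ?M (\<lambda>r. utt r z)"
  proof (rule Bochner_Integration.integrable_cong_AE_imp[OF Bochner_Integration.integrable_diff[OF F_int I_int]])
    show "(\<lambda>r. utt r z) \<in> borel_measurable ?M"
      by (rule borel_measurable_lebesgue_on_AE[OF _ _ utt]) (use F_int I_int in auto)
    show "AE r in ?M. force r z - ?I r = utt r z" by (rule utt)
  qed
  have "l2_inner \<Omega> (ut t) z - l2_inner \<Omega> (ut s) z = (LINT r|lebesgue_on {s..t}. utt r z)"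
    by (rule weak_time_deriv_increment[OF wd continuous_on_inner(2)[OF H01_L2[OF z]] utt_int st])
  also have "\<dots> = (LINT r|lebesgue_on {s..t}. force r z - ?I r)"
  proof (rule integral_cong_AE)
    show "AE r in lebesgue_on {s..t}. utt r z = force r z - ?I r"
      using AE_sub[OF utt st(1,3)] by eventually_elim simp
  qed (use integrable_sub[OF utt_int st(1,3)] integrable_sub[OF F_int st(1,3)] integrable_sub[OF I_int st(1,3)] in auto)
  also have "\<dots> = (LINT r|lebesgue_on {s..t}. force r z) - (LINT r|lebesgue_on {s..t}. ?I r)"
    by (rule Bochner_Integration.integral_diff[OF integrable_sub[OF F_int st(1,3)] integrable_sub[OF I_int st(1,3)]])
  finally show ?thesis using gradient_increment(2)[OF z st] by simp
qed

end

section \<open>The momentum identity\<close>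

text \<open>Sum the local estimates over a fine equidistant partition.\<close>

lemma decreasing_of_local:
  fixes F :: "real \<Rightarrow> real"
  assumes ab: "a \<le> b" and loc: "\<And>e. e > 0 \<Longrightarrow> \<exists>d>0. \<forall>s\<in>{a..b}. \<forall>t\<in>{a..b}. s \<le> t \<and> t - s < d \<longrightarrow>
      F t - F s \<le> e * (t - s)"
  shows "F b \<le> F a"
proof (rule field_le_epsilon)
  fix e0 :: real assume "e0 > 0"
  define e where "e = e0 / (b - a + 1)"
  have e: "e > 0" using \<open>e0 > 0\<close> ab by (simp add: e_def)
  obtain d where d: "d > 0" "\<And>s t. s \<in> {a..b} \<Longrightarrow> t \<in> {a..b} \<Longrightarrow> s \<le> t \<Longrightarrow> t - s < d \<Longrightarrow>
      F t - F s \<le> e * (t - s)" using loc[OF e] by blast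
  obtain n :: nat where n: "(b - a) / d < real n" using reals_Archimedean2 by blast
  then have n0: "n > 0" using ab d(1) by (cases n) (auto simp: divide_less_0_iff)
  define h where "h = (b - a) / n"
  have h: "h \<ge> 0" "h < d" "a + n * h = b" using ab n n0 d(1) by (auto simp: h_def field_simps)
  have "F (a + n * h) - F (a + 0 * h) = (\<Sum>k<n. F (a + Suc k * h) - F (a + k * h))"
    using sum_lessThan_telescope[of "\<lambda>k. F (a + real k * h)" n] by simp
  also have "\<dots> \<le> (\<Sum>k<n. e * h)"
  proof (rule sum_mono)
    fix k assume "k \<in> {..<n}"
    then have "real (Suc k) * h \<le> n * h" "real k * h \<le> n * h" using h(1) by (auto intro!: mult_right_mono)
    then have "a + k * h \<in> {a..b}" "a + Suc k * h \<in> {a..b}" using h by auto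
    then show "F (a + Suc k * h) - F (a + k * h) \<le> e * h"
      using d(2)[of "a + k * h" "a + Suc k * h"] h by (simp add: algebra_simps)
  qed
  also have "\<dots> = e * (b - a)" using n0 by (simp add: h_def)
  also have "\<dots> \<le> e * (b - a + 1)" using e by simp
  also have "\<dots> = e0" using ab by (simp add: e_def)
  finally show "F b \<le> F a + e0" using h(3) by simp
qed

lemma abs_continuous_on_continuous:
  assumes "abs_continuous_on a b F"
  shows "continuous_on {a..b} F"
proof (rule continuous_onI)
  fix x e :: real assume x: "x \<in> {a..b}" and e: "e > 0"
  from assms[unfolded abs_continuous_on_def, rule_format, OF e]
  obtain d where d: "d > 0 \<and> (\<forall>I. finite I \<and> (\<forall>(s, t)\<in>I. a \<le> s \<and> s \<le> t \<and> t \<le> b) \<and>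
        disjoint_family_on (\<lambda>(s, t). {s<..<t}) I \<and> (\<Sum>(s, t)\<in>I. t - s) < d \<longrightarrow>
        (\<Sum>(s, t)\<in>I. \<bar>F t - F s\<bar>) < e)" ..
  have pair: "\<bar>F t - F s\<bar> < e" if "a \<le> s" "s \<le> t" "t \<le> b" "t - s < d" for s t
  proof -
    have "(\<Sum>(s, t)\<in>{(s, t)}. \<bar>F t - F s\<bar>) < e"
      by (rule d[THEN conjunct2, rule_format]) (use that in \<open>auto simp: disjoint_family_on_def\<close>)
    then show ?thesis by simp
  qed
  show "\<exists>d>0. \<forall>y\<in>{a..b}. dist y x < d \<longrightarrow> dist (F y) (F x) \<le> e"
  proof (intro exI[of _ d] conjI ballI impI)
    fix y assume y: "y \<in> {a..b}" "dist y x < d"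
    show "dist (F y) (F x) \<le> e"
    proof (cases "y \<le> x")
      case True
      have "x - y < d" using y(2) True by (simp add: dist_real_def)
      then show ?thesis using pair[of y x] x y True by (simp add: dist_real_def abs_minus_commute less_imp_le)
    next
      case False
      have "y - x < d" using y(2) False by (simp add: dist_real_def)
      then show ?thesis using pair[of x y] x y False by (simp add: dist_real_def less_imp_le)
    qed
  qed (use d in simp)
qed

lemma abs_continuous_on_subinterval:
  assumes ac: "abs_continuous_on a b F" and sub: "a \<le> c" "d \<le> b"
  shows "abs_continuous_on c d F"
  unfolding abs_continuous_on_def
proof (intro allI impI)
  fix e :: real assume e: "e > 0"
  from ac[unfolded abs_continuous_on_def, rule_format, OF e]
  obtain \<delta> where \<delta>: "\<delta> > 0 \<and> (\<forall>I. finite I \<and> (\<forall>(s, t)\<in>I. a \<le> s \<and> s \<le> t \<and> t \<le> b) \<and>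
        disjoint_family_on (\<lambda>(s, t). {s<..<t}) I \<and> (\<Sum>(s, t)\<in>I. t - s) < \<delta> \<longrightarrow>
        (\<Sum>(s, t)\<in>I. \<bar>F t - F s\<bar>) < e)" ..
  show "\<exists>\<delta>>0. \<forall>I. finite I \<and> (\<forall>(s, t)\<in>I. c \<le> s \<and> s \<le> t \<and> t \<le> d) \<and>
        disjoint_family_on (\<lambda>(s, t). {s<..<t}) I \<and> (\<Sum>(s, t)\<in>I. t - s) < \<delta> \<longrightarrow>
        (\<Sum>(s, t)\<in>I. \<bar>F t - F s\<bar>) < e"
  proof (intro exI[of _ \<delta>] conjI allI impI)
    fix I assume I: "finite I \<and> (\<forall>(s, t)\<in>I. c \<le> s \<and> s \<le> t \<and> t \<le> d) \<and>
        disjoint_family_on (\<lambda>(s, t). {s<..<t}) I \<and> (\<Sum>(s, t)\<in>I. t - s) < \<delta>"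
    then have "\<forall>(s, t)\<in>I. a \<le> s \<and> s \<le> t \<and> t \<le> b" using sub by fastforce
    then show "(\<Sum>(s, t)\<in>I. \<bar>F t - F s\<bar>) < e" using I \<delta> by blast
  qed (use \<delta> in simp)
qed

lemma reflect_kernel_integral:
  fixes g :: "real \<Rightarrow> real"
  assumes "continuous_on {0..t} g"
  shows "(LINT s|lebesgue_on {0..t}. g (t - s)) = (LINT s|lebesgue_on {0..t}. g s)"
proof -
  let ?F = "\<lambda>s. indicator {0..t} s *\<^sub>R g s"
  have m: "?F \<in> borel_measurable borel"
    by (rule borel_measurable_continuous_on_indicator) (use assms in auto)
  have e: "(\<lambda>s. indicator {0..t} s *\<^sub>R g (t - s)) = (\<lambda>s. ?F (t + (- 1) * s))"
    by (auto simp: indicator_def)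
  have m2: "(\<lambda>s. ?F (t + (- 1) * s)) \<in> borel_measurable borel"
    by (rule measurable_compose[OF _ m]) measurable
  have "(LINT s|lebesgue_on {0..t}. g (t - s)) = (LINT s|lebesgue. ?F (t + (- 1) * s))"
    by (subst integral_restrict_space) (simp_all only: e, simp_all)
  also have "\<dots> = (LINT s|lborel. ?F (t + (- 1) * s))" by (rule integral_completion) (use m2 in simp)
  also have "\<dots> = (LINT s|lborel. ?F s)"
    using lborel_integral_real_affine[of "-1" ?F t] by simp
  also have "\<dots> = (LINT s|lebesgue. ?F s)" by (rule integral_completion[symmetric]) (use m in simp)
  also have "\<dots> = (LINT s|lebesgue_on {0..t}. g s)" by (rule integral_restrict_space[symmetric]) simp
  finally show ?thesis .
qed

context energy_flow
begin

abbreviation mass :: "real \<Rightarrow> real" where "mass t \<equiv> (l2_norm \<Omega> (u t))\<^sup>2"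
abbreviation dirichlet :: "real \<Rightarrow> real" where "dirichlet t \<equiv> (l2_norm \<Omega> (weak_grad \<Omega> (u t)))\<^sup>2"
abbreviation kinetic :: "real \<Rightarrow> real" where "kinetic t \<equiv> (l2_norm \<Omega> (ut t))\<^sup>2"
abbreviation velocity_dirichlet :: "real \<Rightarrow> real" where
  "velocity_dirichlet t \<equiv> (l2_norm \<Omega> (weak_grad \<Omega> (ut t)))\<^sup>2"
abbreviation pairing :: "real \<Rightarrow> real" where "pairing t \<equiv> l2_inner \<Omega> (u t) (ut t)"

lemma H01_mid: "s \<in> {0..T} \<Longrightarrow> t \<in> {0..T} \<Longrightarrow> (\<lambda>x. c * u s x + c' * u t x) \<in> H01 \<Omega>"
  by (intro H01_lincomb u_H01)

lemma mid_tendsto: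
  assumes "\<And>k::nat. s k \<in> {0..T}" "\<And>k. t k \<in> {0..T}" "t0 \<in> {0..T}" "s \<longlonglongrightarrow> t0" "t \<longlonglongrightarrow> t0"
  shows "(\<lambda>k. l2_norm \<Omega> (\<lambda>x. weak_grad \<Omega> (\<lambda>x. c * u (s k) x + c * u (t k) x) x
      - weak_grad \<Omega> (\<lambda>x. c * u t0 x + c * u t0 x) x)) \<longlonglongrightarrow> 0"
proof (rule Lim_null_comparison[OF always_eventually], rule allI)
  fix k
  let ?W = "\<lambda>r. weak_grad \<Omega> (u r)"
  have "l2_norm \<Omega> (\<lambda>x. weak_grad \<Omega> (\<lambda>x. c * u (s k) x + c * u (t k) x) x
      - weak_grad \<Omega> (\<lambda>x. c * u t0 x + c * u t0 x) x)
    = l2_norm \<Omega> (\<lambda>x. c *\<^sub>R (?W (s k) x - ?W t0 x) + c *\<^sub>R (?W (t k) x - ?W t0 x))"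
  proof (rule l2_norm_cong_AE)
    show "AE x in lebesgue_on \<Omega>. weak_grad \<Omega> (\<lambda>x. c * u (s k) x + c * u (t k) x) x
        - weak_grad \<Omega> (\<lambda>x. c * u t0 x + c * u t0 x) x
        = c *\<^sub>R (?W (s k) x - ?W t0 x) + c *\<^sub>R (?W (t k) x - ?W t0 x)"
      using H01_lincomb(2)[OF u_H01[OF assms(1)[of k]] u_H01[OF assms(2)[of k]], of c c]
        H01_lincomb(2)[OF u_H01[OF assms(3)] u_H01[OF assms(3)], of c c]
      by eventually_elim (simp add: algebra_simps)
  qed (intro L2_diff L2_lincomb weak_grad_L2 H01_mid u_H01 assms)+
  also have "\<dots> \<le> l2_norm \<Omega> (\<lambda>x. c *\<^sub>R (?W (s k) x - ?W t0 x)) + l2_norm \<Omega> (\<lambda>x. c *\<^sub>R (?W (t k) x - ?W t0 x))"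
  proof (rule l2_norm_triangle)
    have "(\<lambda>x. c *\<^sub>R (?W r x - ?W t0 x)) \<in> L2 \<Omega>" if "r \<in> {0..T}" for r
      using L2_lincomb[OF L2_diff[OF gradu_L2[OF that] gradu_L2[OF assms(3)]] L2_diff[OF gradu_L2[OF that] gradu_L2[OF assms(3)]], of c 0]
      by simp
    then show "(\<lambda>x. c *\<^sub>R (?W (s k) x - ?W t0 x)) \<in> L2 \<Omega>" "(\<lambda>x. c *\<^sub>R (?W (t k) x - ?W t0 x)) \<in> L2 \<Omega>"
      using assms by blast+
  qed
  finally show "norm (l2_norm \<Omega> (\<lambda>x. weak_grad \<Omega> (\<lambda>x. c * u (s k) x + c * u (t k) x) x
      - weak_grad \<Omega> (\<lambda>x. c * u t0 x + c * u t0 x) x))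
    \<le> \<bar>c\<bar> * l2_norm \<Omega> (\<lambda>x. ?W (s k) x - ?W t0 x) + \<bar>c\<bar> * l2_norm \<Omega> (\<lambda>x. ?W (t k) x - ?W t0 x)"
    by (simp add: l2_norm_scale)
next
  show "(\<lambda>k. \<bar>c\<bar> * l2_norm \<Omega> (\<lambda>x. weak_grad \<Omega> (u (s k)) x - weak_grad \<Omega> (u t0) x)
      + \<bar>c\<bar> * l2_norm \<Omega> (\<lambda>x. weak_grad \<Omega> (u (t k)) x - weak_grad \<Omega> (u t0) x)) \<longlonglongrightarrow> 0"
    using tendsto_add[OF tendsto_mult_left[OF gradu_tendsto[OF assms(1,3,4)], of "\<bar>c\<bar>"]
        tendsto_mult_left[OF gradu_tendsto[OF assms(2,3,5)], of "\<bar>c\<bar>"]] by simp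
qed

lemma inner_lincomb_real:
  fixes f h w :: "real^'n \<Rightarrow> real"
  assumes "f \<in> L2 \<Omega>" "h \<in> L2 \<Omega>" "w \<in> L2 \<Omega>"
  shows "l2_inner \<Omega> w (\<lambda>x. a * f x + b * h x) = a * l2_inner \<Omega> w f + b * l2_inner \<Omega> w h"
  using l2_inner_lincomb_right[OF assms, of a b] by simp

lemma mass_deriv:
  assumes "0 < t0" "t0 < T"
  shows "(mass has_real_derivative 2 * pairing t0) (at t0)"
proof (rule deriv_of_increment[OF assms, where K = "\<lambda>r s t. 1 * l2_inner \<Omega> (ut r) (u s) + 1 * l2_inner \<Omega> (ut r) (u t)"])
  fix s t assume st: "0 < s" "s < t" "t < T"
  then have m: "s \<in> {0..T}" "t \<in> {0..T}" by auto
  have "l2_inner \<Omega> (u t) (\<lambda>x. 1 * u s x + 1 * u t x) - l2_inner \<Omega> (u s) (\<lambda>x. 1 * u s x + 1 * u t x)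
      = mass t - mass s"
    by (subst (1 2) inner_lincomb_real) (auto intro!: u_L2 m simp: l2_norm_sq l2_inner_commute[of \<Omega> "u t" "u s"])
  moreover have "(LINT r|lebesgue_on {s..t}. l2_inner \<Omega> (ut r) (\<lambda>x. 1 * u s x + 1 * u t x))
      = (LINT r|lebesgue_on {s..t}. 1 * l2_inner \<Omega> (ut r) (u s) + 1 * l2_inner \<Omega> (ut r) (u t))"
  proof (rule Bochner_Integration.integral_cong[OF refl])
    fix r assume "r \<in> space (lebesgue_on {s..t})"
    then have "r \<in> {0..T}" using st by auto
    then show "l2_inner \<Omega> (ut r) (\<lambda>x. 1 * u s x + 1 * u t x) = 1 * l2_inner \<Omega> (ut r) (u s) + 1 * l2_inner \<Omega> (ut r) (u t)"
      by (intro inner_lincomb_real u_L2 ut_L2 m)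
  qed
  ultimately show "mass t - mass s = (LINT r|lebesgue_on {s..t}. 1 * l2_inner \<Omega> (ut r) (u s) + 1 * l2_inner \<Omega> (ut r) (u t))"
    using u_increment[OF H01_mid[OF m, of 1 1] st] by simp
  show "continuous_on {s..t} (\<lambda>r. 1 * l2_inner \<Omega> (ut r) (u s) + 1 * l2_inner \<Omega> (ut r) (u t))"
    using m by (intro continuous_intros continuous_on_subset[OF continuous_on_inner(2)] u_L2) auto
next
  fix r s t :: "nat \<Rightarrow> real"
  assume a: "\<And>k. r k \<in> {0<..<T} \<and> s k \<in> {0<..<T} \<and> t k \<in> {0<..<T}" "r \<longlonglongrightarrow> t0" "s \<longlonglongrightarrow> t0" "t \<longlonglongrightarrow> t0"
  have m: "r k \<in> {0..T}" "s k \<in> {0..T}" "t k \<in> {0..T}" "t0 \<in> {0..T}" for k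
    using a(1)[of k] assms by auto
  have "(\<lambda>k. 1 * l2_inner \<Omega> (ut (r k)) (u (s k)) + 1 * l2_inner \<Omega> (ut (r k)) (u (t k)))
      \<longlonglongrightarrow> 1 * l2_inner \<Omega> (ut t0) (u t0) + 1 * l2_inner \<Omega> (ut t0) (u t0)"
    by (intro tendsto_intros l2_inner_tendsto u_L2 ut_L2 m ut_tendsto u_tendsto a)
  then show "(\<lambda>k. 1 * l2_inner \<Omega> (ut (r k)) (u (s k)) + 1 * l2_inner \<Omega> (ut (r k)) (u (t k))) \<longlonglongrightarrow> 2 * pairing t0"
    by (simp add: l2_inner_commute[of \<Omega> "ut t0"])
qed

text \<open>The weak equation may be tested only with functions independent of time. Testing on \<open>[s, t]\<close>
  with the mean of \<open>u s\<close> and \<open>u t\<close> makes the increments of both the pairing and the Dirichlet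
  energy exact, so that the strong damping term integrates completely.\<close>

lemma momentum_deriv:
  assumes "0 < t0" "t0 < T"
  shows "((\<lambda>t. pairing t + dirichlet t / 2) has_real_derivative (kinetic t0 + force t0 (u t0))) (at t0)"
proof (rule deriv_of_increment[OF assms, where K = "\<lambda>r s t. (1/2 * l2_inner \<Omega> (ut r) (ut s) + 1/2 * l2_inner \<Omega> (ut r) (ut t))
      + force r (\<lambda>x. 1/2 * u s x + 1/2 * u t x)"])
  fix s t assume st: "0 < s" "s < t" "t < T"
  then have m: "s \<in> {0..T}" "t \<in> {0..T}" and st': "0 < t" "s < T" by auto
  let ?z = "\<lambda>x. 1/2 * u s x + 1/2 * u t x"
  have z: "?z \<in> H01 \<Omega>" by (rule H01_mid[OF m])
  have c1: "continuous_on {0..T} (\<lambda>r. l2_inner \<Omega> (ut r) (ut s))" "continuous_on {0..T} (\<lambda>r. l2_inner \<Omega> (ut r) (ut t))"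
    by (intro continuous_on_inner ut_L2 m)+
  have c2: "continuous_on {0..T} (\<lambda>r. force r ?z)" by (rule continuous_on_force[OF z])
  note ints = integrable_sub[OF integrable_open_interval[OF c1(1)] st(1,3)]
    integrable_sub[OF integrable_open_interval[OF c1(2)] st(1,3)]
    integrable_sub[OF integrable_open_interval[OF c2] st(1,3)]
  have v1: "l2_inner \<Omega> (ut r) ?z = 1/2 * l2_inner \<Omega> (ut r) (u s) + 1/2 * l2_inner \<Omega> (ut r) (u t)" if "r \<in> {0..T}" for r
    by (intro inner_lincomb_real u_L2 ut_L2 m that)
  have v2: "l2_inner \<Omega> (weak_grad \<Omega> (u r)) (weak_grad \<Omega> ?z)
      = 1/2 * l2_inner \<Omega> (weak_grad \<Omega> (u r)) (weak_grad \<Omega> (u s)) + 1/2 * l2_inner \<Omega> (weak_grad \<Omega> (u r)) (weak_grad \<Omega> (u t))"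
    if "r \<in> {0..T}" for r
    by (intro l2_inner_weak_grad_lincomb u_H01 gradu_L2 m that)
  have "pairing t + dirichlet t / 2 - (pairing s + dirichlet s / 2)
      = 1/2 * (l2_inner \<Omega> (u t) (ut s) - l2_inner \<Omega> (u s) (ut s)) + 1/2 * (l2_inner \<Omega> (u t) (ut t) - l2_inner \<Omega> (u s) (ut t))
       + (l2_inner \<Omega> (ut t) ?z - l2_inner \<Omega> (ut s) ?z
      + (l2_inner \<Omega> (weak_grad \<Omega> (u t)) (weak_grad \<Omega> ?z) - l2_inner \<Omega> (weak_grad \<Omega> (u s)) (weak_grad \<Omega> ?z)))"
    unfolding v1[OF m(1)] v1[OF m(2)] v2[OF m(1)] v2[OF m(2)] l2_norm_sq
      l2_inner_commute[of \<Omega> "ut t"] l2_inner_commute[of \<Omega> "ut s"]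
      l2_inner_commute[of \<Omega> "weak_grad \<Omega> (u t)" "weak_grad \<Omega> (u s)"] by (simp add: algebra_simps)
  also have "\<dots> = 1/2 * (LINT r|lebesgue_on {s..t}. l2_inner \<Omega> (ut r) (ut s))
      + 1/2 * (LINT r|lebesgue_on {s..t}. l2_inner \<Omega> (ut r) (ut t)) + (LINT r|lebesgue_on {s..t}. force r ?z)"
    unfolding velocity_increment[OF z st] u_increment_velocity[OF st(1) st'(2) st] u_increment_velocity[OF st'(1) st(3) st] ..
  also have "\<dots> = (LINT r|lebesgue_on {s..t}. (1/2 * l2_inner \<Omega> (ut r) (ut s) + 1/2 * l2_inner \<Omega> (ut r) (ut t)) + force r ?z)"
    using ints by simp
  finally show "pairing t + dirichlet t / 2 - (pairing s + dirichlet s / 2)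
      = (LINT r|lebesgue_on {s..t}. (1/2 * l2_inner \<Omega> (ut r) (ut s) + 1/2 * l2_inner \<Omega> (ut r) (ut t)) + force r ?z)" .
  show "continuous_on {s..t} (\<lambda>r. (1/2 * l2_inner \<Omega> (ut r) (ut s) + 1/2 * l2_inner \<Omega> (ut r) (ut t)) + force r ?z)"
    using m by (intro continuous_intros continuous_on_subset[OF c1(1)] continuous_on_subset[OF c1(2)]
        continuous_on_subset[OF c2]) auto
next
  fix r s t :: "nat \<Rightarrow> real"
  assume a: "\<And>k. r k \<in> {0<..<T} \<and> s k \<in> {0<..<T} \<and> t k \<in> {0<..<T}" "r \<longlonglongrightarrow> t0" "s \<longlonglongrightarrow> t0" "t \<longlonglongrightarrow> t0"
  have m: "r k \<in> {0..T}" "s k \<in> {0..T}" "t k \<in> {0..T}" "t0 \<in> {0..T}" for k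
    using a(1)[of k] assms by auto
  have "(\<lambda>k. (1/2 * l2_inner \<Omega> (ut (r k)) (ut (s k)) + 1/2 * l2_inner \<Omega> (ut (r k)) (ut (t k)))
        + force (r k) (\<lambda>x. 1/2 * u (s k) x + 1/2 * u (t k) x))
      \<longlonglongrightarrow> (1/2 * l2_inner \<Omega> (ut t0) (ut t0) + 1/2 * l2_inner \<Omega> (ut t0) (ut t0))
        + force t0 (\<lambda>x. 1/2 * u t0 x + 1/2 * u t0 x)"
    by (intro tendsto_add tendsto_mult_left l2_inner_tendsto ut_L2 m ut_tendsto a force_tendsto H01_mid
        mid_tendsto)
  moreover have "(\<lambda>x. 1/2 * u t0 x + 1/2 * u t0 x) = u t0" by (auto simp: field_simps)
  ultimately show "(\<lambda>k. (1/2 * l2_inner \<Omega> (ut (r k)) (ut (s k)) + 1/2 * l2_inner \<Omega> (ut (r k)) (ut (t k)))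
        + force (r k) (\<lambda>x. 1/2 * u (s k) x + 1/2 * u (t k) x)) \<longlonglongrightarrow> kinetic t0 + force t0 (u t0)"
    by (simp add: l2_norm_sq)
qed

text \<open>Absorbing the deviation of the memory into the memory energy costs \<open>1 / (2 pm)\<close> of the weight
  of the Dirichlet energy.\<close>

lemma memory_ge:
  assumes t: "t \<in> {0..T}"
  defines "G \<equiv> LINT s|lebesgue_on {0..t}. g s"
  shows "(1 - 1 / (2 * pm)) * G * dirichlet t - pm / 2 * memory_energy \<Omega> g u t \<le> memory t (u t)"
proof -
  let ?M = "lebesgue_on {0..t}"
  let ?W = "\<lambda>r. weak_grad \<Omega> (u r)"
  let ?d = "\<lambda>s. (l2_norm \<Omega> (\<lambda>x. ?W t x - ?W s x))\<^sup>2"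
  have sub: "{0..t} \<subseteq> {0..T}" using t by auto
  have cg: "continuous_on {0..t} (\<lambda>s. g (t - s))"
    by (intro continuous_on_compose2[OF kernel_continuous]) (auto intro!: continuous_intros)
  have ci: "continuous_on {0..t} (\<lambda>s. l2_inner \<Omega> (?W s) (?W t))"
    by (rule continuous_on_subset[OF continuous_on_inner(3)[OF gradu_L2[OF t]] sub])
  have d_eq: "?d s = dirichlet t - 2 * l2_inner \<Omega> (?W s) (?W t) + dirichlet s" if "s \<in> {0..T}" for s
    using l2_norm_sq_lincomb[OF gradu_L2[OF t] gradu_L2[OF that], of 1 "-1"]
    by (simp add: l2_inner_commute[of \<Omega> "?W t" "?W s"])
  have cd: "continuous_on {0..t} ?d"
  proof -
    have "continuous_on {0..t} (\<lambda>s. dirichlet t - 2 * l2_inner \<Omega> (?W s) (?W t) + dirichlet s)"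
      by (intro continuous_intros ci continuous_on_subset[OF continuous_on_pair(4) sub])
    then show ?thesis by (rule continuous_on_eq) (use d_eq sub in auto)
  qed
  have i1: "integrable ?M (\<lambda>s. g (t - s))" by (rule continuous_imp_integrable_real[OF cg])
  have i2: "integrable ?M (\<lambda>s. g (t - s) * ?d s)"
    by (intro continuous_imp_integrable_real continuous_on_mult cg cd)
  have i3: "integrable ?M (\<lambda>s. g (t - s) * l2_inner \<Omega> (?W s) (?W t))"
    by (intro continuous_imp_integrable_real continuous_on_mult cg ci)
  have "(LINT s|?M. (1 - 1 / (2 * pm)) * dirichlet t * g (t - s) - pm / 2 * (g (t - s) * ?d s))
      \<le> (LINT s|?M. g (t - s) * l2_inner \<Omega> (?W s) (?W t))"
  proof (rule integral_mono)
    fix s assume "s \<in> space ?M"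
    then have s: "s \<in> {0..t}" "s \<in> {0..T}" using sub by auto
    let ?b = "l2_norm \<Omega> (?W t)" and ?c = "l2_norm \<Omega> (\<lambda>x. ?W t x - ?W s x)"
    have "l2_inner \<Omega> (?W t) (\<lambda>x. ?W t x - ?W s x) \<le> ?b * ?c"
      using l2_Cauchy_Schwarz[OF gradu_L2[OF t] L2_diff[OF gradu_L2[OF t] gradu_L2[OF s(2)]]] by simp
    moreover have "l2_inner \<Omega> (?W t) (\<lambda>x. ?W t x - ?W s x) = ?b\<^sup>2 - l2_inner \<Omega> (?W s) (?W t)"
      by (subst l2_inner_diff_right) (auto intro!: gradu_L2 t s simp: l2_norm_sq l2_inner_commute)
    moreover have "?b * ?c \<le> ?b\<^sup>2 / (2 * pm) + pm / 2 * ?c\<^sup>2"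
    proof -
      have "0 \<le> (?b - pm * ?c)\<^sup>2 / (2 * pm)" using pm_gt_2 by simp
      also have "\<dots> = ?b\<^sup>2 / (2 * pm) + pm / 2 * ?c\<^sup>2 - ?b * ?c"
        using pm_gt_2 by (simp add: power2_eq_square field_simps)
      finally show ?thesis by simp
    qed
    ultimately have "(1 - 1 / (2 * pm)) * ?b\<^sup>2 - pm / 2 * ?c\<^sup>2 \<le> l2_inner \<Omega> (?W s) (?W t)"
      by (simp add: algebra_simps)
    then have "g (t - s) * ((1 - 1 / (2 * pm)) * ?b\<^sup>2 - pm / 2 * ?c\<^sup>2) \<le> g (t - s) * l2_inner \<Omega> (?W s) (?W t)"
      using kernel_nonneg[of "t - s"] s by (intro mult_left_mono) auto
    then show "(1 - 1 / (2 * pm)) * dirichlet t * g (t - s) - pm / 2 * (g (t - s) * ?d s)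
        \<le> g (t - s) * l2_inner \<Omega> (?W s) (?W t)"
      by (simp add: algebra_simps)
  qed (use i1 i2 i3 in auto)
  moreover have "(LINT s|?M. g (t - s)) = G"
    unfolding G_def by (rule reflect_kernel_integral) (rule continuous_on_subset[OF kernel_continuous], auto)
  moreover have "(LINT s|?M. (1 - 1 / (2 * pm)) * dirichlet t * g (t - s) - pm / 2 * (g (t - s) * ?d s))
      = (1 - 1 / (2 * pm)) * dirichlet t * (LINT s|?M. g (t - s)) - pm / 2 * (LINT s|?M. g (t - s) * ?d s)"
    using i1 i2 by simp
  ultimately show ?thesis by (simp add: memory_def memory_energy_def mult_ac)
qed

lemma kernel_mass_le:
  shows "(LINT s|lebesgue_on {0..t}. g s) \<le> 1 - ell g"
proof -
  have g: "integrable (lebesgue_on {0..}) g" using kernel by (simp add: H2_def)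
  have int: "integrable lebesgue (\<lambda>s. indicator {0..} s *\<^sub>R g s)"
    using g by (subst (asm) integrable_restrict_space) auto
  have "integrable (lebesgue_on {0..t}) g"
    by (rule integrable_lebesgue_on_subset[OF g]) auto
  then have int2: "integrable lebesgue (\<lambda>s. indicator {0..t} s *\<^sub>R g s)"
    by (subst (asm) integrable_restrict_space) auto
  have "(LINT s|lebesgue. indicator {0..t} s *\<^sub>R g s) \<le> (LINT s|lebesgue. indicator {0..} s *\<^sub>R g s)"
    by (rule integral_mono[OF int2 int]) (use kernel_nonneg in \<open>auto simp: indicator_def\<close>)
  then show ?thesis by (simp add: ell_def integral_restrict_space)
qed

text \<open>The weight that remains for the Dirichlet energy in the lower bound below; it is nonnegative exactly under
  the smallness condition on the kernel.\<close>

definition gap :: real where "gap = ((pm - 1)\<^sup>2 * ell g - 1) / (2 * pm)"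

text \<open>The source dominates \<open>pm\<close> times its primitive up to the constant of the shifted energy, and the energy
  identity exchanges the primitive for the kinetic, Dirichlet and memory terms.\<close>

lemma momentum_deriv_ge:
  assumes t: "t \<in> {0..T}"
  shows "(1 + pm / 2) * kinetic t + gap * dirichlet t - pm * shifted_energy \<Omega> p g u ut t
    \<le> kinetic t + force t (u t)"
proof -
  let ?G = "LINT s|lebesgue_on {0..t}. g s"
  let ?m = "memory_energy \<Omega> g u t" and ?Q = "dirichlet t" and ?P = "kinetic t"
  let ?F = "LINT x|lebesgue_on \<Omega>. source_primitive (p x) (u t x)"
  let ?S = "LINT x|lebesgue_on \<Omega>. source (p x) (u t x) * u t x"
  have p0: "pm > 0" using pm_gt_2 by simp
  have S: "pm * ?F - C_star \<Omega> p \<le> ?S" by (rule source_energy_ge(1)[OF u_H01[OF t]])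
  have M: "(1 - 1 / (2 * pm)) * ?G * ?Q - pm / 2 * ?m \<le> memory t (u t)" by (rule memory_ge[OF t])
  have force: "force t (u t) = - ?Q + memory t (u t) + ?S" by (simp add: force_def l2_norm_sq)
  have E: "pm * shifted_energy \<Omega> p g u ut t = pm / 2 * ?P + pm / 2 * (1 - ?G) * ?Q + pm / 2 * ?m - pm * ?F + C_star \<Omega> p"
    using p0 by (simp add: shifted_energy_def energy_def algebra_simps)
  have coeff: "gap \<le> - 1 + (1 - 1 / (2 * pm)) * ?G + pm / 2 * (1 - ?G)"
  proof -
    have "2 * pm * (- 1 + (1 - 1 / (2 * pm)) * ?G + pm / 2 * (1 - ?G)) = pm * (pm - 2) - ?G * (pm - 1)\<^sup>2"
      using p0 by (simp add: field_simps power2_eq_square)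
    moreover have "?G * (pm - 1)\<^sup>2 \<le> (1 - ell g) * (pm - 1)\<^sup>2"
      by (rule mult_right_mono[OF kernel_mass_le]) simp
    moreover have "pm * (pm - 2) - (1 - ell g) * (pm - 1)\<^sup>2 = 2 * pm * gap"
    proof -
      have "2 * pm * gap = (pm - 1)\<^sup>2 * ell g - 1" using p0 by (simp add: gap_def)
      then show ?thesis by (simp only:) (simp add: power2_eq_square algebra_simps)
    qed
    ultimately have "2 * pm * gap \<le> 2 * pm * (- 1 + (1 - 1 / (2 * pm)) * ?G + pm / 2 * (1 - ?G))" by linarith
    then show ?thesis using p0 by simp
  qed
  have "gap * ?Q \<le> (- 1 + (1 - 1 / (2 * pm)) * ?G + pm / 2 * (1 - ?G)) * ?Q"
    by (rule mult_right_mono[OF coeff]) simp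
  then show ?thesis using S M unfolding force E by (simp add: algebra_simps)
qed

end

section \<open>Concavity and growth of real functions\<close>

lemma sq_le_of_Young:
  fixes x :: real
  assumes "x \<ge> 0" "A > 0" "B > 0" and young: "\<And>\<eta>. \<eta> > 0 \<Longrightarrow> x \<le> (\<eta> * A + B / \<eta>) / 2"
  shows "x\<^sup>2 \<le> A * B"
proof -
  define \<eta> where "\<eta> = sqrt (A * B) / A"
  have \<eta>: "\<eta> > 0" "\<eta> * A = sqrt (A * B)" using assms by (auto simp: \<eta>_def)
  have "B / \<eta> = A * B / sqrt (A * B)" using assms by (simp add: \<eta>_def)
  also have "\<dots> = sqrt (A * B)" using assms by (intro real_div_sqrt) simp
  finally have "x \<le> sqrt (A * B)" using young[OF \<eta>(1)] \<eta>(2) by simp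
  then have "x\<^sup>2 \<le> (sqrt (A * B))\<^sup>2" using assms(1) by (rule power_mono)
  then show ?thesis using assms by simp
qed

text \<open>The power \<open>\<psi> powr (- \<alpha>)\<close> is concave and its initial slope is negative, so it reaches zero
  no later than its tangent at the initial point.\<close>

lemma concavity_bound:
  fixes \<psi> \<psi>' \<psi>'' :: "real \<Rightarrow> real"
  assumes ab: "a < b" and \<alpha>: "\<alpha> > 0"
    and pos: "\<And>t. t \<in> {a..b} \<Longrightarrow> \<psi> t > 0"
    and cont: "continuous_on {a..b} \<psi>" "continuous_on {a..b} \<psi>'"
    and der: "\<And>t. a < t \<Longrightarrow> t < b \<Longrightarrow> (\<psi> has_real_derivative \<psi>' t) (at t)"
    and der': "\<And>t. a < t \<Longrightarrow> t < b \<Longrightarrow> (\<psi>' has_real_derivative \<psi>'' t) (at t)"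
    and start: "\<psi>' a > 0"
    and convex: "\<And>t. a < t \<Longrightarrow> t < b \<Longrightarrow> \<psi>'' t \<ge> 0"
    and conc: "\<And>t. a < t \<Longrightarrow> t < b \<Longrightarrow> \<psi>' t > 0 \<Longrightarrow> (1 + \<alpha>) * (\<psi>' t)\<^sup>2 \<le> \<psi> t * \<psi>'' t"
  shows "b - a \<le> \<psi> a / (\<alpha> * \<psi>' a)"
proof -
  have \<psi>'_pos: "\<psi>' t > 0" if t: "t \<in> {a..b}" for t
  proof -
    have "\<psi>' a \<le> \<psi>' t"
    proof (rule DERIV_nonneg_imp_increasing_open[where f = "\<psi>'"])
      show "continuous_on {a..t} \<psi>'" by (rule continuous_on_subset[OF cont(2)]) (use t in auto)
      show "\<exists>y. (\<psi>' has_real_derivative y) (at x) \<and> 0 \<le> y" if x: "a < x" "x < t" for x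
        by (intro exI[of _ "\<psi>'' x"] conjI der' convex) (use x t in auto)
    qed (use t in auto)
    then show ?thesis using start by simp
  qed
  define y where "y t = \<psi>' t * \<psi> t powr (- \<alpha> - 1)" for t
  have y_mono: "y a \<le> y t" if t: "t \<in> {a..b}" for t
  proof (rule DERIV_nonneg_imp_increasing_open[where f = y])
    show "continuous_on {a..t} y"
      unfolding y_def using t pos
      by (intro continuous_intros continuous_on_subset[OF cont(1)] continuous_on_subset[OF cont(2)])
        (auto simp: less_imp_neq[THEN not_sym])
    fix x assume x: "a < x" "x < t"
    then have xb: "x \<in> {a..b}" "x < b" using t by auto
    have p: "\<psi> x > 0" by (rule pos[OF xb(1)])
    have "(y has_real_derivative \<psi>'' x * \<psi> x powr (- \<alpha> - 1)
        + (- \<alpha> - 1) * \<psi> x powr (- \<alpha> - 1 - 1) * \<psi>' x * \<psi>' x) (at x)"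
      unfolding y_def
      using DERIV_mult[OF der'[OF x(1) xb(2)] DERIV_fun_powr[OF der[OF x(1) xb(2)] p, of "- \<alpha> - 1"]]
      by (simp add: algebra_simps)
    moreover have "\<psi>'' x * \<psi> x powr (- \<alpha> - 1) + (- \<alpha> - 1) * \<psi> x powr (- \<alpha> - 1 - 1) * \<psi>' x * \<psi>' x
        = \<psi> x powr (- \<alpha> - 1 - 1) * (\<psi> x * \<psi>'' x - (1 + \<alpha>) * (\<psi>' x)\<^sup>2)"
      using p by (simp add: powr_diff power2_eq_square field_simps)
    moreover have "0 \<le> \<psi> x powr (- \<alpha> - 1 - 1) * (\<psi> x * \<psi>'' x - (1 + \<alpha>) * (\<psi>' x)\<^sup>2)"
      using conc[OF x(1) xb(2) \<psi>'_pos[OF xb(1)]] by simp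
    ultimately show "\<exists>z. (y has_real_derivative z) (at x) \<and> 0 \<le> z" by metis
  qed (use t in auto)
  have ya: "y a > 0" using start pos[of a] ab by (simp add: y_def)
  let ?J = "\<lambda>t. - (\<psi> t powr (- \<alpha>)) - \<alpha> * y a * (t - a)"
  have "?J a \<le> ?J b"
  proof (rule DERIV_nonneg_imp_increasing_open[where f = ?J])
    show "continuous_on {a..b} ?J"
      using pos by (intro continuous_intros cont) (auto simp: less_imp_neq[THEN not_sym])
    fix x assume x: "a < x" "x < b"
    have p: "\<psi> x > 0" using pos[of x] x by simp
    have "(?J has_real_derivative \<alpha> * \<psi> x powr (- \<alpha> - 1) * \<psi>' x - \<alpha> * y a) (at x)"
      by (rule derivative_eq_intros DERIV_fun_powr der[OF x] p refl)+ simp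
    moreover have "0 \<le> \<alpha> * \<psi> x powr (- \<alpha> - 1) * \<psi>' x - \<alpha> * y a"
      using mult_left_mono[OF y_mono[of x], of \<alpha>] x \<alpha> by (simp add: y_def mult_ac)
    ultimately show "\<exists>z. (?J has_real_derivative z) (at x) \<and> 0 \<le> z" by metis
  qed (use ab in simp)
  then have "\<alpha> * y a * (b - a) \<le> \<psi> a powr (- \<alpha>) - \<psi> b powr (- \<alpha>)" by simp
  then have le: "\<alpha> * y a * (b - a) \<le> \<psi> a powr (- \<alpha>)" by (rule order_trans) simp
  have p: "\<psi> a > 0" using pos[of a] ab by simp
  have "b - a \<le> \<psi> a powr (- \<alpha>) / (\<alpha> * y a)"
    using le \<alpha> ya by (simp add: field_simps)
  also have "\<dots> = \<psi> a / (\<alpha> * \<psi>' a)" using p start \<alpha> by (simp add: y_def powr_diff field_simps)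
  finally show ?thesis .
qed

text \<open>A first zero of \<open>\<Lambda>\<close> is impossible, as \<open>\<Lambda>\<close> does not decrease below \<open>\<Lambda> 0\<close> before it.\<close>

lemma integral_growth:
  fixes \<Lambda> :: "real \<Rightarrow> real"
  assumes cont: "continuous_on {0..T} \<Lambda>" and C: "C > 0" and start: "\<Lambda> 0 > 0"
    and growth: "\<And>t. t \<in> {0..T} \<Longrightarrow> \<Lambda> t - \<Lambda> 0 \<ge> C * integral {0..t} \<Lambda>"
    and t: "t \<in> {0..T}"
  shows "\<Lambda> t \<ge> \<Lambda> 0 * (1 + C * t)"
proof -
  have nn: "\<Lambda> x \<ge> \<Lambda> 0" if "x \<in> {0..T}" "\<And>r. r \<in> {0..x} \<Longrightarrow> \<Lambda> r \<ge> 0" for x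
  proof -
    have "C * integral {0..x} \<Lambda> \<ge> 0" using C that by (intro mult_nonneg_nonneg integral_nonneg
          integrable_continuous_real continuous_on_subset[OF cont]) auto
    then show ?thesis using growth[OF that(1)] by simp
  qed
  have pos: "\<Lambda> x > 0" if x: "x \<in> {0..T}" for x
  proof (rule ccontr)
    assume neg: "\<not> \<Lambda> x > 0"
    define S where "S = {0..x} \<inter> \<Lambda> -` {0}"
    have c: "continuous_on {0..x} \<Lambda>" by (rule continuous_on_subset[OF cont]) (use x in auto)
    have "\<exists>z\<ge>0. z \<le> x \<and> \<Lambda> z = 0" by (rule IVT2') (use neg start x c in auto)
    then have ne: "S \<noteq> {}" by (auto simp: S_def)
    have "closed S" unfolding S_def by (intro continuous_closed_preimage c) auto
    then have "compact S" using compact_Int_closed[of "{0..x}" S] by (auto simp: S_def Int_absorb)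
    then obtain m where m: "m \<in> S" "\<And>z. z \<in> S \<Longrightarrow> m \<le> z"
      using compact_attains_inf[OF _ ne] by blast
    have "\<Lambda> r \<ge> 0" if r: "r \<in> {0..m}" for r
    proof (rule ccontr)
      assume "\<not> \<Lambda> r \<ge> 0"
      then have "\<exists>z\<ge>0. z \<le> r \<and> \<Lambda> z = 0"
        by (intro IVT2' continuous_on_subset[OF c]) (use r start m(1) in \<open>auto simp: S_def\<close>)
      then obtain z where z: "0 \<le> z" "z \<le> r" "\<Lambda> z = 0" by blast
      then have "z \<in> S" using r m(1) by (auto simp: S_def)
      then have "z = r" using m(2)[of z] z r by simp
      then show False using z \<open>\<not> \<Lambda> r \<ge> 0\<close> by simp
    qed
    then have "\<Lambda> m \<ge> \<Lambda> 0" using m(1) x by (intro nn) (auto simp: S_def)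
    then show False using m(1) start by (simp add: S_def)
  qed
  have ge: "\<Lambda> r \<ge> \<Lambda> 0" if "r \<in> {0..T}" for r
    by (rule nn[OF that]) (use pos that in \<open>auto intro!: less_imp_le\<close>)
  have "integral {0..t} (\<lambda>_. \<Lambda> 0) \<le> integral {0..t} \<Lambda>"
    by (intro integral_le integrable_const_ivl integrable_continuous_real continuous_on_subset[OF cont])
      (use t ge in auto)
  then have "C * (t * \<Lambda> 0) \<le> C * integral {0..t} \<Lambda>" using C t by simp
  then show ?thesis using growth[OF t] by (simp add: algebra_simps)
qed

text \<open>The concavity bounds depend on the shift \<open>\<sigma>\<close> through one function of a real variable, minimized
  where the denominator equals \<open>sqrt (d\<^sup>2 + q\<^sup>2 \<beta> U)\<close>.\<close>

lemma optimal_shift: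
  fixes q \<beta> U d :: real
  assumes q: "q > 0" and \<beta>: "\<beta> > 0" and U: "U > 0"
  defines "s \<equiv> sqrt (d\<^sup>2 + q\<^sup>2 * \<beta> * U)"
  defines "M \<equiv> 4 * (s - d) / (q\<^sup>2 * \<beta>)"
  shows "\<exists>\<sigma>>0. q * \<beta> * \<sigma> + d > 0 \<and> 2 * (U + \<beta> * \<sigma>\<^sup>2) / (q * \<beta> * \<sigma> + d) = M"
    and "q * \<beta> * \<sigma> + d > 0 \<Longrightarrow> M \<le> 2 * (U + \<beta> * \<sigma>\<^sup>2) / (q * \<beta> * \<sigma> + d)"
    and "M > 0"
proof -
  have s2: "s\<^sup>2 = d\<^sup>2 + q\<^sup>2 * \<beta> * U" using assms by (simp add: s_def)
  have "\<bar>d\<bar> < s" unfolding s_def using assms by (intro real_less_rsqrt) simp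
  then have s: "s > 0" "s > d" by auto
  then show M: "M > 0" using assms by (simp add: M_def)
  have val: "2 * (U + \<beta> * \<sigma>\<^sup>2) * (q\<^sup>2 * \<beta>) = 2 * (s\<^sup>2 + (q * \<beta> * \<sigma> + d)\<^sup>2 - 2 * d * (q * \<beta> * \<sigma> + d))" for \<sigma>
    unfolding s2 by (simp add: power2_eq_square algebra_simps)
  have k: "q\<^sup>2 * \<beta> > 0" using assms by simp
  have form: "2 * (U + \<beta> * \<sigma>\<^sup>2) / (q * \<beta> * \<sigma> + d)
      = 2 * (s\<^sup>2 + (q * \<beta> * \<sigma> + d)\<^sup>2 - 2 * d * (q * \<beta> * \<sigma> + d)) / ((q * \<beta> * \<sigma> + d) * (q\<^sup>2 * \<beta>))" for \<sigma>
    unfolding val[symmetric] using q \<beta> by simp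
  show "\<exists>\<sigma>>0. q * \<beta> * \<sigma> + d > 0 \<and> 2 * (U + \<beta> * \<sigma>\<^sup>2) / (q * \<beta> * \<sigma> + d) = M"
  proof (intro exI conjI)
    have e: "q * \<beta> * ((s - d) / (q * \<beta>)) + d = s" using assms by simp
    show "(s - d) / (q * \<beta>) > 0" using assms s by simp
    show "q * \<beta> * ((s - d) / (q * \<beta>)) + d > 0" unfolding e by (rule s)
    show "2 * (U + \<beta> * ((s - d) / (q * \<beta>))\<^sup>2) / (q * \<beta> * ((s - d) / (q * \<beta>)) + d) = M"
    proof -
      have "2 * (s\<^sup>2 + s\<^sup>2 - 2 * d * s) = s * (4 * (s - d))" by (simp add: power2_eq_square algebra_simps)
      then show ?thesis unfolding form unfolding e M_def using s by simp
    qed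
  qed
  show "M \<le> 2 * (U + \<beta> * \<sigma>\<^sup>2) / (q * \<beta> * \<sigma> + d)" if x: "q * \<beta> * \<sigma> + d > 0"
  proof -
    define x where "x = q * \<beta> * \<sigma> + d"
    have "0 \<le> (s - x)\<^sup>2" by simp
    then have "4 * (s - d) * x \<le> 2 * (s\<^sup>2 + x\<^sup>2 - 2 * d * x)" by (simp add: power2_eq_square algebra_simps)
    then have "4 * (s - d) * x / (x * (q\<^sup>2 * \<beta>)) \<le> 2 * (s\<^sup>2 + x\<^sup>2 - 2 * d * x) / (x * (q\<^sup>2 * \<beta>))"
      using x k by (intro divide_right_mono) (auto simp: x_def)
    then show ?thesis unfolding form unfolding M_def x_def[symmetric] using x by (simp add: x_def[symmetric])
  qed
qed

lemma interior_sequences: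
  fixes s t T :: real
  assumes "0 \<le> s" "s < t" "t \<le> T"
  obtains a b :: "nat \<Rightarrow> real" where "\<And>k. 0 < a k \<and> a k < b k \<and> b k < T \<and> s \<le> a k \<and> b k \<le> t"
    "a \<longlonglongrightarrow> s" "b \<longlonglongrightarrow> t"
proof -
  define h where "h k = (t - s) / 3 * inverse (real (Suc k))" for k
  have h0: "h \<longlonglongrightarrow> 0" unfolding h_def
    using tendsto_mult_left[OF LIMSEQ_inverse_real_of_nat, of "(t - s) / 3"] by simp
  have h: "0 < h k" "h k \<le> (t - s) / 3" for k
    using assms mult_left_mono[of "inverse (real (Suc k))" 1 "(t - s) / 3"] by (auto simp: h_def field_simps)
  show ?thesis
  proof (rule that[of "\<lambda>k. s + h k" "\<lambda>k. t - h k"])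
    show "0 < s + h k \<and> s + h k < t - h k \<and> t - h k < T \<and> s \<le> s + h k \<and> t - h k \<le> t" for k
      using h[of k] assms by auto
    show "(\<lambda>k. s + h k) \<longlonglongrightarrow> s" "(\<lambda>k. t - h k) \<longlonglongrightarrow> t"
      using tendsto_add[OF tendsto_const h0, of s] tendsto_diff[OF tendsto_const h0, of t] by simp_all
  qed
qed

section \<open>Increments of the gradient\<close>

context energy_flow
begin

abbreviation dissipated :: "real \<Rightarrow> real \<Rightarrow> real" where
  "dissipated s t \<equiv> integral {s..t} (\<lambda>r. velocity_dirichlet r)"

lemma velocity_dirichlet_integrable:
  assumes "0 \<le> s" "t \<le> T"
  shows "(\<lambda>r. velocity_dirichlet r) integrable_on {s..t}"
proof (rule integrable_subinterval_real)
  show "(\<lambda>r. velocity_dirichlet r) integrable_on {0..T}"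
    using integrable_on_lebesgue_on[OF grad_velocity_integrable(1)]
    by (simp add: integrable_on_open_interval_real)
qed (use assms in auto)

lemma dissipated_mono:
  assumes "0 \<le> s" "s \<le> s'" "t' \<le> t" "t \<le> T"
  shows "dissipated s' t' \<le> dissipated s t"
  by (rule integral_subset_le) (use assms in \<open>auto intro!: velocity_dirichlet_integrable\<close>)

lemma dissipated_nonneg: "0 \<le> s \<Longrightarrow> t \<le> T \<Longrightarrow> 0 \<le> dissipated s t"
  by (intro integral_nonneg velocity_dirichlet_integrable) auto

text \<open>Young's inequality under the time integral, for a test function fixed in time.\<close>

lemma tested_gradient_increment_le:
  assumes z: "z \<in> H01 \<Omega>" and st: "0 < s" "s < t" "t < T" and \<eta>: "\<eta> > 0"
  shows "l2_inner \<Omega> (weak_grad \<Omega> (u t)) (weak_grad \<Omega> z) - l2_inner \<Omega> (weak_grad \<Omega> (u s)) (weak_grad \<Omega> z)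
    \<le> \<eta> / 2 * (t - s) * (l2_norm \<Omega> (weak_grad \<Omega> z))\<^sup>2 + 1 / (2 * \<eta>) * dissipated s t"
proof -
  let ?N = "l2_norm \<Omega> (weak_grad \<Omega> z)"
  let ?k = "\<lambda>r. \<eta> / 2 * ?N\<^sup>2 + 1 / (2 * \<eta>) * velocity_dirichlet r"
  have i1: "integrable (lebesgue_on {s..t}) (\<lambda>r. velocity_dirichlet r)"
    by (rule integrable_sub[OF grad_velocity_integrable(1) st(1,3)])
  have i2: "integrable (lebesgue_on {s..t}) (\<lambda>r. \<eta> / 2 * ?N\<^sup>2)"
    by (intro continuous_imp_integrable_real continuous_intros)
  have ik: "integrable (lebesgue_on {s..t}) ?k"
    by (intro Bochner_Integration.integrable_add i2 integrable_mult_right i1)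
  have "(LINT r|lebesgue_on {s..t}. l2_inner \<Omega> (weak_grad \<Omega> (ut r)) (weak_grad \<Omega> z)) \<le> (LINT r|lebesgue_on {s..t}. ?k r)"
  proof (rule integral_mono_AE[OF integrable_sub[OF gradient_increment(1)[OF z st] st(1,3)] ik])
    show "AE r in lebesgue_on {s..t}. l2_inner \<Omega> (weak_grad \<Omega> (ut r)) (weak_grad \<Omega> z) \<le> ?k r"
      using AE_sub[OF ut_H01_AE st(1,3)]
    proof eventually_elim
      case (elim r)
      let ?v = "l2_norm \<Omega> (weak_grad \<Omega> (ut r))"
      have "l2_inner \<Omega> (weak_grad \<Omega> (ut r)) (weak_grad \<Omega> z) \<le> ?v * ?N"
        using l2_Cauchy_Schwarz[OF weak_grad_L2[OF elim] weak_grad_L2[OF z]] by simp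
      also have "?v * ?N \<le> ?k r"
      proof -
        have "0 \<le> (\<eta> * ?N - ?v)\<^sup>2 / (2 * \<eta>)" using \<eta> by simp
        also have "\<dots> = ?k r - ?v * ?N" using \<eta> by (simp add: power2_eq_square field_simps)
        finally show ?thesis by simp
      qed
      finally show ?case .
    qed
  qed
  also have "\<dots> = integral {s..t} ?k" by (rule lebesgue_integral_eq_integral[OF ik]) simp
  also have "\<dots> = \<eta> / 2 * (t - s) * ?N\<^sup>2 + 1 / (2 * \<eta>) * dissipated s t"
    using st by (subst integral_add) (auto intro!: integrable_on_mult_right integrable_on_divide velocity_dirichlet_integrable)
  finally show ?thesis unfolding gradient_increment(2)[OF z st] .
qed

text \<open>Testing with \<open>u t - u s\<close> itself; the parameter \<open>1 / (t - s)\<close> leaves half of the left-hand side to absorb.\<close>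

lemma gradient_displacement_le:
  assumes st: "0 \<le> s" "s < t" "t \<le> T"
  shows "(l2_norm \<Omega> (\<lambda>x. weak_grad \<Omega> (u t) x - weak_grad \<Omega> (u s) x))\<^sup>2 \<le> (t - s) * dissipated s t"
proof -
  let ?D = "\<lambda>s t x. weak_grad \<Omega> (u t) x - weak_grad \<Omega> (u s) x"
  let ?N = "\<lambda>s t. (l2_norm \<Omega> (?D s t))\<^sup>2"
  have inner: "?N s t \<le> (t - s) * dissipated s t" if st: "0 < s" "s < t" "t < T" for s t
  proof -
    have m: "s \<in> {0..T}" "t \<in> {0..T}" using st by auto
    let ?z = "\<lambda>x. u t x - u s x"
    note z = weak_grad_diff[OF u_H01[OF m(2)] u_H01[OF m(1)]]
    have D: "?D s t \<in> L2 \<Omega>" by (intro L2_diff gradu_L2 m)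
    have N: "(l2_norm \<Omega> (weak_grad \<Omega> ?z))\<^sup>2 = ?N s t"
      using l2_norm_cong_AE[OF weak_grad_L2[OF z(1)] D z(2)] by simp
    have ip: "l2_inner \<Omega> (weak_grad \<Omega> (u r)) (weak_grad \<Omega> ?z) = l2_inner \<Omega> (weak_grad \<Omega> (u r)) (?D s t)"
      if "r \<in> {0..T}" for r
      by (rule l2_inner_cong_AE[OF gradu_L2[OF that] gradu_L2[OF that] weak_grad_L2[OF z(1)] D _ z(2)]) simp
    have "?N s t = l2_inner \<Omega> (weak_grad \<Omega> (u t)) (?D s t) - l2_inner \<Omega> (weak_grad \<Omega> (u s)) (?D s t)"
      unfolding l2_norm_sq by (rule l2_inner_diff_left) (intro gradu_L2 m D)+
    also have "\<dots> \<le> (1 / (t - s)) / 2 * (t - s) * ?N s t + 1 / (2 * (1 / (t - s))) * dissipated s t"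
      using tested_gradient_increment_le[OF z(1) st, of "1 / (t - s)"] st unfolding N ip[OF m(1)] ip[OF m(2)] by simp
    also have "\<dots> = ?N s t / 2 + (t - s) * dissipated s t / 2"
    proof -
      have "(1 / (t - s)) / 2 * (t - s) = 1 / 2" using st by (simp add: field_simps)
      then show ?thesis by (simp only:) simp
    qed
    finally show ?thesis by simp
  qed
  \<comment> \<open>The weak formulation says nothing at the endpoints of \<open>[0, T]\<close>; they are reached by continuity.\<close>
  obtain a b where ab: "\<And>k::nat. 0 < a k \<and> a k < b k \<and> b k < T \<and> s \<le> a k \<and> b k \<le> t"
    "a \<longlonglongrightarrow> s" "b \<longlonglongrightarrow> t"
    by (rule interior_sequences[OF st]) blast
  have m: "a k \<in> {0..T}" "b k \<in> {0..T}" "s \<in> {0..T}" "t \<in> {0..T}" for k using ab(1)[of k] st by auto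
  have eq: "?N s t = dirichlet t - 2 * l2_inner \<Omega> (weak_grad \<Omega> (u t)) (weak_grad \<Omega> (u s)) + dirichlet s"
    if "s \<in> {0..T}" "t \<in> {0..T}" for s t
    using l2_norm_sq_lincomb[OF gradu_L2[OF that(2)] gradu_L2[OF that(1)], of 1 "-1"] by simp
  have "(\<lambda>k. dirichlet (b k) - 2 * l2_inner \<Omega> (weak_grad \<Omega> (u (b k))) (weak_grad \<Omega> (u (a k))) + dirichlet (a k))
      \<longlonglongrightarrow> dirichlet t - 2 * l2_inner \<Omega> (weak_grad \<Omega> (u t)) (weak_grad \<Omega> (u s)) + dirichlet s"
    by (intro tendsto_intros l2_norm_tendsto l2_inner_tendsto gradu_L2 gradu_tendsto m ab)
  then have lim: "(\<lambda>k. ?N (a k) (b k)) \<longlonglongrightarrow> ?N s t" using eq m by simp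
  have "?N (a k) (b k) \<le> (t - s) * dissipated s t" for k
  proof -
    have "?N (a k) (b k) \<le> (b k - a k) * dissipated (a k) (b k)" using inner[of "a k" "b k"] ab(1)[of k] by blast
    also have "\<dots> \<le> (t - s) * dissipated s t"
      using ab(1)[of k] st by (intro mult_mono dissipated_mono dissipated_nonneg) auto
    finally show ?thesis .
  qed
  then show ?thesis by (intro LIMSEQ_le_const2[OF lim]) blast
qed

text \<open>The Dirichlet energy is controlled only through the dissipation: formally its derivative is
  \<open>2 * (grad u, grad ut)\<close>, to which Young's inequality applies with a free parameter.\<close>

lemma dirichlet_increment_le:
  assumes st: "0 \<le> s" "s \<le> t" "t \<le> T" and \<eta>: "\<eta> > 0"
  shows "dirichlet t - dirichlet s \<le> \<eta> * integral {s..t} (\<lambda>r. dirichlet r) + 1 / \<eta> * dissipated s t"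
proof -
  have cd: "continuous_on {0..T} (\<lambda>r. dirichlet r)" by (intro continuous_intros continuous_on_pair)
  have inner: "dirichlet t - dirichlet s \<le> \<eta> / 2 * (t - s) * (dirichlet s + dirichlet t) + 1 / \<eta> * dissipated s t"
    if st: "0 < s" "s < t" "t < T" for s t
  proof -
    have m: "s \<in> {0..T}" "t \<in> {0..T}" using st by auto
    \<comment> \<open>With this test function the increment of the Dirichlet energy is exact.\<close>
    let ?z = "\<lambda>x. 1 * u t x + 1 * u s x"
    let ?c = "l2_inner \<Omega> (weak_grad \<Omega> (u t)) (weak_grad \<Omega> (u s))"
    note z = H01_lincomb[OF u_H01[OF m(2)] u_H01[OF m(1)], of 1 1]
    have D: "(\<lambda>x. 1 *\<^sub>R weak_grad \<Omega> (u t) x + 1 *\<^sub>R weak_grad \<Omega> (u s) x) \<in> L2 \<Omega>"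
      by (intro L2_lincomb gradu_L2 m)
    have N: "(l2_norm \<Omega> (weak_grad \<Omega> ?z))\<^sup>2 = dirichlet t + 2 * ?c + dirichlet s"
      unfolding l2_norm_cong_AE[OF weak_grad_L2[OF z(1)] D z(2)]
      by (subst l2_norm_sq_lincomb) (auto intro!: gradu_L2 m)
    have "2 * ?c \<le> dirichlet t + dirichlet s"
      using l2_Cauchy_Schwarz[OF gradu_L2[OF m(2)] gradu_L2[OF m(1)]]
        two_mult_le_sum_squares[of "l2_norm \<Omega> (weak_grad \<Omega> (u t))" "l2_norm \<Omega> (weak_grad \<Omega> (u s))"] by simp
    then have N2: "(l2_norm \<Omega> (weak_grad \<Omega> ?z))\<^sup>2 \<le> 2 * (dirichlet s + dirichlet t)" unfolding N by simp
    have ip: "l2_inner \<Omega> (weak_grad \<Omega> (u r)) (weak_grad \<Omega> ?z)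
       = 1 * l2_inner \<Omega> (weak_grad \<Omega> (u r)) (weak_grad \<Omega> (u t)) + 1 * l2_inner \<Omega> (weak_grad \<Omega> (u r)) (weak_grad \<Omega> (u s))"
      if "r \<in> {0..T}" for r
      by (intro l2_inner_weak_grad_lincomb u_H01 gradu_L2 m that)
    have "dirichlet t - dirichlet s
        = l2_inner \<Omega> (weak_grad \<Omega> (u t)) (weak_grad \<Omega> ?z) - l2_inner \<Omega> (weak_grad \<Omega> (u s)) (weak_grad \<Omega> ?z)"
      unfolding ip[OF m(1)] ip[OF m(2)] l2_norm_sq l2_inner_commute[of \<Omega> "weak_grad \<Omega> (u s)" "weak_grad \<Omega> (u t)"] by simp
    also have "\<dots> \<le> (\<eta> / 2) / 2 * (t - s) * (l2_norm \<Omega> (weak_grad \<Omega> ?z))\<^sup>2 + 1 / (2 * (\<eta> / 2)) * dissipated s t"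
      by (rule tested_gradient_increment_le[OF z(1) st]) (use \<eta> in simp)
    also have "\<dots> \<le> (\<eta> / 2) / 2 * (t - s) * (2 * (dirichlet s + dirichlet t)) + 1 / (2 * (\<eta> / 2)) * dissipated s t"
      using \<eta> st by (intro add_right_mono mult_left_mono N2) auto
    also have "\<dots> = \<eta> / 2 * (t - s) * (dirichlet s + dirichlet t) + 1 / \<eta> * dissipated s t" by (simp add: field_simps)
    finally show ?thesis .
  qed
  have closed: "dirichlet t - dirichlet s \<le> \<eta> / 2 * (t - s) * (dirichlet s + dirichlet t) + 1 / \<eta> * dissipated s t"
    if st: "0 \<le> s" "s \<le> t" "t \<le> T" for s t
  proof (cases "s = t")
    case False
    then have "s < t" using st by simp
    obtain a b where ab: "\<And>k::nat. 0 < a k \<and> a k < b k \<and> b k < T \<and> s \<le> a k \<and> b k \<le> t"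
      "a \<longlonglongrightarrow> s" "b \<longlonglongrightarrow> t"
      by (rule interior_sequences[OF st(1) \<open>s < t\<close> st(3)]) blast
    have m: "a k \<in> {0..T}" "b k \<in> {0..T}" "s \<in> {0..T}" "t \<in> {0..T}" for k using ab(1)[of k] st by auto
    have lim: "(\<lambda>k. dirichlet (b k) - dirichlet (a k) - \<eta> / 2 * (b k - a k) * (dirichlet (a k) + dirichlet (b k)))
        \<longlonglongrightarrow> dirichlet t - dirichlet s - \<eta> / 2 * (t - s) * (dirichlet s + dirichlet t)"
      by (intro tendsto_intros l2_norm_tendsto gradu_L2 gradu_tendsto m ab)
    have "dirichlet (b k) - dirichlet (a k) - \<eta> / 2 * (b k - a k) * (dirichlet (a k) + dirichlet (b k))
        \<le> 1 / \<eta> * dissipated s t" for k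
    proof -
      have "1 / \<eta> * dissipated (a k) (b k) \<le> 1 / \<eta> * dissipated s t"
        using ab(1)[of k] st \<eta> by (intro mult_left_mono dissipated_mono) auto
      then show ?thesis using inner[of "a k" "b k"] ab(1)[of k] by linarith
    qed
    then have "dirichlet t - dirichlet s - \<eta> / 2 * (t - s) * (dirichlet s + dirichlet t) \<le> 1 / \<eta> * dissipated s t"
      by (intro LIMSEQ_le_const2[OF lim]) blast
    then show ?thesis by simp
  qed simp
  let ?F = "\<lambda>r. dirichlet r - (\<eta> * integral {0..r} (\<lambda>r. dirichlet r) + 1 / \<eta> * dissipated 0 r)"
  have comb: "integral {0..s} (\<lambda>r. dirichlet r) + integral {s..t} (\<lambda>r. dirichlet r) = integral {0..t} (\<lambda>r. dirichlet r)"
    "dissipated 0 s + dissipated s t = dissipated 0 t"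
    if "0 \<le> s" "s \<le> t" "t \<le> T" for s t
    by (intro Henstock_Kurzweil_Integration.integral_combine velocity_dirichlet_integrable integrable_continuous_real
        continuous_on_subset[OF cd] that; use that in auto)+
  have "?F t \<le> ?F s"
  proof (rule decreasing_of_local[OF st(2)])
    fix e :: real assume e: "e > 0"
    have "uniformly_continuous_on {0..T} (\<lambda>r. dirichlet r)"
      by (rule compact_uniformly_continuous[OF cd]) simp
    then obtain \<delta> where \<delta>: "\<delta> > 0" "\<And>x x'. x \<in> {0..T} \<Longrightarrow> x' \<in> {0..T} \<Longrightarrow> dist x' x < \<delta> \<Longrightarrow>
        dist (dirichlet x') (dirichlet x) < e / \<eta>"
      unfolding uniformly_continuous_on_def using e \<eta> by (metis divide_pos_pos)
    show "\<exists>d>0. \<forall>s'\<in>{s..t}. \<forall>t'\<in>{s..t}. s' \<le> t' \<and> t' - s' < d \<longrightarrow> ?F t' - ?F s' \<le> e * (t' - s')"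
    proof (intro exI[of _ \<delta>] conjI ballI impI)
      fix s' t' assume a: "s' \<in> {s..t}" "t' \<in> {s..t}" "s' \<le> t' \<and> t' - s' < \<delta>"
      then have st': "0 \<le> s'" "s' \<le> t'" "t' \<le> T" using st by auto
      have "integral {s'..t'} (\<lambda>_. (dirichlet s' + dirichlet t') / 2 - e / \<eta>) \<le> integral {s'..t'} (\<lambda>r. dirichlet r)"
      proof (intro integral_le integrable_const_ivl integrable_continuous_real continuous_on_subset[OF cd])
        fix r assume r: "r \<in> {s'..t'}"
        then have "dist (dirichlet s') (dirichlet r) < e / \<eta>" "dist (dirichlet t') (dirichlet r) < e / \<eta>"
          using \<delta>(2)[of r s'] \<delta>(2)[of r t'] r a(3) st' by (simp_all add: dist_real_def)
        then show "(dirichlet s' + dirichlet t') / 2 - e / \<eta> \<le> dirichlet r"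
          unfolding dist_real_def abs_less_iff by argo
      qed (use st' in auto)
      then have "(t' - s') * ((dirichlet s' + dirichlet t') / 2 - e / \<eta>) \<le> integral {s'..t'} (\<lambda>r. dirichlet r)"
        using st' by simp
      then have "\<eta> * ((t' - s') * ((dirichlet s' + dirichlet t') / 2 - e / \<eta>)) \<le> \<eta> * integral {s'..t'} (\<lambda>r. dirichlet r)"
        using \<eta> by (intro mult_left_mono) auto
      moreover have "\<eta> * ((t' - s') * ((dirichlet s' + dirichlet t') / 2 - e / \<eta>))
          = \<eta> / 2 * (t' - s') * (dirichlet s' + dirichlet t') - e * (t' - s')"
        using \<eta> by (simp add: field_simps)
      ultimately show "?F t' - ?F s' \<le> e * (t' - s')"
        using closed[OF st'] unfolding comb[OF st', symmetric] distrib_left by linarith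
    qed (use \<delta> in simp)
  qed
  then show ?thesis using comb[OF st] unfolding comb[OF st, symmetric] distrib_left by linarith
qed

end

section \<open>Concavity and excess along the flow\<close>

locale dissipative_flow = energy_flow \<Omega> p g u0 u1 T u ut
  for \<Omega> :: "(real^'n) set" and p g u0 u1 T u ut +
  assumes energy_abs_continuous: "abs_continuous_on 0 T (energy \<Omega> p g u ut)"
    and energy_deriv: "AE t in lebesgue. 0 < t \<and> t < T \<longrightarrow>
      (energy \<Omega> p g u ut has_real_derivative
        (- velocity_dirichlet t - 1/2 * g t * dirichlet t + 1/2 * memory_energy \<Omega> (kernel_deriv g) u t)) (at t)"
begin

abbreviation shifted :: "real \<Rightarrow> real" where "shifted t \<equiv> shifted_energy \<Omega> p g u ut t"
abbreviation C :: real where "C \<equiv> blowup_const \<Omega> p g"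

text \<open>The energy identity, with the two terms of the kernel dropped because of their sign.\<close>

lemma energy_dissipation:
  assumes st: "0 \<le> s" "s \<le> t" "t \<le> T"
  shows "shifted t + dissipated s t \<le> shifted s"
proof (cases "s = t")
  case False
  have memory: "memory_energy \<Omega> (kernel_deriv g) u r \<le> 0" for r
  proof -
    have "0 \<le> (LINT s|lebesgue_on {0..r}. - (kernel_deriv g (r - s)
        * (l2_norm \<Omega> (\<lambda>x. weak_grad \<Omega> (u r) x - weak_grad \<Omega> (u s) x))\<^sup>2))"
      using kernel by (intro Bochner_Integration.integral_nonneg) (auto simp: H2_def mult_nonpos_nonneg)
    then show ?thesis by (simp add: memory_energy_def)
  qed
  have "energy \<Omega> p g u ut t - energy \<Omega> p g u ut s \<le> integral {s..t} (\<lambda>r. - velocity_dirichlet r)"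
  proof (rule abs_continuous_increment_le)
    show "abs_continuous_on s t (energy \<Omega> p g u ut)"
      by (rule abs_continuous_on_subinterval[OF energy_abs_continuous st(1,3)])
    show "(\<lambda>r. - velocity_dirichlet r) integrable_on {s..t}"
      by (intro integrable_neg velocity_dirichlet_integrable st)
    show "AE r in lebesgue. s < r \<and> r < t \<longrightarrow> (energy \<Omega> p g u ut has_real_derivative
        (- velocity_dirichlet r - 1/2 * g r * dirichlet r + 1/2 * memory_energy \<Omega> (kernel_deriv g) u r)) (at r) \<and>
        - velocity_dirichlet r - 1/2 * g r * dirichlet r + 1/2 * memory_energy \<Omega> (kernel_deriv g) u r
          \<le> - velocity_dirichlet r"
      using energy_deriv
    proof eventually_elim
      case (elim r)
      show ?case
      proof (intro impI conjI)
        assume r: "s < r \<and> r < t"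
        then have r': "0 < r" "r < T" using st by auto
        then show "(energy \<Omega> p g u ut has_real_derivative
          (- velocity_dirichlet r - 1/2 * g r * dirichlet r + 1/2 * memory_energy \<Omega> (kernel_deriv g) u r)) (at r)"
          using elim by blast
        have "0 \<le> g r * dirichlet r" using kernel_nonneg[of r] r' by simp
        then show "- velocity_dirichlet r - 1/2 * g r * dirichlet r + 1/2 * memory_energy \<Omega> (kernel_deriv g) u r
            \<le> - velocity_dirichlet r"
          using memory[of r] by linarith
      qed
    qed
  qed (use st False in auto)
  then show ?thesis by (simp add: shifted_energy_def)
qed simp

lemma shifted_continuous: "continuous_on {0..T} (\<lambda>t. shifted t)"
  unfolding shifted_energy_def
  by (intro continuous_on_add continuous_on_const abs_continuous_on_continuous energy_abs_continuous)

lemma shifted_decreasing: "0 \<le> s \<Longrightarrow> s \<le> t \<Longrightarrow> t \<le> T \<Longrightarrow> shifted t \<le> shifted s"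
  using energy_dissipation[of s t] dissipated_nonneg[of s t] by simp

lemma pairing_continuous: "continuous_on {0..T} (\<lambda>t. pairing t)"
  and mass_continuous: "continuous_on {0..T} (\<lambda>t. mass t)"
  and kinetic_continuous: "continuous_on {0..T} (\<lambda>t. kinetic t)"
  and dirichlet_continuous: "continuous_on {0..T} (\<lambda>t. dirichlet t)"
  by (intro continuous_intros continuous_on_pair)+

text \<open>The functional adds to the squared norm the accumulated Dirichlet energy, which turns the strong
  damping into part of its derivative, a linear term keeping it positive, and a quadratic in time
  whose convexity is paid for by the negative energy. Its second derivative is
  \<open>2 (kinetic + force) + 2 \<beta> \<ge> (pm + 2) (kinetic + dissipated + \<beta>)\<close>, while half its first derivative is
  a sum of three cross terms, each bounded by Young's inequality with the same parameter.\<close>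

lemma concavity_estimate:
  assumes gap: "gap \<ge> 0" and t1: "0 \<le> t1" "t1 \<le> T1" "T1 < T"
    and \<beta>: "\<beta> > 0" "shifted t1 \<le> - \<beta>" and \<sigma>: "\<sigma> > 0"
    and adm: "(pm - 2) * (pairing t1 + \<beta> * \<sigma>) > 2 * dirichlet t1"
  shows "(T1 - t1) * ((pm - 2) * (pairing t1 + \<beta> * \<sigma>) - 2 * dirichlet t1) \<le> 2 * (mass t1 + \<beta> * \<sigma>\<^sup>2)"
proof (cases "t1 = T1")
  case True
  then show ?thesis using \<beta> by simp
next
  case False
  then have lt: "t1 < T1" using t1 by simp
  have p2: "pm > 2" by (rule pm_gt_2)
  define d1 where "d1 = dirichlet t1"
  define A where "A t = mass t + integral {t1..t} (\<lambda>r. dirichlet r) + \<beta> * (t - t1 + \<sigma>)\<^sup>2" for t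
  define B where "B t = kinetic t + dissipated t1 t + \<beta>" for t
  define \<psi> where "\<psi> t = mass t + integral {t1..t} (\<lambda>r. dirichlet r) + (T1 - t) * d1 + \<beta> * (t - t1 + \<sigma>)\<^sup>2" for t
  define \<psi>' where "\<psi>' t = 2 * (pairing t + dirichlet t / 2) - d1 + 2 * \<beta> * (t - t1 + \<sigma>)" for t
  define \<psi>'' where "\<psi>'' t = 2 * (kinetic t + force t (u t)) + 2 * \<beta>" for t
  define \<alpha> where "\<alpha> = (pm - 2) / 4"
  have \<alpha>: "\<alpha> > 0" using p2 by (simp add: \<alpha>_def)
  have sub: "{t1..T1} \<subseteq> {0..T}" using t1 by auto
  have cd: "continuous_on {t1..T1} (\<lambda>r. dirichlet r)" by (rule continuous_on_subset[OF dirichlet_continuous sub])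
  have int_nonneg: "integral {t1..t} (\<lambda>r. dirichlet r) \<ge> 0" if "t \<in> {t1..T1}" for t
    by (intro integral_nonneg integrable_continuous_real continuous_on_subset[OF cd]) (use that in auto)
  have sq_pos: "\<beta> * (t - t1 + \<sigma>)\<^sup>2 > 0" if "t \<in> {t1..T1}" for t
    using that \<beta> \<sigma> by auto
  have A_pos: "A t > 0" and A_le: "A t \<le> \<psi> t" if "t \<in> {t1..T1}" for t
    using int_nonneg[OF that] sq_pos[OF that] that by (auto simp: A_def \<psi>_def d1_def add_nonneg_pos)
  have B_pos: "B t > 0" if "t \<in> {t1..T1}" for t
    using \<beta> dissipated_nonneg[of t1 t] that t1 by (auto simp: B_def add_nonneg_pos)
  have \<psi>''_ge: "(pm + 2) * B t \<le> \<psi>'' t" if t: "t \<in> {t1..T1}" for t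
  proof -
    have t': "t \<in> {0..T}" using t sub by auto
    have "shifted t \<le> - \<beta> - dissipated t1 t" using energy_dissipation[of t1 t] t t1 \<beta> by auto
    then have "pm * (\<beta> + dissipated t1 t) \<le> - (pm * shifted t)"
      using p2 mult_left_mono[of "\<beta> + dissipated t1 t" "- shifted t" pm] by simp
    moreover have "0 \<le> gap * dirichlet t" using gap by simp
    ultimately have "(1 + pm / 2) * kinetic t + pm * (\<beta> + dissipated t1 t) \<le> kinetic t + force t (u t)"
      using momentum_deriv_ge[OF t'] by linarith
    moreover have "0 \<le> (pm - 2) * (\<beta> + dissipated t1 t)"
      using p2 \<beta> dissipated_nonneg[of t1 t] t t1 by simp
    ultimately show ?thesis using \<beta> unfolding \<psi>''_def B_def by (simp add: algebra_simps)
  qed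
  have concave: "(1 + \<alpha>) * (\<psi>' t)\<^sup>2 \<le> \<psi> t * \<psi>'' t" if t: "t \<in> {t1..T1}" and pos: "\<psi>' t > 0" for t
  proof -
    have t': "t \<in> {0..T}" using t sub by auto
    have "(\<psi>' t / 2)\<^sup>2 \<le> A t * B t"
    proof (rule sq_le_of_Young)
      fix \<eta> :: real assume \<eta>: "\<eta> > 0"
      have young: "a * b \<le> (\<eta> * a\<^sup>2 + b\<^sup>2 / \<eta>) / 2" for a b :: real
      proof -
        have "0 \<le> (\<eta> * a - b)\<^sup>2 / (2 * \<eta>)" using \<eta> by simp
        also have "\<dots> = (\<eta> * a\<^sup>2 + b\<^sup>2 / \<eta>) / 2 - a * b" using \<eta> by (simp add: power2_eq_square field_simps)
        finally show ?thesis by simp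
      qed
      have "pairing t \<le> l2_norm \<Omega> (u t) * l2_norm \<Omega> (ut t)"
        using l2_Cauchy_Schwarz[OF u_L2[OF t'] ut_L2[OF t']] by simp
      also have "\<dots> \<le> (\<eta> * mass t + kinetic t / \<eta>) / 2" by (rule young)
      finally have 1: "pairing t \<le> (\<eta> * mass t + kinetic t / \<eta>) / 2" .
      have 2: "dirichlet t - d1 \<le> \<eta> * integral {t1..t} (\<lambda>r. dirichlet r) + 1 / \<eta> * dissipated t1 t"
        unfolding d1_def by (rule dirichlet_increment_le) (use t t1 \<eta> in auto)
      have "\<beta> * ((t - t1 + \<sigma>) * 1) \<le> \<beta> * ((\<eta> * (t - t1 + \<sigma>)\<^sup>2 + 1\<^sup>2 / \<eta>) / 2)"
        using \<beta> by (intro mult_left_mono young) simp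
      then have 3: "\<beta> * (t - t1 + \<sigma>) \<le> (\<eta> * (\<beta> * (t - t1 + \<sigma>)\<^sup>2) + \<beta> / \<eta>) / 2" by (simp add: algebra_simps)
      have "\<psi>' t / 2 = pairing t + (dirichlet t - d1) / 2 + \<beta> * (t - t1 + \<sigma>)"
        by (simp add: \<psi>'_def field_simps)
      also have "\<dots> \<le> (\<eta> * mass t + kinetic t / \<eta>) / 2
          + (\<eta> * integral {t1..t} (\<lambda>r. dirichlet r) + 1 / \<eta> * dissipated t1 t) / 2
          + (\<eta> * (\<beta> * (t - t1 + \<sigma>)\<^sup>2) + \<beta> / \<eta>) / 2"
        by (intro add_mono 1 3 divide_right_mono 2) simp
      also have "\<dots> = (\<eta> * A t + B t / \<eta>) / 2" by (simp add: A_def B_def algebra_simps add_divide_distrib)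
      finally show "\<psi>' t / 2 \<le> (\<eta> * A t + B t / \<eta>) / 2" .
    qed (use pos A_pos[OF t] B_pos[OF t] in auto)
    then have "(\<psi>' t)\<^sup>2 \<le> 4 * (A t * B t)" by (simp add: power_divide)
    then have "(1 + \<alpha>) * (\<psi>' t)\<^sup>2 \<le> (1 + \<alpha>) * (4 * (A t * B t))" using \<alpha> by (intro mult_left_mono) auto
    also have "\<dots> = A t * ((pm + 2) * B t)"
    proof -
      have "(1 + \<alpha>) * 4 = pm + 2" by (simp add: \<alpha>_def field_simps)
      then show ?thesis by (metis mult.assoc mult.left_commute)
    qed
    also have "\<dots> \<le> \<psi> t * \<psi>'' t"
      using A_pos[OF t] A_le[OF t] B_pos[OF t] \<psi>''_ge[OF t] p2 by (intro mult_mono) auto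
    finally show ?thesis .
  qed
  have start: "\<psi>' t1 = 2 * (pairing t1 + \<beta> * \<sigma>)" by (simp add: \<psi>'_def d1_def algebra_simps)
  have start_pos: "pairing t1 + \<beta> * \<sigma> > 0"
  proof -
    have "0 < (pm - 2) * (pairing t1 + \<beta> * \<sigma>)" using adm by (rule le_less_trans[rotated]) simp
    then show ?thesis using p2 by (simp add: zero_less_mult_iff)
  qed
  have "T1 - t1 \<le> \<psi> t1 / (\<alpha> * \<psi>' t1)"
  proof (rule concavity_bound[OF lt \<alpha>, where \<psi>'' = \<psi>''])
    show "continuous_on {t1..T1} \<psi>" unfolding \<psi>_def
      by (intro continuous_intros indefinite_integral_continuous_1 integrable_continuous_real cd
          continuous_on_subset[OF mass_continuous sub])
    show "continuous_on {t1..T1} \<psi>'" unfolding \<psi>'_def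
      by (intro continuous_intros cd continuous_on_subset[OF pairing_continuous sub]) auto
    show "\<psi> t > 0" if "t \<in> {t1..T1}" for t using A_pos[OF that] A_le[OF that] by simp
    show "\<psi>' t1 > 0" using start start_pos by simp
  next
    fix t assume t: "t1 < t" "t < T1"
    then have t0: "0 < t" "t < T" and ti: "t \<in> {t1..T1}" using t1 by auto
    have "((\<lambda>x. integral {t1..x} (\<lambda>r. dirichlet r)) has_real_derivative dirichlet t) (at t within {t1..T1})"
      by (rule integral_has_real_derivative[OF cd ti])
    then have di: "((\<lambda>x. integral {t1..x} (\<lambda>r. dirichlet r)) has_real_derivative dirichlet t) (at t)"
      using at_within_Icc_at[OF t] by simp
    show "(\<psi> has_real_derivative \<psi>' t) (at t)" unfolding \<psi>_def \<psi>'_def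
      by (rule derivative_eq_intros mass_deriv[OF t0] di refl)+ (simp add: algebra_simps)
    show "(\<psi>' has_real_derivative \<psi>'' t) (at t)" unfolding \<psi>'_def \<psi>''_def
      by (rule derivative_eq_intros momentum_deriv[OF t0] refl)+ simp
    show "\<psi>'' t \<ge> 0" using \<psi>''_ge[OF ti] B_pos[OF ti] p2
      by (meson add_pos_pos less_eq_real_def mult_pos_pos order_trans zero_less_numeral less_trans)
    show "(1 + \<alpha>) * (\<psi>' t)\<^sup>2 \<le> \<psi> t * \<psi>'' t" if "\<psi>' t > 0" by (rule concave[OF ti that])
  qed
  moreover have "\<alpha> * \<psi>' t1 > 0" using \<alpha> start start_pos by simp
  ultimately have "(T1 - t1) * (\<alpha> * \<psi>' t1) \<le> \<psi> t1" by (simp only: pos_le_divide_eq)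
  moreover have "\<alpha> * \<psi>' t1 = (pm - 2) * (pairing t1 + \<beta> * \<sigma>) / 2"
    unfolding start \<alpha>_def by (simp add: field_simps)
  moreover have "\<psi> t1 = mass t1 + (T1 - t1) * d1 + \<beta> * \<sigma>\<^sup>2" by (simp add: \<psi>_def)
  ultimately have "(T1 - t1) * ((pm - 2) * (pairing t1 + \<beta> * \<sigma>) / 2) \<le> mass t1 + (T1 - t1) * d1 + \<beta> * \<sigma>\<^sup>2"
    by simp
  then show ?thesis by (simp add: d1_def right_diff_distrib)
qed

text \<open>The two terms of the minimum: the first compares \<open>C / 2\<close> with the weight of the kinetic energy in the momentum
  bound, the second splits \<open>gap\<close> into the part needed for the mass, by the Poincare inequality, and the part
  spent on the increment of the Dirichlet energy.\<close>

lemma blowup_const_bounds: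
  assumes "gap > 0"
  shows "C > 0" "C \<le> pm + 2" "C / (2 * lambda1 \<Omega>) + C / (4 * pm) \<le> gap"
proof -
  have pl: "pm > 2" "lambda1 \<Omega> > 0" by (rule pm_gt_2 lambda1_Poincare(1))+
  have num: "(pm - 1)\<^sup>2 * ell g - 1 = 2 * pm * gap" using pl by (simp add: gap_def)
  have C: "C = min (pm + 2) (2 * lambda1 \<Omega> * (2 * pm * gap) / (2 * pm + lambda1 \<Omega>))"
    unfolding blowup_const_def num ..
  show "C > 0" unfolding C using pl assms by simp
  show "C \<le> pm + 2" unfolding C by simp
  have "C \<le> 2 * lambda1 \<Omega> * (2 * pm * gap) / (2 * pm + lambda1 \<Omega>)" unfolding C by simp
  then have "C * (2 * pm + lambda1 \<Omega>) \<le> 4 * lambda1 \<Omega> * pm * gap" using pl by (simp add: field_simps)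
  then have "C * (2 * pm + lambda1 \<Omega>) / (4 * lambda1 \<Omega> * pm) \<le> gap" using pl by (simp add: field_simps)
  moreover have "C * (2 * pm + lambda1 \<Omega>) / (4 * lambda1 \<Omega> * pm) = C / (2 * lambda1 \<Omega>) + C / (4 * pm)"
    using pl by (simp add: field_simps)
  ultimately show "C / (2 * lambda1 \<Omega>) + C / (4 * pm) \<le> gap" by simp
qed

text \<open>The pairing in excess of the energy scaled by \<open>pm / C\<close>. It grows exponentially as long as it is
  positive.\<close>

definition excess :: "real \<Rightarrow> real" where "excess t = pairing t - pm / C * shifted t"

lemma excess_continuous: "continuous_on {0..T} excess"
  unfolding excess_def by (intro continuous_intros pairing_continuous shifted_continuous)

text \<open>The increment of the pairing contains half the increment of the Dirichlet energy with the wrong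
  sign. The constant in Young's inequality is chosen so that the dissipation it costs is exactly
  the dissipation gained from the decrease of the energy.\<close>

lemma excess_growth:
  assumes gap: "gap > 0" and t: "t \<in> {0..T}"
  shows "excess t - excess 0 \<ge> C * integral {0..t} excess"
proof (cases "t = 0")
  case False
  note C = blowup_const_bounds[OF gap]
  have p2: "pm > 2" and \<lambda>: "lambda1 \<Omega> > 0" by (rule pm_gt_2 lambda1_Poincare(1))+
  have sub: "{0..t} \<subseteq> {0..T}" and t0: "0 \<le> t" "t \<le> T" using t by auto
  let ?k = "\<lambda>r. (1 + pm / 2) * kinetic r + gap * dirichlet r - pm * shifted r"
  have ck: "continuous_on {0..t} ?k"
    by (intro continuous_intros continuous_on_subset[OF kinetic_continuous sub]
        continuous_on_subset[OF dirichlet_continuous sub] continuous_on_subset[OF shifted_continuous sub])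
  have cd: "continuous_on {0..t} (\<lambda>r. dirichlet r)" by (rule continuous_on_subset[OF dirichlet_continuous sub])
  have ce: "continuous_on {0..t} excess" by (rule continuous_on_subset[OF excess_continuous sub])
  let ?Y = "\<lambda>r. (pairing r + dirichlet r / 2) - integral {0..r} ?k"
  have "?Y 0 \<le> ?Y t"
  proof (rule DERIV_nonneg_imp_increasing_open[where f = ?Y])
    show "continuous_on {0..t} ?Y"
      by (intro continuous_intros cd continuous_on_subset[OF pairing_continuous sub]
          indefinite_integral_continuous_1 integrable_continuous_real ck) auto
    fix r assume r: "0 < r" "r < t"
    then have "r < T" "r \<in> {0..t}" "r \<in> {0..T}" using t by auto
    have "((\<lambda>x. integral {0..x} ?k) has_real_derivative ?k r) (at r within {0..t})"
      by (rule integral_has_real_derivative[OF ck \<open>r \<in> {0..t}\<close>])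
    then have "((\<lambda>x. integral {0..x} ?k) has_real_derivative ?k r) (at r)"
      using at_within_Icc_at[OF r] by simp
    then have "(?Y has_real_derivative (kinetic r + force r (u r) - ?k r)) (at r)"
      by (rule DERIV_diff[OF momentum_deriv[OF r(1) \<open>r < T\<close>]])
    moreover have "0 \<le> kinetic r + force r (u r) - ?k r"
      unfolding diff_ge_0_iff_ge by (rule momentum_deriv_ge[OF \<open>r \<in> {0..T}\<close>])
    ultimately show "\<exists>y. (?Y has_real_derivative y) (at r) \<and> 0 \<le> y" by (intro exI conjI)
  qed (use t in auto)
  then have momentum: "integral {0..t} ?k \<le> (pairing t + dirichlet t / 2) - (pairing 0 + dirichlet 0 / 2)" by simp
  let ?e = "C / (2 * pm)"
  have "dirichlet t - dirichlet 0 \<le> ?e * integral {0..t} (\<lambda>r. dirichlet r) + 1 / ?e * dissipated 0 t"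
    by (rule dirichlet_increment_le) (use t C(1) p2 in auto)
  moreover have "pm / C * dissipated 0 t \<le> pm / C * (shifted 0 - shifted t)"
    using energy_dissipation[of 0 t] t C(1) p2 by (intro mult_left_mono) auto
  moreover have "1 / ?e * dissipated 0 t = 2 * (pm / C * dissipated 0 t)" by simp
  moreover have "excess t - excess 0 = (pairing t + dirichlet t / 2) - (pairing 0 + dirichlet 0 / 2)
      - (dirichlet t - dirichlet 0) / 2 + pm / C * (shifted 0 - shifted t)"
    by (simp add: excess_def algebra_simps diff_divide_distrib)
  moreover have "ik - e / 2 * I \<le> x"
    if "D \<le> e * I + V2" "V \<le> S" "V2 = 2 * V" "x = Y - D / 2 + S" "ik \<le> Y" for ik e I x D V V2 S Y :: real
    using that by (simp add: field_simps)
  ultimately have "integral {0..t} ?k - ?e / 2 * integral {0..t} (\<lambda>r. dirichlet r) \<le> excess t - excess 0"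
    using momentum by blast
  moreover have "C * integral {0..t} excess \<le> integral {0..t} ?k - ?e / 2 * integral {0..t} (\<lambda>r. dirichlet r)"
  proof -
    have "integral {0..t} (\<lambda>r. C * excess r) \<le> integral {0..t} (\<lambda>r. ?k r - ?e / 2 * dirichlet r)"
    proof (intro integral_le integrable_continuous_real continuous_on_diff[OF ck] continuous_on_mult_left cd ce)
      fix r assume "r \<in> {0..t}"
      then have r: "r \<in> {0..T}" using sub by auto
      have "2 * pairing r \<le> kinetic r + mass r"
        using l2_Cauchy_Schwarz[OF u_L2[OF r] ut_L2[OF r]]
          two_mult_le_sum_squares[of "l2_norm \<Omega> (u r)" "l2_norm \<Omega> (ut r)"] by simp
      then have "C / 2 * (2 * pairing r) \<le> C / 2 * (kinetic r + mass r)" using C(1) by (intro mult_left_mono) auto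
      then have 1: "C * pairing r \<le> C / 2 * kinetic r + C / 2 * mass r" by (simp add: algebra_simps)
      have 2: "C / 2 * kinetic r \<le> (1 + pm / 2) * kinetic r"
        using C(2) by (intro mult_right_mono) auto
      have "mass r \<le> dirichlet r / lambda1 \<Omega>"
        using lambda1_Poincare(2)[OF u_H01[OF r]] \<lambda> by (simp add: field_simps)
      then have "C / 2 * mass r \<le> C / 2 * (dirichlet r / lambda1 \<Omega>)" using C(1) by (intro mult_left_mono) auto
      then have 3: "C / 2 * mass r \<le> C / (2 * lambda1 \<Omega>) * dirichlet r" by simp
      have "(C / (2 * lambda1 \<Omega>) + C / (4 * pm)) * dirichlet r \<le> gap * dirichlet r"
        by (rule mult_right_mono[OF C(3)]) simp
      then have 4: "C / (2 * lambda1 \<Omega>) * dirichlet r + ?e / 2 * dirichlet r \<le> gap * dirichlet r"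
        by (simp add: algebra_simps)
      have "C * excess r = C * pairing r - pm * shifted r" using C(1) by (simp add: excess_def algebra_simps)
      then show "C * excess r \<le> ?k r - ?e / 2 * dirichlet r" using 1 2 3 4 by linarith
    qed
    moreover have "integral {0..t} (\<lambda>r. ?k r - ?e / 2 * dirichlet r)
        = integral {0..t} ?k - integral {0..t} (\<lambda>r. ?e / 2 * dirichlet r)"
      by (intro integral_diff integrable_continuous_real continuous_on_mult_left ck cd)
    ultimately show ?thesis by simp
  qed
  ultimately show ?thesis by linarith
qed simp

lemma displacement_bounds:
  assumes t: "0 < t" "t \<le> T" and K: "shifted 0 - shifted t \<le> K"
  shows "l2_norm \<Omega> (weak_grad \<Omega> (u t)) \<le> l2_norm \<Omega> (weak_grad \<Omega> (u 0)) + sqrt (t * K)"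
    and "l2_norm \<Omega> (u t) \<le> l2_norm \<Omega> (u 0) + sqrt (t * K / lambda1 \<Omega>)"
proof -
  have m: "0 \<in> {0..T}" "t \<in> {0..T}" using t by auto
  let ?D = "l2_norm \<Omega> (\<lambda>x. weak_grad \<Omega> (u t) x - weak_grad \<Omega> (u 0) x)"
  have "?D\<^sup>2 \<le> (t - 0) * dissipated 0 t" by (rule gradient_displacement_le) (use t in auto)
  also have "\<dots> \<le> t * K" using energy_dissipation[of 0 t] t K by (auto intro!: mult_left_mono)
  finally have D: "?D \<le> sqrt (t * K)" by (rule real_le_rsqrt)
  show "l2_norm \<Omega> (weak_grad \<Omega> (u t)) \<le> l2_norm \<Omega> (weak_grad \<Omega> (u 0)) + sqrt (t * K)"
    using l2_norm_diff_ge[OF gradu_L2[OF m(2)] gradu_L2[OF m(1)]] D by linarith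
  note z = weak_grad_diff[OF u_H01[OF m(2)] u_H01[OF m(1)]]
  have "l2_norm \<Omega> (\<lambda>x. u t x - u 0 x) \<le> ?D / sqrt (lambda1 \<Omega>)"
    using Poincare_norm[OF z(1)]
      l2_norm_cong_AE[OF weak_grad_L2[OF z(1)] L2_diff[OF gradu_L2[OF m(2)] gradu_L2[OF m(1)]] z(2)] by simp
  also have "\<dots> \<le> sqrt (t * K) / sqrt (lambda1 \<Omega>)" using D lambda1_Poincare(1) by (intro divide_right_mono) auto
  finally have "l2_norm \<Omega> (\<lambda>x. u t x - u 0 x) \<le> sqrt (t * K / lambda1 \<Omega>)" by (simp add: real_sqrt_divide)
  then show "l2_norm \<Omega> (u t) \<le> l2_norm \<Omega> (u 0) + sqrt (t * K / lambda1 \<Omega>)"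
    using l2_norm_diff_ge[OF u_L2[OF m(2)] u_L2[OF m(1)]] by linarith
qed

text \<open>As long as the energy stays above \<open>-\<beta>\<close>, the displacement and hence the mass is bounded by the
  energy available for dissipation, whereas the growing excess forces the mass up quadratically. The
  equation for \<open>\<tau>\<close> is the equality of the two bounds.\<close>

lemma energy_reaches_level:
  assumes gap: "gap > 0" and E0: "shifted 0 \<ge> 0" and L0: "excess 0 > 0"
    and \<beta>: "\<beta> = C * excess 0 / (2 * pm)" and \<tau>: "0 < \<tau>" "\<tau> \<le> T"
    and root: "C * excess 0 * \<tau>\<^sup>2 + (excess 0 - 2 * (shifted 0 + \<beta>) / lambda1 \<Omega>) * \<tau> - mass 0 = 0"
  shows "\<exists>t1. 0 < t1 \<and> t1 \<le> \<tau> \<and> shifted t1 = - \<beta>"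
proof -
  note C = blowup_const_bounds[OF gap]
  have p2: "pm > 2" and \<lambda>: "lambda1 \<Omega> > 0" by (rule pm_gt_2 lambda1_Poincare(1))+
  have \<beta>0: "\<beta> > 0" using C(1) L0 p2 by (simp add: \<beta>)
  have sub: "{0..\<tau>} \<subseteq> {0..T}" using \<tau> by auto
  have "\<exists>t\<in>{0..\<tau>}. shifted t \<le> - \<beta>"
  proof (rule ccontr)
    assume "\<not> ?thesis"
    then have above: "shifted t > - \<beta>" if "t \<in> {0..\<tau>}" for t using that by force
    let ?f = "\<lambda>t. mass t - (excess 0 * t + C * excess 0 * t\<^sup>2)"
    have "?f 0 \<le> ?f \<tau>"
    proof (rule DERIV_nonneg_imp_increasing_open[where f = ?f])
      show "continuous_on {0..\<tau>} ?f" by (intro continuous_intros continuous_on_subset[OF mass_continuous sub])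
      fix t assume t: "0 < t" "t < \<tau>"
      then have t': "t < T" "t \<in> {0..T}" "t \<in> {0..\<tau>}" using \<tau> by auto
      have "(?f has_real_derivative 2 * pairing t - (excess 0 + C * excess 0 * (2 * t))) (at t)"
        by (rule derivative_eq_intros mass_deriv[OF t(1) t'(1)] refl)+ simp
      moreover have "0 \<le> 2 * pairing t - (excess 0 + C * excess 0 * (2 * t))"
      proof -
        have "excess t \<ge> excess 0 * (1 + C * t)"
          by (rule integral_growth[OF excess_continuous C(1) L0 excess_growth[OF gap] t'(2)])
        then have "excess 0 + C * excess 0 * t \<le> excess t" by (simp add: distrib_left mult_ac)
        moreover have "- (excess 0 / 2) \<le> pm / C * shifted t"
        proof -
          have "- (excess 0 / 2) = pm / C * (- \<beta>)" using C(1) p2 by (simp add: \<beta>)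
          also have "\<dots> \<le> pm / C * shifted t" using above[OF t'(3)] C(1) p2 by (intro mult_left_mono) auto
          finally show ?thesis .
        qed
        moreover have "0 \<le> 2 * y - (e + C * e * (2 * t))"
          if "e + C * e * t \<le> x" "- (e / 2) \<le> P" "x = y - P" for e x P y :: real
          using that by (simp add: algebra_simps)
        ultimately show ?thesis using excess_def[of t] by blast
      qed
      ultimately show "\<exists>y. (?f has_real_derivative y) (at t) \<and> 0 \<le> y" by blast
    qed (use \<tau> in simp)
    then have lower: "mass 0 + excess 0 * \<tau> + C * excess 0 * \<tau>\<^sup>2 \<le> mass \<tau>" by simp
    define K where "K = shifted 0 - shifted \<tau>"
    have K: "K \<ge> 0" "K < shifted 0 + \<beta>" using shifted_decreasing[of 0 \<tau>] above[of \<tau>] \<tau> by (auto simp: K_def)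
    have "l2_norm \<Omega> (u \<tau>) \<le> l2_norm \<Omega> (u 0) + sqrt (\<tau> * K / lambda1 \<Omega>)"
      by (rule displacement_bounds(2)[OF \<tau>]) (simp add: K_def)
    then have "mass \<tau> \<le> (l2_norm \<Omega> (u 0) + sqrt (\<tau> * K / lambda1 \<Omega>))\<^sup>2" by (intro power_mono) auto
    also have "\<dots> \<le> 2 * mass 0 + 2 * (sqrt (\<tau> * K / lambda1 \<Omega>))\<^sup>2"
      using two_mult_le_sum_squares[of "l2_norm \<Omega> (u 0)" "sqrt (\<tau> * K / lambda1 \<Omega>)"]
      by (simp only: power2_sum)
    also have "\<dots> = 2 * mass 0 + 2 * (\<tau> * K / lambda1 \<Omega>)" using \<tau> K \<lambda> by simp
    also have "\<dots> < 2 * mass 0 + 2 * (\<tau> * (shifted 0 + \<beta>) / lambda1 \<Omega>)"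
      using K \<tau> \<lambda> by (simp add: divide_strict_right_mono)
    finally have "mass \<tau> < 2 * mass 0 + 2 * (\<tau> * (shifted 0 + \<beta>) / lambda1 \<Omega>)" .
    moreover have "2 * (\<tau> * (shifted 0 + \<beta>) / lambda1 \<Omega>) = excess 0 * \<tau> - (excess 0 - 2 * (shifted 0 + \<beta>) / lambda1 \<Omega>) * \<tau>"
      by (simp add: algebra_simps)
    ultimately show False using lower root by linarith
  qed
  then obtain t where t: "0 \<le> t" "t \<le> \<tau>" "shifted t \<le> - \<beta>" by auto
  have "\<exists>t1\<ge>0. t1 \<le> t \<and> shifted t1 = - \<beta>"
    by (rule IVT2'[of "\<lambda>t. shifted t"]) (use t E0 \<beta>0 \<tau> in \<open>auto intro!: continuous_on_subset[OF shifted_continuous]\<close>)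
  then obtain t1 where t1: "0 \<le> t1" "t1 \<le> t" "shifted t1 = - \<beta>" by blast
  moreover have "t1 \<noteq> 0" using t1 E0 \<beta>0 by auto
  ultimately show ?thesis using t by (intro exI[of _ t1]) auto
qed

theorem lifespan_of_negative_energy:
  assumes gap: "gap \<ge> 0" and E0: "shifted 0 < 0" and \<sigma>: "\<sigma> > 0"
    and adm: "(pm - 2) * (pairing 0 + - shifted 0 * \<sigma>) > 2 * dirichlet 0" and T1: "0 \<le> T1" "T1 < T"
  shows "T1 \<le> 2 * (mass 0 + - shifted 0 * \<sigma>\<^sup>2) / ((pm - 2) * (pairing 0 + - shifted 0 * \<sigma>) - 2 * dirichlet 0)"
proof -
  have "(T1 - 0) * ((pm - 2) * (pairing 0 + - shifted 0 * \<sigma>) - 2 * dirichlet 0) \<le> 2 * (mass 0 + - shifted 0 * \<sigma>\<^sup>2)"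
    by (rule concavity_estimate[OF gap order_refl T1 _ _ \<sigma> adm]) (use E0 in auto)
  moreover have "0 < (pm - 2) * (pairing 0 + - shifted 0 * \<sigma>) - 2 * dirichlet 0" using adm by simp
  ultimately show ?thesis by (simp only: pos_le_divide_eq diff_zero)
qed

text \<open>At the time \<open>t1\<close> when the energy reaches \<open>-\<beta>\<close> the concavity estimate starts. There the pairing is still at least
  half of the initial excess, by the choice of \<open>\<beta>\<close>, and the displacement bounds control the mass and the
  Dirichlet energy.\<close>

theorem lifespan_of_positive_excess:
  fixes \<tau> :: real
  defines "\<beta> \<equiv> C * excess 0 / (2 * pm)"
  defines "U \<equiv> (l2_norm \<Omega> (u 0) + sqrt (\<tau> * (shifted 0 + \<beta>) / lambda1 \<Omega>))\<^sup>2"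
  defines "G \<equiv> (l2_norm \<Omega> (weak_grad \<Omega> (u 0)) + sqrt (\<tau> * (shifted 0 + \<beta>)))\<^sup>2"
  defines "d \<equiv> (pm - 2) / 2 * excess 0 - 2 * G"
  assumes gap: "gap > 0" and E0: "shifted 0 \<ge> 0" and L0: "excess 0 > 0" and \<tau>: "0 < \<tau>" "\<tau> < T1" "T1 < T"
    and root: "C * excess 0 * \<tau>\<^sup>2 + (excess 0 - 2 * (shifted 0 + \<beta>) / lambda1 \<Omega>) * \<tau> - mass 0 = 0"
  shows "T1 \<le> \<tau> + 4 * (sqrt (d\<^sup>2 + (pm - 2)\<^sup>2 * \<beta> * U) - d) / ((pm - 2)\<^sup>2 * \<beta>)"
proof -
  note C = blowup_const_bounds[OF gap]
  have p2: "pm > 2" and q: "pm - 2 > 0" and \<lambda>: "lambda1 \<Omega> > 0"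
    using pm_gt_2 lambda1_Poincare(1) by auto
  have \<beta>0: "\<beta> > 0" using C(1) L0 p2 by (simp add: \<beta>_def)
  have K: "shifted 0 + \<beta> > 0" using E0 \<beta>0 by simp
  have "0 < sqrt (\<tau> * (shifted 0 + \<beta>) / lambda1 \<Omega>)" using K \<tau> \<lambda> by simp
  then have U: "U > 0" unfolding U_def by (intro zero_less_power add_nonneg_pos) auto
  obtain t1 where t1: "0 < t1" "t1 \<le> \<tau>" "shifted t1 = - \<beta>"
    using energy_reaches_level[OF gap E0 L0 meta_eq_to_obj_eq[OF \<beta>_def] \<tau>(1) _ root] \<tau> by auto
  have t1T: "t1 \<le> T" "t1 \<in> {0..T}" using t1 \<tau> by auto
  have mono: "t1 * (shifted 0 + \<beta>) \<le> \<tau> * (shifted 0 + \<beta>)" using t1 K by (intro mult_right_mono) auto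
  have "l2_norm \<Omega> (u t1) \<le> l2_norm \<Omega> (u 0) + sqrt (t1 * (shifted 0 + \<beta>) / lambda1 \<Omega>)"
    by (rule displacement_bounds(2)[OF t1(1) t1T(1)]) (simp add: t1)
  also have "\<dots> \<le> l2_norm \<Omega> (u 0) + sqrt (\<tau> * (shifted 0 + \<beta>) / lambda1 \<Omega>)"
    using mono \<lambda> by (intro add_left_mono real_sqrt_le_mono divide_right_mono) auto
  finally have mass1: "mass t1 \<le> U" unfolding U_def by (intro power_mono) auto
  have "l2_norm \<Omega> (weak_grad \<Omega> (u t1)) \<le> l2_norm \<Omega> (weak_grad \<Omega> (u 0)) + sqrt (t1 * (shifted 0 + \<beta>))"
    by (rule displacement_bounds(1)[OF t1(1) t1T(1)]) (simp add: t1)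
  also have "\<dots> \<le> l2_norm \<Omega> (weak_grad \<Omega> (u 0)) + sqrt (\<tau> * (shifted 0 + \<beta>))"
    using mono by (intro add_left_mono real_sqrt_le_mono)
  finally have dir1: "dirichlet t1 \<le> G" unfolding G_def by (intro power_mono) auto
  have "excess t1 \<ge> excess 0 * (1 + C * t1)"
    by (rule integral_growth[OF excess_continuous C(1) L0 excess_growth[OF gap] t1T(2)])
  moreover have "excess 0 * (C * t1) \<ge> 0" using L0 C(1) t1 by simp
  moreover have "pm / C * shifted t1 = - excess 0 / 2" using C(1) p2 by (simp add: t1 \<beta>_def)
  ultimately have pair1: "pairing t1 \<ge> excess 0 / 2" by (simp add: excess_def[of t1] distrib_left)
  obtain \<sigma> where \<sigma>: "\<sigma> > 0" "(pm - 2) * \<beta> * \<sigma> + d > 0"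
    "2 * (U + \<beta> * \<sigma>\<^sup>2) / ((pm - 2) * \<beta> * \<sigma> + d) = 4 * (sqrt (d\<^sup>2 + (pm - 2)\<^sup>2 * \<beta> * U) - d) / ((pm - 2)\<^sup>2 * \<beta>)"
    using optimal_shift(1)[OF q \<beta>0 U, of d] by blast
  have "(pm - 2) * (excess 0 / 2) \<le> (pm - 2) * pairing t1" using q pair1 by (intro mult_left_mono) auto
  then have den: "(pm - 2) * \<beta> * \<sigma> + d \<le> (pm - 2) * (pairing t1 + \<beta> * \<sigma>) - 2 * dirichlet t1"
    using dir1 by (simp add: d_def algebra_simps)
  have "(T1 - t1) * ((pm - 2) * \<beta> * \<sigma> + d) \<le> (T1 - t1) * ((pm - 2) * (pairing t1 + \<beta> * \<sigma>) - 2 * dirichlet t1)"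
    using den t1 \<tau> by (intro mult_left_mono) auto
  also have "\<dots> \<le> 2 * (mass t1 + \<beta> * \<sigma>\<^sup>2)"
    by (rule concavity_estimate) (use gap t1 \<tau> \<beta>0 \<sigma> den in auto)
  also have "\<dots> \<le> 2 * (U + \<beta> * \<sigma>\<^sup>2)" using mass1 by simp
  finally have "T1 - t1 \<le> 2 * (U + \<beta> * \<sigma>\<^sup>2) / ((pm - 2) * \<beta> * \<sigma> + d)" using \<sigma>(2) by (simp add: field_simps)
  then show ?thesis using t1 unfolding \<sigma>(3) by linarith
qed

lemma initial_values:
  assumes "u0 \<in> H01 \<Omega>" "u1 \<in> L2 \<Omega>"
  shows "l2_norm \<Omega> (u 0) = l2_norm \<Omega> u0"
    "l2_norm \<Omega> (weak_grad \<Omega> (u 0)) = l2_norm \<Omega> (weak_grad \<Omega> u0)"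
    "pairing 0 = l2_inner \<Omega> u0 u1"
proof -
  have m: "0 \<in> {0..T}" using T_pos by simp
  have AE: "AE x in lebesgue_on \<Omega>. u 0 x = u0 x" "AE x in lebesgue_on \<Omega>. ut 0 x = u1 x"
    using solves by (auto simp: energy_solution_def)
  show "l2_norm \<Omega> (u 0) = l2_norm \<Omega> u0"
    by (rule l2_norm_cong_AE[OF u_L2[OF m] H01_L2[OF assms(1)] AE(1)])
  show "l2_norm \<Omega> (weak_grad \<Omega> (u 0)) = l2_norm \<Omega> (weak_grad \<Omega> u0)"
    by (rule l2_norm_cong_AE[OF gradu_L2[OF m] weak_grad_L2[OF assms(1)] weak_grad_cong[OF u_H01[OF m] assms(1) AE(1)]])
  show "pairing 0 = l2_inner \<Omega> u0 u1"
    by (rule l2_inner_cong_AE[OF u_L2[OF m] H01_L2[OF assms(1)] ut_L2[OF m] assms(2) AE])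
qed

text \<open>Only the source term of the energy can be negative, and it vanishes at the zero function.\<close>

lemma negative_energy_mass_pos:
  assumes "shifted 0 < 0"
  shows "l2_norm \<Omega> (u 0) > 0"
proof (rule ccontr)
  assume "\<not> ?thesis"
  then have "l2_norm \<Omega> (u 0) = 0" by (simp add: order.antisym)
  have m: "0 \<in> {0..T}" using T_pos by simp
  have "AE x in lebesgue_on \<Omega>. u 0 x = 0" by (rule l2_norm_zero_AE[OF u_L2[OF m] \<open>l2_norm \<Omega> (u 0) = 0\<close>])
  then have "AE x in lebesgue_on \<Omega>. source_primitive (p x) (u 0 x) = 0"
    by eventually_elim (simp add: source_primitive_def)
  then have F: "(LINT x|lebesgue_on \<Omega>. source_primitive (p x) (u 0 x)) = 0" by (rule integral_eq_zero_AE)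
  have "0 < 1 - (LINT s|lebesgue_on {0..0}. g s)" using kernel_mass_le[of 0] kernel by (simp add: H2_def)
  moreover have "0 \<le> memory_energy \<Omega> g u 0" unfolding memory_energy_def
    by (rule Bochner_Integration.integral_nonneg) (use kernel_nonneg in auto)
  ultimately have "0 \<le> energy \<Omega> p g u ut 0" unfolding energy_def F by simp
  moreover have "0 \<le> C_star \<Omega> p / pm" using source_energy_ge(2)[OF u_H01[OF m]] pm_gt_2 by simp
  ultimately show False using assms by (simp add: shifted_energy_def)
qed

end

section \<open>Bounds for the lifespan\<close>

lemma quadratic_positive_root:
  fixes A B c :: real
  assumes "A > 0" "c > 0"
  shows "\<exists>!r. 0 < r \<and> A * r\<^sup>2 + B * r - c = 0"
proof (rule ex_ex1I)
  define s where "s = sqrt (B\<^sup>2 + 4 * A * c)"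
  have s2: "s\<^sup>2 = B\<^sup>2 + 4 * A * c" using assms by (simp add: s_def)
  have "\<bar>B\<bar> < s" unfolding s_def using assms by (intro real_less_rsqrt) simp
  then have "0 < (s - B) / (2 * A)" using assms by simp
  moreover have "A * ((s - B) / (2 * A))\<^sup>2 + B * ((s - B) / (2 * A)) - c = (s\<^sup>2 - B\<^sup>2) / (4 * A) - c"
    using assms by (simp add: power2_eq_square field_simps)
  moreover have "(s\<^sup>2 - B\<^sup>2) / (4 * A) - c = 0" unfolding s2 using assms by simp
  ultimately show "\<exists>r. 0 < r \<and> A * r\<^sup>2 + B * r - c = 0" by metis
next
  fix r r' assume r: "0 < r \<and> A * r\<^sup>2 + B * r - c = 0" and r': "0 < r' \<and> A * r'\<^sup>2 + B * r' - c = 0"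
  have "r' * (A * r\<^sup>2 + B * r - c) - r * (A * r'\<^sup>2 + B * r' - c) = (r - r') * (A * r * r' + c)"
    by (simp add: power2_eq_square algebra_simps)
  then have "(r - r') * (A * r * r' + c) = 0" using r r' by simp
  moreover have "A * r * r' + c > 0" using r r' assms by (intro add_pos_pos mult_pos_pos) auto
  ultimately show "r = r'" by simp
qed

lemma ereal_le_of_approach:
  fixes b :: real and S :: ereal
  assumes "\<And>T1 T. b < T1 \<Longrightarrow> T1 < T \<Longrightarrow> ereal T < S \<Longrightarrow> T1 \<le> b"
  shows "S \<le> ereal b"
proof (rule ccontr)
  assume "\<not> S \<le> ereal b"
  then have "ereal b < S" by simp
  then obtain T where T: "ereal b < ereal T" "ereal T < S" using ereal_dense2 by blast
  then have "b < (b + T) / 2" "(b + T) / 2 < T" by auto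
  from assms[OF this T(2)] \<open>b < (b + T) / 2\<close> show False by simp
qed

theorem theorem2p3:
  fixes \<Omega> :: "(real^'n) set"
    and p :: "real^'n \<Rightarrow> real"
    and g :: "real \<Rightarrow> real"
    and u0 u1 :: "real^'n \<Rightarrow> real"
    and u ut :: "real \<Rightarrow> real^'n \<Rightarrow> real"
    and Tmax :: ereal
  assumes "smooth_bounded_domain \<Omega>"
    and "H1 \<Omega> p"
    and "H2 g"
    and "local_theory \<Omega> p g"
    and "u0 \<in> H01 \<Omega>"
    and "u1 \<in> L2 \<Omega>"
    and "maximal_energy_solution \<Omega> p g u0 u1 Tmax u ut"
  shows
    "let pm = p_minus \<Omega> p;
         l = ell g;
         lam = lambda1 \<Omega>;
         C = blowup_const \<Omega> p g;
         E0 = shifted_energy \<Omega> p g u ut 0;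
         ip = l2_inner \<Omega> u0 u1;
         a0 = l2_norm \<Omega> u0;
         b0 = l2_norm \<Omega> (weak_grad \<Omega> u0);
         finite_time_blow_up = (Tmax < \<infinity> \<and> blows_up_at \<Omega> Tmax u ut);
         L0 = ip - pm / C * E0;
         \<beta>' = C * L0 / (2 * pm);
         is_tau = (\<lambda>\<tau>. 0 < \<tau> \<and>
           C * L0 * \<tau>\<^sup>2 + (L0 - 2 * (E0 + \<beta>') / lam) * \<tau> - a0\<^sup>2 = 0);
         U = (\<lambda>\<tau>. (a0 + sqrt (\<tau> * (E0 + \<beta>') / lam))\<^sup>2);
         G = (\<lambda>\<tau>. (b0 + sqrt (\<tau> * (E0 + \<beta>')))\<^sup>2);
         d = (\<lambda>\<tau>. (pm - 2) / 2 * L0 - 2 * G \<tau>);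
         upper_bound = (L0 > 0 \<and> (\<exists>!\<tau>. is_tau \<tau>) \<and>
           (\<forall>\<tau>. is_tau \<tau> \<longrightarrow>
              Tmax \<le> ereal (\<tau> + 4 * (sqrt ((d \<tau>)\<^sup>2 + (pm - 2)\<^sup>2 * \<beta>' * U \<tau>) - d \<tau>)
                                / ((pm - 2)\<^sup>2 * \<beta>'))))
     in
       (l \<ge> 1 / (pm - 1)\<^sup>2 \<and> E0 < 0 \<longrightarrow>
          (let \<beta> = - E0;
               d0 = (pm - 2) * ip - 2 * b0\<^sup>2;
               admissible = (\<lambda>\<sigma>. 0 < \<sigma> \<and> (pm - 2) * (ip + \<beta> * \<sigma>) > 2 * b0\<^sup>2);
               bound = (\<lambda>\<sigma>. 2 * (a0\<^sup>2 + \<beta> * \<sigma>\<^sup>2) / ((pm - 2) * (ip + \<beta> * \<sigma>) - 2 * b0\<^sup>2));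
               M = 4 * (sqrt (d0\<^sup>2 + (pm - 2)\<^sup>2 * \<beta> * a0\<^sup>2) - d0) / ((pm - 2)\<^sup>2 * \<beta>)
           in finite_time_blow_up \<and>
              (\<forall>\<sigma>. admissible \<sigma> \<longrightarrow> Tmax \<le> ereal (bound \<sigma>)) \<and>
              (\<exists>\<sigma>. admissible \<sigma> \<and> bound \<sigma> = M) \<and>
              (\<forall>\<sigma>. admissible \<sigma> \<longrightarrow> M \<le> bound \<sigma>) \<and>
              Tmax \<le> ereal M))
     \<and> (l > 1 / (pm - 1)\<^sup>2 \<and> E0 = 0 \<and> ip > 0 \<longrightarrow>
          finite_time_blow_up \<and> upper_bound)
     \<and> (l > 1 / (pm - 1)\<^sup>2 \<and> 0 < E0 \<and> E0 < C / pm * ip \<longrightarrow>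
          finite_time_blow_up \<and> upper_bound)"
proof -
  let ?pm = "p_minus \<Omega> p" and ?C = "blowup_const \<Omega> p g" and ?E = "shifted_energy \<Omega> p g u ut 0"
    and ?ip = "l2_inner \<Omega> u0 u1" and ?a = "l2_norm \<Omega> u0" and ?b = "l2_norm \<Omega> (weak_grad \<Omega> u0)"
  let ?L = "?ip - ?pm / ?C * ?E"
  let ?\<beta> = "?C * ?L / (2 * ?pm)"
  let ?is_tau = "\<lambda>\<tau>. 0 < \<tau> \<and> ?C * ?L * \<tau>\<^sup>2 + (?L - 2 * (?E + ?\<beta>) / lambda1 \<Omega>) * \<tau> - ?a\<^sup>2 = 0"
  let ?U = "\<lambda>\<tau>. (?a + sqrt (\<tau> * (?E + ?\<beta>) / lambda1 \<Omega>))\<^sup>2"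
  let ?d = "\<lambda>\<tau>. (?pm - 2) / 2 * ?L - 2 * (?b + sqrt (\<tau> * (?E + ?\<beta>)))\<^sup>2"
  let ?bd = "\<lambda>\<tau>. \<tau> + 4 * (sqrt ((?d \<tau>)\<^sup>2 + (?pm - 2)\<^sup>2 * ?\<beta> * ?U \<tau>) - ?d \<tau>) / ((?pm - 2)\<^sup>2 * ?\<beta>)"
  interpret variable_exponent \<Omega> p
    by unfold_locales (use assms(1,2) in \<open>auto simp: smooth_bounded_domain_def\<close>)
  have max: "maximal_energy_solution \<Omega> p g u0 u1 Tmax u ut" by (rule assms)
  note local = assms(4)[unfolded local_theory_def, rule_format, OF assms(5,6), THEN conjunct2, THEN conjunct2, rule_format, OF max]
  have blowup: "blows_up_at \<Omega> Tmax u ut" if "Tmax < \<infinity>" using local that by blast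
  have flow: "dissipative_flow \<Omega> p g u0 u1 T u ut" if T: "0 < T" "ereal T < Tmax" for T
  proof unfold_locales
    show "H2 g" "0 < T" by (rule assms T)+
    show "energy_solution \<Omega> p g u0 u1 T u ut"
      using max T by (simp add: maximal_energy_solution_def solution_before_def)
    show "abs_continuous_on 0 T (energy \<Omega> p g u ut)" using local T by blast
    have "AE t in lebesgue. 0 < t \<and> ereal t < Tmax \<longrightarrow>
              (energy \<Omega> p g u ut has_real_derivative
                 (- (l2_norm \<Omega> (weak_grad \<Omega> (ut t)))\<^sup>2
                  - 1/2 * g t * (l2_norm \<Omega> (weak_grad \<Omega> (u t)))\<^sup>2
                  + 1/2 * memory_energy \<Omega> (kernel_deriv g) u t)) (at t)" using local by blast
    then show "AE t in lebesgue. 0 < t \<and> t < T \<longrightarrow>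
              (energy \<Omega> p g u ut has_real_derivative
                 (- (l2_norm \<Omega> (weak_grad \<Omega> (ut t)))\<^sup>2
                  - 1/2 * g t * (l2_norm \<Omega> (weak_grad \<Omega> (u t)))\<^sup>2
                  + 1/2 * memory_energy \<Omega> (kernel_deriv g) u t)) (at t)"
    proof eventually_elim
      case (elim t)
      have "t < T \<Longrightarrow> ereal t < Tmax" using less_trans[of "ereal t" "ereal T" Tmax] T(2) by simp
      then show ?case using elim by blast
    qed
  qed
  have "0 < Tmax" using max by (simp add: maximal_energy_solution_def)
  then obtain T0 where T0: "0 < T0" "ereal T0 < Tmax"
    using ereal_dense2[of 0 Tmax] by (auto simp: zero_ereal_def)
  \<comment> \<open>Any earlier time serves to read off the statements about initial data.\<close>
  interpret start: dissipative_flow \<Omega> p g u0 u1 T0 u ut by (rule flow[OF T0])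
  note init = start.initial_values[OF assms(5,6)]
  have p2: "?pm > 2" by (rule pm_gt_2)
  have q: "?pm - 2 > 0" using p2 by simp
  have gap: "0 \<le> start.gap \<longleftrightarrow> ell g \<ge> 1 / (?pm - 1)\<^sup>2" "0 < start.gap \<longleftrightarrow> ell g > 1 / (?pm - 1)\<^sup>2"
    unfolding start.gap_def using p2 by (auto simp: field_simps zero_le_divide_iff zero_less_divide_iff)
  have excess: "start.excess 0 = ?L" by (simp add: start.excess_def init)
  show ?thesis
    unfolding Let_def
  proof (intro conjI impI)
    assume hyp: "1 / (?pm - 1)\<^sup>2 \<le> ell g \<and> ?E < 0"
    let ?adm = "\<lambda>\<sigma>. 0 < \<sigma> \<and> 2 * ?b\<^sup>2 < (?pm - 2) * (?ip + - ?E * \<sigma>)"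
    let ?bound = "\<lambda>\<sigma>. 2 * (?a\<^sup>2 + - ?E * \<sigma>\<^sup>2) / ((?pm - 2) * (?ip + - ?E * \<sigma>) - 2 * ?b\<^sup>2)"
    let ?d0 = "(?pm - 2) * ?ip - 2 * ?b\<^sup>2"
    let ?M = "4 * (sqrt (?d0\<^sup>2 + (?pm - 2)\<^sup>2 * - ?E * ?a\<^sup>2) - ?d0) / ((?pm - 2)\<^sup>2 * - ?E)"
    have E: "- ?E > 0" using hyp by simp
    have a: "?a\<^sup>2 > 0" using start.negative_energy_mass_pos hyp by (simp add: init)
    have lifespan: "Tmax \<le> ereal (?bound \<sigma>)" if "?adm \<sigma>" for \<sigma>
    proof (rule ereal_le_of_approach)
      fix T1 T assume T: "?bound \<sigma> < T1" "T1 < T" "ereal T < Tmax"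
      have "0 \<le> ?bound \<sigma>" using that E by (intro divide_nonneg_nonneg mult_nonneg_nonneg add_nonneg_nonneg) auto
      then have "0 \<le> T1" "0 < T" using T by auto
      then interpret dissipative_flow \<Omega> p g u0 u1 T u ut by (intro flow T)
      show "T1 \<le> ?bound \<sigma>"
        using lifespan_of_negative_energy[of \<sigma> T1] hyp gap that T \<open>0 \<le> T1\<close> by (simp add: init)
    qed
    have den: "(?pm - 2) * (?ip + - ?E * \<sigma>) - 2 * ?b\<^sup>2 = (?pm - 2) * - ?E * \<sigma> + ?d0" for \<sigma>
      by (simp add: algebra_simps)
    have adm: "?adm \<sigma> \<longleftrightarrow> 0 < \<sigma> \<and> 0 < (?pm - 2) * - ?E * \<sigma> + ?d0" for \<sigma> unfolding den[symmetric] by simp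
    note opt = optimal_shift(1,2)[OF q E a, where d = ?d0]
    obtain \<sigma> where \<sigma>: "?adm \<sigma>" "?bound \<sigma> = ?M" using opt(1) unfolding adm den by blast
    show "\<exists>\<sigma>. ?adm \<sigma> \<and> ?bound \<sigma> = ?M" using \<sigma> by blast
    show M: "Tmax \<le> ereal ?M" using lifespan[OF \<sigma>(1)] unfolding \<sigma>(2) .
    show fin: "Tmax < \<infinity>" using M by (rule le_less_trans) simp
    show "blows_up_at \<Omega> Tmax u ut" by (rule blowup[OF fin])
    show "\<forall>\<sigma>. ?adm \<sigma> \<longrightarrow> Tmax \<le> ereal (?bound \<sigma>)" using lifespan by blast
    show "\<forall>\<sigma>. ?adm \<sigma> \<longrightarrow> ?M \<le> ?bound \<sigma>" using opt(2) unfolding adm den by blast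
  next
    have upper: "Tmax < \<infinity> \<and> 0 < ?L \<and> (\<exists>!\<tau>. ?is_tau \<tau>) \<and> (\<forall>\<tau>. ?is_tau \<tau> \<longrightarrow> Tmax \<le> ereal (?bd \<tau>))"
      if gap': "start.gap > 0" and E: "?E \<ge> 0" and L: "?L > 0" and ip: "?ip > 0"
    proof -
      have C: "?C > 0" by (rule start.blowup_const_bounds(1)[OF gap'])
      have "?ip \<le> ?a * l2_norm \<Omega> u1" using l2_Cauchy_Schwarz[OF H01_L2[OF assms(5)] assms(6)] by simp
      then have "?a \<noteq> 0" using ip by auto
      then have ex: "\<exists>!\<tau>. ?is_tau \<tau>" using C L by (intro quadratic_positive_root) auto
      have \<beta>: "?\<beta> > 0" using C L p2 by simp
      have le: "Tmax \<le> ereal (?bd \<tau>)" if \<tau>: "?is_tau \<tau>" for \<tau>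
      proof (rule ereal_le_of_approach)
        fix T1 T assume T: "?bd \<tau> < T1" "T1 < T" "ereal T < Tmax"
        have "0 < sqrt (\<tau> * (?E + ?\<beta>) / lambda1 \<Omega>)" using \<tau> E \<beta> lambda1_Poincare(1) by simp
        then have "0 < ?U \<tau>" by (intro zero_less_power add_nonneg_pos) auto
        from optimal_shift(3)[OF q \<beta> this, of "?d \<tau>"] have "\<tau> < T1" using T(1) by linarith
        moreover have "0 < T" using calculation \<tau> T by linarith
        then interpret dissipative_flow \<Omega> p g u0 u1 T u ut by (intro flow T)
        show "T1 \<le> ?bd \<tau>"
          using lifespan_of_positive_excess[of \<tau> T1] gap' E L \<tau> \<open>\<tau> < T1\<close> T(2) unfolding excess init by simp
      qed
      obtain \<tau> where "?is_tau \<tau>" using ex by blast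
      from le[OF this] have "Tmax < \<infinity>" by (rule le_less_trans) simp
      then show ?thesis using ex le L by blast
    qed
    {
      assume hyp: "1 / (?pm - 1)\<^sup>2 < ell g \<and> ?E = 0 \<and> 0 < ?ip"
      have u: "Tmax < \<infinity> \<and> 0 < ?L \<and> (\<exists>!\<tau>. ?is_tau \<tau>) \<and> (\<forall>\<tau>. ?is_tau \<tau> \<longrightarrow> Tmax \<le> ereal (?bd \<tau>))"
        by (rule upper) (use hyp gap in auto)
      show "Tmax < \<infinity>" "0 < ?L" "\<exists>!\<tau>. ?is_tau \<tau>" "\<forall>\<tau>. ?is_tau \<tau> \<longrightarrow> Tmax \<le> ereal (?bd \<tau>)"
        using u by blast+
      show "blows_up_at \<Omega> Tmax u ut" using u blowup by blast
    }
    {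
      assume hyp: "1 / (?pm - 1)\<^sup>2 < ell g \<and> 0 < ?E \<and> ?E < ?C / ?pm * ?ip"
      have C: "?C > 0" using start.blowup_const_bounds(1) hyp gap by blast
      have "0 < ?C / ?pm * ?ip" using hyp by linarith
      then have ip: "0 < ?ip" using C p2 by (simp add: zero_less_mult_iff zero_less_divide_iff)
      have "?pm / ?C * ?E < ?pm / ?C * (?C / ?pm * ?ip)" using hyp C p2 by (intro mult_strict_left_mono) auto
      then have L: "0 < ?L" using C p2 by simp
      have u: "Tmax < \<infinity> \<and> 0 < ?L \<and> (\<exists>!\<tau>. ?is_tau \<tau>) \<and> (\<forall>\<tau>. ?is_tau \<tau> \<longrightarrow> Tmax \<le> ereal (?bd \<tau>))"
        by (rule upper) (use hyp gap L ip in auto)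
      show "Tmax < \<infinity>" "0 < ?L" "\<exists>!\<tau>. ?is_tau \<tau>" "\<forall>\<tau>. ?is_tau \<tau> \<longrightarrow> Tmax \<le> ereal (?bd \<tau>)"
        using u by blast+
      show "blows_up_at \<Omega> Tmax u ut" using u blowup by blast
    }
  qed
qed

end
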